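(* Let $\theta\in\mathbb{R}$, let $A_0$ be the classical Hopf fibration and $A_1$ the deformed Hopf fibration with deformation parameter $\theta$, both regarded as right $H$-comodule algebras over $\mathbb{C}$ with $H=\mathcal{O}(U(1))$, and let $A$ be the $H\otimes\overline{\mathcal{O}}(\mathbb{R})$-comodule algebra over the ground ring $\overline{\mathcal{O}}(\mathbb{R})$ defined in the context. Then there exist isomorphisms of $H$-comodule algebras $\mathrm{ev}_{p\ast}(A)\cong A_p$ for $p=0,1$. Hence, the classical Hopf fibration $A_0$ is $\overline{\mathcal{O}}(\mathbb{R})$-homotopy equivalent to the deformed Hopf fibration $A_1$, for any value of the deformation parameter $\theta\in\mathbb{R}$.
   Context: $\overline{\mathcal{O}}(\mathbb{R})$ is any fixed $\ast$-subalgebra of the $\ast$-algebra of all functions $\mathbb{R}\to\mathbb{C}$ containing the monomials $y^n$ ($n\ge0$) and the exponentials $y\mapsto e^{icy}$ ($c\in\mathbb{R}$). For $p=0,1$, $\mathrm{ev}_p\colon\overline{\mathcal{O}}(\mathbb{R})\to\mathbb{C}$, $f\mapsto f(p)$, and $\mathrm{ev}_{p\ast}(M)=M\otimes_{\overline{\mathcal{O}}(\mathbb{R})}\mathbb{C}$ is base change along $\mathrm{ev}_p$. Principal comodule algebra (over a commutative ground ring $k$, tensor products over $k$): for a Hopf algebra $H$ with bijective antipode, a right $H$-comodule algebra $(A,\delta)$ that admits a strong connection, i.e. a $k$-linear map $\ell\colon H\to A\otimes A$ with $\ell(\mathbf 1_H)=\mathbf 1_A\otimes\mathbf 1_A$,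 $\mu_A\circ\ell=\eta_A\circ\epsilon_H$, $(\mathrm{id}\otimes\delta)\circ\ell=(\ell\otimes\mathrm{id})\circ\Delta_H$, $(\delta_S\otimes\mathrm{id})\circ\ell=(\mathrm{id}\otimes\ell)\circ\Delta_H$, where $\delta_S(a)=S^{-1}(a_{\underline 1})\otimes a_{\underline 0}$ for $\delta(a)=a_{\underline 0}\otimes a_{\underline 1}$. It is "over $B$" if its subalgebra of coinvariants $A^{\mathrm{co}H}=\{a:\delta(a)=a\otimes\mathbf 1\}$ is (isomorphic to) $B$. Homotopy equivalence: for a Hopf algebra $H$ and an algebra $B$ over $\mathbb{C}$ and principal $H$-comodule algebras $A_0,A_1$ over $B$, write $A_0\sim A_1$ if there is a principal $H\otimes\overline{\mathcal{O}}(\mathbb{R})$-comodule algebra $A$ over $B\otimes\overline{\mathcal{O}}(\mathbb{R})$, with ground ring $\overline{\mathcal{O}}(\mathbb{R})$, such that $\mathrm{ev}_{p\ast}(A)\cong A_p$ as $H$-comodule algebras for $p=0,1$. $\overline{\mathcal{O}}(\mathbb{R})$-homotopy equivalence is the equivalence relation generated by $\sim$. Here $H=\mathcal{O}(U(1))$ is the commutative $\ast$-Hopf algebra generated by $t$ with $t^\ast t=\mathbf 1$, $\Delta(t)=t\otimes t$, $\epsilon(t)=1$, $S(t)=t^\ast$, and $B=\mathcal{O}(\mathbb{S}^2)$ is the commutative $\ast$-algebra generated by $z,x$ with $x^\ast=x$, $z^\ast z+x^2=\mathbf 1$. $A_0=\mathcal{O}(\mathbb{S}^3)$ is the commutative $\ast$-algebra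 generated by $z_1,z_2$ with $z_1^\ast z_1+z_2^\ast z_2=\mathbf 1$. $A_1=\mathcal{O}(\mathbb{S}^3_\theta)$ is the $\ast$-algebra over $\mathbb{C}$ generated by $z_1,z_2$ with $z_1z_1^\ast=z_1^\ast z_1$, $z_2z_2^\ast=z_2^\ast z_2$, $z_1z_2=q\,z_2z_1$, $z_1z_2^\ast=q^{-1}z_2^\ast z_1$, $z_1^\ast z_1+z_2^\ast z_2=\mathbf 1$, where $q=e^{2\pi i\theta}$. (Equivalently, $A_1$ is $A_0$ with product deformed by the $2$-cocycle $\sigma_\theta(t_{\mathbf m}\otimes t_{\mathbf m'})=e^{\pi i\theta(m_1m_2'-m_2m_1')}$ on $\mathcal{O}(\mathbb{T}^2)$, where $z_1,z_2$ have $\mathbb{Z}^2$-degrees $(1,0),(0,1)$ and $z_1^\ast,z_2^\ast$ the negatives.) $A$ is the $\ast$-algebra over $\overline{\mathcal{O}}(\mathbb{R})$ generated by $z_1,z_2$ with $z_1z_1^\ast=z_1^\ast z_1$, $z_2z_2^\ast=z_2^\ast z_2$, $z_1z_2=Q\,z_2z_1$, $z_1z_2^\ast=Q^{-1}z_2^\ast z_1$, $z_1^\ast z_1+z_2^\ast z_2=\mathbf 1$, where $Q\in\overline{\mathcal{O}}(\mathbb{R})$ is $Q(y)=e^{2\pi i\theta y}$. In all three cases the coaction (of $H$, respectively of $H\otimes\overline{\mathcal{O}}(\mathbb{R})$) is the algebra map with $\delta(z_i)=z_i\otimes t$, $\delta(z_i^\ast)=z_i^\ast\otimes t^\ast$.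 $A_0$ and $A_1$ are principal $H$-comodule algebras over $B$. *)

theory Defs
  imports Complex_Main "HOL-Algebra.Module" "HOL-Algebra.QuotRing"
begin

section \<open>Associative algebras over a commutative ring\<close>

text \<open>The library locale \<^locale>\<open>algebra\<close> asks the algebra itself to be commutative.\<close>

locale assoc_algebra = module K A + A: ring A
  for K :: "'k ring" and A :: "('k, 'a, 'm) module_scheme" +
  assumes smult_mult_left:
      "\<lbrakk>k \<in> carrier K; x \<in> carrier A; y \<in> carrier A\<rbrakk> \<Longrightarrow>
        (k \<odot>\<^bsub>A\<^esub> x) \<otimes>\<^bsub>A\<^esub> y = k \<odot>\<^bsub>A\<^esub> (x \<otimes>\<^bsub>A\<^esub> y)"
    and smult_mult_right:
      "\<lbrakk>k \<in> carrier K; x \<in> carrier A; y \<in> carrier A\<rbrakk> \<Longrightarrow>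
        x \<otimes>\<^bsub>A\<^esub> (k \<odot>\<^bsub>A\<^esub> y) = k \<odot>\<^bsub>A\<^esub> (x \<otimes>\<^bsub>A\<^esub> y)"

definition linear_maps ::
    "'k ring \<Rightarrow> ('k, 'a, 'm) module_scheme \<Rightarrow> ('k, 'b, 'n) module_scheme \<Rightarrow> ('a \<Rightarrow> 'b) set" where
  "linear_maps K M N = {f. f \<in> carrier M \<rightarrow> carrier N \<and>
     (\<forall>x\<in>carrier M. \<forall>y\<in>carrier M. f (x \<oplus>\<^bsub>M\<^esub> y) = f x \<oplus>\<^bsub>N\<^esub> f y) \<and>
     (\<forall>k\<in>carrier K. \<forall>x\<in>carrier M. f (k \<odot>\<^bsub>M\<^esub> x) = k \<odot>\<^bsub>N\<^esub> f x)}"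

definition algebra_homs ::
    "'k ring \<Rightarrow> ('k, 'a, 'm) module_scheme \<Rightarrow> ('k, 'b, 'n) module_scheme \<Rightarrow> ('a \<Rightarrow> 'b) set" where
  "algebra_homs K A B = linear_maps K A B \<inter> ring_hom A B"

definition algebra_isos ::
    "'k ring \<Rightarrow> ('k, 'a, 'm) module_scheme \<Rightarrow> ('k, 'b, 'n) module_scheme \<Rightarrow> ('a \<Rightarrow> 'b) set" where
  "algebra_isos K A B = {f \<in> algebra_homs K A B. bij_betw f (carrier A) (carrier B)}"

text \<open>The ring \<open>L\<close> as an algebra over \<open>K\<close> along a ring homomorphism \<open>\<phi>: K \<rightarrow> L\<close>, and an
  \<open>L\<close>-algebra regarded as a \<open>K\<close>-algebra along \<open>\<phi>\<close>.\<close>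

definition ring_as_algebra :: "'l ring \<Rightarrow> ('k \<Rightarrow> 'l) \<Rightarrow> ('k, 'l) module" where
  "ring_as_algebra L \<phi> = ring.extend L (module.fields (\<lambda>k x. \<phi> k \<otimes>\<^bsub>L\<^esub> x))"

definition restrict_scalars ::
    "('k \<Rightarrow> 'l) \<Rightarrow> ('l, 'a, 'm) module_scheme \<Rightarrow> ('k, 'a) module" where
  "restrict_scalars \<phi> P = ring.extend (ring.truncate P) (module.fields (\<lambda>k x. \<phi> k \<odot>\<^bsub>P\<^esub> x))"


section \<open>Monoid algebras and their quotients\<close>

text \<open>The monoid algebra \<open>K[M]\<close>: finitely supported functions with convolution product. It
  serves twice: for the free monoid on a set it is the free algebra, and for the product of the
  multiplicative monoids of two algebras \<open>A\<close> and \<open>B\<close> it is the free module on \<open>A \<times> B\<close> of which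
  \<open>A \<otimes> B\<close> is a quotient.\<close>

definition supp :: "'k ring \<Rightarrow> ('x \<Rightarrow> 'k) \<Rightarrow> 'x set" where
  "supp K f = {x. f x \<noteq> \<zero>\<^bsub>K\<^esub>}"

definition monoid_algebra :: "'k ring \<Rightarrow> 'x monoid \<Rightarrow> ('k, 'x \<Rightarrow> 'k) module" where
  "monoid_algebra K M =
    \<lparr>carrier = {f. f \<in> carrier M \<rightarrow> carrier K \<and> supp K f \<subseteq> carrier M \<and> finite (supp K f)},
     mult = (\<lambda>f g z. finsum K (\<lambda>(x, y). f x \<otimes>\<^bsub>K\<^esub> g y)
               {(x, y). x \<in> supp K f \<and> y \<in> supp K g \<and> x \<otimes>\<^bsub>M\<^esub> y = z}),
     one = (\<lambda>x. if x = \<one>\<^bsub>M\<^esub> then \<one>\<^bsub>K\<^esub> else \<zero>\<^bsub>K\<^esub>),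
     zero = (\<lambda>x. \<zero>\<^bsub>K\<^esub>),
     add = (\<lambda>f g x. f x \<oplus>\<^bsub>K\<^esub> g x),
     smult = (\<lambda>k f x. k \<otimes>\<^bsub>K\<^esub> f x)\<rparr>"

definition basis_elem :: "'k ring \<Rightarrow> 'x \<Rightarrow> 'x \<Rightarrow> 'k" where
  "basis_elem K x = (\<lambda>y. if y = x then \<one>\<^bsub>K\<^esub> else \<zero>\<^bsub>K\<^esub>)"

text \<open>The quotient ring of the library, equipped with the induced scalar multiplication.\<close>

definition quot_algebra :: "('k, 'a, 'm) module_scheme \<Rightarrow> 'a set \<Rightarrow> ('k, 'a set) module" where
  "quot_algebra A I =
     ring.extend (A Quot I) (module.fields (\<lambda>k X. \<Union>x\<in>X. I +>\<^bsub>A\<^esub> (k \<odot>\<^bsub>A\<^esub> x)))"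

text \<open>\<open>lin_lift K P \<beta>\<close> is the \<open>K\<close>-linear map into \<open>P\<close> that is defined on a quotient of a free module
  and sends the class of the basis element \<open>x\<close> to \<open>\<beta> x\<close>. It is evaluated on an arbitrary
  representative, hence meaningful only if the linear extension of \<open>\<beta>\<close> kills the submodule
  divided out.\<close>

definition lin_lift ::
    "'k ring \<Rightarrow> ('k, 'p, 'm) module_scheme \<Rightarrow> ('x \<Rightarrow> 'p) \<Rightarrow> ('x \<Rightarrow> 'k) set \<Rightarrow> 'p" where
  "lin_lift K P \<beta> X = (let f = (SOME f. f \<in> X) in \<Oplus>\<^bsub>P\<^esub>x\<in>supp K f. f x \<odot>\<^bsub>P\<^esub> \<beta> x)"


section \<open>Tensor products of algebras\<close>

definition submodule_generated ::
    "'k ring \<Rightarrow> ('k, 'a, 'm) module_scheme \<Rightarrow> 'a set \<Rightarrow> 'a set" where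
  "submodule_generated K M S = \<Inter>{N. submodule N K M \<and> S \<subseteq> N}"

definition pair_algebra ::
    "'k ring \<Rightarrow> ('k, 'a, 'm) module_scheme \<Rightarrow> ('k, 'b, 'n) module_scheme \<Rightarrow> ('k, 'a \<times> 'b \<Rightarrow> 'k) module" where
  "pair_algebra K A B = monoid_algebra K (A \<times>\<times> B)"

definition tensor_relations ::
    "'k ring \<Rightarrow> ('k, 'a, 'm) module_scheme \<Rightarrow> ('k, 'b, 'n) module_scheme \<Rightarrow> ('a \<times> 'b \<Rightarrow> 'k) set" where
  "tensor_relations K A B =
    (let F = pair_algebra K A B; e = basis_elem K in
      {e (a \<oplus>\<^bsub>A\<^esub> a', b) \<ominus>\<^bsub>F\<^esub> (e (a, b) \<oplus>\<^bsub>F\<^esub> e (a', b)) |a a' b.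
          a \<in> carrier A \<and> a' \<in> carrier A \<and> b \<in> carrier B} \<union>
      {e (a, b \<oplus>\<^bsub>B\<^esub> b') \<ominus>\<^bsub>F\<^esub> (e (a, b) \<oplus>\<^bsub>F\<^esub> e (a, b')) |a b b'.
          a \<in> carrier A \<and> b \<in> carrier B \<and> b' \<in> carrier B} \<union>
      {e (k \<odot>\<^bsub>A\<^esub> a, b) \<ominus>\<^bsub>F\<^esub> (k \<odot>\<^bsub>F\<^esub> e (a, b)) |k a b.
          k \<in> carrier K \<and> a \<in> carrier A \<and> b \<in> carrier B} \<union>
      {e (a, k \<odot>\<^bsub>B\<^esub> b) \<ominus>\<^bsub>F\<^esub> (k \<odot>\<^bsub>F\<^esub> e (a, b)) |k a b.
          k \<in> carrier K \<and> a \<in> carrier A \<and> b \<in> carrier B})"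

definition tensor_null ::
    "'k ring \<Rightarrow> ('k, 'a, 'm) module_scheme \<Rightarrow> ('k, 'b, 'n) module_scheme \<Rightarrow> ('a \<times> 'b \<Rightarrow> 'k) set" where
  "tensor_null K A B = submodule_generated K (pair_algebra K A B) (tensor_relations K A B)"

text \<open>As the product on \<open>K[A \<times> B]\<close> is \<open>(a, b)(a', b') = (aa', bb')\<close> on basis elements, the submodule
  \<^const>\<open>tensor_null\<close> is an ideal and the product passes to the quotient.\<close>

definition tensor_algebra ::
    "'k ring \<Rightarrow> ('k, 'a, 'm) module_scheme \<Rightarrow> ('k, 'b, 'n) module_scheme \<Rightarrow> ('k, ('a \<times> 'b \<Rightarrow> 'k) set) module" where
  "tensor_algebra K A B = quot_algebra (pair_algebra K A B) (tensor_null K A B)"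

definition pure_tensor ::
    "'k ring \<Rightarrow> ('k, 'a, 'm) module_scheme \<Rightarrow> ('k, 'b, 'n) module_scheme \<Rightarrow> 'a \<Rightarrow> 'b \<Rightarrow> ('a \<times> 'b \<Rightarrow> 'k) set" where
  "pure_tensor K A B a b = tensor_null K A B +>\<^bsub>pair_algebra K A B\<^esub> basis_elem K (a, b)"

text \<open>In \<open>tensor_map K A B f g\<close>, i.e. \<open>f \<otimes> g\<close>, the algebras \<open>A\<close> and \<open>B\<close> are the codomains.\<close>

definition tensor_map ::
    "'k ring \<Rightarrow> ('k, 'a, 'm) module_scheme \<Rightarrow> ('k, 'b, 'n) module_scheme \<Rightarrow>
     ('c \<Rightarrow> 'a) \<Rightarrow> ('d \<Rightarrow> 'b) \<Rightarrow> ('c \<times> 'd \<Rightarrow> 'k) set \<Rightarrow> ('a \<times> 'b \<Rightarrow> 'k) set" where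
  "tensor_map K A B f g =
     lin_lift K (tensor_algebra K A B) (\<lambda>(c, d). pure_tensor K A B (f c) (g d))"

text \<open>The associator \<open>(A \<otimes> B) \<otimes> C \<rightarrow> A \<otimes> (B \<otimes> C)\<close>.\<close>

definition tensor_assoc ::
    "'k ring \<Rightarrow> ('k, 'a, 'm) module_scheme \<Rightarrow> ('k, 'b, 'n) module_scheme \<Rightarrow> ('k, 'c, 'o) module_scheme \<Rightarrow>
     (('a \<times> 'b \<Rightarrow> 'k) set \<times> 'c \<Rightarrow> 'k) set \<Rightarrow> ('a \<times> ('b \<times> 'c \<Rightarrow> 'k) set \<Rightarrow> 'k) set" where
  "tensor_assoc K A B C =
    (let BC = tensor_algebra K B C; T = tensor_algebra K A BC in
      lin_lift K T (\<lambda>(u, c). lin_lift K T (\<lambda>(a, b). pure_tensor K A BC a (pure_tensor K B C b c)) u))"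

definition mult_map :: "'k ring \<Rightarrow> ('k, 'a, 'm) module_scheme \<Rightarrow> ('a \<times> 'a \<Rightarrow> 'k) set \<Rightarrow> 'a" where
  "mult_map K A = lin_lift K A (\<lambda>(a, b). a \<otimes>\<^bsub>A\<^esub> b)"


section \<open>Hopf algebras\<close>

record ('k, 'h) hopf = "('k, 'h) module" +
  comult :: "'h \<Rightarrow> ('h \<times> 'h \<Rightarrow> 'k) set"
  counit :: "'h \<Rightarrow> 'k"
  antipode :: "'h \<Rightarrow> 'h"

locale hopf_algebra = assoc_algebra K H
  for K :: "'k ring" and H :: "('k, 'h, 'm) hopf_scheme" +
  assumes comult_hom: "comult H \<in> algebra_homs K H (tensor_algebra K H H)"
    and counit_hom: "counit H \<in> algebra_homs K H (ring_as_algebra K (\<lambda>k. k))"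
    and antipode_linear: "antipode H \<in> linear_maps K H H"
    and coassociative: "h \<in> carrier H \<Longrightarrow>
      tensor_assoc K H H H (tensor_map K (tensor_algebra K H H) H (comult H) (\<lambda>x. x) (comult H h)) =
      tensor_map K H (tensor_algebra K H H) (\<lambda>x. x) (comult H) (comult H h)"
    and counit_left: "h \<in> carrier H \<Longrightarrow>
      lin_lift K H (\<lambda>(x, y). counit H x \<odot>\<^bsub>H\<^esub> y) (comult H h) = h"
    and counit_right: "h \<in> carrier H \<Longrightarrow>
      lin_lift K H (\<lambda>(x, y). counit H y \<odot>\<^bsub>H\<^esub> x) (comult H h) = h"
    and antipode_left: "h \<in> carrier H \<Longrightarrow>
      lin_lift K H (\<lambda>(x, y). antipode H x \<otimes>\<^bsub>H\<^esub> y) (comult H h) = counit H h \<odot>\<^bsub>H\<^esub> \<one>\<^bsub>H\<^esub>"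
    and antipode_right: "h \<in> carrier H \<Longrightarrow>
      lin_lift K H (\<lambda>(x, y). x \<otimes>\<^bsub>H\<^esub> antipode H y) (comult H h) = counit H h \<odot>\<^bsub>H\<^esub> \<one>\<^bsub>H\<^esub>"

definition antipode_inv :: "('k, 'h, 'm) hopf_scheme \<Rightarrow> 'h \<Rightarrow> 'h" where
  "antipode_inv H = inv_into (carrier H) (antipode H)"


section \<open>Principal comodule algebras\<close>

record ('k, 'a, 'h) comodule_algebra = "('k, 'a) module" +
  coact :: "'a \<Rightarrow> ('a \<times> 'h \<Rightarrow> 'k) set"

locale right_comodule_algebra = H: hopf_algebra K H + A: assoc_algebra K A
  for K :: "'k ring" and H :: "('k, 'h) hopf" and A :: "('k, 'a, 'h) comodule_algebra" +
  assumes coact_hom: "coact A \<in> algebra_homs K A (tensor_algebra K A H)"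
    and coact_coassociative: "a \<in> carrier A \<Longrightarrow>
      tensor_assoc K A H H (tensor_map K (tensor_algebra K A H) H (coact A) (\<lambda>x. x) (coact A a)) =
      tensor_map K A (tensor_algebra K H H) (\<lambda>x. x) (comult H) (coact A a)"
    and coact_counit: "a \<in> carrier A \<Longrightarrow>
      lin_lift K A (\<lambda>(x, h). counit H h \<odot>\<^bsub>A\<^esub> x) (coact A a) = a"

text \<open>The left coaction \<open>\<delta>\<^sub>S(a) = S\<^sup>-\<^sup>1(a\<^sub>1) \<otimes> a\<^sub>0\<close>.\<close>

definition left_coact ::
    "'k ring \<Rightarrow> ('k, 'h) hopf \<Rightarrow> ('k, 'a, 'h) comodule_algebra \<Rightarrow> 'a \<Rightarrow> ('h \<times> 'a \<Rightarrow> 'k) set" where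
  "left_coact K H A a =
     lin_lift K (tensor_algebra K H A) (\<lambda>(x, h). pure_tensor K H A (antipode_inv H h) x) (coact A a)"

definition strong_connection ::
    "'k ring \<Rightarrow> ('k, 'h) hopf \<Rightarrow> ('k, 'a, 'h) comodule_algebra \<Rightarrow> ('h \<Rightarrow> ('a \<times> 'a \<Rightarrow> 'k) set) \<Rightarrow> bool" where
  "strong_connection K H A l \<longleftrightarrow>
     l \<in> linear_maps K H (tensor_algebra K A A) \<and>
     l \<one>\<^bsub>H\<^esub> = pure_tensor K A A \<one>\<^bsub>A\<^esub> \<one>\<^bsub>A\<^esub> \<and>
     (\<forall>h\<in>carrier H. mult_map K A (l h) = counit H h \<odot>\<^bsub>A\<^esub> \<one>\<^bsub>A\<^esub>) \<and>
     (\<forall>h\<in>carrier H.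
        tensor_map K A (tensor_algebra K A H) (\<lambda>x. x) (coact A) (l h) =
        tensor_assoc K A A H (tensor_map K (tensor_algebra K A A) H l (\<lambda>x. x) (comult H h))) \<and>
     (\<forall>h\<in>carrier H.
        tensor_assoc K H A A (tensor_map K (tensor_algebra K H A) A (left_coact K H A) (\<lambda>x. x) (l h)) =
        tensor_map K H (tensor_algebra K A A) (\<lambda>x. x) l (comult H h))"

definition principal_comodule_algebra ::
    "'k ring \<Rightarrow> ('k, 'h) hopf \<Rightarrow> ('k, 'a, 'h) comodule_algebra \<Rightarrow> bool" where
  "principal_comodule_algebra K H A \<longleftrightarrow>
     right_comodule_algebra K H A \<and>
     bij_betw (antipode H) (carrier H) (carrier H) \<and>
     (\<exists>l. strong_connection K H A l)"

definition coinvariants ::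
    "'k ring \<Rightarrow> ('k, 'h) hopf \<Rightarrow> ('k, 'a, 'h) comodule_algebra \<Rightarrow> ('k, 'a) module" where
  "coinvariants K H A =
     (module.truncate A)\<lparr>carrier := {a \<in> carrier A. coact A a = pure_tensor K A H a \<one>\<^bsub>H\<^esub>}\<rparr>"

definition principal_over ::
    "'k ring \<Rightarrow> ('k, 'h) hopf \<Rightarrow> ('k, 'b) module \<Rightarrow> ('k, 'a, 'h) comodule_algebra \<Rightarrow> bool" where
  "principal_over K H B A \<longleftrightarrow>
     principal_comodule_algebra K H A \<and> assoc_algebra K B \<and>
     algebra_isos K (coinvariants K H A) B \<noteq> {}"

definition comodule_algebra_isomorphic ::
    "'k ring \<Rightarrow> ('k, 'h) hopf \<Rightarrow> ('k, 'a, 'h) comodule_algebra \<Rightarrow> ('k, 'b, 'h) comodule_algebra \<Rightarrow> bool" where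
  "comodule_algebra_isomorphic K H A A' \<longleftrightarrow>
     right_comodule_algebra K H A \<and> right_comodule_algebra K H A' \<and>
     (\<exists>f\<in>algebra_isos K A A'. \<forall>a\<in>carrier A.
        coact A' (f a) = tensor_map K A' H f (\<lambda>x. x) (coact A a))"


section \<open>Base change\<close>

text \<open>\<open>M \<otimes>\<^sub>K L\<close> as an algebra over \<open>L\<close>, for a ring homomorphism \<open>\<phi>: K \<rightarrow> L\<close>.\<close>

definition base_change ::
    "'k ring \<Rightarrow> 'l ring \<Rightarrow> ('k \<Rightarrow> 'l) \<Rightarrow> ('k, 'a, 'm) module_scheme \<Rightarrow> ('l, ('a \<times> 'l \<Rightarrow> 'k) set) module" where
  "base_change K L \<phi> M =
    (let L\<phi> = ring_as_algebra L \<phi> in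
      ring.extend (ring.truncate (tensor_algebra K M L\<phi>))
        (module.fields (\<lambda>l. tensor_map K M L\<phi> (\<lambda>m. m) (\<lambda>x. l \<otimes>\<^bsub>L\<^esub> x))))"

text \<open>The Hopf algebra \<open>H \<otimes>\<^sub>K L\<close> over \<open>L\<close>:
  \<open>\<Delta>(h \<otimes> l) = l \<cdot> (h\<^sub>1 \<otimes> 1) \<otimes>\<^sub>L (h\<^sub>2 \<otimes> 1)\<close>, \<open>\<epsilon>(h \<otimes> l) = \<phi>(\<epsilon>(h)) l\<close>, \<open>S(h \<otimes> l) = S(h) \<otimes> l\<close>.\<close>

definition hopf_base_change ::
    "'k ring \<Rightarrow> 'l ring \<Rightarrow> ('k \<Rightarrow> 'l) \<Rightarrow> ('k, 'h) hopf \<Rightarrow> ('l, ('h \<times> 'l \<Rightarrow> 'k) set) hopf" where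
  "hopf_base_change K L \<phi> H =
    (let L\<phi> = ring_as_algebra L \<phi>;
         HL = base_change K L \<phi> H;
         T = tensor_algebra L HL HL;
         \<iota> = (\<lambda>h. pure_tensor K H L\<phi> h \<one>\<^bsub>L\<^esub>) in
      module.extend HL (hopf.fields
        (lin_lift K (restrict_scalars \<phi> T) (\<lambda>(h, l). l \<odot>\<^bsub>T\<^esub>
           lin_lift K (restrict_scalars \<phi> T) (\<lambda>(h1, h2). pure_tensor L HL HL (\<iota> h1) (\<iota> h2)) (comult H h)))
        (lin_lift K L\<phi> (\<lambda>(h, l). \<phi> (counit H h) \<otimes>\<^bsub>L\<^esub> l))
        (tensor_map K H L\<phi> (antipode H) (\<lambda>l. l))))"


section \<open>Homotopy of principal comodule algebras\<close>

definition complex_ring :: "complex ring" where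
  "complex_ring = \<lparr>carrier = UNIV, mult = (*), one = 1, zero = 0, add = (+)\<rparr>"

definition function_star_subalgebra :: "(real \<Rightarrow> complex) set \<Rightarrow> bool" where
  "function_star_subalgebra F \<longleftrightarrow>
     (\<lambda>y. 1) \<in> F \<and>
     (\<forall>f\<in>F. \<forall>g\<in>F. (\<lambda>y. f y + g y) \<in> F \<and> (\<lambda>y. f y * g y) \<in> F) \<and>
     (\<forall>c. \<forall>f\<in>F. (\<lambda>y. c * f y) \<in> F) \<and>
     (\<forall>f\<in>F. (\<lambda>y. cnj (f y)) \<in> F)"

definition admissible_functions :: "(real \<Rightarrow> complex) set \<Rightarrow> bool" where
  "admissible_functions F \<longleftrightarrow>
     function_star_subalgebra F \<and>
     (\<forall>n::nat. (\<lambda>y. complex_of_real y ^ n) \<in> F) \<and>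
     (\<forall>c::real. (\<lambda>y. exp (\<i> * complex_of_real c * complex_of_real y)) \<in> F)"

definition function_ring :: "(real \<Rightarrow> complex) set \<Rightarrow> (real \<Rightarrow> complex) ring" where
  "function_ring F = \<lparr>carrier = F, mult = (\<lambda>f g y. f y * g y), one = (\<lambda>y. 1),
     zero = (\<lambda>y. 0), add = (\<lambda>f g y. f y + g y)\<rparr>"

abbreviation const_fun :: "complex \<Rightarrow> real \<Rightarrow> complex" where
  "const_fun c \<equiv> \<lambda>y. c"

abbreviation algebra_family ::
    "(real \<Rightarrow> complex) set \<Rightarrow> (complex, 'b) module \<Rightarrow>
     (real \<Rightarrow> complex, ('b \<times> (real \<Rightarrow> complex) \<Rightarrow> complex) set) module" where
  "algebra_family F B \<equiv> base_change complex_ring (function_ring F) const_fun B"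

abbreviation hopf_family ::
    "(real \<Rightarrow> complex) set \<Rightarrow> (complex, 'h) hopf \<Rightarrow>
     (real \<Rightarrow> complex, ('h \<times> (real \<Rightarrow> complex) \<Rightarrow> complex) set) hopf" where
  "hopf_family F H \<equiv> hopf_base_change complex_ring (function_ring F) const_fun H"

text \<open>\<open>ev\<^sub>p\<^sub>*(A) = A \<otimes>\<^sub>F \<complex>\<close> for an \<open>H \<otimes> F\<close>-comodule algebra \<open>A\<close> over \<open>F\<close>. Its coaction is the base change
  \<open>ev\<^sub>p\<^sub>*(A) \<rightarrow> ev\<^sub>p\<^sub>*(A) \<otimes>\<^sub>\<complex> ev\<^sub>p\<^sub>*(H \<otimes> F)\<close> of the coaction of \<open>A\<close>, followed by the canonical isomorphism
  \<open>ev\<^sub>p\<^sub>*(H \<otimes> F) \<cong> H\<close>, \<open>(h \<otimes> f) \<otimes> c \<mapsto> f(p) c h\<close>. So if \<open>\<delta>(a) = \<Sum>\<^sub>i a\<^sub>i \<otimes> (h\<^sub>i \<otimes> f\<^sub>i)\<close>, then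
  \<open>a \<otimes> c \<mapsto> c \<cdot> \<Sum>\<^sub>i (a\<^sub>i \<otimes> f\<^sub>i(p)) \<otimes> h\<^sub>i\<close>.\<close>

definition eval_fibre ::
    "(real \<Rightarrow> complex) set \<Rightarrow> (complex, 'h) hopf \<Rightarrow> real \<Rightarrow>
     (real \<Rightarrow> complex, 'a, ('h \<times> (real \<Rightarrow> complex) \<Rightarrow> complex) set) comodule_algebra \<Rightarrow>
     (complex, ('a \<times> complex \<Rightarrow> real \<Rightarrow> complex) set, 'h) comodule_algebra" where
  "eval_fibre F H p A =
    (let R = function_ring F;
         ev = (\<lambda>f :: real \<Rightarrow> complex. f p);
         Ap = base_change R complex_ring ev A;
         T = tensor_algebra complex_ring Ap H;
         a_tensor = pure_tensor R A (ring_as_algebra complex_ring ev) in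
      module.extend Ap (comodule_algebra.fields
        (lin_lift R (restrict_scalars ev T) (\<lambda>(a, c). c \<odot>\<^bsub>T\<^esub>
           lin_lift R (restrict_scalars ev T) (\<lambda>(x, u).
             lin_lift complex_ring T (\<lambda>(h, f). pure_tensor complex_ring Ap H (a_tensor x (f p)) h) u)
           (coact A a)))))"

text \<open>The relation \<open>\<sim>\<close>. The quantifier over \<open>A\<close> ranges over algebras whose underlying set lives in
  the type given as first argument. Likewise, the chains in the generated equivalence relation
  \<open>homotopy_equivalent\<close> below run through comodule algebras carried by the type of \<open>A\<^sub>0\<close> and \<open>A\<^sub>1\<close>.\<close>

definition elementary_homotopic ::
    "'c itself \<Rightarrow> (real \<Rightarrow> complex) set \<Rightarrow> (complex, 'h) hopf \<Rightarrow> (complex, 'b) module \<Rightarrow>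
     (complex, 'a, 'h) comodule_algebra \<Rightarrow> (complex, 'a, 'h) comodule_algebra \<Rightarrow> bool" where
  "elementary_homotopic _ F H B A0 A1 \<longleftrightarrow>
     principal_over complex_ring H B A0 \<and> principal_over complex_ring H B A1 \<and>
     (\<exists>A :: (real \<Rightarrow> complex, 'c, ('h \<times> (real \<Rightarrow> complex) \<Rightarrow> complex) set) comodule_algebra.
        principal_over (function_ring F) (hopf_family F H) (algebra_family F B) A \<and>
        comodule_algebra_isomorphic complex_ring H (eval_fibre F H 0 A) A0 \<and>
        comodule_algebra_isomorphic complex_ring H (eval_fibre F H 1 A) A1)"

definition homotopy_equivalent ::
    "'c itself \<Rightarrow> (real \<Rightarrow> complex) set \<Rightarrow> (complex, 'h) hopf \<Rightarrow> (complex, 'b) module \<Rightarrow>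
     (complex, 'a, 'h) comodule_algebra \<Rightarrow> (complex, 'a, 'h) comodule_algebra \<Rightarrow> bool" where
  "homotopy_equivalent \<tau> F H B A0 A1 \<longleftrightarrow>
     principal_over complex_ring H B A0 \<and> principal_over complex_ring H B A1 \<and>
     equivclp (elementary_homotopic \<tau> F H B) A0 A1"


section \<open>Algebras with involution given by generators and relations\<close>

datatype 'g letter = Gen 'g | Adj 'g

primrec adjoint :: "'g letter \<Rightarrow> 'g letter" where
  "adjoint (Gen g) = Adj g"
| "adjoint (Adj g) = Gen g"

definition free_algebra :: "'k ring \<Rightarrow> ('k, 'x list \<Rightarrow> 'k) module" where
  "free_algebra K = monoid_algebra K \<lparr>carrier = UNIV, mult = (@), one = []\<rparr>"

text \<open>The involution of the free \<open>*\<close>-algebra over a ring \<open>K\<close> with involution \<open>cj\<close>.\<close>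

definition free_star :: "('k \<Rightarrow> 'k) \<Rightarrow> ('g letter list \<Rightarrow> 'k) \<Rightarrow> ('g letter list \<Rightarrow> 'k)" where
  "free_star cj f = (\<lambda>w. cj (f (rev (map adjoint w))))"

text \<open>A relation \<open>u = v\<close> is given as the pair \<open>(u, v)\<close>. The \<open>*\<close>-ideal generated by the relations is the
  ideal generated by them and their adjoints.\<close>

definition star_ideal ::
    "'k ring \<Rightarrow> ('k \<Rightarrow> 'k) \<Rightarrow> (('g letter list \<Rightarrow> 'k) \<times> ('g letter list \<Rightarrow> 'k)) set \<Rightarrow>
     ('g letter list \<Rightarrow> 'k) set" where
  "star_ideal K cj rels =
    (let F = free_algebra K; D = {u \<ominus>\<^bsub>F\<^esub> v |u v. (u, v) \<in> rels} in
      Idl\<^bsub>F\<^esub> (D \<union> free_star cj ` D))"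

definition star_algebra ::
    "'k ring \<Rightarrow> ('k \<Rightarrow> 'k) \<Rightarrow> (('g letter list \<Rightarrow> 'k) \<times> ('g letter list \<Rightarrow> 'k)) set \<Rightarrow>
     ('k, ('g letter list \<Rightarrow> 'k) set) module" where
  "star_algebra K cj rels = quot_algebra (free_algebra K) (star_ideal K cj rels)"

definition letter_class ::
    "'k ring \<Rightarrow> ('k \<Rightarrow> 'k) \<Rightarrow> (('g letter list \<Rightarrow> 'k) \<times> ('g letter list \<Rightarrow> 'k)) set \<Rightarrow>
     'g letter \<Rightarrow> ('g letter list \<Rightarrow> 'k) set" where
  "letter_class K cj rels x = star_ideal K cj rels +>\<^bsub>free_algebra K\<^esub> basis_elem K [x]"

text \<open>The algebra homomorphism from an algebra presented as above to \<open>P\<close> with values \<open>v\<close> on the letters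
  (meaningful if \<open>v\<close> respects the relations).\<close>

definition hom_from_letters ::
    "'k ring \<Rightarrow> ('k, 'p, 'm) module_scheme \<Rightarrow> ('g letter \<Rightarrow> 'p) \<Rightarrow> ('g letter list \<Rightarrow> 'k) set \<Rightarrow> 'p" where
  "hom_from_letters K P v = lin_lift K P (\<lambda>w. foldr (\<lambda>x y. v x \<otimes>\<^bsub>P\<^esub> y) w \<one>\<^bsub>P\<^esub>)"

definition commutation_relations ::
    "'k ring \<Rightarrow> (('g letter list \<Rightarrow> 'k) \<times> ('g letter list \<Rightarrow> 'k)) set" where
  "commutation_relations K = {(basis_elem K [x, y], basis_elem K [y, x]) |x y. True}"


section \<open>The Hopf fibrations\<close>

datatype u1_gen = gen_t
datatype s2_gen = gen_z | gen_x
datatype s3_gen = gen_z1 | gen_z2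

definition u1_relations where
  "u1_relations = commutation_relations complex_ring \<union>
     {(basis_elem complex_ring [Adj gen_t, Gen gen_t], \<one>\<^bsub>free_algebra complex_ring\<^esub>)}"

abbreviation u1_letter :: "u1_gen letter \<Rightarrow> (u1_gen letter list \<Rightarrow> complex) set" where
  "u1_letter \<equiv> letter_class complex_ring cnj u1_relations"

text \<open>The antipode is an algebra homomorphism, the algebra being commutative.\<close>

definition O_U1 :: "(complex, (u1_gen letter list \<Rightarrow> complex) set) hopf" where
  "O_U1 =
    (let H = star_algebra complex_ring cnj u1_relations;
         HH = tensor_algebra complex_ring H H in
      module.extend H (hopf.fields
        (hom_from_letters complex_ring HH
           (\<lambda>x. pure_tensor complex_ring H H (u1_letter x) (u1_letter x)))
        (hom_from_letters complex_ring (ring_as_algebra complex_ring (\<lambda>k. k)) (\<lambda>x. 1))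
        (hom_from_letters complex_ring H (\<lambda>x. u1_letter (adjoint x)))))"

definition O_S2 :: "(complex, (s2_gen letter list \<Rightarrow> complex) set) module" where
  "O_S2 =
    (let F = free_algebra complex_ring; w = basis_elem complex_ring in
      star_algebra complex_ring cnj
        (commutation_relations complex_ring \<union>
         {(w [Adj gen_x], w [Gen gen_x]),
          (w [Adj gen_z, Gen gen_z] \<oplus>\<^bsub>F\<^esub> w [Gen gen_x, Gen gen_x], \<one>\<^bsub>F\<^esub>)}))"

definition sphere_relation ::
    "'k ring \<Rightarrow> (s3_gen letter list \<Rightarrow> 'k) \<times> (s3_gen letter list \<Rightarrow> 'k)" where
  "sphere_relation K =
    (let F = free_algebra K; w = basis_elem K in
      (w [Adj gen_z1, Gen gen_z1] \<oplus>\<^bsub>F\<^esub> w [Adj gen_z2, Gen gen_z2], \<one>\<^bsub>F\<^esub>))"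

text \<open>The relations of the deformed sphere over \<open>K\<close>; here \<open>q'\<close> stands for the inverse of \<open>q\<close>.\<close>

definition deformed_sphere_relations ::
    "'k ring \<Rightarrow> 'k \<Rightarrow> 'k \<Rightarrow> ((s3_gen letter list \<Rightarrow> 'k) \<times> (s3_gen letter list \<Rightarrow> 'k)) set" where
  "deformed_sphere_relations K q q' =
    (let F = free_algebra K; w = basis_elem K in
      {(w [Gen gen_z1, Adj gen_z1], w [Adj gen_z1, Gen gen_z1]),
       (w [Gen gen_z2, Adj gen_z2], w [Adj gen_z2, Gen gen_z2]),
       (w [Gen gen_z1, Gen gen_z2], q \<odot>\<^bsub>F\<^esub> w [Gen gen_z2, Gen gen_z1]),
       (w [Gen gen_z1, Adj gen_z2], q' \<odot>\<^bsub>F\<^esub> w [Adj gen_z2, Gen gen_z1]),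
       sphere_relation K})"

text \<open>The comodule algebra generated by \<open>z\<^sub>i\<close> subject to \<open>rels\<close>, with \<open>\<delta>(z\<^sub>i) = z\<^sub>i \<otimes> t\<close> and
  \<open>\<delta>(z\<^sub>i\<^sup>*) = z\<^sub>i\<^sup>* \<otimes> t'\<close>.\<close>

definition hopf_fibration ::
    "'k ring \<Rightarrow> ('k \<Rightarrow> 'k) \<Rightarrow> ((s3_gen letter list \<Rightarrow> 'k) \<times> (s3_gen letter list \<Rightarrow> 'k)) set \<Rightarrow>
     ('k, 'h) hopf \<Rightarrow> 'h \<Rightarrow> 'h \<Rightarrow> ('k, (s3_gen letter list \<Rightarrow> 'k) set, 'h) comodule_algebra" where
  "hopf_fibration K cj rels H t t' =
    (let P = star_algebra K cj rels; z = letter_class K cj rels in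
      module.extend P (comodule_algebra.fields
        (hom_from_letters K (tensor_algebra K P H)
           (\<lambda>x. case x of Gen i \<Rightarrow> pure_tensor K P H (z (Gen i)) t
                        | Adj i \<Rightarrow> pure_tensor K P H (z (Adj i)) t'))))"

definition O_S3 where
  "O_S3 = hopf_fibration complex_ring cnj
     (commutation_relations complex_ring \<union> {sphere_relation complex_ring})
     O_U1 (u1_letter (Gen gen_t)) (u1_letter (Adj gen_t))"

definition deform_param :: "real \<Rightarrow> complex" where
  "deform_param \<theta> = exp (2 * complex_of_real pi * \<i> * complex_of_real \<theta>)"

definition O_S3_deformed where
  "O_S3_deformed \<theta> = hopf_fibration complex_ring cnj
     (deformed_sphere_relations complex_ring (deform_param \<theta>) (inverse (deform_param \<theta>)))
     O_U1 (u1_letter (Gen gen_t)) (u1_letter (Adj gen_t))"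

text \<open>Here \<open>Q\<close> is the function \<open>y \<mapsto> exp(2\<pi>i\<theta>y)\<close> and \<open>\<iota> h = h \<otimes> 1\<close>.\<close>

definition O_S3_family where
  "O_S3_family F \<theta> =
    (let \<iota> = (\<lambda>h. pure_tensor complex_ring O_U1 (ring_as_algebra (function_ring F) const_fun) h (\<lambda>y. 1)) in
      hopf_fibration (function_ring F) (\<lambda>f y. cnj (f y))
        (deformed_sphere_relations (function_ring F)
           (\<lambda>y. deform_param (\<theta> * y)) (\<lambda>y. inverse (deform_param (\<theta> * y))))
        (hopf_family F O_U1) (\<iota> (u1_letter (Gen gen_t))) (\<iota> (u1_letter (Adj gen_t))))"

end

theory Submission
  imports Defs
begin

text \<open>Both \<open>\<O>(U(1))\<close> and its base change are Hopf algebras with a basis of group-like elements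
  \<open>t\<^sup>n\<close>, \<open>n \<in> \<int>\<close>, so that comodule algebras over them are \<open>\<int>\<close>-graded algebras, and every required identity
  may be checked on homogeneous elements. A strong connection exists as soon as \<open>\<one>\<close> is a sum of
  products \<open>A\<^sub>-\<^sub>1 A\<^sub>1\<close> and of products \<open>A\<^sub>1 A\<^sub>-\<^sub>1\<close>, which is what the sphere relation and the normality of
  \<open>z\<^sub>1\<close>, \<open>z\<^sub>2\<close> say. The coinvariants are the elements of degree \<open>0\<close>; the map from the two-sphere is
  \<open>z \<mapsto> 2 z\<^sub>1 z\<^sub>2\<^sup>*\<close>, \<open>x \<mapsto> z\<^sub>1 z\<^sub>1\<^sup>* - z\<^sub>2 z\<^sub>2\<^sup>*\<close>. It is onto because a nonempty word of degree \<open>0\<close> contains two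
  adjacent letters of opposite degree, which can be moved to the front up to a scalar. It is injective
  because the sphere with parameter \<open>q\<close> acts on functions \<open>\<int> \<rightarrow> \<complex>\<close> by \<open>z\<^sub>1 = a U\<close>, \<open>z\<^sub>2 = b V\<close> with
  \<open>a\<^sup>2 + b\<^sup>2 = 1\<close>, a shift \<open>U\<close> and a diagonal operator \<open>V\<close>: the coefficients of an element of the two-sphere
  are then those of a family of polynomials in \<open>a\<^sup>2 - b\<^sup>2\<close>. The fibre of the family at \<open>p\<close> satisfies the
  relations of the sphere with parameter \<open>\<theta>p\<close>, and the two universal properties give mutually inverse
  maps.\<close>


section \<open>Linear maps and spanning sets\<close>

text \<open>The structure maps are given as \<open>lin_lift\<close>, evaluated at a representative
  chosen by \<open>SOME\<close>, so nothing can be computed before it is known that the choice is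
  immaterial. Each such map is therefore replaced by two facts, its linearity and its values on pure
  tensors or words; the rest compares linear maps on spanning sets. The ground ring of the family is
  an arbitrary algebra of functions, over which no basis of the three-sphere is at hand. None is
  used: independence matters only for the powers of t and for the two-sphere. The former comes from
  a map to Laurent polynomials. For the latter, a set of ring homomorphisms from the ground ring to
  the complex numbers that jointly detect zero reduces the claim to complex coefficients; it is the
  identity for a single sphere and all point evaluations for the family. This is why the sphere is
  studied over an abstract ground ring with a parameter \<open>q\<close> and its inverse
  \<open>q'\<close>: the deformed fibration and the family are two instances. The classical
  fibration is a third, since at parameter 0 the two defining ideals coincide.\<close>

lemma linear_mapsI:
  assumes "\<And>x. x \<in> carrier M \<Longrightarrow> f x \<in> carrier N"
    and "\<And>x y. x \<in> carrier M \<Longrightarrow> y \<in> carrier M \<Longrightarrow> f (x \<oplus>\<^bsub>M\<^esub> y) = f x \<oplus>\<^bsub>N\<^esub> f y"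
    and "\<And>k x. k \<in> carrier K \<Longrightarrow> x \<in> carrier M \<Longrightarrow> f (k \<odot>\<^bsub>M\<^esub> x) = k \<odot>\<^bsub>N\<^esub> f x"
  shows "f \<in> linear_maps K M N"
  using assms by (auto simp: linear_maps_def)

lemma linear_maps_closed: "f \<in> linear_maps K M N \<Longrightarrow> x \<in> carrier M \<Longrightarrow> f x \<in> carrier N"
  and linear_maps_add: "f \<in> linear_maps K M N \<Longrightarrow> x \<in> carrier M \<Longrightarrow> y \<in> carrier M \<Longrightarrow>
      f (x \<oplus>\<^bsub>M\<^esub> y) = f x \<oplus>\<^bsub>N\<^esub> f y"
  and linear_maps_smult: "f \<in> linear_maps K M N \<Longrightarrow> k \<in> carrier K \<Longrightarrow> x \<in> carrier M \<Longrightarrow>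
      f (k \<odot>\<^bsub>M\<^esub> x) = k \<odot>\<^bsub>N\<^esub> f x"
  by (auto simp: linear_maps_def)

lemma linear_maps_zero:
  assumes "module K M" "module K N" "f \<in> linear_maps K M N"
  shows "f \<zero>\<^bsub>M\<^esub> = \<zero>\<^bsub>N\<^esub>"
proof -
  interpret M: module K M by fact
  interpret N: module K N by fact
  have "f (\<zero>\<^bsub>K\<^esub> \<odot>\<^bsub>M\<^esub> \<zero>\<^bsub>M\<^esub>) = \<zero>\<^bsub>K\<^esub> \<odot>\<^bsub>N\<^esub> f \<zero>\<^bsub>M\<^esub>"
    using assms(3) by (intro linear_maps_smult) auto
  thus ?thesis using linear_maps_closed[OF assms(3)] by simp
qed

lemma (in module) minus_eq_smult: "x \<in> carrier M \<Longrightarrow> \<ominus>\<^bsub>M\<^esub> x = (\<ominus> \<one>) \<odot>\<^bsub>M\<^esub> x"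
  by (simp add: smult_l_minus)

lemma linear_maps_minus:
  assumes "module K M" "module K N" "f \<in> linear_maps K M N" "x \<in> carrier M" "y \<in> carrier M"
  shows "f (x \<ominus>\<^bsub>M\<^esub> y) = f x \<ominus>\<^bsub>N\<^esub> f y"
proof -
  interpret M: module K M by fact
  interpret N: module K N by fact
  show ?thesis using assms linear_maps_closed[OF assms(3)]
    by (simp add: a_minus_def M.minus_eq_smult N.minus_eq_smult linear_maps_add linear_maps_smult)
qed

lemma linear_maps_finsum:
  assumes "module K M" "module K N" "f \<in> linear_maps K M N" "g \<in> A \<rightarrow> carrier M"
  shows "f (\<Oplus>\<^bsub>M\<^esub>i\<in>A. g i) = (\<Oplus>\<^bsub>N\<^esub>i\<in>A. f (g i))"
proof -
  interpret M: module K M by fact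
  interpret N: module K N by fact
  show ?thesis using assms(4)
  proof (induction A rule: infinite_finite_induct)
    case (insert a A)
    have "(\<Oplus>\<^bsub>M\<^esub>i\<in>A. g i) \<in> carrier M" "(\<lambda>i. f (g i)) \<in> A \<rightarrow> carrier N"
      using insert.prems linear_maps_closed[OF assms(3)] by auto
    with insert linear_maps_closed[OF assms(3)] show ?case
      by (auto simp: linear_maps_add[OF assms(3)])
  qed (auto simp: linear_maps_zero[OF assms(1-3)])
qed

lemma linear_maps_compose:
  assumes "f \<in> linear_maps K M N" "g \<in> linear_maps K N P"
  shows "(\<lambda>x. g (f x)) \<in> linear_maps K M P"
  using assms by (auto simp: linear_maps_def Pi_iff)

lemma linear_maps_id: "(\<lambda>x. x) \<in> linear_maps K M M"
  by (auto simp: linear_maps_def)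

lemma linear_maps_sum:
  assumes "module K N" "f \<in> linear_maps K M N" "g \<in> linear_maps K M N"
  shows "(\<lambda>x. f x \<oplus>\<^bsub>N\<^esub> g x) \<in> linear_maps K M N"
proof -
  interpret N: module K N by fact
  show ?thesis
    using assms(2,3)[THEN linear_maps_closed]
    by (intro linear_mapsI)
       (auto simp: linear_maps_add[OF assms(2)] linear_maps_add[OF assms(3)]
          linear_maps_smult[OF assms(2)] linear_maps_smult[OF assms(3)] N.smult_r_distr N.a_ac)
qed

lemma linear_maps_scale:
  assumes "module K N" "f \<in> linear_maps K M N" "k \<in> carrier K"
  shows "(\<lambda>x. k \<odot>\<^bsub>N\<^esub> f x) \<in> linear_maps K M N"
proof -
  interpret N: module K N by fact
  show ?thesis
    using assms(3) assms(2)[THEN linear_maps_closed]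
    by (intro linear_mapsI)
       (auto simp: linear_maps_add[OF assms(2)] linear_maps_smult[OF assms(2)] N.smult_r_distr
          N.smult_assoc1[symmetric] N.R.m_comm)
qed

text \<open>Stated through submodules instead of linear combinations, so that a property closed
  under linear combinations can be proved by induction without coefficients, over any ground
  ring.\<close>

definition spanning :: "'k ring \<Rightarrow> ('k, 'a, 'm) module_scheme \<Rightarrow> 'a set \<Rightarrow> bool" where
  "spanning K M S \<longleftrightarrow> S \<subseteq> carrier M \<and> (\<forall>N. submodule N K M \<longrightarrow> S \<subseteq> N \<longrightarrow> carrier M \<subseteq> N)"

lemma submodule_sep:
  assumes "module K M" "P \<zero>\<^bsub>M\<^esub>"
    "\<And>x y. x \<in> carrier M \<Longrightarrow> y \<in> carrier M \<Longrightarrow> P x \<Longrightarrow> P y \<Longrightarrow> P (x \<oplus>\<^bsub>M\<^esub> y)"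
    "\<And>k x. k \<in> carrier K \<Longrightarrow> x \<in> carrier M \<Longrightarrow> P x \<Longrightarrow> P (k \<odot>\<^bsub>M\<^esub> x)"
  shows "submodule {x \<in> carrier M. P x} K M"
proof -
  interpret M: module K M by fact
  show ?thesis
    by (rule M.submoduleI) (auto intro: assms simp: M.minus_eq_smult)
qed

lemma spanning_subset: "spanning K M S \<Longrightarrow> x \<in> S \<Longrightarrow> x \<in> carrier M"
  by (auto simp: spanning_def)

lemma spanning_induct [consumes 3, case_names zero base add smult]:
  assumes "module K M" "spanning K M S" "x \<in> carrier M"
    "P \<zero>\<^bsub>M\<^esub>" "\<And>x. x \<in> S \<Longrightarrow> P x"
    "\<And>x y. x \<in> carrier M \<Longrightarrow> y \<in> carrier M \<Longrightarrow> P x \<Longrightarrow> P y \<Longrightarrow> P (x \<oplus>\<^bsub>M\<^esub> y)"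
    "\<And>k x. k \<in> carrier K \<Longrightarrow> x \<in> carrier M \<Longrightarrow> P x \<Longrightarrow> P (k \<odot>\<^bsub>M\<^esub> x)"
  shows "P x"
proof -
  have "submodule {x \<in> carrier M. P x} K M"
    by (rule submodule_sep) (use assms in auto)
  moreover have "S \<subseteq> {x \<in> carrier M. P x}"
    using assms(2,5) by (auto simp: spanning_def)
  ultimately show ?thesis using assms(2,3) by (auto simp: spanning_def)
qed

lemma spanningI:
  assumes "S \<subseteq> carrier M"
    "\<And>x N. submodule N K M \<Longrightarrow> S \<subseteq> N \<Longrightarrow> x \<in> carrier M \<Longrightarrow> x \<in> N"
  shows "spanning K M S"
  using assms by (auto simp: spanning_def)

lemma spanning_carrier: "spanning K M (carrier M)"
  by (auto simp: spanning_def)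

lemma submodule_zero: "module K M \<Longrightarrow> submodule N K M \<Longrightarrow> \<zero>\<^bsub>M\<^esub> \<in> N"
  and submodule_add: "module K M \<Longrightarrow> submodule N K M \<Longrightarrow> x \<in> N \<Longrightarrow> y \<in> N \<Longrightarrow> x \<oplus>\<^bsub>M\<^esub> y \<in> N"
  and submodule_smult: "module K M \<Longrightarrow> submodule N K M \<Longrightarrow> k \<in> carrier K \<Longrightarrow> x \<in> N \<Longrightarrow> k \<odot>\<^bsub>M\<^esub> x \<in> N"
  and submodule_carrier: "module K M \<Longrightarrow> submodule N K M \<Longrightarrow> x \<in> N \<Longrightarrow> x \<in> carrier M"
proof -
  assume "module K M" "submodule N K M"
  thus "\<zero>\<^bsub>M\<^esub> \<in> N" using subgroup.one_closed[OF submodule.axioms(1)] by fastforce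
qed (auto dest: module.submoduleE)

lemma spanning_trans:
  assumes "module K M" "spanning K M S" "S' \<subseteq> carrier M"
    "\<And>x N. x \<in> S \<Longrightarrow> submodule N K M \<Longrightarrow> S' \<subseteq> N \<Longrightarrow> x \<in> N"
  shows "spanning K M S'"
proof (rule spanningI)
  fix x N assume N: "submodule N K M" "S' \<subseteq> N" and x: "x \<in> carrier M"
  show "x \<in> N" using assms(1,2) x
    by (induction rule: spanning_induct)
       (auto intro: assms(4)[OF _ N] submodule_zero[OF assms(1) N(1)] submodule_add[OF assms(1) N(1)]
          submodule_smult[OF assms(1) N(1)])
qed fact

lemma spanning_image:
  assumes "module K M" "module K N" "f \<in> linear_maps K M N" "f ` carrier M = carrier N" "spanning K M S"
  shows "spanning K N (f ` S)"
proof (rule spanningI)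
  show "f ` S \<subseteq> carrier N" using assms(4,5) by (auto simp: spanning_def)
  fix y L assume L: "submodule L K N" "f ` S \<subseteq> L" and y: "y \<in> carrier N"
  then obtain x where x: "x \<in> carrier M" "y = f x" using assms(4) by blast
  have "f x \<in> L" using assms(1,5) x(1)
    by (induction rule: spanning_induct)
       (use L in \<open>auto simp: linear_maps_zero[OF assms(1-3)] linear_maps_add[OF assms(3)]
          linear_maps_smult[OF assms(3)] submodule_zero[OF assms(2)]
          submodule_add[OF assms(2)] submodule_smult[OF assms(2)]\<close>)
  thus "y \<in> L" using x by simp
qed

lemma linear_maps_eqI:
  assumes "module K M" "module K N" "spanning K M S" "f \<in> linear_maps K M N" "g \<in> linear_maps K M N"
    "\<And>x. x \<in> S \<Longrightarrow> f x = g x" "x \<in> carrier M"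
  shows "f x = g x"
  using assms(1,3,7)
  by (induction rule: spanning_induct)
     (auto simp: assms(6) linear_maps_zero[OF assms(1,2,4)] linear_maps_zero[OF assms(1,2,5)]
        linear_maps_add[OF assms(4)] linear_maps_add[OF assms(5)]
        linear_maps_smult[OF assms(4)] linear_maps_smult[OF assms(5)])

lemma algebra_homsI:
  assumes "f \<in> linear_maps K A B"
    "\<And>x y. x \<in> carrier A \<Longrightarrow> y \<in> carrier A \<Longrightarrow> f (x \<otimes>\<^bsub>A\<^esub> y) = f x \<otimes>\<^bsub>B\<^esub> f y"
    "f \<one>\<^bsub>A\<^esub> = \<one>\<^bsub>B\<^esub>"
  shows "f \<in> algebra_homs K A B"
  using assms by (auto simp: algebra_homs_def linear_maps_def ring_hom_def)

lemma algebra_homs_linear: "f \<in> algebra_homs K A B \<Longrightarrow> f \<in> linear_maps K A B"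
  and algebra_homs_mult: "f \<in> algebra_homs K A B \<Longrightarrow> x \<in> carrier A \<Longrightarrow> y \<in> carrier A \<Longrightarrow>
      f (x \<otimes>\<^bsub>A\<^esub> y) = f x \<otimes>\<^bsub>B\<^esub> f y"
  and algebra_homs_one: "f \<in> algebra_homs K A B \<Longrightarrow> f \<one>\<^bsub>A\<^esub> = \<one>\<^bsub>B\<^esub>"
  by (auto simp: algebra_homs_def ring_hom_def)

lemmas algebra_homs_closed = linear_maps_closed[OF algebra_homs_linear]
  and algebra_homs_add = linear_maps_add[OF algebra_homs_linear]
  and algebra_homs_smult = linear_maps_smult[OF algebra_homs_linear]

lemma assoc_algebra_module: "assoc_algebra K A \<Longrightarrow> module K A"
  by (rule assoc_algebra.axioms)

lemma assoc_algebraI: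
  assumes "module K A"
    "\<And>x y. x \<in> carrier A \<Longrightarrow> y \<in> carrier A \<Longrightarrow> x \<otimes>\<^bsub>A\<^esub> y \<in> carrier A"
    "\<one>\<^bsub>A\<^esub> \<in> carrier A"
    "\<And>x y z. x \<in> carrier A \<Longrightarrow> y \<in> carrier A \<Longrightarrow> z \<in> carrier A \<Longrightarrow>
       (x \<otimes>\<^bsub>A\<^esub> y) \<otimes>\<^bsub>A\<^esub> z = x \<otimes>\<^bsub>A\<^esub> (y \<otimes>\<^bsub>A\<^esub> z)"
    "\<And>x. x \<in> carrier A \<Longrightarrow> \<one>\<^bsub>A\<^esub> \<otimes>\<^bsub>A\<^esub> x = x" "\<And>x. x \<in> carrier A \<Longrightarrow> x \<otimes>\<^bsub>A\<^esub> \<one>\<^bsub>A\<^esub> = x"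
    "\<And>x. x \<in> carrier A \<Longrightarrow> (\<lambda>y. x \<otimes>\<^bsub>A\<^esub> y) \<in> linear_maps K A A"
    "\<And>y. y \<in> carrier A \<Longrightarrow> (\<lambda>x. x \<otimes>\<^bsub>A\<^esub> y) \<in> linear_maps K A A"
  shows "assoc_algebra K A"
proof -
  interpret module K A by fact
  have "ring A"
    by (rule ringI)
       (use assms in \<open>auto intro!: monoidI abelian_group_axioms simp: linear_maps_def\<close>)
  thus ?thesis
    using assms by (auto intro!: assoc_algebra.intro assoc_algebra_axioms.intro simp: linear_maps_def)
qed

lemma (in assoc_algebra) mult_left_linear: "x \<in> carrier A \<Longrightarrow> (\<lambda>y. x \<otimes>\<^bsub>A\<^esub> y) \<in> linear_maps K A A"
  by (intro linear_mapsI) (auto simp: A.r_distr smult_mult_right)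

lemma (in assoc_algebra) mult_right_linear: "y \<in> carrier A \<Longrightarrow> (\<lambda>x. x \<otimes>\<^bsub>A\<^esub> y) \<in> linear_maps K A A"
  by (intro linear_mapsI) (auto simp: A.l_distr smult_mult_left)

text \<open>Both sides of multiplicativity are bilinear in the pair, so agreement on generators
  extends first in the right factor and then in the left one.\<close>

lemma algebra_homs_spanningI:
  assumes A: "assoc_algebra K A" and B: "assoc_algebra K B"
    and f: "f \<in> linear_maps K A B" "spanning K A S"
    "\<And>x y. x \<in> S \<Longrightarrow> y \<in> S \<Longrightarrow> f (x \<otimes>\<^bsub>A\<^esub> y) = f x \<otimes>\<^bsub>B\<^esub> f y"
    "f \<one>\<^bsub>A\<^esub> = \<one>\<^bsub>B\<^esub>"
  shows "f \<in> algebra_homs K A B"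
proof (rule algebra_homsI)
  interpret A: assoc_algebra K A by fact
  interpret B: assoc_algebra K B by fact
  note [simp] = linear_maps_closed[OF f(1)]
  fix x y assume x: "x \<in> carrier A" and y: "y \<in> carrier A"
  have *: "f (x \<otimes>\<^bsub>A\<^esub> y) = f x \<otimes>\<^bsub>B\<^esub> f y" if "x \<in> S" for x
  proof (rule linear_maps_eqI[OF A.module_axioms B.module_axioms f(2) _ _ _ y,
      of "\<lambda>y. f (x \<otimes>\<^bsub>A\<^esub> y)" "\<lambda>y. f x \<otimes>\<^bsub>B\<^esub> f y"])
    have "x \<in> carrier A" using f(2) that by (rule spanning_subset)
    then have x: "x \<in> carrier A" "f x \<in> carrier B" by simp_all
    show "(\<lambda>y. f (x \<otimes>\<^bsub>A\<^esub> y)) \<in> linear_maps K A B"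
      by (rule linear_maps_compose[OF A.mult_left_linear[OF x(1)] f(1)])
    show "(\<lambda>y. f x \<otimes>\<^bsub>B\<^esub> f y) \<in> linear_maps K A B"
      by (rule linear_maps_compose[OF f(1) B.mult_left_linear[OF x(2)]])
  qed (use f that in auto)
  show "f (x \<otimes>\<^bsub>A\<^esub> y) = f x \<otimes>\<^bsub>B\<^esub> f y"
  proof (rule linear_maps_eqI[OF A.module_axioms B.module_axioms f(2) _ _ _ x,
      of "\<lambda>x. f (x \<otimes>\<^bsub>A\<^esub> y)" "\<lambda>x. f x \<otimes>\<^bsub>B\<^esub> f y"])
    from y have y: "y \<in> carrier A" "f y \<in> carrier B" by simp_all
    show "(\<lambda>x. f (x \<otimes>\<^bsub>A\<^esub> y)) \<in> linear_maps K A B"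
      by (rule linear_maps_compose[OF A.mult_right_linear[OF y(1)] f(1)])
    show "(\<lambda>x. f x \<otimes>\<^bsub>B\<^esub> f y) \<in> linear_maps K A B"
      by (rule linear_maps_compose[OF f(1) B.mult_right_linear[OF y(2)]])
  qed (use * in auto)
qed fact+


section \<open>Free modules and monoid algebras\<close>

definition lin_ext ::
    "'k ring \<Rightarrow> ('k, 'p, 'm) module_scheme \<Rightarrow> ('x \<Rightarrow> 'p) \<Rightarrow> ('x \<Rightarrow> 'k) \<Rightarrow> 'p" where
  "lin_ext K P \<beta> f = (\<Oplus>\<^bsub>P\<^esub>x\<in>supp K f. f x \<odot>\<^bsub>P\<^esub> \<beta> x)"

lemma monoid_algebra_carrier:
  "f \<in> carrier (monoid_algebra K M) \<longleftrightarrow>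
     f \<in> carrier M \<rightarrow> carrier K \<and> supp K f \<subseteq> carrier M \<and> finite (supp K f)"
  by (simp add: monoid_algebra_def)

lemma monoid_algebra_simps:
  "\<zero>\<^bsub>monoid_algebra K M\<^esub> = (\<lambda>x. \<zero>\<^bsub>K\<^esub>)"
  "f \<oplus>\<^bsub>monoid_algebra K M\<^esub> g = (\<lambda>x. f x \<oplus>\<^bsub>K\<^esub> g x)"
  "k \<odot>\<^bsub>monoid_algebra K M\<^esub> f = (\<lambda>x. k \<otimes>\<^bsub>K\<^esub> f x)"
  "\<one>\<^bsub>monoid_algebra K M\<^esub> = basis_elem K \<one>\<^bsub>M\<^esub>"
  by (simp_all add: monoid_algebra_def basis_elem_def)

context
  fixes R :: "'k ring" (structure)
  assumes R: "cring R"
begin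

interpretation cring R by (rule R)

lemma monoid_algebra_value:
  assumes "f \<in> carrier (monoid_algebra R M)" shows "f x \<in> carrier R"
proof (cases "x \<in> supp R f")
  case True thus ?thesis using assms by (auto simp: monoid_algebra_carrier)
qed (simp add: supp_def)

lemma monoid_algebraI:
  assumes "\<And>x. f x \<in> carrier R" "finite S" "supp R f \<subseteq> S" "S \<subseteq> carrier M"
  shows "f \<in> carrier (monoid_algebra R M)"
  using assms finite_subset by (auto simp: monoid_algebra_carrier)

lemma basis_elem_closed: "x \<in> carrier M \<Longrightarrow> basis_elem R x \<in> carrier (monoid_algebra R M)"
  by (rule monoid_algebraI[where S = "{x}"]) (auto simp: basis_elem_def supp_def)

lemma monoid_algebra_module: "module R (monoid_algebra R M)"
proof -
  let ?F = "monoid_algebra R M"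
  have add: "f \<oplus>\<^bsub>?F\<^esub> g \<in> carrier ?F" if "f \<in> carrier ?F" "g \<in> carrier ?F" for f g
    using that
    by (intro monoid_algebraI[where S = "supp R f \<union> supp R g"])
       (auto simp: monoid_algebra_simps monoid_algebra_value supp_def monoid_algebra_carrier)
  have smult: "k \<odot>\<^bsub>?F\<^esub> f \<in> carrier ?F" if "f \<in> carrier ?F" "k \<in> carrier R" for f k
    using that
    by (intro monoid_algebraI[where S = "supp R f"])
       (auto simp: monoid_algebra_simps monoid_algebra_value supp_def monoid_algebra_carrier)
  have zero: "\<zero>\<^bsub>?F\<^esub> \<in> carrier ?F"
    by (auto simp: monoid_algebra_simps monoid_algebra_carrier supp_def)
  have "abelian_group ?F"
  proof (rule abelian_groupI)
    fix f assume f: "f \<in> carrier ?F"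
    have "(\<ominus> \<one>) \<odot>\<^bsub>?F\<^esub> f \<oplus>\<^bsub>?F\<^esub> f = \<zero>\<^bsub>?F\<^esub>"
      using monoid_algebra_value[OF f] by (auto simp: monoid_algebra_simps l_minus l_neg)
    thus "\<exists>y\<in>carrier ?F. y \<oplus>\<^bsub>?F\<^esub> f = \<zero>\<^bsub>?F\<^esub>" using smult[OF f] by (metis a_inv_closed one_closed)
  qed (auto simp: add zero, auto simp: monoid_algebra_simps monoid_algebra_value a_ac)
  thus ?thesis
    by (intro moduleI is_cring)
       (auto simp: smult, auto simp: monoid_algebra_simps monoid_algebra_value l_distr r_distr m_ac)
qed

lemma spanning_basis: "spanning R (monoid_algebra R M) (basis_elem R ` carrier M)"
proof (rule spanningI)
  let ?F = "monoid_algebra R M"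
  note mod = monoid_algebra_module[of M]
  show "basis_elem R ` carrier M \<subseteq> carrier ?F" by (auto simp: basis_elem_closed)
  fix f N assume N: "submodule N R ?F" "basis_elem R ` carrier M \<subseteq> N" and f: "f \<in> carrier ?F"
  define S where "S = supp R f"
  have S: "finite S" "supp R f \<subseteq> S" "S \<subseteq> carrier M" using f by (auto simp: S_def monoid_algebra_carrier)
  \<comment> \<open>Generalized over all functions supported in \<open>S\<close>, because the step
    subtracts the value at one point and leaves a different function.\<close>
  have "\<forall>f. f \<in> carrier ?F \<longrightarrow> supp R f \<subseteq> S \<longrightarrow> f \<in> N"
    using S(1,3)
  proof (induction S rule: finite_induct)
    case empty
    then show ?case using submodule_zero[OF mod N(1)] by (auto simp: supp_def monoid_algebra_simps)
  next
    case (insert x S)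
    show ?case
    proof (intro allI impI)
      fix f assume f: "f \<in> carrier ?F" "supp R f \<subseteq> insert x S"
      let ?g = "f(x := \<zero>)"
      have g: "?g \<in> carrier ?F" "supp R ?g \<subseteq> S"
      proof -
        show "supp R ?g \<subseteq> S" using f by (auto simp: supp_def)
        show "?g \<in> carrier ?F"
          by (rule monoid_algebraI[where S = "supp R f"])
             (use f monoid_algebra_value[OF f(1)] in \<open>auto simp: monoid_algebra_carrier supp_def\<close>)
      qed
      have "f = ?g \<oplus>\<^bsub>?F\<^esub> f x \<odot>\<^bsub>?F\<^esub> basis_elem R x"
        using monoid_algebra_value[OF f(1)] by (auto simp: monoid_algebra_simps basis_elem_def)
      moreover have "\<dots> \<in> N"
        using N insert.IH insert.prems g monoid_algebra_value[OF f(1)]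
        by (intro submodule_add[OF mod] submodule_smult[OF mod]) auto
      ultimately show "f \<in> N" by simp
    qed
  qed
  thus "f \<in> N" using f S by blast
qed

end

text \<open>Sums over \<open>supp K f\<close> change their index set with \<open>f\<close>; over a
  common finite set, two functions can be added termwise. Terms outside the support vanish since
  their coefficient is zero.\<close>

lemma lin_ext_superset:
  assumes "module K P" "f \<in> carrier (monoid_algebra K M)" "\<beta> \<in> carrier M \<rightarrow> carrier P"
    "finite S" "supp K f \<subseteq> S" "S \<subseteq> carrier M"
  shows "lin_ext K P \<beta> f = (\<Oplus>\<^bsub>P\<^esub>x\<in>S. f x \<odot>\<^bsub>P\<^esub> \<beta> x)"
proof -
  interpret P: module K P by fact
  show ?thesis unfolding lin_ext_def
    by (rule P.add.finprod_mono_neutral_cong_left)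
       (use assms monoid_algebra_value[OF P.is_cring assms(2)] in \<open>auto simp: supp_def Pi_iff subset_iff\<close>)
qed

lemma lin_ext_linear:
  assumes "module K P" "\<beta> \<in> carrier M \<rightarrow> carrier P"
  shows "lin_ext K P \<beta> \<in> linear_maps K (monoid_algebra K M) P"
proof (rule linear_mapsI)
  let ?F = "monoid_algebra K M"
  interpret P: module K P by fact
  interpret F: module K ?F by (rule monoid_algebra_module[OF P.is_cring])
  note val [simp] = monoid_algebra_value[OF P.is_cring, where M = M]
  fix f assume f: "f \<in> carrier ?F"
  show "lin_ext K P \<beta> f \<in> carrier P" unfolding lin_ext_def
    by (rule P.finsum_closed) (use f assms in \<open>auto simp: monoid_algebra_carrier\<close>)
  have [simp]: "\<And>x. x \<in> supp K f \<Longrightarrow> x \<in> carrier M" using f by (auto simp: monoid_algebra_carrier)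
  show "lin_ext K P \<beta> (k \<odot>\<^bsub>?F\<^esub> f) = k \<odot>\<^bsub>P\<^esub> lin_ext K P \<beta> f" if k: "k \<in> carrier K" for k
  proof -
    have "lin_ext K P \<beta> (k \<odot>\<^bsub>?F\<^esub> f) = (\<Oplus>\<^bsub>P\<^esub>x\<in>supp K f. (k \<odot>\<^bsub>?F\<^esub> f) x \<odot>\<^bsub>P\<^esub> \<beta> x)"
      using f k F.smult_closed[OF k f] by (intro lin_ext_superset[OF assms(1) _ assms(2)])
        (auto simp: monoid_algebra_simps monoid_algebra_carrier supp_def)
    also have "\<dots> = (\<Oplus>\<^bsub>P\<^esub>x\<in>supp K f. k \<odot>\<^bsub>P\<^esub> (f x \<odot>\<^bsub>P\<^esub> \<beta> x))"
      using f k assms by (intro P.finsum_cong') (auto simp: monoid_algebra_simps P.smult_assoc1 Pi_iff)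
    also have "\<dots> = k \<odot>\<^bsub>P\<^esub> lin_ext K P \<beta> f"
      using f k assms unfolding lin_ext_def
      by (intro P.finsum_smult_ldistr[symmetric]) (auto simp: monoid_algebra_carrier Pi_iff)
    finally show ?thesis .
  qed
  fix g assume g: "g \<in> carrier ?F"
  have [simp]: "\<And>x. x \<in> supp K g \<Longrightarrow> x \<in> carrier M" using g by (auto simp: monoid_algebra_carrier)
  let ?S = "supp K f \<union> supp K g"
  have S: "finite ?S" "?S \<subseteq> carrier M" using f g by (auto simp: monoid_algebra_carrier)
  have "lin_ext K P \<beta> (f \<oplus>\<^bsub>?F\<^esub> g) = (\<Oplus>\<^bsub>P\<^esub>x\<in>?S. (f \<oplus>\<^bsub>?F\<^esub> g) x \<odot>\<^bsub>P\<^esub> \<beta> x)"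
    using S by (intro lin_ext_superset[OF assms(1) F.a_closed[OF f g] assms(2)])
      (auto simp: monoid_algebra_simps supp_def)
  also have "\<dots> = (\<Oplus>\<^bsub>P\<^esub>x\<in>?S. f x \<odot>\<^bsub>P\<^esub> \<beta> x \<oplus>\<^bsub>P\<^esub> g x \<odot>\<^bsub>P\<^esub> \<beta> x)"
    using f g S assms by (intro P.finsum_cong') (auto simp: monoid_algebra_simps P.smult_l_distr Pi_iff)
  also have "\<dots> = (\<Oplus>\<^bsub>P\<^esub>x\<in>?S. f x \<odot>\<^bsub>P\<^esub> \<beta> x) \<oplus>\<^bsub>P\<^esub> (\<Oplus>\<^bsub>P\<^esub>x\<in>?S. g x \<odot>\<^bsub>P\<^esub> \<beta> x)"
    using f g S assms by (intro P.finsum_addf) (auto simp: Pi_iff)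
  also have "\<dots> = lin_ext K P \<beta> f \<oplus>\<^bsub>P\<^esub> lin_ext K P \<beta> g"
    using f g S by (simp add: lin_ext_superset[OF assms(1) _ assms(2), of _ ?S])
  finally show "lin_ext K P \<beta> (f \<oplus>\<^bsub>?F\<^esub> g) = lin_ext K P \<beta> f \<oplus>\<^bsub>P\<^esub> lin_ext K P \<beta> g" .
qed

lemma lin_ext_basis:
  fixes M :: "'x monoid"
  assumes "module K P" "\<beta> \<in> carrier M \<rightarrow> carrier P" "x \<in> carrier M"
  shows "lin_ext K P \<beta> (basis_elem K x) = \<beta> x"
proof -
  interpret P: module K P by fact
  have "lin_ext K P \<beta> (basis_elem K x) = (\<Oplus>\<^bsub>P\<^esub>y\<in>{x}. basis_elem K x y \<odot>\<^bsub>P\<^esub> \<beta> y)"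
    using assms(3)
    by (intro lin_ext_superset[OF assms(1) basis_elem_closed[OF P.is_cring assms(3)] assms(2)])
       (auto simp: supp_def basis_elem_def)
  also have "\<dots> = \<beta> x" using funcset_mem[OF assms(2,3)] by (subst P.finsum_insert) (auto simp: basis_elem_def)
  finally show ?thesis .
qed

context
  fixes R :: "'k ring" (structure)
  assumes R: "cring R"
begin

interpretation cring R by (rule R)

text \<open>The convolution sums over a set that depends on the point and on both supports. Summing
  an indicator over a fixed rectangle frees it from this dependence, and linearity in each factor
  becomes termwise.\<close>

lemma monoid_algebra_mult_superset:
  assumes "monoid M" "f \<in> carrier (monoid_algebra R M)" "g \<in> carrier (monoid_algebra R M)"
    "finite S" "supp R f \<subseteq> S" "S \<subseteq> carrier M" "finite T" "supp R g \<subseteq> T" "T \<subseteq> carrier M"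
  shows "(f \<otimes>\<^bsub>monoid_algebra R M\<^esub> g) z =
    (\<Oplus>p\<in>S \<times> T. if fst p \<otimes>\<^bsub>M\<^esub> snd p = z then f (fst p) \<otimes> g (snd p) else \<zero>)"
proof -
  note val [simp] = assms(2,3)[THEN monoid_algebra_value[OF R]]
  have "(f \<otimes>\<^bsub>monoid_algebra R M\<^esub> g) z = finsum R (\<lambda>(x, y). f x \<otimes> g y) {(x, y). x \<in> supp R f \<and> y \<in> supp R g \<and> x \<otimes>\<^bsub>M\<^esub> y = z}"
    by (simp add: monoid_algebra_def)
  also have "\<dots> = (\<Oplus>p\<in>S \<times> T. if fst p \<otimes>\<^bsub>M\<^esub> snd p = z then f (fst p) \<otimes> g (snd p) else \<zero>)"
    by (rule add.finprod_mono_neutral_cong_left)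
       (use assms in \<open>auto simp: supp_def split: if_splits\<close>)
  finally show ?thesis .
qed

lemma monoid_algebra_mult_closed:
  assumes "monoid M" "f \<in> carrier (monoid_algebra R M)" "g \<in> carrier (monoid_algebra R M)"
  shows "f \<otimes>\<^bsub>monoid_algebra R M\<^esub> g \<in> carrier (monoid_algebra R M)"
proof (rule monoid_algebraI[OF R])
  interpret M: monoid M by fact
  note val [simp] = assms(2,3)[THEN monoid_algebra_value[OF R]]
  have supp: "finite (supp R f)" "supp R f \<subseteq> carrier M" "finite (supp R g)" "supp R g \<subseteq> carrier M"
    using assms by (auto simp: monoid_algebra_carrier)
  let ?S = "(\<lambda>(x, y). x \<otimes>\<^bsub>M\<^esub> y) ` (supp R f \<times> supp R g)"
  show "finite ?S" "?S \<subseteq> carrier M" using supp by auto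
  show "(f \<otimes>\<^bsub>monoid_algebra R M\<^esub> g) z \<in> carrier R" for z
    by (subst monoid_algebra_mult_superset[OF assms supp(1) order_refl supp(2,3) order_refl supp(4)])
       (auto intro!: finsum_closed)
  have "(f \<otimes>\<^bsub>monoid_algebra R M\<^esub> g) z = \<zero>" if "z \<notin> ?S" for z
    by (subst monoid_algebra_mult_superset[OF assms supp(1) order_refl supp(2,3) order_refl supp(4)])
       (use that in \<open>auto intro!: add.finprod_one_eqI\<close>)
  thus "supp R (f \<otimes>\<^bsub>monoid_algebra R M\<^esub> g) \<subseteq> ?S" by (auto simp: supp_def)
qed

lemma monoid_algebra_mult_linear:
  assumes "monoid M" "f \<in> carrier (monoid_algebra R M)"
  shows "(\<lambda>g. f \<otimes>\<^bsub>monoid_algebra R M\<^esub> g) \<in> linear_maps R (monoid_algebra R M) (monoid_algebra R M)" (is ?L)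
    and "(\<lambda>g. g \<otimes>\<^bsub>monoid_algebra R M\<^esub> f) \<in> linear_maps R (monoid_algebra R M) (monoid_algebra R M)" (is ?R)
proof -
  let ?F = "monoid_algebra R M"
  interpret F: module R ?F by (rule monoid_algebra_module[OF R])
  have val [simp]: "\<And>f x. f \<in> carrier ?F \<Longrightarrow> f x \<in> carrier R" by (rule monoid_algebra_value[OF R])
  have fin: "finite (supp R f)" "supp R f \<subseteq> carrier M" if "f \<in> carrier ?F" for f
    using that by (auto simp: monoid_algebra_carrier)
  note sup = monoid_algebra_mult_superset[OF assms(1)]
  show ?L
  proof (rule linear_mapsI)
    fix g assume g: "g \<in> carrier ?F"
    show "f \<otimes>\<^bsub>?F\<^esub> g \<in> carrier ?F" by (intro monoid_algebra_mult_closed assms g)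
    have ev: "(f \<otimes>\<^bsub>?F\<^esub> u) z = (\<Oplus>p\<in>supp R f \<times> T. if fst p \<otimes>\<^bsub>M\<^esub> snd p = z then f (fst p) \<otimes> u (snd p) else \<zero>)"
      if "u \<in> carrier ?F" "finite T" "supp R u \<subseteq> T" "T \<subseteq> carrier M" for u z T
      using that fin[OF assms(2)] by (intro sup assms(2)) auto
    {
      fix h assume h: "h \<in> carrier ?F"
      let ?T = "supp R g \<union> supp R h"
      have T: "finite ?T" "?T \<subseteq> carrier M" using fin g h by auto
      have "(f \<otimes>\<^bsub>?F\<^esub> (g \<oplus>\<^bsub>?F\<^esub> h)) z = (f \<otimes>\<^bsub>?F\<^esub> g) z \<oplus> (f \<otimes>\<^bsub>?F\<^esub> h) z" for z
      proof -
        have "(f \<otimes>\<^bsub>?F\<^esub> (g \<oplus>\<^bsub>?F\<^esub> h)) z = (\<Oplus>p\<in>supp R f \<times> ?T.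
          (if fst p \<otimes>\<^bsub>M\<^esub> snd p = z then f (fst p) \<otimes> g (snd p) else \<zero>) \<oplus>
          (if fst p \<otimes>\<^bsub>M\<^esub> snd p = z then f (fst p) \<otimes> h (snd p) else \<zero>))"
          by (subst ev[OF F.a_closed[OF g h] T(1) _ T(2)], force simp: supp_def monoid_algebra_simps, rule finsum_cong')
             (use g h assms in \<open>auto simp: monoid_algebra_simps(2) r_distr\<close>)
        also have "\<dots> = (f \<otimes>\<^bsub>?F\<^esub> g) z \<oplus> (f \<otimes>\<^bsub>?F\<^esub> h) z"
          by (subst finsum_addf) (use g h assms in \<open>auto simp: ev[OF g T(1) _ T(2)] ev[OF h T(1) _ T(2)]\<close>)
        finally show ?thesis .
      qed
      thus "f \<otimes>\<^bsub>?F\<^esub> (g \<oplus>\<^bsub>?F\<^esub> h) = f \<otimes>\<^bsub>?F\<^esub> g \<oplus>\<^bsub>?F\<^esub> f \<otimes>\<^bsub>?F\<^esub> h"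
        by (auto simp: monoid_algebra_simps(2)[where f = "f \<otimes>\<^bsub>?F\<^esub> g"])
    }
    fix k assume k: "k \<in> carrier R"
    have "(f \<otimes>\<^bsub>?F\<^esub> (k \<odot>\<^bsub>?F\<^esub> g)) z = k \<otimes> (f \<otimes>\<^bsub>?F\<^esub> g) z" for z
      by (subst ev[OF F.smult_closed[OF k g] fin(1)[OF g] _ fin(2)[OF g]], use g k in \<open>force simp: supp_def monoid_algebra_simps\<close>,
          subst ev[OF g fin(1)[OF g] order_refl fin(2)[OF g]], subst finsum_rdistr)
         (use k g fin[OF g] fin[OF assms(2)] assms in \<open>auto simp: monoid_algebra_simps m_ac intro!: finsum_cong'\<close>)
    thus "f \<otimes>\<^bsub>?F\<^esub> (k \<odot>\<^bsub>?F\<^esub> g) = k \<odot>\<^bsub>?F\<^esub> (f \<otimes>\<^bsub>?F\<^esub> g)"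
      by (auto simp: monoid_algebra_simps(3)[where f = "f \<otimes>\<^bsub>?F\<^esub> g"])
  qed
  show ?R
  proof (rule linear_mapsI)
    fix g assume g: "g \<in> carrier ?F"
    show "g \<otimes>\<^bsub>?F\<^esub> f \<in> carrier ?F" by (intro monoid_algebra_mult_closed assms g)
    have ev: "(u \<otimes>\<^bsub>?F\<^esub> f) z = (\<Oplus>p\<in>T \<times> supp R f. if fst p \<otimes>\<^bsub>M\<^esub> snd p = z then u (fst p) \<otimes> f (snd p) else \<zero>)"
      if "u \<in> carrier ?F" "finite T" "supp R u \<subseteq> T" "T \<subseteq> carrier M" for u z T
      using that fin[OF assms(2)] by (intro sup assms(2)) auto
    {
      fix h assume h: "h \<in> carrier ?F"
      let ?T = "supp R g \<union> supp R h"
      have T: "finite ?T" "?T \<subseteq> carrier M" using fin g h by auto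
      have "((g \<oplus>\<^bsub>?F\<^esub> h) \<otimes>\<^bsub>?F\<^esub> f) z = (g \<otimes>\<^bsub>?F\<^esub> f) z \<oplus> (h \<otimes>\<^bsub>?F\<^esub> f) z" for z
      proof -
        have "((g \<oplus>\<^bsub>?F\<^esub> h) \<otimes>\<^bsub>?F\<^esub> f) z = (\<Oplus>p\<in>?T \<times> supp R f.
          (if fst p \<otimes>\<^bsub>M\<^esub> snd p = z then g (fst p) \<otimes> f (snd p) else \<zero>) \<oplus>
          (if fst p \<otimes>\<^bsub>M\<^esub> snd p = z then h (fst p) \<otimes> f (snd p) else \<zero>))"
          by (subst ev[OF F.a_closed[OF g h] T(1) _ T(2)], force simp: supp_def monoid_algebra_simps, rule finsum_cong')
             (use g h assms in \<open>auto simp: monoid_algebra_simps(2) l_distr\<close>)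
        also have "\<dots> = (g \<otimes>\<^bsub>?F\<^esub> f) z \<oplus> (h \<otimes>\<^bsub>?F\<^esub> f) z"
          by (subst finsum_addf) (use g h assms in \<open>auto simp: ev[OF g T(1) _ T(2)] ev[OF h T(1) _ T(2)]\<close>)
        finally show ?thesis .
      qed
      thus "(g \<oplus>\<^bsub>?F\<^esub> h) \<otimes>\<^bsub>?F\<^esub> f = g \<otimes>\<^bsub>?F\<^esub> f \<oplus>\<^bsub>?F\<^esub> h \<otimes>\<^bsub>?F\<^esub> f"
        by (auto simp: monoid_algebra_simps(2)[where f = "g \<otimes>\<^bsub>?F\<^esub> f"])
    }
    fix k assume k: "k \<in> carrier R"
    have "((k \<odot>\<^bsub>?F\<^esub> g) \<otimes>\<^bsub>?F\<^esub> f) z = k \<otimes> (g \<otimes>\<^bsub>?F\<^esub> f) z" for z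
      by (subst ev[OF F.smult_closed[OF k g] fin(1)[OF g] _ fin(2)[OF g]], use g k in \<open>force simp: supp_def monoid_algebra_simps\<close>,
          subst ev[OF g fin(1)[OF g] order_refl fin(2)[OF g]], subst finsum_rdistr)
         (use k g fin[OF g] fin[OF assms(2)] assms in \<open>auto simp: monoid_algebra_simps m_ac intro!: finsum_cong'\<close>)
    thus "(k \<odot>\<^bsub>?F\<^esub> g) \<otimes>\<^bsub>?F\<^esub> f = k \<odot>\<^bsub>?F\<^esub> (g \<otimes>\<^bsub>?F\<^esub> f)"
      by (auto simp: monoid_algebra_simps(3)[where f = "g \<otimes>\<^bsub>?F\<^esub> f"])
  qed
qed

lemma basis_elem_mult:
  assumes "monoid M" "x \<in> carrier M" "y \<in> carrier M"
  shows "basis_elem R x \<otimes>\<^bsub>monoid_algebra R M\<^esub> basis_elem R y = basis_elem R (x \<otimes>\<^bsub>M\<^esub> y)"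
proof
  fix z
  have "(basis_elem R x \<otimes>\<^bsub>monoid_algebra R M\<^esub> basis_elem R y) z =
    (\<Oplus>p\<in>{x} \<times> {y}. if fst p \<otimes>\<^bsub>M\<^esub> snd p = z then basis_elem R x (fst p) \<otimes> basis_elem R y (snd p) else \<zero>)"
    using assms by (intro monoid_algebra_mult_superset basis_elem_closed[OF R]) (auto simp: supp_def basis_elem_def)
  also have "\<dots> = basis_elem R (x \<otimes>\<^bsub>M\<^esub> y) z"
    by (simp add: basis_elem_def)
  finally show "(basis_elem R x \<otimes>\<^bsub>monoid_algebra R M\<^esub> basis_elem R y) z = basis_elem R (x \<otimes>\<^bsub>M\<^esub> y) z" .
qed

lemma monoid_algebra_assoc_algebra:
  assumes "monoid M"
  shows "assoc_algebra R (monoid_algebra R M)"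
proof (rule assoc_algebraI)
  let ?F = "monoid_algebra R M"
  interpret M: monoid M by fact
  note mod = monoid_algebra_module[OF R, of M]
  note sp = spanning_basis[OF R, of M]
  note L = monoid_algebra_mult_linear(1)[OF assms] and Rt = monoid_algebra_mult_linear(2)[OF assms]
  note cl [simp] = monoid_algebra_mult_closed[OF assms] basis_elem_closed[OF R]
  show "module R ?F" by (rule mod)
  show "\<one>\<^bsub>?F\<^esub> \<in> carrier ?F" by (simp add: monoid_algebra_simps)
  fix x assume x: "x \<in> carrier ?F"
  show "\<one>\<^bsub>?F\<^esub> \<otimes>\<^bsub>?F\<^esub> x = x"
    by (rule linear_maps_eqI[OF mod mod sp L linear_maps_id _ x])
       (auto simp: monoid_algebra_simps basis_elem_mult[OF assms])
  show "x \<otimes>\<^bsub>?F\<^esub> \<one>\<^bsub>?F\<^esub> = x"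
    by (rule linear_maps_eqI[OF mod mod sp Rt linear_maps_id _ x])
       (auto simp: monoid_algebra_simps basis_elem_mult[OF assms])
  show "(\<lambda>y. x \<otimes>\<^bsub>?F\<^esub> y) \<in> linear_maps R ?F ?F" "(\<lambda>y. y \<otimes>\<^bsub>?F\<^esub> x) \<in> linear_maps R ?F ?F"
    using x by (simp_all add: L Rt)
  fix y z assume y: "y \<in> carrier ?F" and z: "z \<in> carrier ?F"
  show "x \<otimes>\<^bsub>?F\<^esub> y \<in> carrier ?F" using x y by simp
  \<comment> \<open>Associativity is trilinear: it is checked on basis elements and then extended in
    the third, the second and the first argument in turn.\<close>
  have 1: "(basis_elem R a \<otimes>\<^bsub>?F\<^esub> basis_elem R b) \<otimes>\<^bsub>?F\<^esub> z = basis_elem R a \<otimes>\<^bsub>?F\<^esub> (basis_elem R b \<otimes>\<^bsub>?F\<^esub> z)"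
    if ab: "a \<in> carrier M" "b \<in> carrier M" for a b
    by (rule linear_maps_eqI[OF mod mod sp L linear_maps_compose[OF L L] _ z])
       (use ab in \<open>auto simp: basis_elem_mult[OF assms] M.m_assoc\<close>)
  have 2: "(basis_elem R a \<otimes>\<^bsub>?F\<^esub> y) \<otimes>\<^bsub>?F\<^esub> z = basis_elem R a \<otimes>\<^bsub>?F\<^esub> (y \<otimes>\<^bsub>?F\<^esub> z)"
    if a: "a \<in> carrier M" for a
    by (rule linear_maps_eqI[OF mod mod sp linear_maps_compose[OF L Rt] linear_maps_compose[OF Rt L] _ y])
       (use a z 1 in auto)
  show "(x \<otimes>\<^bsub>?F\<^esub> y) \<otimes>\<^bsub>?F\<^esub> z = x \<otimes>\<^bsub>?F\<^esub> (y \<otimes>\<^bsub>?F\<^esub> z)"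
    by (rule linear_maps_eqI[OF mod mod sp linear_maps_compose[OF Rt Rt] Rt _ x])
       (use y z 2 in auto)
qed

end

section \<open>Quotients\<close>

lemma abelian_group_cong:
  assumes "abelian_group R" "carrier S = carrier R" "zero S = zero R" "add S = add R"
  shows "abelian_group S"
proof -
  interpret abelian_group R by fact
  show ?thesis
  proof (rule abelian_groupI)
    fix x assume "x \<in> carrier S"
    hence "\<ominus>\<^bsub>R\<^esub> x \<in> carrier S \<and> (\<ominus>\<^bsub>R\<^esub> x) \<oplus>\<^bsub>S\<^esub> x = \<zero>\<^bsub>S\<^esub>" using assms(2-) by (simp add: l_neg)
    thus "\<exists>y\<in>carrier S. y \<oplus>\<^bsub>S\<^esub> x = \<zero>\<^bsub>S\<^esub>" by blast
  qed (use assms(2-) in \<open>simp_all add: a_ac\<close>)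
qed

lemma ring_cong:
  assumes "ring R" "carrier S = carrier R" "mult S = mult R" "one S = one R" "zero S = zero R" "add S = add R"
  shows "ring S"
proof -
  interpret ring R by fact
  show ?thesis
  proof (rule ringI)
    show "abelian_group S" by (rule abelian_group_cong[OF abelian_group_axioms]) (use assms in auto)
    show "Group.monoid S"
      by (rule monoidI) (use assms(2-) in \<open>simp_all add: m_assoc\<close>)
  qed (use assms(2-) in \<open>simp_all add: l_distr r_distr\<close>)
qed

lemma module_cong:
  assumes "module K M" "carrier N = carrier M" "zero N = zero M" "add N = add M" "smult N = smult M"
  shows "module K N"
proof -
  interpret module K M by fact
  show ?thesis
  proof (rule moduleI)
    show "abelian_group N" by (rule abelian_group_cong[OF abelian_group_axioms]) (use assms in auto)
  qed (use assms(2-) in \<open>simp_all add: is_cring smult_l_distr smult_r_distr smult_assoc1\<close>)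
qed

lemma assoc_algebra_cong:
  assumes "assoc_algebra K M" "carrier N = carrier M" "zero N = zero M" "add N = add M" "smult N = smult M"
    "mult N = mult M" "one N = one M"
  shows "assoc_algebra K N"
proof -
  interpret assoc_algebra K M by fact
  have "module K N" by (rule module_cong[OF module_axioms assms(2-5)])
  moreover have "ring N" by (rule ring_cong[OF A.ring_axioms]) (use assms in auto)
  ultimately show ?thesis
    using assms(2-)
    by (auto intro!: assoc_algebra.intro assoc_algebra_axioms.intro simp: smult_mult_left smult_mult_right)
qed

context
  fixes K :: "'k ring" and A :: "('k, 'a, 'm) module_scheme" and I :: "'a set"
  assumes A: "assoc_algebra K A" and I: "ideal I A"
begin

interpretation A: assoc_algebra K A by (rule A)
interpretation I: ideal I A by (rule I)

lemma quot_algebra_carrier: "carrier (quot_algebra A I) = (\<lambda>x. I +>\<^bsub>A\<^esub> x) ` carrier A"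
  by (auto simp: quot_algebra_def ring.defs FactRing_def A_RCOSETS_defs a_r_coset_def r_coset_def)

lemma quot_algebra_closed: "x \<in> carrier A \<Longrightarrow> I +>\<^bsub>A\<^esub> x \<in> carrier (quot_algebra A I)"
  by (auto simp: quot_algebra_carrier)

lemma quot_algebra_ring: "ring (quot_algebra A I)"
  by (rule ring_cong[OF I.quotient_is_ring]) (simp_all add: quot_algebra_def ring.defs)

lemma quot_algebra_add: "x \<in> carrier A \<Longrightarrow> y \<in> carrier A \<Longrightarrow>
    (I +>\<^bsub>A\<^esub> x) \<oplus>\<^bsub>quot_algebra A I\<^esub> (I +>\<^bsub>A\<^esub> y) = I +>\<^bsub>A\<^esub> (x \<oplus>\<^bsub>A\<^esub> y)"
  by (simp add: quot_algebra_def ring.defs FactRing_def I.a_rcos_sum)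

lemma quot_algebra_mult: "x \<in> carrier A \<Longrightarrow> y \<in> carrier A \<Longrightarrow>
    (I +>\<^bsub>A\<^esub> x) \<otimes>\<^bsub>quot_algebra A I\<^esub> (I +>\<^bsub>A\<^esub> y) = I +>\<^bsub>A\<^esub> (x \<otimes>\<^bsub>A\<^esub> y)"
  by (simp add: quot_algebra_def ring.defs FactRing_def I.rcoset_mult_add)

lemma quot_algebra_one: "\<one>\<^bsub>quot_algebra A I\<^esub> = I +>\<^bsub>A\<^esub> \<one>\<^bsub>A\<^esub>"
  by (simp add: quot_algebra_def ring.defs FactRing_def)

text \<open>A ring ideal absorbs multiplication by elements of \<open>A\<close>, and the scalar
  \<open>k\<close> acts as multiplication by the element k times the unit.\<close>

lemma ideal_smult_closed:
  assumes "k \<in> carrier K" "x \<in> I" shows "k \<odot>\<^bsub>A\<^esub> x \<in> I"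
proof -
  have x: "x \<in> carrier A" using assms(2) by (rule I.a_Hcarr)
  have "k \<odot>\<^bsub>A\<^esub> x = (k \<odot>\<^bsub>A\<^esub> \<one>\<^bsub>A\<^esub>) \<otimes>\<^bsub>A\<^esub> x" using assms x by (simp add: A.smult_mult_left)
  also have "\<dots> \<in> I" using assms by (intro I.I_l_closed) auto
  finally show ?thesis .
qed

lemma quot_algebra_eq_iff:
  "x \<in> carrier A \<Longrightarrow> y \<in> carrier A \<Longrightarrow> I +>\<^bsub>A\<^esub> x = I +>\<^bsub>A\<^esub> y \<longleftrightarrow> x \<ominus>\<^bsub>A\<^esub> y \<in> I"
  using A.A.quotient_eq_iff_same_a_r_cos[OF I] by blast

text \<open>The scalar multiple of a coset is defined as a union over all its representatives. These
  differ by elements of \<open>I\<close>, which scalars preserve, so all the cosets united are the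
  same one.\<close>

lemma quot_algebra_smult:
  assumes "k \<in> carrier K" "x \<in> carrier A"
  shows "k \<odot>\<^bsub>quot_algebra A I\<^esub> (I +>\<^bsub>A\<^esub> x) = I +>\<^bsub>A\<^esub> (k \<odot>\<^bsub>A\<^esub> x)"
proof -
  have *: "I +>\<^bsub>A\<^esub> (k \<odot>\<^bsub>A\<^esub> y) = I +>\<^bsub>A\<^esub> (k \<odot>\<^bsub>A\<^esub> x)" if y: "y \<in> I +>\<^bsub>A\<^esub> x" for y
  proof -
    obtain h where h: "h \<in> I" "y = h \<oplus>\<^bsub>A\<^esub> x" using y unfolding a_r_coset_def'[of A] by blast
    have hc: "h \<in> carrier A" using h(1) by (rule I.a_Hcarr)
    have "(h \<oplus>\<^bsub>A\<^esub> x) \<ominus>\<^bsub>A\<^esub> x = h" using hc assms(2) by (simp add: a_minus_def A.a_assoc A.r_neg)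
    hence "k \<odot>\<^bsub>A\<^esub> y \<ominus>\<^bsub>A\<^esub> k \<odot>\<^bsub>A\<^esub> x = k \<odot>\<^bsub>A\<^esub> h"
      using linear_maps_minus[OF A.module_axioms A.module_axioms linear_maps_scale[OF A.module_axioms linear_maps_id assms(1)], of y x]
        h hc assms by simp
    thus ?thesis using ideal_smult_closed[OF assms(1) h(1)] h(2) hc assms by (subst quot_algebra_eq_iff) auto
  qed
  have "I +>\<^bsub>A\<^esub> x \<noteq> {}" using I.a_rcos_self[OF assms(2)] by blast
  hence "(\<Union>y\<in>I +>\<^bsub>A\<^esub> x. I +>\<^bsub>A\<^esub> (k \<odot>\<^bsub>A\<^esub> y)) = I +>\<^bsub>A\<^esub> (k \<odot>\<^bsub>A\<^esub> x)"
    by (rule SUP_eq_const) (rule *)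
  thus ?thesis by (simp add: quot_algebra_def ring.defs module.defs)
qed

lemma quot_algebra_module: "module K (quot_algebra A I)"
proof (rule moduleI)
  interpret Q: ring "quot_algebra A I" by (rule quot_algebra_ring)
  show "abelian_group (quot_algebra A I)" by (rule Q.abelian_group_axioms)
qed (auto simp: A.is_cring quot_algebra_carrier quot_algebra_smult quot_algebra_add A.smult_l_distr
    A.smult_r_distr A.smult_assoc1)

lemma quot_algebra_assoc_algebra: "assoc_algebra K (quot_algebra A I)"
proof (intro assoc_algebra.intro assoc_algebra_axioms.intro quot_algebra_module quot_algebra_ring)
qed (auto simp: quot_algebra_carrier quot_algebra_smult quot_algebra_mult A.smult_mult_left A.smult_mult_right)

lemma quot_algebra_proj: "(\<lambda>x. I +>\<^bsub>A\<^esub> x) \<in> algebra_homs K A (quot_algebra A I)"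
  by (intro algebra_homsI linear_mapsI)
     (auto simp: quot_algebra_closed quot_algebra_add quot_algebra_mult quot_algebra_smult quot_algebra_one)

lemma quot_algebra_spanning:
  "spanning K A S \<Longrightarrow> spanning K (quot_algebra A I) ((\<lambda>x. I +>\<^bsub>A\<^esub> x) ` S)"
  by (rule spanning_image[OF A.module_axioms quot_algebra_module algebra_homs_linear[OF quot_algebra_proj]])
     (auto simp: quot_algebra_carrier)

end

lemma spanning_submodule:
  "spanning K M S \<Longrightarrow> submodule N K M \<Longrightarrow> S \<subseteq> N \<Longrightarrow> x \<in> carrier M \<Longrightarrow> x \<in> N"
  by (auto simp: spanning_def)

lemma kernel_submodule:
  assumes "module K M" "module K N" "f \<in> linear_maps K M N"
  shows "submodule {x \<in> carrier M. f x = \<zero>\<^bsub>N\<^esub>} K M"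
proof -
  interpret N: module K N by fact
  show ?thesis
    by (rule submodule_sep[OF assms(1)])
       (auto simp: linear_maps_zero[OF assms] linear_maps_add[OF assms(3)] linear_maps_smult[OF assms(3)])
qed

text \<open>Whatever representative \<open>SOME\<close> picks, it differs from \<open>f\<close> by
  an element of \<open>I\<close>, which the linear extension kills. All later values of
  \<open>lin_lift\<close> come from here.\<close>

lemma lin_lift_coset:
  fixes M :: "'x monoid"
  assumes "monoid M" "module K P" "\<beta> \<in> carrier M \<rightarrow> carrier P" "ideal I (monoid_algebra K M)"
    "\<And>f. f \<in> I \<Longrightarrow> lin_ext K P \<beta> f = \<zero>\<^bsub>P\<^esub>" "f \<in> carrier (monoid_algebra K M)"
  shows "lin_lift K P \<beta> (I +>\<^bsub>monoid_algebra K M\<^esub> f) = lin_ext K P \<beta> f"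
proof -
  let ?F = "monoid_algebra K M"
  interpret P: module K P by fact
  interpret I: ideal I ?F by fact
  define g where "g = (SOME g. g \<in> I +>\<^bsub>?F\<^esub> f)"
  have "g \<in> I +>\<^bsub>?F\<^esub> f" using I.a_rcos_self[OF assms(6)] unfolding g_def by (metis someI)
  then obtain h where h: "h \<in> I" "g = h \<oplus>\<^bsub>?F\<^esub> f" unfolding a_r_coset_def'[of ?F] by blast
  have "lin_ext K P \<beta> g = lin_ext K P \<beta> h \<oplus>\<^bsub>P\<^esub> lin_ext K P \<beta> f"
    unfolding h(2) by (rule linear_maps_add[OF lin_ext_linear[OF assms(2,3)] I.a_Hcarr[OF h(1)] assms(6)])
  also have "\<dots> = lin_ext K P \<beta> f"
    using assms(5)[OF h(1)] linear_maps_closed[OF lin_ext_linear[OF assms(2,3)] assms(6)] by simp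
  finally show ?thesis by (simp add: lin_lift_def lin_ext_def g_def Let_def)
qed

lemma lin_lift_linear:
  fixes M :: "'x monoid"
  assumes "monoid M" "module K P" "\<beta> \<in> carrier M \<rightarrow> carrier P" "ideal I (monoid_algebra K M)"
    "\<And>f. f \<in> I \<Longrightarrow> lin_ext K P \<beta> f = \<zero>\<^bsub>P\<^esub>"
  shows "lin_lift K P \<beta> \<in> linear_maps K (quot_algebra (monoid_algebra K M) I) P"
proof -
  let ?F = "monoid_algebra K M"
  interpret P: module K P by fact
  have F: "assoc_algebra K ?F" by (rule monoid_algebra_assoc_algebra[OF P.is_cring assms(1)])
  interpret F: assoc_algebra K ?F by (rule F)
  note L = lin_ext_linear[OF assms(2,3)]
  show ?thesis
    by (rule linear_mapsI)
       (auto simp: quot_algebra_carrier[OF F assms(4)] quot_algebra_add[OF F assms(4)]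
          quot_algebra_smult[OF F assms(4)] lin_lift_coset[OF assms]
          linear_maps_closed[OF L] linear_maps_add[OF L] linear_maps_smult[OF L])
qed

lemma submodule_generated_submodule:
  assumes "module K M" "S \<subseteq> carrier M"
  shows "submodule (submodule_generated K M S) K M"
proof -
  interpret M: module K M by fact
  \<comment> \<open>The carrier itself belongs to the family, so the intersection is not over the
    empty family and stays inside the carrier.\<close>
  have *: "carrier M \<in> {N. submodule N K M \<and> S \<subseteq> N}" using assms M.carrier_is_submodule by auto
  show ?thesis unfolding submodule_generated_def
    by (rule M.submoduleI)
       (use * in \<open>auto simp: submodule_zero[OF assms(1)] submodule_add[OF assms(1)] submodule_smult[OF assms(1)]
         intro: module.submoduleE[OF assms(1)] submodule_carrier[OF assms(1)]\<close>)
qed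

lemma submodule_generated_subset: "S \<subseteq> submodule_generated K M S"
  by (auto simp: submodule_generated_def)

lemma submodule_generated_minimal: "submodule N K M \<Longrightarrow> S \<subseteq> N \<Longrightarrow> submodule_generated K M S \<subseteq> N"
  by (auto simp: submodule_generated_def)


section \<open>Tensor products\<close>

definition bilinear ::
    "'k ring \<Rightarrow> ('k, 'a, 'm) module_scheme \<Rightarrow> ('k, 'b, 'n) module_scheme \<Rightarrow> ('k, 'p, 'o) module_scheme \<Rightarrow>
     ('a \<Rightarrow> 'b \<Rightarrow> 'p) \<Rightarrow> bool" where
  "bilinear K A B P \<beta> \<longleftrightarrow> (\<forall>a\<in>carrier A. (\<lambda>b. \<beta> a b) \<in> linear_maps K B P) \<and>
     (\<forall>b\<in>carrier B. (\<lambda>a. \<beta> a b) \<in> linear_maps K A P)"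

lemma bilinearI:
  assumes "\<And>a. a \<in> carrier A \<Longrightarrow> (\<lambda>b. \<beta> a b) \<in> linear_maps K B P"
    "\<And>b. b \<in> carrier B \<Longrightarrow> (\<lambda>a. \<beta> a b) \<in> linear_maps K A P"
  shows "bilinear K A B P \<beta>"
  using assms by (simp add: bilinear_def)

context
  fixes K :: "'k ring" and A :: "('k, 'a, 'm) module_scheme" and B :: "('k, 'b, 'n) module_scheme"
  assumes A: "assoc_algebra K A" and B: "assoc_algebra K B"
begin

interpretation A: assoc_algebra K A by (rule A)
interpretation B: assoc_algebra K B by (rule B)

lemma pair_monoid: "monoid (A \<times>\<times> B)"
  by (rule DirProd_monoid) (rule A.A.monoid_axioms B.A.monoid_axioms)+

lemma pair_algebra_assoc_algebra: "assoc_algebra K (pair_algebra K A B)"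
  unfolding pair_algebra_def by (rule monoid_algebra_assoc_algebra[OF A.is_cring pair_monoid])

interpretation F: assoc_algebra K "pair_algebra K A B" by (rule pair_algebra_assoc_algebra)

lemma pair_basis_closed:
  "a \<in> carrier A \<Longrightarrow> b \<in> carrier B \<Longrightarrow> basis_elem K (a, b) \<in> carrier (pair_algebra K A B)"
  unfolding pair_algebra_def by (rule basis_elem_closed[OF A.is_cring]) simp

lemma pair_basis_mult:
  "a \<in> carrier A \<Longrightarrow> b \<in> carrier B \<Longrightarrow> a' \<in> carrier A \<Longrightarrow> b' \<in> carrier B \<Longrightarrow>
   basis_elem K (a, b) \<otimes>\<^bsub>pair_algebra K A B\<^esub> basis_elem K (a', b') =
   basis_elem K (a \<otimes>\<^bsub>A\<^esub> a', b \<otimes>\<^bsub>B\<^esub> b')"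
  unfolding pair_algebra_def using basis_elem_mult[OF A.is_cring pair_monoid] by auto

lemma pair_spanning:
  "spanning K (pair_algebra K A B) (basis_elem K ` (carrier A \<times> carrier B))"
  using spanning_basis[OF A.is_cring, of "A \<times>\<times> B"] by (simp add: pair_algebra_def)

lemma tensor_relations_cases:
  assumes "r \<in> tensor_relations K A B"
  obtains (add_left) a a' b where "a \<in> carrier A" "a' \<in> carrier A" "b \<in> carrier B"
      "r = basis_elem K (a \<oplus>\<^bsub>A\<^esub> a', b) \<ominus>\<^bsub>pair_algebra K A B\<^esub>
        (basis_elem K (a, b) \<oplus>\<^bsub>pair_algebra K A B\<^esub> basis_elem K (a', b))"
  | (add_right) a b b' where "a \<in> carrier A" "b \<in> carrier B" "b' \<in> carrier B"
      "r = basis_elem K (a, b \<oplus>\<^bsub>B\<^esub> b') \<ominus>\<^bsub>pair_algebra K A B\<^esub>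
        (basis_elem K (a, b) \<oplus>\<^bsub>pair_algebra K A B\<^esub> basis_elem K (a, b'))"
  | (smult_left) k a b where "k \<in> carrier K" "a \<in> carrier A" "b \<in> carrier B"
      "r = basis_elem K (k \<odot>\<^bsub>A\<^esub> a, b) \<ominus>\<^bsub>pair_algebra K A B\<^esub> k \<odot>\<^bsub>pair_algebra K A B\<^esub> basis_elem K (a, b)"
  | (smult_right) k a b where "k \<in> carrier K" "a \<in> carrier A" "b \<in> carrier B"
      "r = basis_elem K (a, k \<odot>\<^bsub>B\<^esub> b) \<ominus>\<^bsub>pair_algebra K A B\<^esub> k \<odot>\<^bsub>pair_algebra K A B\<^esub> basis_elem K (a, b)"
  using assms
  by (unfold tensor_relations_def Let_def, elim UnE CollectE exE conjE)
     ((rule add_left; assumption), (rule add_right; assumption),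
      (rule smult_left; assumption), (rule smult_right; assumption))

lemma tensor_relationsI:
  "a \<in> carrier A \<Longrightarrow> a' \<in> carrier A \<Longrightarrow> b \<in> carrier B \<Longrightarrow>
     basis_elem K (a \<oplus>\<^bsub>A\<^esub> a', b) \<ominus>\<^bsub>pair_algebra K A B\<^esub>
        (basis_elem K (a, b) \<oplus>\<^bsub>pair_algebra K A B\<^esub> basis_elem K (a', b)) \<in> tensor_relations K A B"
  "a \<in> carrier A \<Longrightarrow> b \<in> carrier B \<Longrightarrow> b' \<in> carrier B \<Longrightarrow>
     basis_elem K (a, b \<oplus>\<^bsub>B\<^esub> b') \<ominus>\<^bsub>pair_algebra K A B\<^esub>
        (basis_elem K (a, b) \<oplus>\<^bsub>pair_algebra K A B\<^esub> basis_elem K (a, b')) \<in> tensor_relations K A B"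
  "k \<in> carrier K \<Longrightarrow> a \<in> carrier A \<Longrightarrow> b \<in> carrier B \<Longrightarrow>
     basis_elem K (k \<odot>\<^bsub>A\<^esub> a, b) \<ominus>\<^bsub>pair_algebra K A B\<^esub> k \<odot>\<^bsub>pair_algebra K A B\<^esub> basis_elem K (a, b)
       \<in> tensor_relations K A B"
  "k \<in> carrier K \<Longrightarrow> a \<in> carrier A \<Longrightarrow> b \<in> carrier B \<Longrightarrow>
     basis_elem K (a, k \<odot>\<^bsub>B\<^esub> b) \<ominus>\<^bsub>pair_algebra K A B\<^esub> k \<odot>\<^bsub>pair_algebra K A B\<^esub> basis_elem K (a, b)
       \<in> tensor_relations K A B"
  unfolding tensor_relations_def Let_def by blast+

lemma tensor_relations_subset: "tensor_relations K A B \<subseteq> carrier (pair_algebra K A B)"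
  by (auto elim!: tensor_relations_cases simp: pair_basis_closed)

lemma tensor_null_submodule: "submodule (tensor_null K A B) K (pair_algebra K A B)"
  unfolding tensor_null_def
  by (rule submodule_generated_submodule[OF F.module_axioms tensor_relations_subset])

text \<open>Multiplication by a basis element acts linearly on each of the two slots, so each of the
  four kinds of relation goes to a relation of the same kind.\<close>

lemma basis_mult_tensor_relations:
  assumes "r \<in> tensor_relations K A B" "a0 \<in> carrier A" "b0 \<in> carrier B"
  shows "basis_elem K (a0, b0) \<otimes>\<^bsub>pair_algebra K A B\<^esub> r \<in> tensor_relations K A B"
    and "r \<otimes>\<^bsub>pair_algebra K A B\<^esub> basis_elem K (a0, b0) \<in> tensor_relations K A B"
proof -
  let ?F = "pair_algebra K A B"
  let ?x = "basis_elem K (a0, b0)"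
  have x: "?x \<in> carrier ?F" using assms by (simp add: pair_basis_closed)
  note L = F.mult_left_linear[OF x] and R = F.mult_right_linear[OF x]
  note Lm = linear_maps_minus[OF F.module_axioms F.module_axioms L]
    and Rm = linear_maps_minus[OF F.module_axioms F.module_axioms R]
  show "?x \<otimes>\<^bsub>?F\<^esub> r \<in> tensor_relations K A B"
    using assms(1)
    by (cases rule: tensor_relations_cases)
       (use assms(2,3) x in \<open>simp_all add: Lm pair_basis_closed pair_basis_mult A.A.r_distr B.A.r_distr F.A.r_distr
         A.smult_mult_right B.smult_mult_right F.smult_mult_right tensor_relationsI\<close>)
  show "r \<otimes>\<^bsub>?F\<^esub> ?x \<in> tensor_relations K A B"
    using assms(1)
    by (cases rule: tensor_relations_cases)
       (use assms(2,3) x in \<open>simp_all add: Rm pair_basis_closed pair_basis_mult A.A.l_distr B.A.l_distr F.A.l_distr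
         A.smult_mult_left B.smult_mult_left F.smult_mult_left tensor_relationsI\<close>)
qed

lemma preimage_submodule:
  assumes "f \<in> linear_maps K (pair_algebra K A B) (pair_algebra K A B)"
  shows "submodule {x \<in> carrier (pair_algebra K A B). f x \<in> tensor_null K A B} K (pair_algebra K A B)"
  by (rule submodule_sep[OF F.module_axioms])
     (auto simp: linear_maps_zero[OF F.module_axioms F.module_axioms assms] linear_maps_add[OF assms]
        linear_maps_smult[OF assms] submodule_zero[OF F.module_axioms tensor_null_submodule]
        submodule_add[OF F.module_axioms tensor_null_submodule]
        submodule_smult[OF F.module_axioms tensor_null_submodule])

text \<open>\<open>tensor_null\<close> is generated as a submodule only. Closure under products is
  extended twice by linearity: from basis elements to all multipliers (\<open>rl\<close>,
  \<open>rr\<close>), then from the relations to the submodule that they generate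
  (\<open>nl\<close>, \<open>nr\<close>).\<close>

lemma tensor_null_ideal: "ideal (tensor_null K A B) (pair_algebra K A B)"
proof -
  let ?F = "pair_algebra K A B" and ?N = "tensor_null K A B"
  have rel: "tensor_relations K A B \<subseteq> ?N" unfolding tensor_null_def by (rule submodule_generated_subset)
  have rl: "x \<otimes>\<^bsub>?F\<^esub> r \<in> ?N" if x: "x \<in> carrier ?F" and r: "r \<in> tensor_relations K A B" for x r
  proof -
    have rc: "r \<in> carrier ?F" using r tensor_relations_subset by blast
    have "x \<in> {x \<in> carrier ?F. x \<otimes>\<^bsub>?F\<^esub> r \<in> ?N}"
      by (rule spanning_submodule[OF pair_spanning preimage_submodule[OF F.mult_right_linear[OF rc]] _ x])
         (use basis_mult_tensor_relations[OF r] rel in \<open>auto simp: pair_basis_closed\<close>)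
    thus ?thesis by blast
  qed
  have rr: "r \<otimes>\<^bsub>?F\<^esub> x \<in> ?N" if x: "x \<in> carrier ?F" and r: "r \<in> tensor_relations K A B" for x r
  proof -
    have rc: "r \<in> carrier ?F" using r tensor_relations_subset by blast
    have "x \<in> {x \<in> carrier ?F. r \<otimes>\<^bsub>?F\<^esub> x \<in> ?N}"
      by (rule spanning_submodule[OF pair_spanning preimage_submodule[OF F.mult_left_linear[OF rc]] _ x])
         (use basis_mult_tensor_relations[OF r] rel in \<open>auto simp: pair_basis_closed\<close>)
    thus ?thesis by blast
  qed
  have nl: "?N \<subseteq> {n \<in> carrier ?F. x \<otimes>\<^bsub>?F\<^esub> n \<in> ?N}" if "x \<in> carrier ?F" for x
    by (subst tensor_null_def, rule submodule_generated_minimal[OF preimage_submodule[OF F.mult_left_linear[OF that]]])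
       (use rl that tensor_relations_subset in auto)
  have nr: "?N \<subseteq> {n \<in> carrier ?F. n \<otimes>\<^bsub>?F\<^esub> x \<in> ?N}" if "x \<in> carrier ?F" for x
    by (subst tensor_null_def, rule submodule_generated_minimal[OF preimage_submodule[OF F.mult_right_linear[OF that]]])
       (use rr that tensor_relations_subset in auto)
  show ?thesis
    by (rule idealI[OF F.A.ring_axioms]) (use nl nr submodule.axioms(1)[OF tensor_null_submodule] in auto)
qed

lemma tensor_algebra_assoc_algebra: "assoc_algebra K (tensor_algebra K A B)"
  unfolding tensor_algebra_def
  by (rule quot_algebra_assoc_algebra[OF pair_algebra_assoc_algebra tensor_null_ideal])

lemma tensor_algebra_module: "module K (tensor_algebra K A B)"
  by (rule assoc_algebra_module[OF tensor_algebra_assoc_algebra])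

lemma pure_tensor_closed:
  "a \<in> carrier A \<Longrightarrow> b \<in> carrier B \<Longrightarrow> pure_tensor K A B a b \<in> carrier (tensor_algebra K A B)"
  unfolding tensor_algebra_def pure_tensor_def
  by (rule quot_algebra_closed[OF pair_algebra_assoc_algebra tensor_null_ideal pair_basis_closed])

lemma tensor_coset_eqI:
  assumes "x \<in> carrier (pair_algebra K A B)" "y \<in> carrier (pair_algebra K A B)"
    "x \<ominus>\<^bsub>pair_algebra K A B\<^esub> y \<in> tensor_relations K A B"
  shows "tensor_null K A B +>\<^bsub>pair_algebra K A B\<^esub> x = tensor_null K A B +>\<^bsub>pair_algebra K A B\<^esub> y"
  using assms submodule_generated_subset[of "tensor_relations K A B" K "pair_algebra K A B"]
  by (subst quot_algebra_eq_iff[OF pair_algebra_assoc_algebra tensor_null_ideal])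
     (auto simp: tensor_null_def)

lemma pure_tensor_bilinear: "bilinear K A B (tensor_algebra K A B) (pure_tensor K A B)"
proof (rule bilinearI; rule linear_mapsI)
  let ?F = "pair_algebra K A B" and ?N = "tensor_null K A B"
  note add = quot_algebra_add[OF pair_algebra_assoc_algebra tensor_null_ideal]
  note smult = quot_algebra_smult[OF pair_algebra_assoc_algebra tensor_null_ideal]
  note cl = pair_basis_closed
  fix a b assume a: "a \<in> carrier A" and b: "b \<in> carrier B"
  show "pure_tensor K A B a b \<in> carrier (tensor_algebra K A B)"
    "pure_tensor K A B a b \<in> carrier (tensor_algebra K A B)"
    using a b by (simp_all add: pure_tensor_closed)
  show "pure_tensor K A B a (b \<oplus>\<^bsub>B\<^esub> b') =
      pure_tensor K A B a b \<oplus>\<^bsub>tensor_algebra K A B\<^esub> pure_tensor K A B a b'" if "b' \<in> carrier B" for b'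
    using a b that unfolding pure_tensor_def tensor_algebra_def
    by (subst add) (simp_all add: cl tensor_coset_eqI tensor_relationsI)
  show "pure_tensor K A B (a \<oplus>\<^bsub>A\<^esub> a') b =
      pure_tensor K A B a b \<oplus>\<^bsub>tensor_algebra K A B\<^esub> pure_tensor K A B a' b" if "a' \<in> carrier A" for a'
    using a b that unfolding pure_tensor_def tensor_algebra_def
    by (subst add) (simp_all add: cl tensor_coset_eqI tensor_relationsI)
  show "pure_tensor K A B a (k \<odot>\<^bsub>B\<^esub> b) = k \<odot>\<^bsub>tensor_algebra K A B\<^esub> pure_tensor K A B a b"
    "pure_tensor K A B (k \<odot>\<^bsub>A\<^esub> a) b = k \<odot>\<^bsub>tensor_algebra K A B\<^esub> pure_tensor K A B a b"
    if "k \<in> carrier K" for k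
    using a b that unfolding pure_tensor_def tensor_algebra_def
    by (subst smult; simp add: cl tensor_coset_eqI tensor_relationsI)+
qed

text \<open>The elements whose pure tensors lie in a given submodule form a submodule of the factor,
  by bilinearity. So generators may be replaced by arbitrary elements, first in the right slot and
  then in the left.\<close>

lemma tensor_algebra_spanning:
  assumes "spanning K A S" "spanning K B T"
  shows "spanning K (tensor_algebra K A B) {pure_tensor K A B a b |a b. a \<in> S \<and> b \<in> T}"
proof (rule spanning_trans[OF tensor_algebra_module])
  let ?T = "tensor_algebra K A B"
  interpret T: module K ?T by (rule tensor_algebra_module)
  have "spanning K ?T ((\<lambda>x. tensor_null K A B +>\<^bsub>pair_algebra K A B\<^esub> x) ` basis_elem K ` (carrier A \<times> carrier B))"
    unfolding tensor_algebra_def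
    by (rule quot_algebra_spanning[OF pair_algebra_assoc_algebra tensor_null_ideal pair_spanning])
  thus "spanning K ?T ((\<lambda>(a, b). pure_tensor K A B a b) ` (carrier A \<times> carrier B))"
    by (rule back_subst[where P = "spanning K ?T"]) (auto simp: pure_tensor_def image_iff)
  show "{pure_tensor K A B a b |a b. a \<in> S \<and> b \<in> T} \<subseteq> carrier ?T"
    using assms by (auto dest!: spanning_subset intro: pure_tensor_closed)
  fix x N
  assume x: "x \<in> (\<lambda>(a, b). pure_tensor K A B a b) ` (carrier A \<times> carrier B)"
    and N: "submodule N K ?T" "{pure_tensor K A B a b |a b. a \<in> S \<and> b \<in> T} \<subseteq> N"
  note bil = pure_tensor_bilinear[unfolded bilinear_def]
  have N': "submodule {y \<in> carrier M. f y \<in> N} K M" if "module K M" "f \<in> linear_maps K M ?T" for M f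
    by (rule submodule_sep[OF that(1)])
       (auto simp: linear_maps_zero[OF that(1) T.module_axioms that(2)] linear_maps_add[OF that(2)]
        linear_maps_smult[OF that(2)] submodule_zero[OF T.module_axioms N(1)]
        submodule_add[OF T.module_axioms N(1)] submodule_smult[OF T.module_axioms N(1)])
  have 1: "pure_tensor K A B a b \<in> N" if a: "a \<in> S" and b: "b \<in> carrier B" for a b
  proof -
    have "(\<lambda>b. pure_tensor K A B a b) \<in> linear_maps K B ?T" using bil a assms(1) spanning_subset by metis
    from N'[OF B.module_axioms this] show ?thesis
      using assms(2) N(2) a b unfolding spanning_def by blast
  qed
  have 2: "pure_tensor K A B a b \<in> N" if a: "a \<in> carrier A" and b: "b \<in> carrier B" for a b
  proof -
    have "(\<lambda>a. pure_tensor K A B a b) \<in> linear_maps K A ?T" using bil b by blast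
    from N'[OF A.module_axioms this] show ?thesis
      using assms(1) 1 b a unfolding spanning_def by blast
  qed
  show "x \<in> N" using x 2 by auto
qed

lemma pure_tensor_mult:
  "a \<in> carrier A \<Longrightarrow> b \<in> carrier B \<Longrightarrow> a' \<in> carrier A \<Longrightarrow> b' \<in> carrier B \<Longrightarrow>
   pure_tensor K A B a b \<otimes>\<^bsub>tensor_algebra K A B\<^esub> pure_tensor K A B a' b' =
   pure_tensor K A B (a \<otimes>\<^bsub>A\<^esub> a') (b \<otimes>\<^bsub>B\<^esub> b')"
  unfolding tensor_algebra_def pure_tensor_def
  by (subst quot_algebra_mult[OF pair_algebra_assoc_algebra tensor_null_ideal])
     (simp_all add: pair_basis_closed pair_basis_mult)

lemma tensor_algebra_one: "\<one>\<^bsub>tensor_algebra K A B\<^esub> = pure_tensor K A B \<one>\<^bsub>A\<^esub> \<one>\<^bsub>B\<^esub>"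
  unfolding tensor_algebra_def pure_tensor_def
    quot_algebra_one[OF pair_algebra_assoc_algebra tensor_null_ideal]
  by (simp add: pair_algebra_def monoid_algebra_simps)

text \<open>The universal property of the tensor product, for the \<open>SOME\<close>-based
  \<open>lin_lift\<close>: bilinearity is what makes the linear extension vanish on the four kinds
  of relations, hence on the submodule that they generate.\<close>

lemma tensor_lift:
  assumes P: "module K P" and \<beta>: "bilinear K A B P \<beta>"
  shows tensor_lift_linear: "lin_lift K P (\<lambda>(a, b). \<beta> a b) \<in> linear_maps K (tensor_algebra K A B) P"
    and tensor_lift_pure: "a \<in> carrier A \<Longrightarrow> b \<in> carrier B \<Longrightarrow>
      lin_lift K P (\<lambda>(a, b). \<beta> a b) (pure_tensor K A B a b) = \<beta> a b"
proof -
  let ?\<beta> = "\<lambda>(a, b). \<beta> a b" and ?F = "pair_algebra K A B"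
  interpret P: module K P by (rule P)
  note bil = \<beta>[unfolded bilinear_def]
  have car: "\<And>a b. a \<in> carrier A \<Longrightarrow> b \<in> carrier B \<Longrightarrow> \<beta> a b \<in> carrier P"
    using bil by (meson linear_maps_closed)
  hence fs: "?\<beta> \<in> carrier (A \<times>\<times> B) \<rightarrow> carrier P" by auto
  have L: "lin_ext K P ?\<beta> \<in> linear_maps K ?F P"
    unfolding pair_algebra_def by (rule lin_ext_linear[OF P fs])
  have b: "lin_ext K P ?\<beta> (basis_elem K (a, b)) = \<beta> a b" if "a \<in> carrier A" "b \<in> carrier B" for a b
    using lin_ext_basis[OF P fs, of "(a, b)"] that by simp
  have rel: "lin_ext K P ?\<beta> r = \<zero>\<^bsub>P\<^esub>" if "r \<in> tensor_relations K A B" for r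
    using that
  proof (cases rule: tensor_relations_cases)
    case (add_left a a' b)
    thus ?thesis using bil
      by (simp add: linear_maps_minus[OF F.module_axioms P L] linear_maps_add[OF L] pair_basis_closed b car
        linear_maps_add[of "\<lambda>a. \<beta> a b" K A P] P.r_neg a_minus_def[of P])
  next
    case (add_right a b b')
    thus ?thesis using bil
      by (simp add: linear_maps_minus[OF F.module_axioms P L] linear_maps_add[OF L] pair_basis_closed b car
        linear_maps_add[of "\<lambda>b. \<beta> a b" K B P] P.r_neg a_minus_def[of P])
  next
    case (smult_left k a b)
    thus ?thesis using bil
      by (simp add: linear_maps_minus[OF F.module_axioms P L] linear_maps_smult[OF L] pair_basis_closed b car
        linear_maps_smult[of "\<lambda>a. \<beta> a b" K A P] P.r_neg a_minus_def[of P])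
  next
    case (smult_right k a b)
    thus ?thesis using bil
      by (simp add: linear_maps_minus[OF F.module_axioms P L] linear_maps_smult[OF L] pair_basis_closed b car
        linear_maps_smult[of "\<lambda>b. \<beta> a b" K B P] P.r_neg a_minus_def[of P])
  qed
  have "tensor_null K A B \<subseteq> {x \<in> carrier ?F. lin_ext K P ?\<beta> x = \<zero>\<^bsub>P\<^esub>}"
    unfolding tensor_null_def
    by (rule submodule_generated_minimal[OF kernel_submodule[OF F.module_axioms P L]])
       (use rel tensor_relations_subset in auto)
  hence kill: "\<And>f. f \<in> tensor_null K A B \<Longrightarrow> lin_ext K P ?\<beta> f = \<zero>\<^bsub>P\<^esub>" by blast
  note I = tensor_null_ideal[unfolded pair_algebra_def]
  show "lin_lift K P ?\<beta> \<in> linear_maps K (tensor_algebra K A B) P"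
    unfolding tensor_algebra_def pair_algebra_def
    by (rule lin_lift_linear[OF pair_monoid P fs I kill])
  show "lin_lift K P ?\<beta> (pure_tensor K A B a b) = \<beta> a b" if "a \<in> carrier A" "b \<in> carrier B"
    unfolding pure_tensor_def pair_algebra_def
    using lin_lift_coset[OF pair_monoid P fs I kill pair_basis_closed[OF that, unfolded pair_algebra_def]] b[OF that]
    by simp
qed

end

lemma bilinear_compose:
  assumes "bilinear K A B P \<beta>" "f \<in> linear_maps K A' A" "g \<in> linear_maps K B' B" "h \<in> linear_maps K P Q"
  shows "bilinear K A' B' Q (\<lambda>a b. h (\<beta> (f a) (g b)))"
proof (rule bilinearI)
  fix a assume "a \<in> carrier A'"
  hence "(\<lambda>b. \<beta> (f a) b) \<in> linear_maps K B P"
    using assms(1) linear_maps_closed[OF assms(2)] by (simp add: bilinear_def)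
  from linear_maps_compose[OF linear_maps_compose[OF assms(3) this] assms(4)]
  show "(\<lambda>b. h (\<beta> (f a) (g b))) \<in> linear_maps K B' Q" .
next
  fix b assume "b \<in> carrier B'"
  hence "(\<lambda>a. \<beta> a (g b)) \<in> linear_maps K A P"
    using assms(1) linear_maps_closed[OF assms(3)] by (simp add: bilinear_def)
  from linear_maps_compose[OF linear_maps_compose[OF assms(2) this] assms(4)]
  show "(\<lambda>a. h (\<beta> (f a) (g b))) \<in> linear_maps K A' Q" .
qed

lemmas bilinear_compose2 = bilinear_compose[OF _ _ _ linear_maps_id]

lemma tensor_map:
  assumes alg: "assoc_algebra K A" "assoc_algebra K B" "assoc_algebra K A'" "assoc_algebra K B'"
    and f: "f \<in> linear_maps K A' A" and g: "g \<in> linear_maps K B' B"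
  shows tensor_map_linear:
      "tensor_map K A B f g \<in> linear_maps K (tensor_algebra K A' B') (tensor_algebra K A B)"
    and tensor_map_pure: "a \<in> carrier A' \<Longrightarrow> b \<in> carrier B' \<Longrightarrow>
      tensor_map K A B f g (pure_tensor K A' B' a b) = pure_tensor K A B (f a) (g b)"
  unfolding tensor_map_def
  using tensor_lift[OF alg(3,4) tensor_algebra_module[OF alg(1,2)]
      bilinear_compose2[OF pure_tensor_bilinear[OF alg(1,2)] f g]]
  by simp_all

lemma pure_tensor_linear_right:
  assumes "assoc_algebra K A" "assoc_algebra K B" "a \<in> carrier A"
  shows "pure_tensor K A B a \<in> linear_maps K B (tensor_algebra K A B)"
  using pure_tensor_bilinear[OF assms(1,2)] assms(3) unfolding bilinear_def by blast

lemma pure_tensor_linear_left: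
  assumes "assoc_algebra K A" "assoc_algebra K B" "b \<in> carrier B"
  shows "(\<lambda>a. pure_tensor K A B a b) \<in> linear_maps K A (tensor_algebra K A B)"
  using pure_tensor_bilinear[OF assms(1,2)] assms(3) unfolding bilinear_def by blast

text \<open>The associator lifts a map that is itself a lift with a parameter \<open>c\<close>.
  Linearity in \<open>c\<close> of the inner lift is not visible on an arbitrary representative, but
  it is on pure tensors, where the value is known, and these span.\<close>

lemma bilinear_lift:
  assumes "assoc_algebra K A" "assoc_algebra K B" "module K C" "module K P"
    and bil: "\<And>c. c \<in> carrier C \<Longrightarrow> bilinear K A B P (\<lambda>a b. \<gamma> a b c)"
    and lin: "\<And>a b. a \<in> carrier A \<Longrightarrow> b \<in> carrier B \<Longrightarrow> (\<lambda>c. \<gamma> a b c) \<in> linear_maps K C P"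
  shows "bilinear K (tensor_algebra K A B) C P (\<lambda>u c. lin_lift K P (\<lambda>(a, b). \<gamma> a b c) u)"
proof (rule bilinearI)
  let ?T = "tensor_algebra K A B"
  let ?L = "\<lambda>c. lin_lift K P (\<lambda>(a, b). \<gamma> a b c)"
  interpret P: module K P by fact
  interpret C: module K C by fact
  note L = tensor_lift_linear[OF assms(1,2,4) bil]
  note pure = tensor_lift_pure[OF assms(1,2,4) bil]
  note T = tensor_algebra_module[OF assms(1,2)]
    and sp = tensor_algebra_spanning[OF assms(1,2) spanning_carrier spanning_carrier]
  show "(\<lambda>u. ?L c u) \<in> linear_maps K ?T P" if "c \<in> carrier C" for c
    using that by (rule L)
  fix u assume u: "u \<in> carrier ?T"
  show "(\<lambda>c. ?L c u) \<in> linear_maps K C P"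
  proof (rule linear_mapsI)
    fix c assume c: "c \<in> carrier C"
    show "?L c u \<in> carrier P" using linear_maps_closed[OF L[OF c] u] .
    show "?L (c \<oplus>\<^bsub>C\<^esub> c') u = ?L c u \<oplus>\<^bsub>P\<^esub> ?L c' u" if c': "c' \<in> carrier C" for c'
      by (rule linear_maps_eqI[OF T \<open>module K P\<close> sp L linear_maps_sum[OF \<open>module K P\<close> L L] _ u])
         (use c c' in \<open>auto simp: pure linear_maps_add[OF lin]\<close>)
    show "?L (k \<odot>\<^bsub>C\<^esub> c) u = k \<odot>\<^bsub>P\<^esub> ?L c u" if k: "k \<in> carrier K" for k
      by (rule linear_maps_eqI[OF T \<open>module K P\<close> sp L linear_maps_scale[OF \<open>module K P\<close> L] _ u])
         (use c k in \<open>auto simp: pure linear_maps_smult[OF lin]\<close>)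
  qed
qed

lemma tensor_assoc:
  assumes A: "assoc_algebra K A" and B: "assoc_algebra K B" and C: "assoc_algebra K C"
  shows tensor_assoc_linear: "tensor_assoc K A B C \<in>
      linear_maps K (tensor_algebra K (tensor_algebra K A B) C) (tensor_algebra K A (tensor_algebra K B C))"
    and tensor_assoc_pure: "a \<in> carrier A \<Longrightarrow> b \<in> carrier B \<Longrightarrow> c \<in> carrier C \<Longrightarrow>
      tensor_assoc K A B C (pure_tensor K (tensor_algebra K A B) C (pure_tensor K A B a b) c) =
      pure_tensor K A (tensor_algebra K B C) a (pure_tensor K B C b c)"
proof -
  let ?BC = "tensor_algebra K B C"
  let ?T = "tensor_algebra K A ?BC"
  let ?\<gamma> = "\<lambda>a b c. pure_tensor K A ?BC a (pure_tensor K B C b c)"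
  note AB = tensor_algebra_assoc_algebra[OF A B] and BC = tensor_algebra_assoc_algebra[OF B C]
  note T = tensor_algebra_module[OF A BC]
  have bil: "bilinear K A B ?T (\<lambda>a b. ?\<gamma> a b c)" if "c \<in> carrier C" for c
    by (rule bilinear_compose2[OF pure_tensor_bilinear[OF A BC] linear_maps_id
          pure_tensor_linear_left[OF B C that]])
  have lin: "(\<lambda>c. ?\<gamma> a b c) \<in> linear_maps K C ?T" if "a \<in> carrier A" "b \<in> carrier B" for a b
    by (rule linear_maps_compose[OF pure_tensor_linear_right[OF B C that(2)]
          pure_tensor_linear_right[OF A BC that(1)]])
  have bl: "bilinear K (tensor_algebra K A B) C ?T (\<lambda>u c. lin_lift K ?T (\<lambda>(a, b). ?\<gamma> a b c) u)"
    by (rule bilinear_lift[OF A B assoc_algebra_module[OF C] T bil lin])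
  note L = tensor_lift[OF AB C T bl]
  show "tensor_assoc K A B C \<in> linear_maps K (tensor_algebra K (tensor_algebra K A B) C) ?T"
    unfolding tensor_assoc_def Let_def by (rule L(1))
  show "tensor_assoc K A B C (pure_tensor K (tensor_algebra K A B) C (pure_tensor K A B a b) c) = ?\<gamma> a b c"
    if "a \<in> carrier A" "b \<in> carrier B" "c \<in> carrier C"
    unfolding tensor_assoc_def Let_def
    using L(2)[OF pure_tensor_closed[OF A B that(1,2)] that(3)] tensor_lift_pure[OF A B T bil[OF that(3)] that(1,2)]
    by simp
qed

lemma mult_map:
  assumes A: "assoc_algebra K A"
  shows mult_map_linear: "mult_map K A \<in> linear_maps K (tensor_algebra K A A) A"
    and mult_map_pure: "a \<in> carrier A \<Longrightarrow> b \<in> carrier A \<Longrightarrow> mult_map K A (pure_tensor K A A a b) = a \<otimes>\<^bsub>A\<^esub> b"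
proof -
  interpret A: assoc_algebra K A by (rule A)
  have "bilinear K A A A (\<otimes>\<^bsub>A\<^esub>)"
    by (rule bilinearI) (simp_all add: A.mult_left_linear A.mult_right_linear)
  note L = tensor_lift[OF A A A.module_axioms this]
  show "mult_map K A \<in> linear_maps K (tensor_algebra K A A) A"
    "a \<in> carrier A \<Longrightarrow> b \<in> carrier A \<Longrightarrow> mult_map K A (pure_tensor K A A a b) = a \<otimes>\<^bsub>A\<^esub> b"
    unfolding mult_map_def using L by simp_all
qed

section \<open>Base change\<close>

lemma linear_maps_cong:
  assumes "f \<in> linear_maps K M N" "module K M" "\<And>x. x \<in> carrier M \<Longrightarrow> g x = f x"
  shows "g \<in> linear_maps K M N"
proof -
  interpret M: module K M by fact
  show ?thesis
    by (rule linear_mapsI)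
       (simp_all add: assms(3) linear_maps_closed[OF assms(1)] linear_maps_add[OF assms(1)] linear_maps_smult[OF assms(1)])
qed

lemma bilinear_smult:
  assumes "module K P" "f \<in> linear_maps K A (ring_as_algebra K (\<lambda>k. k))" "g \<in> linear_maps K B P"
  shows "bilinear K A B P (\<lambda>a b. f a \<odot>\<^bsub>P\<^esub> g b)"
proof -
  interpret P: module K P by fact
  note f = linear_maps_closed[OF assms(2)] linear_maps_add[OF assms(2)] linear_maps_smult[OF assms(2)]
    and g = linear_maps_closed[OF assms(3)] linear_maps_add[OF assms(3)] linear_maps_smult[OF assms(3)]
  have fc: "f a \<in> carrier K" if "a \<in> carrier A" for a
    using f(1)[OF that] by (simp add: ring_as_algebra_def ring.defs)
  show ?thesis
  proof (rule bilinearI; rule linear_mapsI)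
    fix a b k assume "a \<in> carrier A" "b \<in> carrier B" "k \<in> carrier K"
    thus "f a \<odot>\<^bsub>P\<^esub> g (k \<odot>\<^bsub>B\<^esub> b) = k \<odot>\<^bsub>P\<^esub> (f a \<odot>\<^bsub>P\<^esub> g b)"
      using fc[of a] g(1)[of b] by (simp add: g P.smult_assoc1[symmetric] P.m_comm)
  qed (use f(2,3) in \<open>auto simp: fc g P.smult_r_distr P.smult_l_distr P.smult_assoc1
      ring_as_algebra_def ring.defs module.defs\<close>)
qed

lemma bilinear_flip: "bilinear K A B P \<beta> \<Longrightarrow> bilinear K B A P (\<lambda>b a. \<beta> a b)"
  by (simp add: bilinear_def)

lemma ring_as_algebra_simps [simp]:
  "carrier (ring_as_algebra L \<phi>) = carrier L" "mult (ring_as_algebra L \<phi>) = mult L"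
  "one (ring_as_algebra L \<phi>) = one L" "zero (ring_as_algebra L \<phi>) = zero L"
  "add (ring_as_algebra L \<phi>) = add L" "k \<odot>\<^bsub>ring_as_algebra L \<phi>\<^esub> x = \<phi> k \<otimes>\<^bsub>L\<^esub> x"
  by (simp_all add: ring_as_algebra_def ring.defs module.defs)

lemma restrict_scalars_simps [simp]:
  "carrier (restrict_scalars \<phi> P) = carrier P" "mult (restrict_scalars \<phi> P) = mult P"
  "one (restrict_scalars \<phi> P) = one P" "zero (restrict_scalars \<phi> P) = zero P"
  "add (restrict_scalars \<phi> P) = add P" "k \<odot>\<^bsub>restrict_scalars \<phi> P\<^esub> x = \<phi> k \<odot>\<^bsub>P\<^esub> x"
  by (simp_all add: restrict_scalars_def ring.defs module.defs)

lemma tensor_algebra_extend_left [simp]: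
  "tensor_algebra K (module.extend A x) B = tensor_algebra K A B"
  "pure_tensor K (module.extend A x) B = pure_tensor K A B"
  by (simp_all add: tensor_algebra_def pair_algebra_def tensor_null_def tensor_relations_def DirProd_def
      module.defs pure_tensor_def fun_eq_iff)

lemma tensor_algebra_extend_right [simp]:
  "tensor_algebra K A (module.extend B y) = tensor_algebra K A B"
  "pure_tensor K A (module.extend B y) = pure_tensor K A B"
  by (simp_all add: tensor_algebra_def pair_algebra_def tensor_null_def tensor_relations_def DirProd_def
      module.defs pure_tensor_def fun_eq_iff)

lemmas tensor_algebra_extend = tensor_algebra_extend_left tensor_algebra_extend_right

lemma module_extend_simps [simp]:
  "carrier (module.extend A x) = carrier A" "mult (module.extend A x) = mult A"
  "one (module.extend A x) = one A" "zero (module.extend A x) = zero A"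
  "add (module.extend A x) = add A" "smult (module.extend A x) = smult A"
  by (simp_all add: module.defs)

lemma linear_maps_extend [simp]:
  "linear_maps K (module.extend A x) B = linear_maps K A B"
  "linear_maps K B (module.extend A x) = linear_maps K B A"
  by (simp_all add: linear_maps_def)

lemma spanning_extend [simp]: "spanning K (module.extend A x) S = spanning K A S"
proof -
  have "submodule N K (module.extend A x) = submodule N K A" for N
    by (simp add: submodule_def submodule_axioms_def subgroup_def m_inv_def)
  thus ?thesis by (simp add: spanning_def)
qed

lemma assoc_algebra_extend [simp]: "assoc_algebra K (module.extend A x) = assoc_algebra K A"
  by (rule iffI; erule assoc_algebra_cong) simp_all

section \<open>Restriction and extension of scalars along a ring homomorphism\<close>

locale scalar_extension = K: cring K + L: cring L
  for K :: "'k ring" and L :: "'l ring" and \<phi> :: "'k \<Rightarrow> 'l" +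
  assumes \<phi>_hom: "\<phi> \<in> ring_hom K L"
begin

lemma \<phi>_simps [simp]:
  "k \<in> carrier K \<Longrightarrow> \<phi> k \<in> carrier L" "\<phi> \<one>\<^bsub>K\<^esub> = \<one>\<^bsub>L\<^esub>" "\<phi> \<zero>\<^bsub>K\<^esub> = \<zero>\<^bsub>L\<^esub>"
  "k \<in> carrier K \<Longrightarrow> k' \<in> carrier K \<Longrightarrow> \<phi> (k \<oplus>\<^bsub>K\<^esub> k') = \<phi> k \<oplus>\<^bsub>L\<^esub> \<phi> k'"
  "k \<in> carrier K \<Longrightarrow> k' \<in> carrier K \<Longrightarrow> \<phi> (k \<otimes>\<^bsub>K\<^esub> k') = \<phi> k \<otimes>\<^bsub>L\<^esub> \<phi> k'"
  using \<phi>_hom ring_hom_zero[OF \<phi>_hom K.ring_axioms L.ring_axioms]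
  by (auto simp: ring_hom_def)

lemma restrict_scalars_module:
  assumes "module L P" shows "module K (restrict_scalars \<phi> P)"
proof -
  interpret P: module L P by fact
  have "abelian_group (restrict_scalars \<phi> P)"
    by (rule abelian_group_cong[OF P.abelian_group_axioms]) simp_all
  thus ?thesis
    by (intro moduleI K.is_cring) (auto simp: P.smult_l_distr P.smult_r_distr P.smult_assoc1)
qed

lemma restrict_scalars_assoc_algebra:
  assumes "assoc_algebra L P" shows "assoc_algebra K (restrict_scalars \<phi> P)"
proof -
  interpret P: assoc_algebra L P by fact
  have "ring (restrict_scalars \<phi> P)" by (rule ring_cong[OF P.A.ring_axioms]) simp_all
  thus ?thesis
    by (intro assoc_algebra.intro restrict_scalars_module P.module_axioms assoc_algebra_axioms.intro)
       (auto simp: P.smult_mult_left P.smult_mult_right)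
qed

lemma ring_as_algebra_assoc_algebra: "assoc_algebra K (ring_as_algebra L \<phi>)"
proof -
  have R: "ring (ring_as_algebra L \<phi>)" by (rule ring_cong[OF L.ring_axioms]) simp_all
  interpret R: ring "ring_as_algebra L \<phi>" by (rule R)
  have "module K (ring_as_algebra L \<phi>)"
    by (intro moduleI K.is_cring R.abelian_group_axioms) (auto simp: L.l_distr L.r_distr L.m_assoc)
  thus ?thesis
    by (intro assoc_algebra.intro R assoc_algebra_axioms.intro) (auto simp: L.m_ac)
qed

lemma linear_maps_restrict: "f \<in> linear_maps L M N \<Longrightarrow> f \<in> linear_maps K (restrict_scalars \<phi> M) (restrict_scalars \<phi> N)"
  by (auto simp: linear_maps_def)

end

lemma scalar_extension_id: "cring K \<Longrightarrow> scalar_extension K K (\<lambda>k. k)"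
  by (intro scalar_extension.intro scalar_extension_axioms.intro) (auto simp: ring_hom_def cring.is_cring)

lemma base_change_simps [simp]:
  "carrier (base_change K L \<phi> M) = carrier (tensor_algebra K M (ring_as_algebra L \<phi>))"
  "mult (base_change K L \<phi> M) = mult (tensor_algebra K M (ring_as_algebra L \<phi>))"
  "one (base_change K L \<phi> M) = one (tensor_algebra K M (ring_as_algebra L \<phi>))"
  "zero (base_change K L \<phi> M) = zero (tensor_algebra K M (ring_as_algebra L \<phi>))"
  "add (base_change K L \<phi> M) = add (tensor_algebra K M (ring_as_algebra L \<phi>))"
  "l \<odot>\<^bsub>base_change K L \<phi> M\<^esub> u =
     tensor_map K M (ring_as_algebra L \<phi>) (\<lambda>m. m) (\<lambda>x. l \<otimes>\<^bsub>L\<^esub> x) u"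
  by (simp_all add: base_change_def Let_def ring.defs module.defs)

lemma linear_maps_cong_codomain:
  assumes "f \<in> linear_maps K M N" "carrier N' = carrier N" "add N' = add N"
    "\<And>k x. k \<in> carrier K \<Longrightarrow> x \<in> carrier N \<Longrightarrow> k \<odot>\<^bsub>N'\<^esub> x = k \<odot>\<^bsub>N\<^esub> x"
  shows "f \<in> linear_maps K M N'"
  using assms by (auto simp: linear_maps_def Pi_iff)

locale base_change_algebra = scalar_extension K L \<phi> + M: assoc_algebra K M
  for K :: "'k ring" and L :: "'l ring" and \<phi> and M :: "('k, 'a, 'm) module_scheme"
begin

abbreviation L\<phi> where "L\<phi> \<equiv> ring_as_algebra L \<phi>"
abbreviation LM where "LM \<equiv> base_change K L \<phi> M"
text \<open>\<open>LM0\<close> and \<open>LM\<close> have the same elements and ring operations and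
  differ in the scalars, \<open>K\<close> versus \<open>L\<close>. Identities in \<open>LM\<close>
  are checked \<open>K\<close>-linearly in \<open>LM0\<close>, where pure tensors span.\<close>

abbreviation LM0 where "LM0 \<equiv> tensor_algebra K M L\<phi>"
abbreviation tensor :: "'a \<Rightarrow> 'l \<Rightarrow> ('a \<times> 'l \<Rightarrow> 'k) set" (infixl \<open>\<diamondop>\<close> 75) where "m \<diamondop> x \<equiv> pure_tensor K M L\<phi> m x"

sublocale L\<phi>: assoc_algebra K L\<phi> by (rule ring_as_algebra_assoc_algebra)
sublocale LM0: assoc_algebra K LM0
  by (rule tensor_algebra_assoc_algebra[OF M.assoc_algebra_axioms L\<phi>.assoc_algebra_axioms])

lemmas algs = M.assoc_algebra_axioms L\<phi>.assoc_algebra_axioms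

lemma left_mult_linear: "l \<in> carrier L \<Longrightarrow> (\<lambda>x. l \<otimes>\<^bsub>L\<^esub> x) \<in> linear_maps K L\<phi> L\<phi>"
  using L\<phi>.mult_left_linear by simp

lemma base_change_smult_linear: "l \<in> carrier L \<Longrightarrow> (\<lambda>u. l \<odot>\<^bsub>LM\<^esub> u) \<in> linear_maps K LM0 LM0"
  using tensor_map_linear[OF algs algs linear_maps_id left_mult_linear]
  by (simp add: linear_maps_def)

lemma base_change_smult_pure:
  "l \<in> carrier L \<Longrightarrow> m \<in> carrier M \<Longrightarrow> x \<in> carrier L \<Longrightarrow> l \<odot>\<^bsub>LM\<^esub> (m \<diamondop> x) = m \<diamondop> (l \<otimes>\<^bsub>L\<^esub> x)"
  using tensor_map_pure[OF algs algs linear_maps_id left_mult_linear] by simp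

lemma tensor_closed [simp]: "m \<in> carrier M \<Longrightarrow> x \<in> carrier L \<Longrightarrow> m \<diamondop> x \<in> carrier LM0"
  using pure_tensor_closed[OF algs] by simp

lemma tensor_add_right: "m \<in> carrier M \<Longrightarrow> x \<in> carrier L \<Longrightarrow> y \<in> carrier L \<Longrightarrow>
    m \<diamondop> (x \<oplus>\<^bsub>L\<^esub> y) = m \<diamondop> x \<oplus>\<^bsub>LM0\<^esub> m \<diamondop> y"
  using linear_maps_add[OF pure_tensor_linear_right[OF algs]] by simp

lemma base_change_mult_pure:
  "m \<in> carrier M \<Longrightarrow> x \<in> carrier L \<Longrightarrow> m' \<in> carrier M \<Longrightarrow> x' \<in> carrier L \<Longrightarrow>
    (m \<diamondop> x) \<otimes>\<^bsub>LM0\<^esub> (m' \<diamondop> x') = (m \<otimes>\<^bsub>M\<^esub> m') \<diamondop> (x \<otimes>\<^bsub>L\<^esub> x')"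
  using pure_tensor_mult[OF algs] by simp

lemma LM0_eqI:
  assumes "f \<in> linear_maps K LM0 P" "g \<in> linear_maps K LM0 P" "module K P" "u \<in> carrier LM0"
    "\<And>m x. m \<in> carrier M \<Longrightarrow> x \<in> carrier L \<Longrightarrow> f (m \<diamondop> x) = g (m \<diamondop> x)"
  shows "f u = g u"
  by (rule linear_maps_eqI[OF LM0.module_axioms assms(3)
        tensor_algebra_spanning[OF algs spanning_carrier spanning_carrier] assms(1,2) _ assms(4)])
     (use assms(5) in auto)

lemma base_change_assoc_algebra: "assoc_algebra L LM"
proof -
  note [simp del] = base_change_simps(6)
  note lin = base_change_smult_linear
  have cl: "l \<odot>\<^bsub>LM\<^esub> u \<in> carrier LM0" if "l \<in> carrier L" "u \<in> carrier LM0" for l u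
    using linear_maps_closed[OF lin] that by blast
  have ring: "ring LM" by (rule ring_cong[OF LM0.A.ring_axioms]) simp_all
  then interpret LM: ring LM .
  have mod: "module L LM"
  proof (rule moduleI)
    show "cring L" by (rule L.is_cring)
    show "abelian_group LM" by (rule LM.abelian_group_axioms)
    show "\<one>\<^bsub>L\<^esub> \<odot>\<^bsub>LM\<^esub> u = u" if "u \<in> carrier LM" for u
      by (rule LM0_eqI[OF lin linear_maps_id LM0.module_axioms]) (use that in \<open>auto simp: base_change_smult_pure\<close>)
    fix l u assume l: "l \<in> carrier L" and u: "u \<in> carrier LM"
    hence u: "u \<in> carrier LM0" by simp
    show "l \<odot>\<^bsub>LM\<^esub> u \<in> carrier LM" using l u by (simp add: cl)
    show "l \<odot>\<^bsub>LM\<^esub> (u \<oplus>\<^bsub>LM\<^esub> v) = l \<odot>\<^bsub>LM\<^esub> u \<oplus>\<^bsub>LM\<^esub> l \<odot>\<^bsub>LM\<^esub> v" if "v \<in> carrier LM" for v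
      using linear_maps_add[OF lin[OF l] u, of v] that by simp
    fix l' assume l': "l' \<in> carrier L"
    show "(l \<oplus>\<^bsub>L\<^esub> l') \<odot>\<^bsub>LM\<^esub> u = l \<odot>\<^bsub>LM\<^esub> u \<oplus>\<^bsub>LM\<^esub> l' \<odot>\<^bsub>LM\<^esub> u"
      using LM0_eqI[OF lin linear_maps_sum[OF LM0.module_axioms lin lin] LM0.module_axioms u, of "l \<oplus>\<^bsub>L\<^esub> l'" l l']
        l l' by (simp add: base_change_smult_pure L.l_distr tensor_add_right)
    show "(l \<otimes>\<^bsub>L\<^esub> l') \<odot>\<^bsub>LM\<^esub> u = l \<odot>\<^bsub>LM\<^esub> (l' \<odot>\<^bsub>LM\<^esub> u)"
      by (rule LM0_eqI[OF lin linear_maps_compose[OF lin lin] LM0.module_axioms u])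
         (use l l' in \<open>auto simp: base_change_smult_pure L.m_assoc\<close>)
  qed
  have left: "(l \<odot>\<^bsub>LM\<^esub> u) \<otimes>\<^bsub>LM0\<^esub> v = l \<odot>\<^bsub>LM\<^esub> (u \<otimes>\<^bsub>LM0\<^esub> v)"
    and right: "u \<otimes>\<^bsub>LM0\<^esub> (l \<odot>\<^bsub>LM\<^esub> v) = l \<odot>\<^bsub>LM\<^esub> (u \<otimes>\<^bsub>LM0\<^esub> v)"
    if l: "l \<in> carrier L" and u: "u \<in> carrier LM0" and v: "v \<in> carrier LM0" for l u v
  proof -
    note ml = LM0.mult_left_linear and mr = LM0.mult_right_linear
    \<comment> \<open>Compatibility of product and scalars is bilinear in \<open>u\<close> and
      \<open>v\<close>: here \<open>u\<close> is a pure tensor and \<open>v\<close> is extended from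
      pure tensors; afterwards \<open>u\<close> is extended as well.\<close>
    have 1: "(l \<odot>\<^bsub>LM\<^esub> (m \<diamondop> x)) \<otimes>\<^bsub>LM0\<^esub> v = l \<odot>\<^bsub>LM\<^esub> ((m \<diamondop> x) \<otimes>\<^bsub>LM0\<^esub> v)"
      "(m \<diamondop> x) \<otimes>\<^bsub>LM0\<^esub> (l \<odot>\<^bsub>LM\<^esub> v) = l \<odot>\<^bsub>LM\<^esub> ((m \<diamondop> x) \<otimes>\<^bsub>LM0\<^esub> v)"
      if m: "m \<in> carrier M" "x \<in> carrier L" for m x
    proof -
      show "(l \<odot>\<^bsub>LM\<^esub> (m \<diamondop> x)) \<otimes>\<^bsub>LM0\<^esub> v = l \<odot>\<^bsub>LM\<^esub> ((m \<diamondop> x) \<otimes>\<^bsub>LM0\<^esub> v)"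
        by (rule LM0_eqI[OF ml linear_maps_compose[OF ml lin] LM0.module_axioms v])
           (use l m in \<open>auto simp: base_change_smult_pure base_change_mult_pure L.m_assoc cl\<close>)
      show "(m \<diamondop> x) \<otimes>\<^bsub>LM0\<^esub> (l \<odot>\<^bsub>LM\<^esub> v) = l \<odot>\<^bsub>LM\<^esub> ((m \<diamondop> x) \<otimes>\<^bsub>LM0\<^esub> v)"
        by (rule LM0_eqI[OF linear_maps_compose[OF lin ml] linear_maps_compose[OF ml lin] LM0.module_axioms v])
           (use l m in \<open>auto simp: base_change_smult_pure base_change_mult_pure L.m_lcomm cl\<close>)
    qed
    show "(l \<odot>\<^bsub>LM\<^esub> u) \<otimes>\<^bsub>LM0\<^esub> v = l \<odot>\<^bsub>LM\<^esub> (u \<otimes>\<^bsub>LM0\<^esub> v)"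
      by (rule LM0_eqI[OF linear_maps_compose[OF lin mr] linear_maps_compose[OF mr lin] LM0.module_axioms u])
         (use l v 1 in auto)
    show "u \<otimes>\<^bsub>LM0\<^esub> (l \<odot>\<^bsub>LM\<^esub> v) = l \<odot>\<^bsub>LM\<^esub> (u \<otimes>\<^bsub>LM0\<^esub> v)"
      by (rule LM0_eqI[OF mr linear_maps_compose[OF mr lin] LM0.module_axioms u])
         (use l v 1 cl in auto)
  qed
  show ?thesis
    by (intro assoc_algebra.intro mod ring assoc_algebra_axioms.intro) (auto simp: left right)
qed

sublocale LM: assoc_algebra L LM by (rule base_change_assoc_algebra)

lemma base_change_smult_scalar: "k \<in> carrier K \<Longrightarrow> u \<in> carrier LM0 \<Longrightarrow> \<phi> k \<odot>\<^bsub>LM\<^esub> u = k \<odot>\<^bsub>LM0\<^esub> u"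
  by (rule LM0_eqI[OF base_change_smult_linear linear_maps_scale[OF LM0.module_axioms linear_maps_id] LM0.module_axioms])
     (use linear_maps_smult[OF pure_tensor_linear_right[OF algs]] in
       \<open>auto simp: base_change_smult_pure simp del: base_change_simps(6)\<close>)

text \<open>The two scalar actions of \<open>K\<close> are known to agree on the carrier, but not
  outside it. So the two structures are not identified, only the linear maps into them.\<close>

lemma linear_maps_restrict_base_change:
  "linear_maps K P (restrict_scalars \<phi> LM) = linear_maps K P LM0"
  by (intro equalityI subsetI; erule linear_maps_cong_codomain)
     (simp_all add: base_change_smult_scalar[symmetric] del: base_change_simps(6))

lemma base_change_unit_linear: "(\<lambda>m. m \<diamondop> \<one>\<^bsub>L\<^esub>) \<in> linear_maps K M (restrict_scalars \<phi> LM)"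
  unfolding linear_maps_restrict_base_change
  using pure_tensor_linear_left[OF algs, of "\<one>\<^bsub>L\<^esub>"] by simp

lemma tensor_one_smult: "m \<in> carrier M \<Longrightarrow> x \<in> carrier L \<Longrightarrow> x \<odot>\<^bsub>LM\<^esub> (m \<diamondop> \<one>\<^bsub>L\<^esub>) = m \<diamondop> x"
  by (simp add: base_change_smult_pure del: base_change_simps)

text \<open>The pure tensor \<open>m \<diamondop> x\<close> is the \<open>L\<close>-multiple by
  \<open>x\<close> of \<open>m\<close> tensored with the unit. To exploit that pure tensors span
  over \<open>K\<close>, an \<open>L\<close>-submodule is first viewed as a
  \<open>K\<close>-submodule through \<open>\<phi>\<close>.\<close>

lemma base_change_spanning:
  assumes "spanning K M S"
  shows "spanning L LM ((\<lambda>m. m \<diamondop> \<one>\<^bsub>L\<^esub>) ` S)"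
proof (rule spanningI)
  note [simp del] = base_change_simps(6)
  note S = spanning_subset[OF assms]
  show "(\<lambda>m. m \<diamondop> \<one>\<^bsub>L\<^esub>) ` S \<subseteq> carrier LM" using S by auto
  fix u N assume N: "submodule N L LM" "(\<lambda>m. m \<diamondop> \<one>\<^bsub>L\<^esub>) ` S \<subseteq> N" and u: "u \<in> carrier LM"
  have N': "submodule {u \<in> carrier LM0. u \<in> N} K LM0"
  proof (rule submodule_sep[OF LM0.module_axioms])
    show "\<zero>\<^bsub>LM0\<^esub> \<in> N" using submodule_zero[OF LM.module_axioms N(1)] by simp
    show "x \<oplus>\<^bsub>LM0\<^esub> y \<in> N" if "x \<in> N" "y \<in> N" for x y
      using submodule_add[OF LM.module_axioms N(1) that] by simp
    show "k \<odot>\<^bsub>LM0\<^esub> x \<in> N" if "k \<in> carrier K" "x \<in> N" "x \<in> carrier LM0" for k x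
      using submodule_smult[OF LM.module_axioms N(1) _ that(2), of "\<phi> k"] that by (simp add: base_change_smult_scalar)
  qed
  have "u \<in> {u \<in> carrier LM0. u \<in> N}"
  proof (rule spanning_submodule[OF tensor_algebra_spanning[OF algs assms spanning_carrier] N'])
    show "u \<in> carrier LM0" using u by simp
    show "{m \<diamondop> x |m x. m \<in> S \<and> x \<in> carrier L\<phi>} \<subseteq> {u \<in> carrier LM0. u \<in> N}"
    proof clarsimp
      fix m x assume m: "m \<in> S" and x: "x \<in> carrier L"
      have "x \<odot>\<^bsub>LM\<^esub> (m \<diamondop> \<one>\<^bsub>L\<^esub>) \<in> N" using m N(2) x by (intro submodule_smult[OF LM.module_axioms N(1)]) auto
      thus "m \<diamondop> x \<in> carrier LM0 \<and> m \<diamondop> x \<in> N" using m x S by (simp add: tensor_one_smult)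
    qed
  qed
  thus "u \<in> N" by simp
qed

lemma base_change_lift:
  assumes P: "module L P" and bil: "bilinear K M L\<phi> (restrict_scalars \<phi> P) \<beta>"
    and sm: "\<And>m x l. m \<in> carrier M \<Longrightarrow> x \<in> carrier L \<Longrightarrow> l \<in> carrier L \<Longrightarrow> \<beta> m (l \<otimes>\<^bsub>L\<^esub> x) = l \<odot>\<^bsub>P\<^esub> \<beta> m x"
  shows base_change_lift_linear: "lin_lift K (restrict_scalars \<phi> P) (\<lambda>(m, x). \<beta> m x) \<in> linear_maps L LM P"
    and base_change_lift_pure: "m \<in> carrier M \<Longrightarrow> x \<in> carrier L \<Longrightarrow>
      lin_lift K (restrict_scalars \<phi> P) (\<lambda>(m, x). \<beta> m x) (m \<diamondop> x) = \<beta> m x"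
proof -
  note [simp del] = base_change_simps(6)
  let ?f = "lin_lift K (restrict_scalars \<phi> P) (\<lambda>(m, x). \<beta> m x)"
  interpret P: module L P by (rule P)
  note P' = restrict_scalars_module[OF P]
  note f = tensor_lift[OF algs P' bil]
  show pure: "?f (m \<diamondop> x) = \<beta> m x" if "m \<in> carrier M" "x \<in> carrier L" for m x
    using f(2) that by simp
  show "?f \<in> linear_maps L LM P"
  proof (rule linear_mapsI)
    fix u assume u: "u \<in> carrier LM"
    hence u: "u \<in> carrier LM0" by simp
    show "?f u \<in> carrier P" using linear_maps_closed[OF f(1) u] by simp
    show "?f (u \<oplus>\<^bsub>LM\<^esub> v) = ?f u \<oplus>\<^bsub>P\<^esub> ?f v" if "v \<in> carrier LM" for v
      using linear_maps_add[OF f(1) u, of v] that by simp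
    fix l assume l: "l \<in> carrier L"
    have "(\<lambda>p. l \<odot>\<^bsub>P\<^esub> p) \<in> linear_maps K (restrict_scalars \<phi> P) (restrict_scalars \<phi> P)"
      by (rule linear_maps_restrict[OF linear_maps_scale[OF P linear_maps_id l]])
    from linear_maps_compose[OF f(1) this]
    show "?f (l \<odot>\<^bsub>LM\<^esub> u) = l \<odot>\<^bsub>P\<^esub> ?f u"
      by (rule LM0_eqI[OF linear_maps_compose[OF base_change_smult_linear[OF l] f(1)] _ P' u])
         (use l sm in \<open>auto simp: base_change_smult_pure pure\<close>)
  qed
qed

lemma bilinear_smult_left:
  assumes "module L P" "f \<in> linear_maps K M (restrict_scalars \<phi> P)"
  shows "bilinear K M L\<phi> (restrict_scalars \<phi> P) (\<lambda>m x. x \<odot>\<^bsub>P\<^esub> f m)"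
proof -
  interpret P: module L P by fact
  show ?thesis
    by (intro bilinearI linear_mapsI)
       (use linear_maps_closed[OF assms(2)] linear_maps_add[OF assms(2)] linear_maps_smult[OF assms(2)] in
         \<open>auto simp: P.smult_l_distr P.smult_r_distr P.smult_assoc1[symmetric] L.m_comm\<close>)
qed

text \<open>One half of the adjunction between extension and restriction of scalars. In this form it
  serves the comultiplication of the base change, the coaction on a fibre, and the maps out of a
  fibre and out of the two-sphere over \<open>K\<close>.\<close>

lemma base_change_extend:
  assumes P: "module L P" and f: "f \<in> linear_maps K M (restrict_scalars \<phi> P)"
  shows base_change_extend_linear:
      "lin_lift K (restrict_scalars \<phi> P) (\<lambda>(m, x). x \<odot>\<^bsub>P\<^esub> f m) \<in> linear_maps L LM P"
    and base_change_extend_pure: "m \<in> carrier M \<Longrightarrow> x \<in> carrier L \<Longrightarrow>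
      lin_lift K (restrict_scalars \<phi> P) (\<lambda>(m, x). x \<odot>\<^bsub>P\<^esub> f m) (m \<diamondop> x) = x \<odot>\<^bsub>P\<^esub> f m"
proof -
  interpret P: module L P by (rule P)
  have f': "\<And>m. m \<in> carrier M \<Longrightarrow> f m \<in> carrier P" using linear_maps_closed[OF f] by simp
  note * = base_change_lift[OF P bilinear_smult_left[OF P f]]
  show "lin_lift K (restrict_scalars \<phi> P) (\<lambda>(m, x). x \<odot>\<^bsub>P\<^esub> f m) \<in> linear_maps L LM P"
    by (rule *(1)) (simp add: P.smult_assoc1 f')
  show "lin_lift K (restrict_scalars \<phi> P) (\<lambda>(m, x). x \<odot>\<^bsub>P\<^esub> f m) (m \<diamondop> x) = x \<odot>\<^bsub>P\<^esub> f m"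
    if "m \<in> carrier M" "x \<in> carrier L"
    by (rule *(2)) (simp_all add: P.smult_assoc1 f' that)
qed

lemma base_change_extend_hom:
  assumes P: "assoc_algebra L P" and f: "f \<in> algebra_homs K M (restrict_scalars \<phi> P)"
  shows "lin_lift K (restrict_scalars \<phi> P) (\<lambda>(m, x). x \<odot>\<^bsub>P\<^esub> f m) \<in> algebra_homs L LM P"
proof (rule algebra_homs_spanningI[OF base_change_assoc_algebra P])
  interpret P: assoc_algebra L P by (rule P)
  note ext = base_change_extend[OF P.module_axioms algebra_homs_linear[OF f]]
  have f': "\<And>m. m \<in> carrier M \<Longrightarrow> f m \<in> carrier P" using algebra_homs_closed[OF f] by simp
  show "lin_lift K (restrict_scalars \<phi> P) (\<lambda>(m, x). x \<odot>\<^bsub>P\<^esub> f m) \<in> linear_maps L LM P" by (rule ext(1))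
  show "spanning L LM ((\<lambda>m. m \<diamondop> \<one>\<^bsub>L\<^esub>) ` carrier M)" by (rule base_change_spanning[OF spanning_carrier])
  show "lin_lift K (restrict_scalars \<phi> P) (\<lambda>(m, x). x \<odot>\<^bsub>P\<^esub> f m) \<one>\<^bsub>LM\<^esub> = \<one>\<^bsub>P\<^esub>"
    using algebra_homs_one[OF f] by (simp add: tensor_algebra_one[OF algs] ext(2))
  fix u v assume "u \<in> (\<lambda>m. m \<diamondop> \<one>\<^bsub>L\<^esub>) ` carrier M" "v \<in> (\<lambda>m. m \<diamondop> \<one>\<^bsub>L\<^esub>) ` carrier M"
  thus "lin_lift K (restrict_scalars \<phi> P) (\<lambda>(m, x). x \<odot>\<^bsub>P\<^esub> f m) (u \<otimes>\<^bsub>LM\<^esub> v) =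
    lin_lift K (restrict_scalars \<phi> P) (\<lambda>(m, x). x \<odot>\<^bsub>P\<^esub> f m) u \<otimes>\<^bsub>P\<^esub>
    lin_lift K (restrict_scalars \<phi> P) (\<lambda>(m, x). x \<odot>\<^bsub>P\<^esub> f m) v"
    using algebra_homs_mult[OF f] by (auto simp: base_change_mult_pure ext(2) f')
qed

end

section \<open>The Hopf algebra of Laurent polynomials\<close>

abbreviation int_monoid :: "int monoid" where
  "int_monoid \<equiv> \<lparr>carrier = UNIV, mult = (+), one = 0\<rparr>"

lemma int_monoid: "monoid int_monoid"
  by (rule monoidI) auto

lemma hopf_simps [simp]:
  "comult (module.extend A (hopf.fields d e s)) = d"
  "counit (module.extend A (hopf.fields d e s)) = e"
  "antipode (module.extend A (hopf.fields d e s)) = s"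
  by (simp_all add: module.defs hopf.defs)

text \<open>The \<open>T n\<close> span, and the coordinate map \<open>C\<close> makes them
  independent, so they form a basis of group-like elements. The structure maps are assumed linear;
  that comultiplication and counit are multiplicative is derived from \<open>T_add\<close>.\<close>

locale laurent_hopf = H: assoc_algebra K H for K :: "'k ring" and H :: "('k, 'h) hopf" +
  fixes T :: "int \<Rightarrow> 'h" and C :: "'h \<Rightarrow> int \<Rightarrow> 'k"
  assumes T_closed [simp]: "T n \<in> carrier H"
    and T_zero: "T 0 = \<one>\<^bsub>H\<^esub>"
    and T_add: "T m \<otimes>\<^bsub>H\<^esub> T n = T (m + n)"
    and T_spanning: "spanning K H (range T)"
    and comult_linear: "comult H \<in> linear_maps K H (tensor_algebra K H H)"
    and comult_T: "comult H (T n) = pure_tensor K H H (T n) (T n)"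
    and counit_linear: "counit H \<in> linear_maps K H (ring_as_algebra K (\<lambda>k. k))"
    and counit_T: "counit H (T n) = \<one>\<^bsub>K\<^esub>"
    and antipode_linear: "antipode H \<in> linear_maps K H H"
    and antipode_T: "antipode H (T n) = T (- n)"
    and coord_linear: "C \<in> linear_maps K H (monoid_algebra K int_monoid)"
    and coord_T: "C (T n) = basis_elem K n"
begin

lemma H: "assoc_algebra K H" by (rule H.assoc_algebra_axioms)

lemma HH: "assoc_algebra K (tensor_algebra K H H)" by (rule tensor_algebra_assoc_algebra[OF H H])

lemma ground_algebra: "assoc_algebra K (ring_as_algebra K (\<lambda>k. k))"
  by (rule scalar_extension.ring_as_algebra_assoc_algebra[OF scalar_extension_id[OF H.is_cring]])

lemma H_eqI:
  assumes "f \<in> linear_maps K H P" "g \<in> linear_maps K H P" "module K P" "\<And>n. f (T n) = g (T n)" "h \<in> carrier H"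
  shows "f h = g h"
  by (rule linear_maps_eqI[OF H.module_axioms assms(3) T_spanning assms(1,2) _ assms(5)]) (auto simp: assms(4))

lemma hopf: "hopf_algebra K H"
proof (intro hopf_algebra.intro hopf_algebra_axioms.intro H antipode_linear)
  interpret HH: assoc_algebra K "tensor_algebra K H H" by (rule HH)
  interpret G: assoc_algebra K "ring_as_algebra K (\<lambda>k. k)" by (rule ground_algebra)
  show "comult H \<in> algebra_homs K H (tensor_algebra K H H)"
    by (rule algebra_homs_spanningI[OF H HH comult_linear T_spanning])
       (auto simp: T_add comult_T pure_tensor_mult[OF H H] tensor_algebra_one[OF H H] T_zero[symmetric])
  show "counit H \<in> algebra_homs K H (ring_as_algebra K (\<lambda>k. k))"
    by (rule algebra_homs_spanningI[OF H ground_algebra counit_linear T_spanning])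
       (auto simp: T_add counit_T T_zero[symmetric])
  fix h assume h: "h \<in> carrier H"
  note idl = linear_maps_id[of K H]
  show "tensor_assoc K H H H (tensor_map K (tensor_algebra K H H) H (comult H) (\<lambda>x. x) (comult H h)) =
      tensor_map K H (tensor_algebra K H H) (\<lambda>x. x) (comult H) (comult H h)"
    by (rule H_eqI[OF linear_maps_compose[OF comult_linear linear_maps_compose[OF
            tensor_map_linear[OF HH H H H comult_linear idl] tensor_assoc_linear[OF H H H]]]
          linear_maps_compose[OF comult_linear tensor_map_linear[OF H HH H H idl comult_linear]]
          tensor_algebra_module[OF H HH] _ h])
       (simp add: comult_T tensor_map_pure[OF HH H H H comult_linear idl] tensor_map_pure[OF H HH H H idl comult_linear]
         tensor_assoc_pure[OF H H H])
  note bl = bilinear_smult[OF H.module_axioms counit_linear idl]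
  show "lin_lift K H (\<lambda>(x, y). counit H x \<odot>\<^bsub>H\<^esub> y) (comult H h) = h"
    by (rule H_eqI[OF linear_maps_compose[OF comult_linear tensor_lift_linear[OF H H H.module_axioms bl]] idl
          H.module_axioms _ h])
       (simp add: comult_T tensor_lift_pure[OF H H H.module_axioms bl] counit_T)
  note br = bilinear_flip[OF bl]
  show "lin_lift K H (\<lambda>(x, y). counit H y \<odot>\<^bsub>H\<^esub> x) (comult H h) = h"
    by (rule H_eqI[OF linear_maps_compose[OF comult_linear tensor_lift_linear[OF H H H.module_axioms br]] idl
          H.module_axioms _ h])
       (simp add: comult_T tensor_lift_pure[OF H H H.module_axioms br] counit_T)
  have bm: "bilinear K H H H (\<lambda>x y. x \<otimes>\<^bsub>H\<^esub> y)"
    by (rule bilinearI) (simp_all add: H.mult_left_linear H.mult_right_linear)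
  have e: "(\<lambda>h. counit H h \<odot>\<^bsub>H\<^esub> \<one>\<^bsub>H\<^esub>) \<in> linear_maps K H H"
    using bilinear_smult[OF H.module_axioms counit_linear idl] by (simp add: bilinear_def)
  note bsl = bilinear_compose2[OF bm antipode_linear idl]
  show "lin_lift K H (\<lambda>(x, y). antipode H x \<otimes>\<^bsub>H\<^esub> y) (comult H h) = counit H h \<odot>\<^bsub>H\<^esub> \<one>\<^bsub>H\<^esub>"
    by (rule H_eqI[OF linear_maps_compose[OF comult_linear tensor_lift_linear[OF H H H.module_axioms bsl]] e
          H.module_axioms _ h])
       (simp add: comult_T tensor_lift_pure[OF H H H.module_axioms bsl] counit_T antipode_T T_add T_zero)
  note bsr = bilinear_compose2[OF bm idl antipode_linear]
  show "lin_lift K H (\<lambda>(x, y). x \<otimes>\<^bsub>H\<^esub> antipode H y) (comult H h) = counit H h \<odot>\<^bsub>H\<^esub> \<one>\<^bsub>H\<^esub>"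
    by (rule H_eqI[OF linear_maps_compose[OF comult_linear tensor_lift_linear[OF H H H.module_axioms bsr]] e
          H.module_axioms _ h])
       (simp add: comult_T tensor_lift_pure[OF H H H.module_axioms bsr] counit_T antipode_T T_add T_zero)
qed

text \<open>Negating an exponent twice restores it. So the antipode is bijective and its own
  inverse, which makes \<open>antipode_inv\<close> and with it \<open>left_coact\<close>
  computable.\<close>

lemma antipode_involutive: "h \<in> carrier H \<Longrightarrow> antipode H (antipode H h) = h"
  by (rule H_eqI[OF linear_maps_compose[OF antipode_linear antipode_linear] linear_maps_id H.module_axioms])
     (simp_all add: antipode_T)

lemma antipode_bij: "bij_betw (antipode H) (carrier H) (carrier H)"
  by (rule bij_betw_byWitness[where f' = "antipode H"])
     (auto simp: antipode_involutive linear_maps_closed[OF antipode_linear])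

lemma antipode_inv_eq: "h \<in> carrier H \<Longrightarrow> antipode_inv H h = antipode H h"
  unfolding antipode_inv_def
  by (rule inv_into_f_eq)
     (use antipode_bij in \<open>auto simp: bij_betw_def antipode_involutive linear_maps_closed[OF antipode_linear]\<close>)

lemma antipode_inv_linear: "antipode_inv H \<in> linear_maps K H H"
  by (rule linear_maps_cong[OF antipode_linear H.module_axioms antipode_inv_eq])

end

section \<open>Base change of the Laurent Hopf algebra\<close>

locale laurent_base_change = base_change_algebra K L \<phi> H + laurent_hopf K H T C
  for K :: "'k ring" and L :: "'l ring" and \<phi> and H :: "('k, 'h) hopf" and T and C
begin

notation tensor (infixl \<open>\<diamondop>\<close> 75)

abbreviation HL where "HL \<equiv> hopf_base_change K L \<phi> H"
abbreviation TL where "TL n \<equiv> T n \<diamondop> \<one>\<^bsub>L\<^esub>"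
abbreviation P where "P \<equiv> tensor_algebra L LM LM"

lemma HL: "HL = module.extend LM (hopf.fields (comult HL) (counit HL) (antipode HL))"
  by (simp add: hopf_base_change_def Let_def module.defs hopf.defs)

definition CL where
  "CL = lin_lift K (restrict_scalars \<phi> (monoid_algebra L int_monoid))
     (\<lambda>(h, x). x \<odot>\<^bsub>monoid_algebra L int_monoid\<^esub> (\<lambda>n. \<phi> (C h n)))"

lemma laurent: "laurent_hopf L HL TL CL"
proof -
  note [simp del] = base_change_simps(6)
  note A = LM.assoc_algebra_axioms
  have PM: "module L P" by (rule tensor_algebra_module[OF A A])
  have comult: "comult HL = lin_lift K (restrict_scalars \<phi> P) (\<lambda>(h, l). l \<odot>\<^bsub>P\<^esub>
      lin_lift K (restrict_scalars \<phi> P) (\<lambda>(h1, h2). pure_tensor L LM LM (h1 \<diamondop> \<one>\<^bsub>L\<^esub>) (h2 \<diamondop> \<one>\<^bsub>L\<^esub>)) (comult H h))"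
    by (simp add: hopf_base_change_def Let_def module.defs hopf.defs)
  have counit: "counit HL = lin_lift K L\<phi> (\<lambda>(h, l). \<phi> (counit H h) \<otimes>\<^bsub>L\<^esub> l)"
    and antipode: "antipode HL = tensor_map K H L\<phi> (antipode H) (\<lambda>l. l)"
    by (simp_all add: hopf_base_change_def Let_def module.defs hopf.defs)
  have b1: "bilinear K H H (restrict_scalars \<phi> P) (\<lambda>h1 h2. pure_tensor L LM LM (h1 \<diamondop> \<one>\<^bsub>L\<^esub>) (h2 \<diamondop> \<one>\<^bsub>L\<^esub>))"
  proof (rule bilinear_compose2[OF _ base_change_unit_linear base_change_unit_linear])
    show "bilinear K (restrict_scalars \<phi> LM) (restrict_scalars \<phi> LM) (restrict_scalars \<phi> P) (pure_tensor L LM LM)"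
      by (rule bilinearI; rule linear_maps_restrict)
         (use pure_tensor_bilinear[OF A A] in \<open>simp_all add: bilinear_def\<close>)
  qed
  note i1 = tensor_lift[OF H H restrict_scalars_module[OF PM] b1]
  note c1 = linear_maps_compose[OF comult_linear i1(1)]
  note c2 = base_change_extend[OF PM c1]
  note MZ = monoid_algebra_module[OF L.is_cring, of int_monoid]
  have supp: "supp L (\<lambda>n. \<phi> (f n)) \<subseteq> supp K f" for f by (auto simp: supp_def)
  have Cl: "(\<lambda>h n. \<phi> (C h n)) \<in> linear_maps K H (restrict_scalars \<phi> (monoid_algebra L int_monoid))"
  proof (rule linear_mapsI)
    note val = monoid_algebra_value[OF K.is_cring linear_maps_closed[OF coord_linear]]
    fix h assume h: "h \<in> carrier H"
    have "C h \<in> carrier (monoid_algebra K int_monoid)" using linear_maps_closed[OF coord_linear h] .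
    thus "(\<lambda>n. \<phi> (C h n)) \<in> carrier (restrict_scalars \<phi> (monoid_algebra L int_monoid))"
      using finite_subset[OF supp] by (auto simp: monoid_algebra_carrier Pi_iff)
    show "(\<lambda>n. \<phi> (C (h \<oplus>\<^bsub>H\<^esub> h') n)) = (\<lambda>n. \<phi> (C h n)) \<oplus>\<^bsub>restrict_scalars \<phi> (monoid_algebra L int_monoid)\<^esub> (\<lambda>n. \<phi> (C h' n))"
      if "h' \<in> carrier H" for h'
      using h that val by (simp add: linear_maps_add[OF coord_linear] monoid_algebra_simps)
    show "(\<lambda>n. \<phi> (C (k \<odot>\<^bsub>H\<^esub> h) n)) = k \<odot>\<^bsub>restrict_scalars \<phi> (monoid_algebra L int_monoid)\<^esub> (\<lambda>n. \<phi> (C h n))"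
      if "k \<in> carrier K" for k
      using h that val by (simp add: linear_maps_smult[OF coord_linear] monoid_algebra_simps)
  qed
  note CL = base_change_extend[OF MZ Cl]
  note Lalg = scalar_extension.ring_as_algebra_assoc_algebra[OF scalar_extension_id[OF L.is_cring]]
  have eps: "counit H \<in> linear_maps K H (ring_as_algebra K (\<lambda>k. k))" by (rule counit_linear)
  have ebil: "bilinear K H L\<phi> (restrict_scalars \<phi> (ring_as_algebra L (\<lambda>l. l))) (\<lambda>h l. \<phi> (counit H h) \<otimes>\<^bsub>L\<^esub> l)"
    using linear_maps_closed[OF eps] linear_maps_add[OF eps] linear_maps_smult[OF eps]
    by (intro bilinearI linear_mapsI) (auto simp: L.l_distr L.r_distr L.m_ac)
  \<comment> \<open>The counit is lifted into \<open>L\<close> as a \<open>K\<close>-algebra,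
    whereas the extension lemma expects \<open>L\<close> over itself with scalars restricted. The
    sums and scalars agree, so the two lifts are the same function.\<close>
  have eL: "lin_lift K (restrict_scalars \<phi> (ring_as_algebra L (\<lambda>l. l))) = lin_lift K L\<phi>"
    by (intro ext) (simp add: lin_lift_def finsum_def finprod_def Let_def)
  note e = base_change_lift[OF assoc_algebra_module[OF Lalg] ebil]
  have 1: "comult HL \<in> linear_maps L LM P" unfolding comult by (rule c2(1))
  have 2: "comult HL (TL n) = pure_tensor L LM LM (TL n) (TL n)" for n
  proof -
    interpret P: module L P by (rule PM)
    show ?thesis unfolding comult
      by (simp add: c2(2) comult_T i1(2) pure_tensor_closed[OF A A])
  qed
  have 3: "counit HL \<in> linear_maps L LM (ring_as_algebra L (\<lambda>k. k))"
    unfolding counit eL[symmetric] by (rule e(1)) (simp add: L.m_lcomm linear_maps_closed[OF eps, simplified])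
  have 4: "counit HL (TL n) = \<one>\<^bsub>L\<^esub>" for n
    unfolding counit eL[symmetric]
    by (subst e(2)) (simp_all add: L.m_lcomm linear_maps_closed[OF eps, simplified] counit_T)
  note S = tensor_map[OF algs algs antipode_linear linear_maps_id]
  have 5: "antipode HL \<in> linear_maps L LM LM"
  proof (rule linear_mapsI)
    fix u assume "u \<in> carrier LM"
    hence u: "u \<in> carrier LM0" by simp
    show "antipode HL u \<in> carrier LM" using linear_maps_closed[OF S(1) u] by (simp add: antipode)
    show "antipode HL (u \<oplus>\<^bsub>LM\<^esub> v) = antipode HL u \<oplus>\<^bsub>LM\<^esub> antipode HL v" if "v \<in> carrier LM" for v
      using linear_maps_add[OF S(1) u, of v] that by (simp add: antipode)
    show "antipode HL (l \<odot>\<^bsub>LM\<^esub> u) = l \<odot>\<^bsub>LM\<^esub> antipode HL u" if l: "l \<in> carrier L" for l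
      unfolding antipode
      by (rule LM0_eqI[OF linear_maps_compose[OF base_change_smult_linear[OF l] S(1)]
            linear_maps_compose[OF S(1) base_change_smult_linear[OF l]] LM0.module_axioms u])
         (use l S(2) linear_maps_closed[OF antipode_linear] in \<open>auto simp: base_change_smult_pure\<close>)
  qed
  have 6: "antipode HL (TL n) = TL (- n)" for n
    using S(2)[of "T n" "\<one>\<^bsub>L\<^esub>"] by (simp add: antipode antipode_T)
  have 7: "CL \<in> linear_maps L LM (monoid_algebra L int_monoid)" unfolding CL_def by (rule CL(1))
  have 8: "CL (TL n) = basis_elem L n" for n
  proof -
    have "CL (TL n) = \<one>\<^bsub>L\<^esub> \<odot>\<^bsub>monoid_algebra L int_monoid\<^esub> (\<lambda>m. \<phi> (C (T n) m))"
      unfolding CL_def by (rule CL(2)) simp_all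
    thus ?thesis by (auto simp: coord_T basis_elem_def monoid_algebra_simps)
  qed
  note ex = tensor_algebra_extend module_extend_simps linear_maps_extend spanning_extend assoc_algebra_extend
  \<comment> \<open>\<open>HL\<close> occurs on both sides of its record equation. With its Hopf
    fields hidden in an opaque \<open>X\<close>, the equation is a terminating rewrite rule that
    reduces everything to \<open>LM\<close>.\<close>
  obtain X where X: "HL = module.extend LM X" using HL by blast
  have car: "carrier HL = carrier LM0" "one HL = one LM0" "mult HL = mult LM0" by (simp_all add: X)
  have lin: "linear_maps L HL = linear_maps L LM" "\<And>X. linear_maps L X HL = linear_maps L X LM"
    unfolding X by (simp_all add: fun_eq_iff)
  have ten: "tensor_algebra L HL HL = P" "pure_tensor L HL HL = pure_tensor L LM LM"
    by (simp_all only: X ex)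
  have sp: "spanning L HL = spanning L LM" by (simp add: X fun_eq_iff)
  have al: "assoc_algebra L HL" by (simp only: X ex A)
  show ?thesis
  proof (intro laurent_hopf.intro laurent_hopf_axioms.intro al)
    show "TL n \<in> carrier HL" for n by (simp add: car)
    show "TL 0 = \<one>\<^bsub>HL\<^esub>" by (simp add: car T_zero tensor_algebra_one[OF algs])
    show "TL m \<otimes>\<^bsub>HL\<^esub> TL n = TL (m + n)" for m n by (simp add: car base_change_mult_pure T_add)
    show "spanning L HL (range TL)" using base_change_spanning[OF T_spanning] by (simp add: sp image_image)
    show "comult HL \<in> linear_maps L HL (tensor_algebra L HL HL)" using 1 by (simp only: lin ten)
    show "comult HL (TL n) = pure_tensor L HL HL (TL n) (TL n)" for n using 2 by (simp only: ten)
    show "counit HL \<in> linear_maps L HL (ring_as_algebra L (\<lambda>k. k))" using 3 by (simp only: lin)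
    show "antipode HL \<in> linear_maps L HL HL" using 5 by (simp only: lin)
    show "CL \<in> linear_maps L HL (monoid_algebra L int_monoid)" using 7 by (simp only: lin)
  qed (rule 4 6 8)+
qed

end



section \<open>Graded comodule algebras\<close>

text \<open>\<open>G n\<close> is merely a set that generates the degree \<open>n\<close> part, such
  as the words of degree \<open>n\<close>. That the sum is direct is not part of the data: the
  coaction already tells the degrees apart.\<close>

locale graded_comodule_algebra = laurent_hopf K H T C + A: assoc_algebra K A
  for K :: "'k ring" and H :: "('k, 'h) hopf" and T and C and A :: "('k, 'a, 'h) comodule_algebra" +
  fixes G :: "int \<Rightarrow> 'a set"
  assumes G_spanning: "spanning K A (\<Union>n. G n)"
    and G_one: "\<one>\<^bsub>A\<^esub> \<in> G 0"
    and G_mult: "x \<in> G m \<Longrightarrow> y \<in> G n \<Longrightarrow> x \<otimes>\<^bsub>A\<^esub> y \<in> G (m + n)"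
    and coact_linear: "coact A \<in> linear_maps K A (tensor_algebra K A H)"
    and coact_G: "x \<in> G n \<Longrightarrow> coact A x = pure_tensor K A H x (T n)"
begin

lemma A: "assoc_algebra K A" by (rule A.assoc_algebra_axioms)

lemma G_closed: "x \<in> G n \<Longrightarrow> x \<in> carrier A"
  using G_spanning by (auto simp: spanning_def)

lemma A_eqI:
  assumes "f \<in> linear_maps K A P" "g \<in> linear_maps K A P" "module K P"
    "\<And>x n. x \<in> G n \<Longrightarrow> f x = g x" "a \<in> carrier A"
  shows "f a = g a"
  by (rule linear_maps_eqI[OF A.module_axioms assms(3) G_spanning assms(1,2) _ assms(5)]) (auto simp: assms(4))

lemma AH: "assoc_algebra K (tensor_algebra K A H)" by (rule tensor_algebra_assoc_algebra[OF A H])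
lemma HA: "assoc_algebra K (tensor_algebra K H A)" by (rule tensor_algebra_assoc_algebra[OF H A])
lemma AA: "assoc_algebra K (tensor_algebra K A A)" by (rule tensor_algebra_assoc_algebra[OF A A])

lemma comodule_algebra: "right_comodule_algebra K H A"
proof (intro right_comodule_algebra.intro right_comodule_algebra_axioms.intro hopf A)
  note idl = linear_maps_id
  show "coact A \<in> algebra_homs K A (tensor_algebra K A H)"
  proof (rule algebra_homs_spanningI[OF A AH coact_linear G_spanning])
    show "coact A \<one>\<^bsub>A\<^esub> = \<one>\<^bsub>tensor_algebra K A H\<^esub>"
      by (simp add: coact_G[OF G_one] T_zero tensor_algebra_one[OF A H])
    fix x y assume "x \<in> (\<Union>n. G n)" "y \<in> (\<Union>n. G n)"
    then obtain m n where "x \<in> G m" "y \<in> G n" by blast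
    thus "coact A (x \<otimes>\<^bsub>A\<^esub> y) = coact A x \<otimes>\<^bsub>tensor_algebra K A H\<^esub> coact A y"
      by (simp add: coact_G[OF G_mult] coact_G pure_tensor_mult[OF A H] G_closed T_add)
  qed
  fix a assume a: "a \<in> carrier A"
  show "tensor_assoc K A H H (tensor_map K (tensor_algebra K A H) H (coact A) (\<lambda>x. x) (coact A a)) =
      tensor_map K A (tensor_algebra K H H) (\<lambda>x. x) (comult H) (coact A a)"
    by (rule A_eqI[OF linear_maps_compose[OF coact_linear linear_maps_compose[OF
            tensor_map_linear[OF AH H A H coact_linear idl] tensor_assoc_linear[OF A H H]]]
          linear_maps_compose[OF coact_linear tensor_map_linear[OF A HH A H idl comult_linear]]
          tensor_algebra_module[OF A HH] _ a])
       (simp add: coact_G comult_T tensor_map_pure[OF AH H A H coact_linear idl] G_closed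
         tensor_map_pure[OF A HH A H idl comult_linear] tensor_assoc_pure[OF A H H])
  note b = bilinear_flip[OF bilinear_smult[OF A.module_axioms counit_linear idl]]
  show "lin_lift K A (\<lambda>(x, h). counit H h \<odot>\<^bsub>A\<^esub> x) (coact A a) = a"
    by (rule A_eqI[OF linear_maps_compose[OF coact_linear tensor_lift_linear[OF A H A.module_axioms b]] idl
          A.module_axioms _ a])
       (simp add: coact_G tensor_lift_pure[OF A H A.module_axioms b] counit_T G_closed)
qed

text \<open>Reading off the coordinate of \<open>T 0\<close> after the coaction, i.e.
  \<open>p (coact A a)\<close>, projects onto degree 0: it lands in the span of \<open>G 0\<close>
  and fixes coinvariant elements. The converse holds on \<open>G 0\<close>, and both sides of the
  equation are linear.\<close>

lemma coinvariant_iff: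
  assumes "a \<in> carrier A"
  shows "coact A a = pure_tensor K A H a \<one>\<^bsub>H\<^esub> \<longleftrightarrow> a \<in> submodule_generated K A (G 0)"
proof
  have sub: "submodule (submodule_generated K A (G 0)) K A"
    by (rule submodule_generated_submodule[OF A.module_axioms]) (auto intro: G_closed)
  have "(\<lambda>f. f 0) \<in> linear_maps K (monoid_algebra K int_monoid) (ring_as_algebra K (\<lambda>k. k))"
    by (rule linear_mapsI) (auto simp: monoid_algebra_simps intro: monoid_algebra_value[OF H.is_cring])
  from linear_maps_compose[OF coord_linear this]
  have c: "(\<lambda>h. C h 0) \<in> linear_maps K H (ring_as_algebra K (\<lambda>k. k))" .
  note b = bilinear_flip[OF bilinear_smult[OF A.module_axioms c linear_maps_id]]
  define p where "p = lin_lift K A (\<lambda>(x, h). C h 0 \<odot>\<^bsub>A\<^esub> x)"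
  note p = tensor_lift[OF A H A.module_axioms b, folded p_def]
  have cT: "C (T n) 0 = (if n = 0 then \<one>\<^bsub>K\<^esub> else \<zero>\<^bsub>K\<^esub>)" for n by (auto simp: coord_T basis_elem_def)
  note pc = linear_maps_compose[OF coact_linear p(1)]
  have "p (coact A a) \<in> submodule_generated K A (G 0)"
    using A.module_axioms G_spanning assms
  proof (induction rule: spanning_induct)
    case (base x)
    then obtain n where x: "x \<in> G n" by blast
    show ?case
      using x G_closed[OF x] submodule_generated_subset[of "G 0" K A] submodule_zero[OF A.module_axioms sub]
      by (cases "n = 0") (auto simp: coact_G[OF x] p(2) cT)
  qed (simp_all add: linear_maps_zero[OF A.module_axioms A.module_axioms pc] linear_maps_add[OF pc]
      linear_maps_smult[OF pc] submodule_zero[OF A.module_axioms sub] submodule_add[OF A.module_axioms sub]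
      submodule_smult[OF A.module_axioms sub])
  moreover assume "coact A a = pure_tensor K A H a \<one>\<^bsub>H\<^esub>"
  ultimately show "a \<in> submodule_generated K A (G 0)"
    using assms p(2)[of a "T 0"] cT[of 0] by (simp add: T_zero[symmetric])
next
  note ll = pure_tensor_linear_left[OF A H T_closed[of 0]]
  have "submodule {x \<in> carrier A. coact A x = pure_tensor K A H x (T 0)} K A"
    by (rule submodule_sep[OF A.module_axioms])
       (simp_all add: linear_maps_zero[OF A.module_axioms tensor_algebra_module[OF A H]]
         coact_linear ll linear_maps_add[OF coact_linear] linear_maps_add[OF ll]
         linear_maps_smult[OF coact_linear] linear_maps_smult[OF ll]
         linear_maps_zero[OF A.module_axioms tensor_algebra_module[OF A H] ll]
         linear_maps_zero[OF A.module_axioms tensor_algebra_module[OF A H] coact_linear])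
  moreover have "G 0 \<subseteq> {x \<in> carrier A. coact A x = pure_tensor K A H x (T 0)}"
    by (auto simp: coact_G G_closed)
  moreover assume "a \<in> submodule_generated K A (G 0)"
  ultimately show "coact A a = pure_tensor K A H a \<one>\<^bsub>H\<^esub>"
    using submodule_generated_minimal unfolding T_zero[symmetric] by blast
qed

end

text \<open>The degree \<open>n\<close> component of a strong connection is an element of \<open>A\<^sub>-\<^sub>n \<otimes> A\<^sub>n\<close> mapped to \<open>\<one>\<close> by the
  product. Such elements are obtained for all \<open>n\<close> from \<open>n = \<plusminus>1\<close> by nesting.\<close>

locale strongly_graded_comodule_algebra = graded_comodule_algebra +
  fixes x1 x2 y1 y2
  assumes xy_degree: "x1 \<in> G (- 1)" "x2 \<in> G (- 1)" "y1 \<in> G 1" "y2 \<in> G 1"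
    and xy: "x1 \<otimes>\<^bsub>A\<^esub> y1 \<oplus>\<^bsub>A\<^esub> x2 \<otimes>\<^bsub>A\<^esub> y2 = \<one>\<^bsub>A\<^esub>"
    and yx: "y1 \<otimes>\<^bsub>A\<^esub> x1 \<oplus>\<^bsub>A\<^esub> y2 \<otimes>\<^bsub>A\<^esub> x2 = \<one>\<^bsub>A\<^esub>"
begin

definition conn_space where
  "conn_space n = submodule_generated K (tensor_algebra K A A)
     {pure_tensor K A A a b |a b. a \<in> G (- n) \<and> b \<in> G n}"

definition nest where "nest x y = tensor_map K A A (\<lambda>a. a \<otimes>\<^bsub>A\<^esub> x) (\<lambda>b. y \<otimes>\<^bsub>A\<^esub> b)"

lemma conn_space_submodule: "submodule (conn_space n) K (tensor_algebra K A A)"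
  unfolding conn_space_def
  by (rule submodule_generated_submodule[OF tensor_algebra_module[OF A A]])
     (auto intro!: pure_tensor_closed[OF A A] G_closed)

lemma conn_space_induct:
  assumes "u \<in> conn_space n" "submodule {u \<in> carrier (tensor_algebra K A A). Q u} K (tensor_algebra K A A)"
    "\<And>a b. a \<in> G (- n) \<Longrightarrow> b \<in> G n \<Longrightarrow> Q (pure_tensor K A A a b)"
  shows "Q u"
proof -
  have "conn_space n \<subseteq> {u \<in> carrier (tensor_algebra K A A). Q u}"
    unfolding conn_space_def
    by (rule submodule_generated_minimal[OF assms(2)])
       (auto intro!: pure_tensor_closed[OF A A] G_closed assms(3))
  thus ?thesis using assms(1) by blast
qed

lemma equalizer_submodule:
  assumes "module K M" "module K N" "f \<in> linear_maps K M N" "g \<in> linear_maps K M N"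
  shows "submodule {u \<in> carrier M. f u = g u} K M"
  by (rule submodule_sep[OF assms(1)])
     (simp_all add: linear_maps_zero[OF assms(1,2) assms(3)] linear_maps_zero[OF assms(1,2) assms(4)]
       linear_maps_add[OF assms(3)] linear_maps_add[OF assms(4)]
       linear_maps_smult[OF assms(3)] linear_maps_smult[OF assms(4)])

lemma conn_space_carrier: "u \<in> conn_space n \<Longrightarrow> u \<in> carrier (tensor_algebra K A A)"
  by (rule submodule_carrier[OF tensor_algebra_module[OF A A] conn_space_submodule])

lemma nest:
  assumes "x \<in> carrier A" "y \<in> carrier A"
  shows nest_linear: "nest x y \<in> linear_maps K (tensor_algebra K A A) (tensor_algebra K A A)"
    and nest_pure: "a \<in> carrier A \<Longrightarrow> b \<in> carrier A \<Longrightarrow>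
      nest x y (pure_tensor K A A a b) = pure_tensor K A A (a \<otimes>\<^bsub>A\<^esub> x) (y \<otimes>\<^bsub>A\<^esub> b)"
  using tensor_map[OF A A A A A.mult_right_linear[OF assms(1)] A.mult_left_linear[OF assms(2)]]
  by (simp_all add: nest_def)

lemma nest_conn_space:
  assumes "x \<in> G (- d)" "y \<in> G d" "u \<in> conn_space n"
  shows "nest x y u \<in> conn_space (n + d)"
proof (rule conn_space_induct[OF assms(3)])
  note N = nest[OF assms(1,2)[THEN G_closed]]
  note AAm = tensor_algebra_module[OF A A]
  show "submodule {u \<in> carrier (tensor_algebra K A A). nest x y u \<in> conn_space (n + d)} K (tensor_algebra K A A)"
    by (rule submodule_sep[OF AAm])
       (simp_all add: linear_maps_zero[OF AAm AAm N(1)] linear_maps_add[OF N(1)] linear_maps_smult[OF N(1)]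
          submodule_zero[OF AAm conn_space_submodule] submodule_add[OF AAm conn_space_submodule]
          submodule_smult[OF AAm conn_space_submodule])
  fix a b assume "a \<in> G (- n)" "b \<in> G n"
  hence "a \<otimes>\<^bsub>A\<^esub> x \<in> G (- (n + d))" "y \<otimes>\<^bsub>A\<^esub> b \<in> G (n + d)"
    using G_mult[of a "- n" x "- d"] G_mult[of y d b n] assms by (simp_all add: add.commute)
  moreover have "nest x y (pure_tensor K A A a b) = pure_tensor K A A (a \<otimes>\<^bsub>A\<^esub> x) (y \<otimes>\<^bsub>A\<^esub> b)"
    using \<open>a \<in> G (- n)\<close> \<open>b \<in> G n\<close> by (simp add: N(2) G_closed)
  ultimately show "nest x y (pure_tensor K A A a b) \<in> conn_space (n + d)"
    unfolding conn_space_def using submodule_generated_subset by fastforce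
qed

text \<open>\<open>nest\<close> inserts its factors on the inner sides of the tensor sign, so they
  become neighbours under multiplication, and the sum a (x y + x' y') b collapses to a b.\<close>

lemma mult_nest_sum:
  assumes "x \<in> carrier A" "y \<in> carrier A" "x' \<in> carrier A" "y' \<in> carrier A"
    "x \<otimes>\<^bsub>A\<^esub> y \<oplus>\<^bsub>A\<^esub> x' \<otimes>\<^bsub>A\<^esub> y' = \<one>\<^bsub>A\<^esub>" "u \<in> carrier (tensor_algebra K A A)"
  shows "mult_map K A (nest x y u \<oplus>\<^bsub>tensor_algebra K A A\<^esub> nest x' y' u) = mult_map K A u"
proof (rule linear_maps_eqI[OF tensor_algebra_module[OF A A] A.module_axioms
      tensor_algebra_spanning[OF A A spanning_carrier spanning_carrier] _ mult_map_linear[OF A] _ assms(6)])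
  note N = nest[OF assms(1,2)] and N' = nest[OF assms(3,4)]
  show "(\<lambda>u. mult_map K A (nest x y u \<oplus>\<^bsub>tensor_algebra K A A\<^esub> nest x' y' u)) \<in>
    linear_maps K (tensor_algebra K A A) A"
    by (rule linear_maps_compose[OF linear_maps_sum[OF tensor_algebra_module[OF A A] N(1) N'(1)] mult_map_linear[OF A]])
  fix u assume "u \<in> {pure_tensor K A A a b |a b. a \<in> carrier A \<and> b \<in> carrier A}"
  then obtain a b where ab: "a \<in> carrier A" "b \<in> carrier A" "u = pure_tensor K A A a b" by blast
  have "mult_map K A (nest x y u \<oplus>\<^bsub>tensor_algebra K A A\<^esub> nest x' y' u) =
      (a \<otimes>\<^bsub>A\<^esub> x) \<otimes>\<^bsub>A\<^esub> (y \<otimes>\<^bsub>A\<^esub> b) \<oplus>\<^bsub>A\<^esub> (a \<otimes>\<^bsub>A\<^esub> x') \<otimes>\<^bsub>A\<^esub> (y' \<otimes>\<^bsub>A\<^esub> b)"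
    using ab assms(1-4)
    by (simp add: N(2) N'(2) linear_maps_add[OF mult_map_linear[OF A]] pure_tensor_closed[OF A A] mult_map_pure[OF A])
  also have "\<dots> = a \<otimes>\<^bsub>A\<^esub> ((x \<otimes>\<^bsub>A\<^esub> y \<oplus>\<^bsub>A\<^esub> x' \<otimes>\<^bsub>A\<^esub> y') \<otimes>\<^bsub>A\<^esub> b)"
    using ab(1,2) assms(1-4) by (simp add: A.A.m_assoc A.A.l_distr A.A.r_distr)
  also have "\<dots> = mult_map K A u" using ab assms(5) by (simp add: mult_map_pure[OF A])
  finally show "mult_map K A (nest x y u \<oplus>\<^bsub>tensor_algebra K A A\<^esub> nest x' y' u) = mult_map K A u" .
qed

primrec conn_pos where
  "conn_pos 0 = pure_tensor K A A \<one>\<^bsub>A\<^esub> \<one>\<^bsub>A\<^esub>"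
| "conn_pos (Suc n) = nest x1 y1 (conn_pos n) \<oplus>\<^bsub>tensor_algebra K A A\<^esub> nest x2 y2 (conn_pos n)"

text \<open>The roles of \<open>x1\<close>, \<open>x2\<close> and of \<open>y1\<close>,
  \<open>y2\<close> are exchanged, so the collapse under multiplication rests on \<open>yx\<close>
  instead of \<open>xy\<close>.\<close>

primrec conn_neg where
  "conn_neg 0 = pure_tensor K A A \<one>\<^bsub>A\<^esub> \<one>\<^bsub>A\<^esub>"
| "conn_neg (Suc n) = nest y1 x1 (conn_neg n) \<oplus>\<^bsub>tensor_algebra K A A\<^esub> nest y2 x2 (conn_neg n)"

lemma conn_one: "pure_tensor K A A \<one>\<^bsub>A\<^esub> \<one>\<^bsub>A\<^esub> \<in> conn_space 0"
  using submodule_generated_subset G_one unfolding conn_space_def by fastforce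

lemma conn_pos: "conn_pos n \<in> conn_space (int n) \<and> mult_map K A (conn_pos n) = \<one>\<^bsub>A\<^esub>"
proof (induction n)
  case (Suc n)
  have "nest x1 y1 (conn_pos n) \<in> conn_space (int n + 1)" "nest x2 y2 (conn_pos n) \<in> conn_space (int n + 1)"
    using Suc xy_degree nest_conn_space by blast+
  note submodule_add[OF tensor_algebra_module[OF A A] conn_space_submodule this]
  moreover have "conn_pos n \<in> carrier (tensor_algebra K A A)" using Suc conn_space_carrier by blast
  ultimately show ?case using Suc xy_degree[THEN G_closed] xy by (simp add: mult_nest_sum add.commute)
qed (simp add: conn_one mult_map_pure[OF A])

lemma conn_neg: "conn_neg n \<in> conn_space (- int n) \<and> mult_map K A (conn_neg n) = \<one>\<^bsub>A\<^esub>"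
proof (induction n)
  case (Suc n)
  have e: "- int n + - 1 = - int (Suc n)" by simp
  have "nest y1 x1 (conn_neg n) \<in> conn_space (- int n + - 1)" "nest y2 x2 (conn_neg n) \<in> conn_space (- int n + - 1)"
    using Suc xy_degree nest_conn_space[of _ "- 1"] by simp_all
  note submodule_add[OF tensor_algebra_module[OF A A] conn_space_submodule this, unfolded e]
  moreover have "conn_neg n \<in> carrier (tensor_algebra K A A)" using Suc conn_space_carrier by blast
  ultimately show ?case using Suc xy_degree[THEN G_closed] yx by (simp add: mult_nest_sum del: of_nat_Suc)
qed (simp add: conn_one mult_map_pure[OF A])

definition conn where "conn n = (if n \<ge> 0 then conn_pos (nat n) else conn_neg (nat (- n)))"

lemma conn: "conn n \<in> conn_space n" "mult_map K A (conn n) = \<one>\<^bsub>A\<^esub>"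
  using conn_pos[of "nat n"] conn_neg[of "nat (- n)"] by (auto simp: conn_def)

lemma principal: "principal_comodule_algebra K H A"
proof -
  let ?AA = "tensor_algebra K A A"
  note AAm = tensor_algebra_module[OF A A]
  \<comment> \<open>As the \<open>T n\<close> form a basis with coordinates \<open>C\<close>, a
    linear map may be prescribed freely on them; this one sends \<open>T n\<close> to
    \<open>conn n\<close>.\<close>
  define l where "l h = lin_ext K ?AA conn (C h)" for h
  have fs: "conn \<in> carrier int_monoid \<rightarrow> carrier ?AA" using conn(1) conn_space_carrier by auto
  have l: "l \<in> linear_maps K H ?AA"
    unfolding l_def by (rule linear_maps_compose[OF coord_linear lin_ext_linear[OF AAm fs]])
  have lT: "l (T n) = conn n" for n
    unfolding l_def coord_T using lin_ext_basis[OF AAm fs] by simp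
  note idl = linear_maps_id
  note conn' = conn_space_carrier[OF conn(1)]
  have m: "mult_map K A (l h) = counit H h \<odot>\<^bsub>A\<^esub> \<one>\<^bsub>A\<^esub>" if h: "h \<in> carrier H" for h
  proof (rule H_eqI[OF linear_maps_compose[OF l mult_map_linear[OF A]] _ A.module_axioms _ h])
    show "(\<lambda>h. counit H h \<odot>\<^bsub>A\<^esub> \<one>\<^bsub>A\<^esub>) \<in> linear_maps K H A"
      using bilinear_smult[OF A.module_axioms counit_linear idl] by (simp add: bilinear_def)
  qed (simp add: lT conn counit_T)
  have r: "tensor_map K A (tensor_algebra K A H) (\<lambda>x. x) (coact A) (l h) =
      tensor_assoc K A A H (tensor_map K ?AA H l (\<lambda>x. x) (comult H h))" if h: "h \<in> carrier H" for h
  proof (rule H_eqI[OF linear_maps_compose[OF l tensor_map_linear[OF A AH A A idl coact_linear]]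
        linear_maps_compose[OF comult_linear linear_maps_compose[OF tensor_map_linear[OF AA H H H l idl]
            tensor_assoc_linear[OF A A H]]] tensor_algebra_module[OF A AH] _ h])
    fix n
    \<comment> \<open>The right leg of \<open>conn n\<close> has degree \<open>n\<close>, so
      coacting on it appends \<open>T n\<close>.\<close>
    have "tensor_map K A (tensor_algebra K A H) (\<lambda>x. x) (coact A) (conn n) =
      tensor_assoc K A A H (pure_tensor K ?AA H (conn n) (T n))"
    proof (rule conn_space_induct[OF conn(1)])
      show "submodule {u \<in> carrier ?AA. tensor_map K A (tensor_algebra K A H) (\<lambda>x. x) (coact A) u =
          tensor_assoc K A A H (pure_tensor K ?AA H u (T n))} K ?AA"
        by (rule equalizer_submodule[OF AAm tensor_algebra_module[OF A AH] tensor_map_linear[OF A AH A A idl coact_linear]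
              linear_maps_compose[OF pure_tensor_linear_left[OF AA H T_closed] tensor_assoc_linear[OF A A H]]])
    qed (simp add: tensor_map_pure[OF A AH A A idl coact_linear] G_closed tensor_assoc_pure[OF A A H] coact_G)
    thus "tensor_map K A (tensor_algebra K A H) (\<lambda>x. x) (coact A) (l (T n)) =
      tensor_assoc K A A H (tensor_map K ?AA H l (\<lambda>x. x) (comult H (T n)))"
      by (simp add: lT comult_T tensor_map_pure[OF AA H H H l idl])
  qed
  have lcb: "bilinear K A H (tensor_algebra K H A) (\<lambda>x h. pure_tensor K H A (antipode_inv H h) x)"
    by (rule bilinear_flip[OF bilinear_compose2[OF pure_tensor_bilinear[OF H A] antipode_inv_linear idl]])
  note lc = tensor_lift[OF A H tensor_algebra_module[OF H A] lcb]
  have lcl: "left_coact K H A \<in> linear_maps K A (tensor_algebra K H A)"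
    unfolding left_coact_def by (rule linear_maps_compose[OF coact_linear lc(1)])
  \<comment> \<open>The inverse antipode turns \<open>T n\<close> into \<open>T (- n)\<close>. On
    the left leg of \<open>conn n\<close>, which has degree \<open>- n\<close>, this gives
    \<open>T n\<close>, as left colinearity demands.\<close>
  have lcG: "left_coact K H A x = pure_tensor K H A (T (- n)) x" if "x \<in> G n" for x n
    using that by (simp add: left_coact_def coact_G lc(2) G_closed antipode_inv_eq antipode_T)
  have s: "tensor_assoc K H A A (tensor_map K (tensor_algebra K H A) A (left_coact K H A) (\<lambda>x. x) (l h)) =
      tensor_map K H ?AA (\<lambda>x. x) l (comult H h)" if h: "h \<in> carrier H" for h
  proof (rule H_eqI[OF linear_maps_compose[OF l linear_maps_compose[OF tensor_map_linear[OF HA A A A lcl idl]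
            tensor_assoc_linear[OF H A A]]] linear_maps_compose[OF comult_linear tensor_map_linear[OF H AA H H idl l]]
        tensor_algebra_module[OF H AA] _ h])
    fix n
    have "tensor_assoc K H A A (tensor_map K (tensor_algebra K H A) A (left_coact K H A) (\<lambda>x. x) (conn n)) =
      pure_tensor K H ?AA (T n) (conn n)"
    proof (rule conn_space_induct[OF conn(1)])
      show "submodule {u \<in> carrier ?AA. tensor_assoc K H A A (tensor_map K (tensor_algebra K H A) A
          (left_coact K H A) (\<lambda>x. x) u) = pure_tensor K H ?AA (T n) u} K ?AA"
        by (rule equalizer_submodule[OF AAm tensor_algebra_module[OF H AA] linear_maps_compose[OF
              tensor_map_linear[OF HA A A A lcl idl] tensor_assoc_linear[OF H A A]]
              pure_tensor_linear_right[OF H AA T_closed]])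
      fix a b assume "a \<in> G (- n)" "b \<in> G n"
      thus "tensor_assoc K H A A (tensor_map K (tensor_algebra K H A) A (left_coact K H A) (\<lambda>x. x)
          (pure_tensor K A A a b)) = pure_tensor K H ?AA (T n) (pure_tensor K A A a b)"
        using lcG[of a "- n"] by (simp add: tensor_map_pure[OF HA A A A lcl idl] G_closed tensor_assoc_pure[OF H A A])
    qed
    thus "tensor_assoc K H A A (tensor_map K (tensor_algebra K H A) A (left_coact K H A) (\<lambda>x. x) (l (T n))) =
      tensor_map K H ?AA (\<lambda>x. x) l (comult H (T n))"
      by (simp add: lT comult_T tensor_map_pure[OF H AA H H idl l] conn')
  qed
  have "l \<one>\<^bsub>H\<^esub> = pure_tensor K A A \<one>\<^bsub>A\<^esub> \<one>\<^bsub>A\<^esub>" using lT[of 0] by (simp add: T_zero conn_def)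
  hence "strong_connection K H A l" unfolding strong_connection_def using l m r s by blast
  thus ?thesis unfolding principal_comodule_algebra_def using comodule_algebra antipode_bij by blast
qed

end

section \<open>Algebras given by generators and relations\<close>

abbreviation word_monoid :: "'x list monoid" where
  "word_monoid \<equiv> \<lparr>carrier = UNIV, mult = (@), one = []\<rparr>"

lemma word_monoid: "monoid word_monoid"
  by (rule monoidI) auto

locale star_presentation = K: cring K for K :: "'k ring" +
  fixes cj :: "'k \<Rightarrow> 'k" and rels :: "(('g letter list \<Rightarrow> 'k) \<times> ('g letter list \<Rightarrow> 'k)) set"
  assumes cj_hom: "cj \<in> ring_hom K K"
    and rels_closed: "(u, v) \<in> rels \<Longrightarrow> u \<in> carrier (free_algebra K) \<and> v \<in> carrier (free_algebra K)"
begin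

abbreviation FA where "FA \<equiv> (free_algebra K :: ('k, 'g letter list \<Rightarrow> 'k) module)"
abbreviation SA where "SA \<equiv> star_algebra K cj rels"
abbreviation SI where "SI \<equiv> star_ideal K cj rels"
abbreviation cls where "cls f \<equiv> SI +>\<^bsub>FA\<^esub> f"
abbreviation word where "word w \<equiv> cls (basis_elem K w)"
abbreviation letr where "letr \<equiv> letter_class K cj rels"

lemma cj_simps [simp]:
  "k \<in> carrier K \<Longrightarrow> cj k \<in> carrier K" "cj \<one>\<^bsub>K\<^esub> = \<one>\<^bsub>K\<^esub>" "cj \<zero>\<^bsub>K\<^esub> = \<zero>\<^bsub>K\<^esub>"
  "k \<in> carrier K \<Longrightarrow> k' \<in> carrier K \<Longrightarrow> cj (k \<oplus>\<^bsub>K\<^esub> k') = cj k \<oplus>\<^bsub>K\<^esub> cj k'"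
  "k \<in> carrier K \<Longrightarrow> k' \<in> carrier K \<Longrightarrow> cj (k \<otimes>\<^bsub>K\<^esub> k') = cj k \<otimes>\<^bsub>K\<^esub> cj k'"
  using cj_hom ring_hom_zero[OF cj_hom K.ring_axioms K.ring_axioms]
  by (auto simp: ring_hom_def)

lemma FA: "assoc_algebra K FA"
  unfolding free_algebra_def by (rule monoid_algebra_assoc_algebra[OF K.is_cring word_monoid])

sublocale FA: assoc_algebra K FA by (rule FA)

lemma basis_closed [simp]: "basis_elem K w \<in> carrier FA"
  unfolding free_algebra_def by (rule basis_elem_closed[OF K.is_cring]) simp

lemma basis_mult [simp]: "basis_elem K w \<otimes>\<^bsub>FA\<^esub> basis_elem K w' = basis_elem K (w @ w')"
  unfolding free_algebra_def by (subst basis_elem_mult[OF K.is_cring word_monoid]) simp_all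

lemma FA_one: "\<one>\<^bsub>FA\<^esub> = basis_elem K []"
  by (simp add: free_algebra_def monoid_algebra_simps)

lemma FA_spanning: "spanning K FA (range (basis_elem K))"
  using spanning_basis[OF K.is_cring, of word_monoid] by (simp add: free_algebra_def)

lemma FA_value: "f \<in> carrier FA \<Longrightarrow> f w \<in> carrier K"
  unfolding free_algebra_def by (rule monoid_algebra_value[OF K.is_cring])

lemma adjoint_adjoint [simp]: "adjoint (adjoint x) = x" by (cases x) auto

lemma map_adjoint [simp]: "map adjoint (map adjoint w) = w" by (simp add: map_idI)

lemma free_star_basis [simp]: "free_star cj (basis_elem K w) = basis_elem K (rev (map adjoint w))"
proof -
  have "rev (map adjoint w') = w \<longleftrightarrow> w' = rev (map adjoint w)" for w' by (metis map_adjoint rev_map rev_rev_ident)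
  thus ?thesis by (auto simp: free_star_def basis_elem_def fun_eq_iff)
qed

lemma free_star_one [simp]: "free_star cj \<one>\<^bsub>FA\<^esub> = \<one>\<^bsub>FA\<^esub>"
  by (simp add: FA_one)

lemma free_star_closed:
  assumes "f \<in> carrier FA" shows "free_star cj f \<in> carrier FA"
  unfolding free_algebra_def
proof (rule monoid_algebraI[OF K.is_cring, where S = "(\<lambda>w. rev (map adjoint w)) ` supp K f"])
  show "free_star cj f x \<in> carrier K" for x using FA_value[OF assms] by (simp add: free_star_def)
  show "finite ((\<lambda>w. rev (map adjoint w)) ` supp K f)"
    using assms by (simp add: free_algebra_def monoid_algebra_carrier)
  have "w = rev (map adjoint (rev (map adjoint w)))" for w :: "'g letter list"
    by (metis map_adjoint rev_map rev_rev_ident)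
  note eq = this
  show "supp K (free_star cj f) \<subseteq> (\<lambda>w. rev (map adjoint w)) ` supp K f"
  proof
    fix w assume "w \<in> supp K (free_star cj f)"
    hence "rev (map adjoint w) \<in> supp K f" by (auto simp: supp_def free_star_def)
    thus "w \<in> (\<lambda>w. rev (map adjoint w)) ` supp K f" by (rule rev_image_eqI) (rule eq)
  qed
qed simp

lemma free_star_add:
  "f \<in> carrier FA \<Longrightarrow> g \<in> carrier FA \<Longrightarrow> free_star cj (f \<oplus>\<^bsub>FA\<^esub> g) = free_star cj f \<oplus>\<^bsub>FA\<^esub> free_star cj g"
  using FA_value[of f] FA_value[of g] by (simp add: free_star_def free_algebra_def monoid_algebra_simps)

lemma free_star_smult:
  "k \<in> carrier K \<Longrightarrow> f \<in> carrier FA \<Longrightarrow> free_star cj (k \<odot>\<^bsub>FA\<^esub> f) = cj k \<odot>\<^bsub>FA\<^esub> free_star cj f"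
  using FA_value[of f] by (simp add: free_star_def free_algebra_def monoid_algebra_simps)

lemma free_star_minus:
  assumes "f \<in> carrier FA" "g \<in> carrier FA"
  shows "free_star cj (f \<ominus>\<^bsub>FA\<^esub> g) = free_star cj f \<ominus>\<^bsub>FA\<^esub> free_star cj g"
proof -
  have "cj (\<ominus>\<^bsub>K\<^esub> \<one>\<^bsub>K\<^esub>) \<oplus>\<^bsub>K\<^esub> cj \<one>\<^bsub>K\<^esub> = \<zero>\<^bsub>K\<^esub>" by (subst cj_simps(4)[symmetric]) (auto simp: K.l_neg)
  hence "cj (\<ominus>\<^bsub>K\<^esub> \<one>\<^bsub>K\<^esub>) = \<ominus>\<^bsub>K\<^esub> \<one>\<^bsub>K\<^esub>" using K.minus_equality[of "cj (\<ominus>\<^bsub>K\<^esub> \<one>\<^bsub>K\<^esub>)" "\<one>\<^bsub>K\<^esub>"] by simp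
  thus ?thesis using assms
    by (simp add: a_minus_def FA.minus_eq_smult free_star_add free_star_smult free_star_closed)
qed

definition relators where "relators = {u \<ominus>\<^bsub>FA\<^esub> v |u v. (u, v) \<in> rels}"

lemma SI_def': "SI = Idl\<^bsub>FA\<^esub> (relators \<union> free_star cj ` relators)"
  by (simp add: star_ideal_def relators_def Let_def)

lemma relators_closed: "relators \<union> free_star cj ` relators \<subseteq> carrier FA"
  using rels_closed by (fastforce simp: relators_def intro!: free_star_closed)

lemma SI: "ideal SI FA"
  unfolding SI_def' by (rule FA.A.genideal_ideal[OF relators_closed])

lemma SA: "assoc_algebra K SA"
  unfolding star_algebra_def by (rule quot_algebra_assoc_algebra[OF FA SI])

sublocale SA: assoc_algebra K SA by (rule SA)

lemma cls_hom: "(\<lambda>f. cls f) \<in> algebra_homs K FA SA"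
  unfolding star_algebra_def by (rule quot_algebra_proj[OF FA SI])

lemma word_closed [simp]: "word w \<in> carrier SA"
  by (rule algebra_homs_closed[OF cls_hom basis_closed])

lemma word_mult: "word w \<otimes>\<^bsub>SA\<^esub> word w' = word (w @ w')"
  using algebra_homs_mult[OF cls_hom basis_closed basis_closed, of w w'] by simp

lemma word_Nil: "word [] = \<one>\<^bsub>SA\<^esub>"
  using algebra_homs_one[OF cls_hom] by (simp add: FA_one)

lemma letr_eq: "letr x = word [x]" by (simp add: letter_class_def)

lemma letr_closed [simp]: "letr x \<in> carrier SA" by (simp add: letr_eq)

lemma word_Cons: "word (x # w) = letr x \<otimes>\<^bsub>SA\<^esub> word w"
  by (simp add: letr_eq word_mult)

lemma word_spanning: "spanning K SA (range (\<lambda>w. word w))"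
  using quot_algebra_spanning[OF FA SI FA_spanning] by (simp add: star_algebra_def image_image)

lemma cls_eq_iff: "f \<in> carrier FA \<Longrightarrow> g \<in> carrier FA \<Longrightarrow> cls f = cls g \<longleftrightarrow> f \<ominus>\<^bsub>FA\<^esub> g \<in> SI"
  by (rule quot_algebra_eq_iff[OF FA SI])

lemma rels_hold:
  assumes "(u, v) \<in> rels" shows "cls u = cls v" "cls (free_star cj u) = cls (free_star cj v)"
proof -
  have "relators \<union> free_star cj ` relators \<subseteq> SI"
    unfolding SI_def' by (rule FA.A.genideal_self[OF relators_closed])
  moreover have "u \<ominus>\<^bsub>FA\<^esub> v \<in> relators" using assms by (auto simp: relators_def)
  ultimately have "u \<ominus>\<^bsub>FA\<^esub> v \<in> SI" "free_star cj (u \<ominus>\<^bsub>FA\<^esub> v) \<in> SI" by blast+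
  thus "cls u = cls v" "cls (free_star cj u) = cls (free_star cj v)"
    using rels_closed[OF assms] by (simp_all add: cls_eq_iff free_star_minus free_star_closed)
qed

lemma SI_subsetI:
  assumes "ideal J FA" "\<And>u v. (u, v) \<in> rels \<Longrightarrow> u \<ominus>\<^bsub>FA\<^esub> v \<in> J"
    "\<And>u v. (u, v) \<in> rels \<Longrightarrow> free_star cj u \<ominus>\<^bsub>FA\<^esub> free_star cj v \<in> J"
  shows "SI \<subseteq> J"
  unfolding SI_def'
proof (rule FA.A.genideal_minimal[OF assms(1)])
  show "relators \<union> free_star cj ` relators \<subseteq> J"
    using assms(2,3) rels_closed by (auto simp: relators_def free_star_minus)
qed

definition ext_letters :: "('k, 'p, 'm) module_scheme \<Rightarrow> ('g letter \<Rightarrow> 'p) \<Rightarrow> ('g letter list \<Rightarrow> 'k) \<Rightarrow> 'p" where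
  "ext_letters P v = lin_ext K P (\<lambda>w. foldr (\<lambda>x y. v x \<otimes>\<^bsub>P\<^esub> y) w \<one>\<^bsub>P\<^esub>)"

context
  fixes P :: "('k, 'p, 'm) module_scheme" and v :: "'g letter \<Rightarrow> 'p"
  assumes P: "assoc_algebra K P" and v: "\<And>x. v x \<in> carrier P"
begin

interpretation P: assoc_algebra K P by (rule P)

lemma foldr_closed [simp]: "foldr (\<lambda>x y. v x \<otimes>\<^bsub>P\<^esub> y) w \<one>\<^bsub>P\<^esub> \<in> carrier P"
  by (induction w) (auto simp: v)

lemma foldr_append_mult:
  "foldr (\<lambda>x y. v x \<otimes>\<^bsub>P\<^esub> y) (w @ w') \<one>\<^bsub>P\<^esub> =
   foldr (\<lambda>x y. v x \<otimes>\<^bsub>P\<^esub> y) w \<one>\<^bsub>P\<^esub> \<otimes>\<^bsub>P\<^esub> foldr (\<lambda>x y. v x \<otimes>\<^bsub>P\<^esub> y) w' \<one>\<^bsub>P\<^esub>"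
  by (induction w) (auto simp: v P.A.m_assoc simp del: foldr_append)

lemma ext_letters_basis: "ext_letters P v (basis_elem K w) = foldr (\<lambda>x y. v x \<otimes>\<^bsub>P\<^esub> y) w \<one>\<^bsub>P\<^esub>"
  unfolding ext_letters_def by (rule lin_ext_basis[where M = word_monoid]) (auto simp: P.module_axioms)

lemma ext_letters_hom: "ext_letters P v \<in> algebra_homs K FA P"
proof (rule algebra_homs_spanningI[OF FA P _ FA_spanning])
  show "ext_letters P v \<in> linear_maps K FA P"
    unfolding free_algebra_def ext_letters_def by (rule lin_ext_linear) (auto simp: P.module_axioms)
  show "ext_letters P v \<one>\<^bsub>FA\<^esub> = \<one>\<^bsub>P\<^esub>" by (simp add: FA_one ext_letters_basis)
qed (auto simp: ext_letters_basis foldr_append_mult simp del: foldr_append)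

context
  assumes rel: "\<And>r s. (r, s) \<in> rels \<Longrightarrow> ext_letters P v r = ext_letters P v s"
    and rel_star: "\<And>r s. (r, s) \<in> rels \<Longrightarrow> ext_letters P v (free_star cj r) = ext_letters P v (free_star cj s)"
begin

text \<open>The target has no involution from which the adjoint relations could follow, so relations
  and adjoint relations are separate hypotheses. The kernel is an ideal that contains both kinds of
  generators of the star ideal.\<close>

lemma ext_letters_SI: "f \<in> SI \<Longrightarrow> ext_letters P v f = \<zero>\<^bsub>P\<^esub>"
proof -
  let ?E = "ext_letters P v"
  note E = algebra_homs_linear[OF ext_letters_hom]
  interpret E: ring_hom_ring FA P ?E
    using ext_letters_hom
    by (auto intro!: ring_hom_ringI2 FA.A.ring_axioms P.A.ring_axioms simp: algebra_homs_def)
  have "SI \<subseteq> a_kernel FA P ?E"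
  proof (rule SI_subsetI[OF E.kernel_is_ideal])
    fix r s assume rs: "(r, s) \<in> rels"
    note c = rels_closed[OF rs]
    have eq: "f \<ominus>\<^bsub>FA\<^esub> g \<in> a_kernel FA P ?E"
      if "f \<in> carrier FA" "g \<in> carrier FA" "?E f = ?E g" for f g
    proof -
      have "?E (f \<ominus>\<^bsub>FA\<^esub> g) = ?E g \<ominus>\<^bsub>P\<^esub> ?E g"
        using linear_maps_minus[OF FA.module_axioms P.module_axioms E that(1,2)] by (simp only: that(3))
      also have "\<dots> = \<zero>\<^bsub>P\<^esub>"
        unfolding a_minus_def by (rule P.r_neg[OF linear_maps_closed[OF E that(2)]])
      finally have "?E (f \<ominus>\<^bsub>FA\<^esub> g) = \<zero>\<^bsub>P\<^esub>" .
      thus ?thesis using FA.minus_closed[OF that(1,2)] by (simp only: a_kernel_def' mem_Collect_eq simp_thms)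
    qed
    show "r \<ominus>\<^bsub>FA\<^esub> s \<in> a_kernel FA P ?E" by (rule eq[OF c[THEN conjunct1] c[THEN conjunct2] rel[OF rs]])
    show "free_star cj r \<ominus>\<^bsub>FA\<^esub> free_star cj s \<in> a_kernel FA P ?E"
      by (rule eq[OF c[THEN conjunct1, THEN free_star_closed] c[THEN conjunct2, THEN free_star_closed] rel_star[OF rs]])
  qed
  thus "f \<in> SI \<Longrightarrow> ?E f = \<zero>\<^bsub>P\<^esub>" unfolding a_kernel_def' by blast
qed

lemma hom_from_letters_cls:
  assumes "f \<in> carrier FA" shows "hom_from_letters K P v (cls f) = ext_letters P v f"
  unfolding hom_from_letters_def ext_letters_def free_algebra_def
  by (rule lin_lift_coset[OF word_monoid P.module_axioms _ SI[unfolded free_algebra_def]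
        ext_letters_SI[unfolded ext_letters_def] assms[unfolded free_algebra_def]]) auto

lemma hom_from_letters_word:
  "hom_from_letters K P v (word w) = foldr (\<lambda>x y. v x \<otimes>\<^bsub>P\<^esub> y) w \<one>\<^bsub>P\<^esub>"
  by (simp add: hom_from_letters_cls ext_letters_basis)

lemma hom_from_letters_letr: "hom_from_letters K P v (letr x) = v x"
  by (simp add: letr_eq hom_from_letters_word v)

lemma hom_from_letters_hom: "hom_from_letters K P v \<in> algebra_homs K SA P"
proof (rule algebra_homs_spanningI[OF SA P _ word_spanning])
  show "hom_from_letters K P v \<in> linear_maps K SA P"
    unfolding hom_from_letters_def star_algebra_def free_algebra_def
    by (rule lin_lift_linear[OF word_monoid P.module_axioms _ SI[unfolded free_algebra_def]
        ext_letters_SI[unfolded ext_letters_def]]) auto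
  show "hom_from_letters K P v \<one>\<^bsub>SA\<^esub> = \<one>\<^bsub>P\<^esub>"
    unfolding word_Nil[symmetric] by (simp add: hom_from_letters_word)
qed (auto simp: word_mult hom_from_letters_word foldr_append_mult simp del: foldr_append)

end

end

lemma hom_eq_on_letters:
  assumes P: "assoc_algebra K P" and f: "f \<in> algebra_homs K SA P" and g: "g \<in> algebra_homs K SA P"
    and eq: "\<And>x. f (letr x) = g (letr x)" and a: "a \<in> carrier SA"
  shows "f a = g a"
proof (rule linear_maps_eqI[OF SA.module_axioms assoc_algebra_module[OF P] word_spanning algebra_homs_linear[OF f]
      algebra_homs_linear[OF g] _ a])
  have "f (word w) = g (word w)" for w
  proof (induction w)
    case Nil thus ?case using algebra_homs_one[OF f] algebra_homs_one[OF g] by (simp add: word_Nil)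
  next
    case (Cons x w) thus ?case
      by (simp add: word_Cons algebra_homs_mult[OF f] algebra_homs_mult[OF g] eq)
  qed
  thus "f x = g x" if "x \<in> range (\<lambda>w. word w)" for x using that by auto
qed

end

text \<open>Applied in both directions, this shows that two presentations define the same ideal,
  hence literally the same algebra and not only isomorphic ones.\<close>

lemma star_ideal_subset:
  assumes "star_presentation K cj rels" "star_presentation K cj rels'"
    "\<And>u v. (u, v) \<in> rels \<Longrightarrow> star_ideal K cj rels' +>\<^bsub>free_algebra K\<^esub> u = star_ideal K cj rels' +>\<^bsub>free_algebra K\<^esub> v"
    "\<And>u v. (u, v) \<in> rels \<Longrightarrow> star_ideal K cj rels' +>\<^bsub>free_algebra K\<^esub> free_star cj u =
        star_ideal K cj rels' +>\<^bsub>free_algebra K\<^esub> free_star cj v"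
  shows "star_ideal K cj rels \<subseteq> star_ideal K cj rels'"
proof -
  interpret A: star_presentation K cj rels by fact
  interpret B: star_presentation K cj rels' by fact
  show ?thesis
    by (rule A.SI_subsetI[OF B.SI])
       (use assms(3,4) A.rels_closed in \<open>auto simp: B.cls_eq_iff[symmetric] A.free_star_closed\<close>)
qed


section \<open>The circle\<close>

lemma complex_ring_simps [simp]:
  "carrier complex_ring = UNIV" "mult complex_ring = (*)" "one complex_ring = 1"
  "zero complex_ring = 0" "add complex_ring = (+)"
  by (simp_all add: complex_ring_def)

lemma complex_ring: "cring complex_ring"
  by (rule cringI) (auto intro!: abelian_groupI comm_monoidI exI[of _ "- _"] simp: algebra_simps add_eq_0_iff)

lemma cnj_hom: "cnj \<in> ring_hom complex_ring complex_ring"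
  by (auto simp: ring_hom_def)

fun letter_degree :: "'g letter \<Rightarrow> int" where
  "letter_degree (Gen g) = 1" | "letter_degree (Adj g) = - 1"

definition degree :: "'g letter list \<Rightarrow> int" where "degree w = sum_list (map letter_degree w)"

lemma degree_simps [simp]: "degree [] = 0" "degree (x # w) = letter_degree x + degree w"
  "degree (w @ w') = degree w + degree w'"
  by (simp_all add: degree_def)

lemma letter_degree_adjoint [simp]: "letter_degree (adjoint x) = - letter_degree x"
  by (cases x) auto

lemma degree_adjoint [simp]: "degree (map adjoint w) = - degree w"
  by (induction w) auto

interpretation U: star_presentation complex_ring cnj u1_relations
  by (intro star_presentation.intro star_presentation_axioms.intro complex_ring cnj_hom)
     (auto simp: u1_relations_def commutation_relations_def free_algebra_def monoid_algebra_simps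
       intro!: basis_elem_closed[OF complex_ring])


lemma u1_commute: "U.letr x \<otimes>\<^bsub>U.SA\<^esub> U.letr y = U.letr y \<otimes>\<^bsub>U.SA\<^esub> U.letr x"
proof -
  have "(basis_elem complex_ring [x, y], basis_elem complex_ring [y, x]) \<in> u1_relations"
    by (auto simp: u1_relations_def commutation_relations_def)
  from U.rels_hold(1)[OF this] show ?thesis by (simp add: U.letr_eq U.word_mult)
qed

lemma u1_unitary: "U.letr (Adj gen_t) \<otimes>\<^bsub>U.SA\<^esub> U.letr (Gen gen_t) = \<one>\<^bsub>U.SA\<^esub>"
proof -
  have "(basis_elem complex_ring [Adj gen_t, Gen gen_t], \<one>\<^bsub>U.FA\<^esub>) \<in> u1_relations"
    by (auto simp: u1_relations_def)
  from U.rels_hold(1)[OF this] show ?thesis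
    by (simp add: U.letr_eq U.word_mult U.FA_one U.word_Nil)
qed

lemma u1_universal:
  assumes P: "assoc_algebra complex_ring P" and v: "\<And>x. v x \<in> carrier P"
    and inv: "v (Gen gen_t) \<otimes>\<^bsub>P\<^esub> v (Adj gen_t) = \<one>\<^bsub>P\<^esub>" "v (Adj gen_t) \<otimes>\<^bsub>P\<^esub> v (Gen gen_t) = \<one>\<^bsub>P\<^esub>"
  shows u1_hom: "hom_from_letters complex_ring P v \<in> algebra_homs complex_ring U.SA P"
    and u1_hom_word: "hom_from_letters complex_ring P v (U.word w) = foldr (\<lambda>x y. v x \<otimes>\<^bsub>P\<^esub> y) w \<one>\<^bsub>P\<^esub>"
proof -
  interpret P: assoc_algebra complex_ring P by (rule P)
  \<comment> \<open>The two letters are inverse to each other, so commutativity of the circle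
    imposes nothing further on their images.\<close>
  have comm: "v x \<otimes>\<^bsub>P\<^esub> v y = v y \<otimes>\<^bsub>P\<^esub> v x" for x y
    using inv by (cases x; cases y; rename_tac g g'; case_tac g; case_tac g'; simp)
  note E = U.ext_letters_basis[OF P v]
  note E1 = algebra_homs_one[OF U.ext_letters_hom[OF P v]]
  have 1: "U.ext_letters P v r = U.ext_letters P v s" if "(r, s) \<in> u1_relations" for r s
    using that comm inv v E1 by (auto simp: u1_relations_def commutation_relations_def E)
  have 2: "U.ext_letters P v (free_star cnj r) = U.ext_letters P v (free_star cnj s)" if "(r, s) \<in> u1_relations" for r s
    using that comm inv v E1 by (auto simp: u1_relations_def commutation_relations_def E)
  show "hom_from_letters complex_ring P v \<in> algebra_homs complex_ring U.SA P"
    by (rule U.hom_from_letters_hom[OF P v 1 2])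
  show "hom_from_letters complex_ring P v (U.word w) = foldr (\<lambda>x y. v x \<otimes>\<^bsub>P\<^esub> y) w \<one>\<^bsub>P\<^esub>"
    by (rule U.hom_from_letters_word[OF P v 1 2])
qed

text \<open>Integer powers need inverses, hence the power is taken in the group of units, where the
  exponent law for all integers is available.\<close>

definition u1_power :: "int \<Rightarrow> (u1_gen letter list \<Rightarrow> complex) set" where
  "u1_power n = U.letr (Gen gen_t) [^]\<^bsub>units_of U.SA\<^esub> n"

text \<open>The algebra map to the group algebra of the integers, i.e. to Laurent polynomials. That
  it exists at all is what makes the powers of t linearly independent.\<close>

definition u1_coord :: "(u1_gen letter list \<Rightarrow> complex) set \<Rightarrow> int \<Rightarrow> complex" where
  "u1_coord = hom_from_letters complex_ring (monoid_algebra complex_ring int_monoid)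
     (\<lambda>x. basis_elem complex_ring (letter_degree x))"

lemma u1_power:
  shows u1_power_closed: "u1_power n \<in> carrier U.SA"
    and u1_power_zero: "u1_power 0 = \<one>\<^bsub>U.SA\<^esub>"
    and u1_power_add: "u1_power m \<otimes>\<^bsub>U.SA\<^esub> u1_power n = u1_power (m + n)"
    and u1_power_letter: "U.letr x = u1_power (letter_degree x)"
proof -
  let ?G = "units_of U.SA"
  interpret G: group ?G by (rule U.SA.A.units_group)
  note [simp] = units_of_carrier units_of_mult units_of_one
  have tt: "U.letr (Gen gen_t) \<otimes>\<^bsub>U.SA\<^esub> U.letr (Adj gen_t) = \<one>\<^bsub>U.SA\<^esub>"
    using u1_unitary u1_commute by simp
  have t: "U.letr (Gen gen_t) \<in> carrier ?G" and ts: "U.letr (Adj gen_t) \<in> carrier ?G"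
    using tt u1_unitary by (auto simp: Units_def)
  have "u1_power n \<in> carrier ?G" using t by (simp add: u1_power_def del: units_of_carrier)
  thus "u1_power n \<in> carrier U.SA" by (auto simp: Units_def)
  show "u1_power 0 = \<one>\<^bsub>U.SA\<^esub>" by (simp add: u1_power_def)
  show "u1_power m \<otimes>\<^bsub>U.SA\<^esub> u1_power n = u1_power (m + n)"
    using G.int_pow_mult[OF t] by (simp add: u1_power_def)
  have "inv\<^bsub>?G\<^esub> U.letr (Gen gen_t) = U.letr (Adj gen_t)"
    using tt u1_unitary t ts by (intro G.inv_equality) auto
  thus "U.letr x = u1_power (letter_degree x)"
    using t by (cases x; rename_tac g; case_tac g) (auto simp: u1_power_def G.int_pow_neg simp del: units_of_carrier)
qed

lemma u1_word: "U.word w = u1_power (degree w)"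
  by (induction w) (simp_all add: U.word_Nil u1_power_zero U.word_Cons u1_power_letter u1_power_add)

lemma u1_power_word: "\<exists>w. u1_power n = U.word w \<and> degree w = n"
proof (cases "n \<ge> 0")
  case True
  have "degree (replicate m (Gen gen_t)) = int m" for m by (induction m) auto
  thus ?thesis using True u1_word by (metis int_nat_eq)
next
  case False
  have "degree (replicate m (Adj gen_t)) = - int m" for m by (induction m) auto
  hence "degree (replicate (nat (- n)) (Adj gen_t)) = n" using False by simp
  thus ?thesis using u1_word by metis
qed

lemma O_U1_laurent: "laurent_hopf complex_ring O_U1 u1_power u1_coord"
proof -
  let ?K = complex_ring and ?H = U.SA
  let ?HH = "tensor_algebra ?K ?H ?H"
  let ?Z = "monoid_algebra ?K int_monoid"
  let ?I = "ring_as_algebra ?K (\<lambda>k. k)"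
  note H = U.SA
  note HH = tensor_algebra_assoc_algebra[OF H H]
  interpret HH: assoc_algebra ?K ?HH by (rule HH)
  have Z: "assoc_algebra ?K ?Z" by (rule monoid_algebra_assoc_algebra[OF complex_ring int_monoid])
  have I: "assoc_algebra ?K ?I"
    by (rule scalar_extension.ring_as_algebra_assoc_algebra[OF scalar_extension_id[OF complex_ring]])
  define d where "d = hom_from_letters ?K ?HH (\<lambda>x. pure_tensor ?K ?H ?H (u1_letter x) (u1_letter x))"
  define e where "e = hom_from_letters ?K ?I (\<lambda>x::u1_gen letter. 1)"
  define s where "s = hom_from_letters ?K ?H (\<lambda>x. u1_letter (adjoint x))"
  have O: "O_U1 = module.extend ?H (hopf.fields d e s)"
    by (simp add: O_U1_def Let_def d_def e_def s_def)
  note pm = pure_tensor_mult[OF H H] and pc = pure_tensor_closed[OF H H] and po = tensor_algebra_one[OF H H]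
  have tt: "U.letr (Gen gen_t) \<otimes>\<^bsub>U.SA\<^esub> U.letr (Adj gen_t) = \<one>\<^bsub>U.SA\<^esub>"
    using u1_unitary u1_commute by simp
  note du = u1_universal[OF HH, of "\<lambda>x. pure_tensor ?K ?H ?H (u1_letter x) (u1_letter x)", folded d_def]
  have d: "d \<in> algebra_homs ?K ?H ?HH" "\<And>w. d (U.word w) = foldr (\<lambda>x y. pure_tensor ?K ?H ?H (u1_letter x) (u1_letter x) \<otimes>\<^bsub>?HH\<^esub> y) w \<one>\<^bsub>?HH\<^esub>"
    by (rule du; simp add: pm pc po tt u1_unitary)+
  have dw: "d (U.word w) = pure_tensor ?K ?H ?H (U.word w) (U.word w)" for w
    unfolding d(2) by (induction w) (simp_all add: po U.word_Nil U.word_Cons pm pc)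
  note eu = u1_universal[OF I, of "\<lambda>x. 1", folded e_def]
  have e: "e \<in> algebra_homs ?K ?H ?I" "\<And>w. e (U.word w) = foldr (\<lambda>x y. 1 \<otimes>\<^bsub>?I\<^esub> y) w \<one>\<^bsub>?I\<^esub>"
    by (rule eu; simp)+
  have ew: "e (U.word w) = 1" for w unfolding e(2) by (induction w) simp_all
  note su = u1_universal[OF H, of "\<lambda>x. u1_letter (adjoint x)", folded s_def]
  have s: "s \<in> algebra_homs ?K ?H ?H" "\<And>w. s (U.word w) = foldr (\<lambda>x y. u1_letter (adjoint x) \<otimes>\<^bsub>?H\<^esub> y) w \<one>\<^bsub>?H\<^esub>"
    by (rule su; simp add: tt u1_unitary)+
  have sw: "s (U.word w) = U.word (map adjoint w)" for w
    unfolding s(2) by (induction w) (simp_all add: U.word_Nil U.word_Cons)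
  note cu = u1_universal[OF Z, of "\<lambda>x. basis_elem ?K (letter_degree x)", folded u1_coord_def]
  note bm = basis_elem_mult[OF complex_ring int_monoid]
  have c: "u1_coord \<in> algebra_homs ?K ?H ?Z" "\<And>w. u1_coord (U.word w) =
      foldr (\<lambda>x y. basis_elem ?K (letter_degree x) \<otimes>\<^bsub>?Z\<^esub> y) w \<one>\<^bsub>?Z\<^esub>"
    by (rule cu; simp add: bm basis_elem_closed[OF complex_ring] monoid_algebra_simps)+
  have cw: "u1_coord (U.word w) = basis_elem ?K (degree w)" for w
    unfolding c(2) by (induction w) (simp_all add: monoid_algebra_simps bm)
  have range: "range u1_power = range (\<lambda>w. U.word w)"
  proof
    show "range u1_power \<subseteq> range (\<lambda>w. U.word w)" using u1_power_word by (metis image_subsetI rangeI)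
  qed (auto simp: u1_word)
  \<comment> \<open>The structure maps are known on words, so each power is represented by a word of
    that degree.\<close>
  obtain wd where wd: "\<And>n. u1_power n = U.word (wd n)" "\<And>n. degree (wd n) = n"
    using u1_power_word by metis
  obtain X where X: "O_U1 = module.extend ?H X" "comult O_U1 = d" "counit O_U1 = e" "antipode O_U1 = s"
    by (rule that[OF O]) (simp_all add: O)
  show ?thesis
  proof (intro laurent_hopf.intro laurent_hopf_axioms.intro)
    show "assoc_algebra ?K O_U1" by (simp only: X(1) assoc_algebra_extend H)
    show "u1_power n \<in> carrier O_U1" "u1_power 0 = \<one>\<^bsub>O_U1\<^esub>"
      "u1_power m \<otimes>\<^bsub>O_U1\<^esub> u1_power n = u1_power (m + n)" for m n
      by (simp_all add: X(1) u1_power)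
    show "spanning ?K O_U1 (range u1_power)"
      using U.word_spanning by (simp only: X(1) spanning_extend range)
    show "comult O_U1 \<in> linear_maps ?K O_U1 (tensor_algebra ?K O_U1 O_U1)"
      using algebra_homs_linear[OF d(1)] by (simp only: X(2)) (simp only: X(1) tensor_algebra_extend linear_maps_extend)
    show "comult O_U1 (u1_power n) = pure_tensor ?K O_U1 O_U1 (u1_power n) (u1_power n)" for n
      by (simp only: X(2)) (simp only: X(1) tensor_algebra_extend wd dw)
    show "counit O_U1 \<in> linear_maps ?K O_U1 (ring_as_algebra ?K (\<lambda>k. k))"
      using algebra_homs_linear[OF e(1)] by (simp only: X(3)) (simp only: X(1) linear_maps_extend)
    show "counit O_U1 (u1_power n) = \<one>\<^bsub>?K\<^esub>" for n by (simp add: X(3) wd ew)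
    show "antipode O_U1 \<in> linear_maps ?K O_U1 O_U1"
      using algebra_homs_linear[OF s(1)] by (simp only: X(4)) (simp only: X(1) linear_maps_extend)
    show "antipode O_U1 (u1_power n) = u1_power (- n)" for n
      by (simp only: X(4) wd(1)[of n] sw) (simp add: u1_word wd(2))
    show "u1_coord \<in> linear_maps ?K O_U1 ?Z"
      using algebra_homs_linear[OF c(1)] by (simp only: X(1) linear_maps_extend)
    show "u1_coord (u1_power n) = basis_elem ?K n" for n by (simp add: wd cw)
  qed
qed

section \<open>The Hopf fibrations as graded algebras\<close>

text \<open>Of the four rules that exchange different generators, the last two are the adjoints of
  the first two, conjugation exchanging \<open>q\<close> and \<open>q'\<close>; they are listed
  because \<open>P\<close> carries no involution. The normality and sphere relations are their own
  adjoints.\<close>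

definition sphere_letters ::
    "('k, 'p, 'm) module_scheme \<Rightarrow> 'k \<Rightarrow> 'k \<Rightarrow> (s3_gen letter \<Rightarrow> 'p) \<Rightarrow> bool" where
  "sphere_letters P q q' v \<longleftrightarrow> range v \<subseteq> carrier P \<and>
     v (Gen gen_z1) \<otimes>\<^bsub>P\<^esub> v (Adj gen_z1) = v (Adj gen_z1) \<otimes>\<^bsub>P\<^esub> v (Gen gen_z1) \<and>
     v (Gen gen_z2) \<otimes>\<^bsub>P\<^esub> v (Adj gen_z2) = v (Adj gen_z2) \<otimes>\<^bsub>P\<^esub> v (Gen gen_z2) \<and>
     v (Gen gen_z1) \<otimes>\<^bsub>P\<^esub> v (Gen gen_z2) = q \<odot>\<^bsub>P\<^esub> (v (Gen gen_z2) \<otimes>\<^bsub>P\<^esub> v (Gen gen_z1)) \<and>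
     v (Gen gen_z1) \<otimes>\<^bsub>P\<^esub> v (Adj gen_z2) = q' \<odot>\<^bsub>P\<^esub> (v (Adj gen_z2) \<otimes>\<^bsub>P\<^esub> v (Gen gen_z1)) \<and>
     v (Adj gen_z2) \<otimes>\<^bsub>P\<^esub> v (Adj gen_z1) = q' \<odot>\<^bsub>P\<^esub> (v (Adj gen_z1) \<otimes>\<^bsub>P\<^esub> v (Adj gen_z2)) \<and>
     v (Gen gen_z2) \<otimes>\<^bsub>P\<^esub> v (Adj gen_z1) = q \<odot>\<^bsub>P\<^esub> (v (Adj gen_z1) \<otimes>\<^bsub>P\<^esub> v (Gen gen_z2)) \<and>
     v (Adj gen_z1) \<otimes>\<^bsub>P\<^esub> v (Gen gen_z1) \<oplus>\<^bsub>P\<^esub> v (Adj gen_z2) \<otimes>\<^bsub>P\<^esub> v (Gen gen_z2) = \<one>\<^bsub>P\<^esub>"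

locale deformed_sphere = K0: cring K for K :: "'k ring" +
  fixes cj :: "'k \<Rightarrow> 'k" and q q' :: 'k
  assumes cj_hom0: "cj \<in> ring_hom K K"
    and q_closed [simp]: "q \<in> carrier K" "q' \<in> carrier K"
    and q_inv: "q \<otimes>\<^bsub>K\<^esub> q' = \<one>\<^bsub>K\<^esub>"
    and q_star [simp]: "cj q = q'" "cj q' = q"
begin

lemma deformed_relations_presentation: "star_presentation K cj (deformed_sphere_relations K q q')"
proof -
  have FA: "assoc_algebra K (free_algebra K)"
    unfolding free_algebra_def by (rule monoid_algebra_assoc_algebra[OF K0.is_cring word_monoid])
  interpret FA: assoc_algebra K "free_algebra K" by (rule FA)
  have "basis_elem K w \<in> carrier (free_algebra K)" for w
    unfolding free_algebra_def by (rule basis_elem_closed[OF K0.is_cring]) simp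
  thus ?thesis
    by (intro star_presentation.intro star_presentation_axioms.intro K0.is_cring cj_hom0)
       (auto simp: deformed_sphere_relations_def sphere_relation_def Let_def)
qed

sublocale star_presentation K cj "deformed_sphere_relations K q q'"
  by (rule deformed_relations_presentation)

lemma cls_smult: "k \<in> carrier K \<Longrightarrow> cls (k \<odot>\<^bsub>FA\<^esub> basis_elem K w) = k \<odot>\<^bsub>SA\<^esub> word w"
  by (rule algebra_homs_smult[OF cls_hom _ basis_closed])

lemma cls_add: "cls (basis_elem K w \<oplus>\<^bsub>FA\<^esub> basis_elem K w') = word w \<oplus>\<^bsub>SA\<^esub> word w'"
  by (rule algebra_homs_add[OF cls_hom basis_closed basis_closed])

lemma letters: "sphere_letters SA q q' letr"
proof -
  have mem: "(basis_elem K [Gen gen_z1, Adj gen_z1], basis_elem K [Adj gen_z1, Gen gen_z1]) \<in> deformed_sphere_relations K q q'"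
    "(basis_elem K [Gen gen_z2, Adj gen_z2], basis_elem K [Adj gen_z2, Gen gen_z2]) \<in> deformed_sphere_relations K q q'"
    "(basis_elem K [Gen gen_z1, Gen gen_z2], q \<odot>\<^bsub>FA\<^esub> basis_elem K [Gen gen_z2, Gen gen_z1]) \<in> deformed_sphere_relations K q q'"
    "(basis_elem K [Gen gen_z1, Adj gen_z2], q' \<odot>\<^bsub>FA\<^esub> basis_elem K [Adj gen_z2, Gen gen_z1]) \<in> deformed_sphere_relations K q q'"
    "(basis_elem K [Adj gen_z1, Gen gen_z1] \<oplus>\<^bsub>FA\<^esub> basis_elem K [Adj gen_z2, Gen gen_z2], \<one>\<^bsub>FA\<^esub>)
        \<in> deformed_sphere_relations K q q'"
    by (simp_all add: deformed_sphere_relations_def sphere_relation_def Let_def)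
  note r = mem[THEN rels_hold(1)] and rs = mem(3,4)[THEN rels_hold(2)]
  note s = letr_eq word_mult cls_smult cls_add FA_one word_Nil free_star_smult
  show ?thesis
    unfolding sphere_letters_def
    using r rs by (simp add: s image_subset_iff)
qed

context
  fixes P :: "('k, 'p, 'm) module_scheme" and v :: "s3_gen letter \<Rightarrow> 'p"
  assumes P: "assoc_algebra K P" and v: "sphere_letters P q q' v"
begin

interpretation P: assoc_algebra K P by (rule P)

lemma v_closed: "v x \<in> carrier P" using v by (auto simp: sphere_letters_def)

lemma sphere_relators:
  assumes "(r, s) \<in> deformed_sphere_relations K q q'"
  shows "ext_letters P v r = ext_letters P v s"
    "ext_letters P v (free_star cj r) = ext_letters P v (free_star cj s)"
proof -
  note h = ext_letters_hom[OF P v_closed]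
  note s = ext_letters_basis[OF P v_closed] algebra_homs_one[OF h] algebra_homs_add[OF h] algebra_homs_smult[OF h]
    v_closed free_star_add free_star_smult
  show "ext_letters P v r = ext_letters P v s"
    using assms v by (auto simp: deformed_sphere_relations_def sphere_relation_def Let_def sphere_letters_def s)
  show "ext_letters P v (free_star cj r) = ext_letters P v (free_star cj s)"
    using assms v by (auto simp: deformed_sphere_relations_def sphere_relation_def Let_def sphere_letters_def s)
qed

lemma sphere_hom: "hom_from_letters K P v \<in> algebra_homs K SA P"
  and sphere_hom_word: "hom_from_letters K P v (word w) = foldr (\<lambda>x y. v x \<otimes>\<^bsub>P\<^esub> y) w \<one>\<^bsub>P\<^esub>"
  and sphere_hom_letr: "hom_from_letters K P v (letr x) = v x"
  using hom_from_letters_hom[OF P v_closed sphere_relators] hom_from_letters_word[OF P v_closed sphere_relators]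
    hom_from_letters_letr[OF P v_closed sphere_relators]
  by auto

end

end

lemma coact_extend [simp]: "coact (module.extend A (comodule_algebra.fields d)) = d"
  by (simp add: module.defs comodule_algebra.defs)

locale deformed_hopf_fibration = deformed_sphere K cj q q' + laurent_hopf K H T C
  for K :: "'k ring" and cj q q' and H :: "('k, 'h) hopf" and T C
begin

definition fib where "fib = hopf_fibration K cj (deformed_sphere_relations K q q') H (T 1) (T (- 1))"

definition words_of_degree where "words_of_degree n = {word w |w. degree w = n}"

lemma fib_eq: "fib = module.extend SA (comodule_algebra.fields (coact fib))"
  by (simp add: fib_def hopf_fibration_def Let_def)

lemma SAH: "assoc_algebra K (tensor_algebra K SA H)"
  by (rule tensor_algebra_assoc_algebra[OF SA H])

lemma coact_fib: "coact fib = hom_from_letters K (tensor_algebra K SA H)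
    (\<lambda>x. pure_tensor K SA H (letr x) (T (letter_degree x)))"
proof -
  have "(\<lambda>x. case x of Gen i \<Rightarrow> pure_tensor K SA H (letr (Gen i)) (T 1)
      | Adj i \<Rightarrow> pure_tensor K SA H (letr (Adj i)) (T (- 1))) =
    (\<lambda>x. pure_tensor K SA H (letr x) (T (letter_degree x)))"
    by (auto simp: fun_eq_iff split: letter.split)
  thus ?thesis by (simp add: fib_def hopf_fibration_def Let_def)
qed

text \<open>Each relation is homogeneous, so tensoring every letter with the power of t of its
  degree tensors both sides with the same group-like element. For the sphere relation this is
  \<open>T 0\<close>, the unit.\<close>

lemma coact_letters: "sphere_letters (tensor_algebra K SA H) q q' (\<lambda>x. pure_tensor K SA H (letr x) (T (letter_degree x)))"
proof -
  note pm = pure_tensor_mult[OF SA H letr_closed T_closed letr_closed T_closed]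
  note ll = pure_tensor_linear_left[OF SA H T_closed]
  note L = letters[unfolded sphere_letters_def]
  note s = pm T_add linear_maps_smult[OF ll, symmetric] linear_maps_add[OF ll, symmetric]
    tensor_algebra_one[OF SA H] T_zero[symmetric]
  show ?thesis
    unfolding sphere_letters_def using L
    by (simp add: s image_subset_iff pure_tensor_closed[OF SA H])
qed

lemma coact_word: "coact fib (word w) = pure_tensor K SA H (word w) (T (degree w))"
proof -
  let ?v = "\<lambda>x. pure_tensor K SA H (letr x) (T (letter_degree x))"
  have "foldr (\<lambda>x y. ?v x \<otimes>\<^bsub>tensor_algebra K SA H\<^esub> y) w \<one>\<^bsub>tensor_algebra K SA H\<^esub> =
      pure_tensor K SA H (word w) (T (degree w))"
    by (induction w) (simp_all add: tensor_algebra_one[OF SA H] word_Nil T_zero word_Cons pure_tensor_mult[OF SA H] T_add)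
  thus ?thesis unfolding coact_fib by (simp only: sphere_hom_word[OF SAH coact_letters])
qed

lemma strongly_graded: "strongly_graded_comodule_algebra K H T C fib words_of_degree
    (letr (Adj gen_z1)) (letr (Adj gen_z2)) (letr (Gen gen_z1)) (letr (Gen gen_z2))"
proof -
  obtain X where X: "fib = module.extend SA X" using fib_eq by blast
  note ex = X tensor_algebra_extend module_extend_simps linear_maps_extend spanning_extend assoc_algebra_extend
  have deg: "letr x \<in> words_of_degree (letter_degree x)" for x
    unfolding words_of_degree_def letr_eq by (intro CollectI exI[of _ "[x]"]) simp
  note L = letters[unfolded sphere_letters_def]
  show ?thesis
  proof (intro strongly_graded_comodule_algebra.intro graded_comodule_algebra.intro
      strongly_graded_comodule_algebra_axioms.intro graded_comodule_algebra_axioms.intro laurent_hopf_axioms)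
    show "assoc_algebra K fib" by (simp only: ex SA)
    have "(\<Union>n. words_of_degree n) = range (\<lambda>w. word w)" by (auto simp: words_of_degree_def)
    thus "spanning K fib (\<Union>n. words_of_degree n)" using word_spanning by (simp only: ex)
    show "\<one>\<^bsub>fib\<^esub> \<in> words_of_degree 0"
      unfolding words_of_degree_def by (intro CollectI exI[of _ "[]"]) (simp add: X word_Nil)
    show "x \<otimes>\<^bsub>fib\<^esub> y \<in> words_of_degree (m + n)" if "x \<in> words_of_degree m" "y \<in> words_of_degree n" for x y m n
    proof -
      obtain w w' where "x = word w" "degree w = m" "y = word w'" "degree w' = n"
        using \<open>x \<in> words_of_degree m\<close> \<open>y \<in> words_of_degree n\<close> by (auto simp: words_of_degree_def)
      thus ?thesis unfolding words_of_degree_def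
        by (intro CollectI exI[of _ "w @ w'"]) (simp add: X word_mult)
    qed
    show "coact fib \<in> linear_maps K fib (tensor_algebra K fib H)"
      using algebra_homs_linear[OF sphere_hom[OF SAH coact_letters]]
      by (simp only: coact_fib) (simp only: ex)
    show "coact fib x = pure_tensor K fib H x (T n)" if "x \<in> words_of_degree n" for x n
    proof -
      obtain w where "x = word w" "degree w = n" using \<open>x \<in> words_of_degree n\<close> by (auto simp: words_of_degree_def)
      thus ?thesis using coact_word[of w] by (simp only:) (simp only: ex)
    qed
    show "letr (Adj gen_z1) \<in> words_of_degree (- 1)" "letr (Adj gen_z2) \<in> words_of_degree (- 1)"
      "letr (Gen gen_z1) \<in> words_of_degree 1" "letr (Gen gen_z2) \<in> words_of_degree 1"
      using deg[of "Adj _"] deg[of "Gen _"] by simp_all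
  qed (use L in \<open>simp_all add: X\<close>)
qed

sublocale fib: strongly_graded_comodule_algebra K H T C fib words_of_degree
    "letr (Adj gen_z1)" "letr (Adj gen_z2)" "letr (Gen gen_z1)" "letr (Gen gen_z2)"
  by (rule strongly_graded)

end

text \<open>Colinearity compares two linear maps, so homogeneous elements suffice, and there it says
  that \<open>f\<close> preserves the degree.\<close>

lemma comodule_algebra_isomorphicI:
  assumes "graded_comodule_algebra K H T C A G" "right_comodule_algebra K H A'"
    and f: "f \<in> algebra_isos K A A'"
    and coact: "\<And>x n. x \<in> G n \<Longrightarrow> coact A' (f x) = pure_tensor K A' H (f x) (T n)"
  shows "comodule_algebra_isomorphic K H A A'"
proof -
  interpret A: graded_comodule_algebra K H T C A G by fact
  interpret A': right_comodule_algebra K H A' by fact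
  have fl: "f \<in> linear_maps K A A'" using f by (auto simp: algebra_isos_def algebra_homs_linear)
  note A' = A'.A.assoc_algebra_axioms
  have cl: "coact A' \<in> linear_maps K A' (tensor_algebra K A' H)"
    using A'.coact_hom by (rule algebra_homs_linear)
  have "coact A' (f a) = tensor_map K A' H f (\<lambda>x. x) (coact A a)" if a: "a \<in> carrier A" for a
    by (rule A.A_eqI[OF linear_maps_compose[OF fl cl] linear_maps_compose[OF A.coact_linear
          tensor_map_linear[OF A' A.H A.A A.H fl linear_maps_id]] tensor_algebra_module[OF A' A.H] _ a])
       (simp add: coact A.coact_G tensor_map_pure[OF A' A.H A.A A.H fl linear_maps_id] A.G_closed)
  thus ?thesis
    unfolding comodule_algebra_isomorphic_def using A.comodule_algebra assms(2) f by blast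
qed


section \<open>Evaluation at a point\<close>

lemma lin_lift_cong:
  assumes "carrier P' = carrier P" "add P' = add P" "zero P' = zero P"
    "\<And>k x. k \<odot>\<^bsub>P'\<^esub> x = k \<odot>\<^bsub>P\<^esub> x"
  shows "lin_lift K P' = lin_lift K P"
  using assms by (intro ext) (simp add: lin_lift_def finsum_def finprod_def Let_def)

lemma function_ring_simps [simp]:
  "carrier (function_ring F) = F" "f \<otimes>\<^bsub>function_ring F\<^esub> g = (\<lambda>y. f y * g y)"
  "one (function_ring F) = (\<lambda>y. 1)" "zero (function_ring F) = (\<lambda>y. 0)"
  "f \<oplus>\<^bsub>function_ring F\<^esub> g = (\<lambda>y. f y + g y)"
  by (simp_all add: function_ring_def)

locale function_family =
  fixes F :: "(real \<Rightarrow> complex) set"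
  assumes F: "function_star_subalgebra F"
begin

abbreviation R where "R \<equiv> function_ring F"

lemma F_closed [simp]:
  "(\<lambda>y. c) \<in> F" "f \<in> F \<Longrightarrow> g \<in> F \<Longrightarrow> (\<lambda>y. f y + g y) \<in> F"
  "f \<in> F \<Longrightarrow> g \<in> F \<Longrightarrow> (\<lambda>y. f y * g y) \<in> F" "f \<in> F \<Longrightarrow> (\<lambda>y. c * f y) \<in> F"
  "f \<in> F \<Longrightarrow> (\<lambda>y. cnj (f y)) \<in> F"
proof -
  have 1: "(\<lambda>y. 1) \<in> F" and sm: "\<And>f. f \<in> F \<Longrightarrow> (\<lambda>y. c * f y) \<in> F"
    using F by (auto simp: function_star_subalgebra_def)
  from sm[OF 1] show "(\<lambda>y. c) \<in> F" by simp
qed (use F in \<open>auto simp: function_star_subalgebra_def\<close>)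

lemma R: "cring R"
proof (rule cringI)
  show "abelian_group R"
  proof (rule abelian_groupI)
    fix f assume "f \<in> carrier R"
    hence "(\<lambda>y. - 1 * f y) \<in> carrier R" by (simp only: function_ring_simps F_closed)
    thus "\<exists>g\<in>carrier R. g \<oplus>\<^bsub>R\<^esub> f = \<zero>\<^bsub>R\<^esub>" by (intro bexI) auto
  qed (auto simp: algebra_simps)
qed (auto intro!: comm_monoidI simp: algebra_simps)

lemma constants: "scalar_extension complex_ring R const_fun"
  by (intro scalar_extension.intro scalar_extension_axioms.intro complex_ring R) (auto simp: ring_hom_def)

lemma evaluation: "scalar_extension R complex_ring (\<lambda>f. f p)"
  by (intro scalar_extension.intro scalar_extension_axioms.intro complex_ring R) (auto simp: ring_hom_def)

end

locale fibre = function_family F + h: laurent_hopf complex_ring H T C +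
    a: graded_comodule_algebra "function_ring F" "hopf_family F H"
      "\<lambda>n. pure_tensor complex_ring H (ring_as_algebra (function_ring F) const_fun) (T n) (\<lambda>y. 1)" CL A G
  for F and H :: "(complex, 'h) hopf" and T C CL
    and A :: "(real \<Rightarrow> complex, 'a, ('h \<times> (real \<Rightarrow> complex) \<Rightarrow> complex) set) comodule_algebra" and G +
  fixes p :: real
begin

abbreviation ev where "ev \<equiv> (\<lambda>f :: real \<Rightarrow> complex. f p)"

sublocale b: base_change_algebra R complex_ring ev A
  by (intro base_change_algebra.intro evaluation a.A)

sublocale c: base_change_algebra complex_ring R const_fun H
  by (intro base_change_algebra.intro constants h.H)

abbreviation TH where "TH \<equiv> tensor_algebra complex_ring b.LM H"

lemma TH: "module complex_ring TH"
  by (rule tensor_algebra_module[OF b.base_change_assoc_algebra h.H])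

lemma RTH: "module R (restrict_scalars ev TH)"
  by (rule b.restrict_scalars_module[OF TH])

text \<open>The coaction of \<open>eval_fibre\<close> consists of three nested lifts, which are
  shown to be well defined from the inside out: \<open>inner\<close> on h \<otimes> f,
  \<open>outer\<close> on x \<otimes> u, and \<open>coact_ext\<close> on a \<otimes> c.\<close>

abbreviation inner where
  "inner x \<equiv> lin_lift complex_ring TH (\<lambda>(h, f). pure_tensor complex_ring b.LM H (b.tensor x (f p)) h)"

lemma inner:
  assumes x: "x \<in> carrier A"
  shows inner_linear: "inner x \<in> linear_maps R c.LM (restrict_scalars ev TH)"
    and inner_pure: "h \<in> carrier H \<Longrightarrow> f \<in> F \<Longrightarrow>
      inner x (c.tensor h f) = pure_tensor complex_ring b.LM H (b.tensor x (f p)) h"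
proof -
  let ?P = "restrict_scalars ev TH"
  let ?b = "\<lambda>h f. pure_tensor complex_ring b.LM H (b.tensor x (f p)) h"
  note LM = b.base_change_assoc_algebra
  note ll = pure_tensor_linear_left[OF LM h.H] and lr = pure_tensor_linear_right[OF LM h.H]
  \<comment> \<open>A constant function takes its constant as value at \<open>p\<close>, so
    restricting scalars from the complex numbers to functions and back to constants changes nothing
    that a lift depends on.\<close>
  have e: "lin_lift complex_ring (restrict_scalars const_fun ?P) = lin_lift complex_ring TH"
    by (rule lin_lift_cong) simp_all
  have sm: "b.tensor x (k * c) = k \<odot>\<^bsub>b.LM\<^esub> b.tensor x c" for k c
    using b.base_change_smult_pure[of k x c] x by simp
  have bil: "bilinear complex_ring H c.L\<phi> (restrict_scalars const_fun ?P) ?b"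
  proof (rule bilinearI)
    fix f assume "f \<in> carrier c.L\<phi>"
    hence "b.tensor x (f p) \<in> carrier b.LM" using x by simp
    from lr[OF this] show "(\<lambda>h. ?b h f) \<in> linear_maps complex_ring H (restrict_scalars const_fun ?P)"
      by (simp add: linear_maps_def)
  next
    fix h assume h: "h \<in> carrier H"
    show "(\<lambda>f. ?b h f) \<in> linear_maps complex_ring c.L\<phi> (restrict_scalars const_fun ?P)"
      using linear_maps_closed[OF ll[OF h]] linear_maps_add[OF ll[OF h]] linear_maps_smult[OF ll[OF h]] x
        b.tensor_add_right[of x]
      by (intro linear_mapsI) (simp_all add: sm del: base_change_simps(6))
  qed
  have sm2: "?b h (l \<otimes>\<^bsub>R\<^esub> f) = l \<odot>\<^bsub>?P\<^esub> ?b h f" if "h \<in> carrier H" for h l f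
    using linear_maps_smult[OF ll[OF that], of "l p" "b.tensor x (f p)"] x by (simp add: sm del: base_change_simps(6))
  note * = c.base_change_lift[OF RTH bil sm2, unfolded e]
  show "inner x \<in> linear_maps R c.LM ?P" by (rule *(1))
  show "h \<in> carrier H \<Longrightarrow> f \<in> F \<Longrightarrow> inner x (c.tensor h f) = ?b h f" using *(2) by simp
qed

text \<open>Linearity in \<open>x\<close> is an identity for every \<open>u\<close>, and both of its
  sides are linear in \<open>u\<close> over the function ring. Hence it suffices to take h \<otimes>
  1 for \<open>u\<close>, where the value of \<open>inner\<close> is explicit.\<close>

lemma inner_bilinear: "bilinear R A (hopf_family F H) (restrict_scalars ev TH) inner"
proof -
  have X: "\<exists>X. hopf_family F H = module.extend c.LM X"
    unfolding hopf_base_change_def Let_def by blast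
  then obtain X where X: "hopf_family F H = module.extend c.LM X" by blast
  let ?P = "restrict_scalars ev TH"
  interpret P: module R ?P by (rule RTH)
  note LM = b.base_change_assoc_algebra
  note ll = pure_tensor_linear_left[OF LM h.H]
  note sp = c.base_change_spanning[OF spanning_carrier]
  note cm = c.LM.module_axioms
  have "bilinear R A c.LM ?P inner"
  proof (rule bilinearI)
    show "inner x \<in> linear_maps R c.LM ?P" if "x \<in> carrier A" for x by (rule inner_linear[OF that])
    fix u assume u: "u \<in> carrier c.LM"
    show "(\<lambda>x. inner x u) \<in> linear_maps R A ?P"
    proof (rule linear_mapsI)
      fix x assume x: "x \<in> carrier A"
      show "inner x u \<in> carrier ?P" by (rule linear_maps_closed[OF inner_linear[OF x] u])
      show "inner (x \<oplus>\<^bsub>A\<^esub> y) u = inner x u \<oplus>\<^bsub>?P\<^esub> inner y u" if y: "y \<in> carrier A" for y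
      proof (rule linear_maps_eqI[OF cm RTH sp inner_linear linear_maps_sum[OF RTH inner_linear inner_linear] _ u])
        fix w assume "w \<in> (\<lambda>m. c.tensor m \<one>\<^bsub>R\<^esub>) ` carrier H"
        thus "inner (x \<oplus>\<^bsub>A\<^esub> y) w = inner x w \<oplus>\<^bsub>?P\<^esub> inner y w"
          using x y linear_maps_add[OF ll] linear_maps_add[OF pure_tensor_linear_left[OF b.algs, of 1]]
          by (auto simp: inner_pure)
      qed (use x y in auto)
      show "inner (k \<odot>\<^bsub>A\<^esub> x) u = k \<odot>\<^bsub>?P\<^esub> inner x u" if k: "k \<in> carrier R" for k
      proof (rule linear_maps_eqI[OF cm RTH sp inner_linear linear_maps_scale[OF RTH inner_linear] _ u])
        fix w assume "w \<in> (\<lambda>m. c.tensor m \<one>\<^bsub>R\<^esub>) ` carrier H"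
        then obtain m where m: "m \<in> carrier H" "w = c.tensor m \<one>\<^bsub>R\<^esub>" by blast
        have "b.tensor (k \<odot>\<^bsub>A\<^esub> x) 1 = k p \<odot>\<^bsub>b.LM\<^esub> b.tensor x 1"
          using linear_maps_smult[OF b.base_change_unit_linear k x] by (simp del: base_change_simps(6))
        thus "inner (k \<odot>\<^bsub>A\<^esub> x) w = k \<odot>\<^bsub>?P\<^esub> inner x w"
          using x k m linear_maps_smult[OF ll[OF m(1)], of "k p" "b.tensor x 1"]
          by (simp add: inner_pure del: base_change_simps(6))
      qed (use x k in auto)
    qed
  qed
  thus ?thesis unfolding X by (simp add: bilinear_def)
qed

lemmas outer = tensor_lift[OF a.A a.H RTH inner_bilinear]

lemma eval_fibre_eq: "eval_fibre F H p A = module.extend b.LM (comodule_algebra.fields (coact (eval_fibre F H p A)))"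
  by (simp add: eval_fibre_def Let_def)

lemma coact_eval_fibre: "coact (eval_fibre F H p A) =
    lin_lift R (restrict_scalars ev TH) (\<lambda>(a, c). c \<odot>\<^bsub>TH\<^esub>
      lin_lift R (restrict_scalars ev TH) (\<lambda>(x, u). inner x u) (coact A a))"
  by (simp add: eval_fibre_def Let_def)

lemmas coact_ext = b.base_change_extend[OF TH linear_maps_compose[OF a.coact_linear outer(1)], folded coact_eval_fibre]

definition GE where "GE n = {b.tensor x c |x c. x \<in> G n}"

lemma graded: "graded_comodule_algebra complex_ring H T C (eval_fibre F H p A) GE"
proof -
  obtain X where X: "eval_fibre F H p A = module.extend b.LM X" using eval_fibre_eq by blast
  note ex = X tensor_algebra_extend module_extend_simps linear_maps_extend spanning_extend assoc_algebra_extend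
  note LM = b.base_change_assoc_algebra
  show ?thesis
  proof (intro graded_comodule_algebra.intro graded_comodule_algebra_axioms.intro h.laurent_hopf_axioms)
    show "assoc_algebra complex_ring (eval_fibre F H p A)" by (simp only: ex LM)
    have "spanning complex_ring b.LM (\<Union>n. GE n)"
    proof (rule spanning_trans[OF b.LM.module_axioms b.base_change_spanning[OF a.G_spanning]])
      show "(\<Union>n. GE n) \<subseteq> carrier b.LM" by (auto simp: GE_def a.G_closed)
      fix x N assume "x \<in> (\<lambda>m. b.tensor m \<one>\<^bsub>complex_ring\<^esub>) ` (\<Union>n. G n)" "(\<Union>n. GE n) \<subseteq> N"
      thus "x \<in> N" by (auto simp: GE_def)
    qed
    thus "spanning complex_ring (eval_fibre F H p A) (\<Union>n. GE n)" by (simp only: ex)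
    have "b.tensor \<one>\<^bsub>A\<^esub> 1 \<in> GE 0" using a.G_one unfolding GE_def by blast
    thus "\<one>\<^bsub>eval_fibre F H p A\<^esub> \<in> GE 0" by (simp add: X tensor_algebra_one[OF b.algs])
    show "x \<otimes>\<^bsub>eval_fibre F H p A\<^esub> y \<in> GE (m + n)" if xy: "x \<in> GE m" "y \<in> GE n" for x y m n
    proof -
      obtain x' c where x: "x' \<in> G m" "x = b.tensor x' c" using xy(1) by (auto simp: GE_def)
      obtain y' d where y: "y' \<in> G n" "y = b.tensor y' d" using xy(2) by (auto simp: GE_def)
      have "x \<otimes>\<^bsub>eval_fibre F H p A\<^esub> y = b.tensor (x' \<otimes>\<^bsub>A\<^esub> y') (c * d)"
        using b.base_change_mult_pure[of x' c y' d] x y a.G_closed by (simp add: X)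
      thus ?thesis using a.G_mult[OF x(1) y(1)] unfolding GE_def by blast
    qed
    show "coact (eval_fibre F H p A) \<in> linear_maps complex_ring (eval_fibre F H p A)
        (tensor_algebra complex_ring (eval_fibre F H p A) H)"
      using coact_ext(1) by (simp only: ex(2-) X[THEN arg_cong[where f = "linear_maps complex_ring"]] X[THEN arg_cong[where f = "tensor_algebra complex_ring"]])
    show "coact (eval_fibre F H p A) x = pure_tensor complex_ring (eval_fibre F H p A) H x (T n)" if "x \<in> GE n" for x n
    proof -
      obtain x' c where x: "x' \<in> G n" "x = b.tensor x' c" using \<open>x \<in> GE n\<close> by (auto simp: GE_def)
      have xc: "x' \<in> carrier A" using x(1) by (rule a.G_closed)
      have "coact (eval_fibre F H p A) x = c \<odot>\<^bsub>TH\<^esub> pure_tensor complex_ring b.LM H (b.tensor x' 1) (T n)"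
        using x xc outer(2)[OF xc a.T_closed] inner_pure[OF xc h.T_closed, of "\<lambda>y. 1"]
        by (simp add: coact_ext(2) a.coact_G)
      also have "\<dots> = pure_tensor complex_ring b.LM H (c \<odot>\<^bsub>b.LM\<^esub> b.tensor x' 1) (T n)"
        using linear_maps_smult[OF pure_tensor_linear_left[OF LM h.H h.T_closed], of c "b.tensor x' 1"] xc
        by (simp del: base_change_simps(6))
      also have "c \<odot>\<^bsub>b.LM\<^esub> b.tensor x' 1 = x"
        using b.base_change_smult_pure[of c x' 1] x xc by simp
      finally show ?thesis by (simp add: X)
    qed
  qed
qed

end

lemma algebra_homs_compose:
  assumes "f \<in> algebra_homs K A B" "g \<in> algebra_homs K B D"
  shows "(\<lambda>x. g (f x)) \<in> algebra_homs K A D"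
  using linear_maps_compose[OF assms[THEN algebra_homs_linear]] algebra_homs_closed[OF assms(1)]
  by (intro algebra_homsI)
     (simp_all add: algebra_homs_mult[OF assms(1)] algebra_homs_mult[OF assms(2)]
        algebra_homs_one[OF assms(1)] algebra_homs_one[OF assms(2)])

lemma algebra_homs_id: "(\<lambda>x. x) \<in> algebra_homs K A A"
  by (intro algebra_homsI linear_maps_id) auto

lemma algebra_homs_extend [simp]:
  "algebra_homs K (module.extend A x) B = algebra_homs K A B"
  "algebra_homs K B (module.extend A x) = algebra_homs K B A"
  by (simp_all add: algebra_homs_def ring_hom_def)

lemma (in scalar_extension) algebra_homs_restrict:
  "f \<in> algebra_homs L M N \<Longrightarrow> f \<in> algebra_homs K (restrict_scalars \<phi> M) (restrict_scalars \<phi> N)"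
  by (simp add: algebra_homs_def linear_maps_restrict ring_hom_def)

lemma (in base_change_algebra) base_change_unit_hom:
  "(\<lambda>m. m \<diamondop> \<one>\<^bsub>L\<^esub>) \<in> algebra_homs K M (restrict_scalars \<phi> LM)"
  by (intro algebra_homsI base_change_unit_linear)
     (simp_all add: base_change_mult_pure tensor_algebra_one[OF algs])

lemma algebra_isosI:
  assumes "assoc_algebra K A" "assoc_algebra K B" "f \<in> algebra_homs K A B" "g \<in> algebra_homs K B A"
    "\<And>x. x \<in> carrier A \<Longrightarrow> g (f x) = x" "\<And>y. y \<in> carrier B \<Longrightarrow> f (g y) = y"
  shows "f \<in> algebra_isos K A B"
  unfolding algebra_isos_def
  using assms algebra_homs_closed[OF assms(3)] algebra_homs_closed[OF assms(4)]
  by (auto intro!: bij_betw_byWitness[where f' = g])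

section \<open>The deformation parameter and the classical limit\<close>

lemma deform_param_props:
  "deform_param \<theta> * inverse (deform_param \<theta>) = 1" "cnj (deform_param \<theta>) = inverse (deform_param \<theta>)"
  "cnj (inverse (deform_param \<theta>)) = deform_param \<theta>"
proof -
  have "deform_param \<theta> = cis (2 * pi * \<theta>)" by (simp add: deform_param_def cis_conv_exp mult_ac)
  thus "cnj (deform_param \<theta>) = inverse (deform_param \<theta>)" "cnj (inverse (deform_param \<theta>)) = deform_param \<theta>"
    by (simp_all add: cis_cnj)
qed (simp add: deform_param_def)

lemma deformed_sphere_complex:
  "deformed_sphere complex_ring cnj (deform_param \<theta>) (inverse (deform_param \<theta>))"
  by (intro deformed_sphere.intro deformed_sphere_axioms.intro complex_ring cnj_hom)
     (simp_all add: deform_param_props)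

lemma deformed_fibration_complex:
  "deformed_hopf_fibration complex_ring cnj (deform_param \<theta>) (inverse (deform_param \<theta>)) O_U1 u1_power u1_coord"
  by (intro deformed_hopf_fibration.intro deformed_sphere_complex O_U1_laurent)

lemma O_S3_deformed_eq:
  "O_S3_deformed \<theta> = deformed_hopf_fibration.fib complex_ring cnj (deform_param \<theta>) (inverse (deform_param \<theta>)) O_U1 u1_power"
  unfolding deformed_hopf_fibration.fib_def[OF deformed_fibration_complex] O_S3_deformed_def
  by (simp add: u1_power_letter)

text \<open>At parameter 0 the deformed relations become commutators. They name only some pairs of
  letters; their adjoints supply the other pairs, so the two star ideals coincide. The outcome is an
  equality of records, so the fibre at 0 needs no separate treatment.\<close>

lemma O_S3_eq: "O_S3 = O_S3_deformed 0"
proof -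
  let ?c = "commutation_relations complex_ring \<union> {sphere_relation complex_ring}"
  let ?d = "deformed_sphere_relations complex_ring 1 1"
  have one: "deform_param 0 = 1" by (simp add: deform_param_def)
  interpret D: deformed_sphere complex_ring cnj 1 1 using deformed_sphere_complex[of 0] by (simp add: one)
  have pc: "star_presentation complex_ring cnj ?c"
    by (intro star_presentation.intro star_presentation_axioms.intro complex_ring cnj_hom)
       (auto simp: commutation_relations_def sphere_relation_def Let_def)
  interpret E: star_presentation complex_ring cnj ?c by (rule pc)
  have sph: "sphere_relation complex_ring = (basis_elem complex_ring [Adj gen_z1, Gen gen_z1] \<oplus>\<^bsub>D.FA\<^esub>
      basis_elem complex_ring [Adj gen_z2, Gen gen_z2], \<one>\<^bsub>D.FA\<^esub>)"
    by (simp add: sphere_relation_def Let_def)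
  have sph_c: "(basis_elem complex_ring [Adj gen_z1, Gen gen_z1] \<oplus>\<^bsub>D.FA\<^esub>
      basis_elem complex_ring [Adj gen_z2, Gen gen_z2], \<one>\<^bsub>D.FA\<^esub>) \<in> ?c"
    and sph_d: "(basis_elem complex_ring [Adj gen_z1, Gen gen_z1] \<oplus>\<^bsub>D.FA\<^esub>
      basis_elem complex_ring [Adj gen_z2, Gen gen_z2], \<one>\<^bsub>D.FA\<^esub>) \<in> ?d"
    by (simp_all add: deformed_sphere_relations_def Let_def sph)
  have comm_d: "D.word [x, y] = D.word [y, x]" for x y
  proof -
    have "D.letr x \<otimes>\<^bsub>D.SA\<^esub> D.letr y = D.letr y \<otimes>\<^bsub>D.SA\<^esub> D.letr x"
      using D.letters D.SA.smult_one[unfolded complex_ring_simps] unfolding sphere_letters_def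
      by (cases x; cases y; rename_tac g g'; case_tac g; case_tac g'; simp)
    thus ?thesis by (simp add: D.letr_eq D.word_mult)
  qed
  have comm_c: "E.word [x, y] = E.word [y, x]" for x y
  proof -
    have "(basis_elem complex_ring [x, y], basis_elem complex_ring [y, x]) \<in> ?c"
      by (auto simp: commutation_relations_def)
    from E.rels_hold(1)[OF this] show ?thesis .
  qed
  have "star_ideal complex_ring cnj ?c = star_ideal complex_ring cnj ?d"
  proof
    show "star_ideal complex_ring cnj ?c \<subseteq> star_ideal complex_ring cnj ?d"
      by (rule star_ideal_subset[OF pc D.deformed_relations_presentation])
         (use comm_d D.rels_hold[OF sph_d] in \<open>auto simp: commutation_relations_def sph\<close>)
    have sm: "1 \<odot>\<^bsub>D.FA\<^esub> basis_elem complex_ring w = basis_elem complex_ring w" for w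
      using D.FA.smult_one[of "basis_elem complex_ring w"] by simp
    show "star_ideal complex_ring cnj ?d \<subseteq> star_ideal complex_ring cnj ?c"
      by (rule star_ideal_subset[OF D.deformed_relations_presentation pc])
         (use comm_c E.rels_hold[OF sph_c] in
           \<open>auto simp: deformed_sphere_relations_def Let_def sm sph\<close>)
  qed
  hence "star_algebra complex_ring cnj ?c = star_algebra complex_ring cnj ?d"
    "letter_class complex_ring cnj ?c = letter_class complex_ring cnj ?d"
    by (simp_all add: star_algebra_def letter_class_def fun_eq_iff)
  thus ?thesis by (simp add: O_S3_def O_S3_deformed_def hopf_fibration_def one)
qed

section \<open>The family over the function ring and its fibres\<close>

locale theta_family =
  fixes F :: "(real \<Rightarrow> complex) set" and \<theta> :: real
  assumes admissible: "admissible_functions F"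
begin

sublocale function_family F
  using admissible by unfold_locales (simp add: admissible_functions_def)

abbreviation Q where "Q \<equiv> (\<lambda>y. deform_param (\<theta> * y))"
abbreviation Q' where "Q' \<equiv> (\<lambda>y. inverse (deform_param (\<theta> * y)))"
abbreviation cjF where "cjF \<equiv> (\<lambda>(f :: real \<Rightarrow> complex) y. cnj (f y))"

text \<open>Both functions are exponentials, of frequencies 2\<pi>\<theta> and -2\<pi>\<theta>,
  which admissibility provides.\<close>

lemma Q_closed: "Q \<in> F" "Q' \<in> F"
proof -
  have e: "(\<lambda>y. exp (\<i> * complex_of_real c * complex_of_real y)) \<in> F" for c
    using admissible by (simp add: admissible_functions_def)
  have "Q = (\<lambda>y. exp (\<i> * complex_of_real (2 * pi * \<theta>) * complex_of_real y))"
    by (simp add: deform_param_def fun_eq_iff mult_ac)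
  thus "Q \<in> F" using e[of "2 * pi * \<theta>"] by simp
  have "Q' = (\<lambda>y. exp (\<i> * complex_of_real (- (2 * pi * \<theta>)) * complex_of_real y))"
    by (simp add: deform_param_def fun_eq_iff mult_ac flip: exp_minus)
  thus "Q' \<in> F" using e[of "- (2 * pi * \<theta>)"] by simp
qed

sublocale u: laurent_base_change complex_ring R const_fun O_U1 u1_power u1_coord
  by (intro laurent_base_change.intro base_change_algebra.intro constants O_U1_laurent laurent_hopf.H[OF O_U1_laurent])

lemma family_sphere: "deformed_sphere R cjF Q Q'"
  by (intro deformed_sphere.intro deformed_sphere_axioms.intro R)
     (auto simp: ring_hom_def Q_closed deform_param_props)

sublocale fam: deformed_hopf_fibration R cjF Q Q' "hopf_family F O_U1" "\<lambda>n. u.tensor (u1_power n) (\<lambda>y. 1)" u.CL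
  using u.laurent by (intro deformed_hopf_fibration.intro family_sphere) simp

lemma O_S3_family_eq: "O_S3_family F \<theta> = fam.fib"
  unfolding O_S3_family_def fam.fib_def Let_def by (simp add: u1_power_letter)

end

locale theta_fibre = theta_family F \<theta> for F \<theta> +
  fixes p :: real
begin

sublocale e: fibre F O_U1 u1_power u1_coord u.CL fam.fib fam.words_of_degree p
proof (intro fibre.intro function_family_axioms O_U1_laurent)
  show "graded_comodule_algebra R (hopf_family F O_U1)
      (\<lambda>n. pure_tensor complex_ring O_U1 (ring_as_algebra R const_fun) (u1_power n) (\<lambda>y. 1)) u.CL fam.fib fam.words_of_degree"
    using fam.fib.graded_comodule_algebra_axioms by simp
qed

sublocale d: deformed_hopf_fibration complex_ring cnj "deform_param (\<theta> * p)" "inverse (deform_param (\<theta> * p))"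
    O_U1 u1_power u1_coord
  by (rule deformed_fibration_complex)

lemma fibre_isomorphic:
  "comodule_algebra_isomorphic complex_ring O_U1 (eval_fibre F O_U1 p (O_S3_family F \<theta>)) (O_S3_deformed (\<theta> * p))"
proof -
  let ?RS = "restrict_scalars e.ev d.SA"
  note [simp del] = base_change_simps(6)
  obtain X where X: "fam.fib = module.extend fam.SA X" using fam.fib_eq by blast
  obtain Y where Y: "d.fib = module.extend d.SA Y" using d.fib_eq by blast
  obtain Z where Z: "eval_fibre F O_U1 p fam.fib = module.extend e.b.LM Z" using e.eval_fibre_eq by blast
  have RS: "assoc_algebra R ?RS" by (rule e.b.restrict_scalars_assoc_algebra[OF d.SA])
  \<comment> \<open>The sphere at parameter \<open>\<theta> * p\<close> becomes an algebra over
    functions by evaluation at \<open>p\<close>; there \<open>Q\<close> acts as the number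
    \<open>Q p\<close>, so its letters obey the relations of the family.\<close>
  have l\<pi>: "sphere_letters ?RS Q Q' d.letr"
    using d.letters by (simp add: sphere_letters_def)
  define \<pi> where "\<pi> = hom_from_letters R ?RS d.letr"
  have \<pi>: "\<pi> \<in> algebra_homs R fam.SA ?RS" "\<And>x. \<pi> (fam.letr x) = d.letr x"
    "\<And>w. \<pi> (fam.word w) = foldr (\<lambda>x y. d.letr x \<otimes>\<^bsub>?RS\<^esub> y) w \<one>\<^bsub>?RS\<^esub>"
    unfolding \<pi>_def
    by (rule fam.sphere_hom[OF RS l\<pi>] fam.sphere_hom_letr[OF RS l\<pi>] fam.sphere_hom_word[OF RS l\<pi>])+
  have \<pi>w: "\<pi> (fam.word w) = d.word w" for w
    unfolding \<pi>(3) by (induction w) (simp_all add: d.word_Nil d.word_Cons)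
  define f where "f = lin_lift R ?RS (\<lambda>(a, c). c \<odot>\<^bsub>d.SA\<^esub> \<pi> a)"
  have \<pi>': "\<pi> \<in> algebra_homs R fam.fib ?RS" using \<pi>(1) by (simp only: X algebra_homs_extend)
  have f: "f \<in> algebra_homs complex_ring e.b.LM d.SA"
    unfolding f_def by (rule e.b.base_change_extend_hom[OF d.SA \<pi>'])
  have fp: "f (e.b.tensor a c) = c \<odot>\<^bsub>d.SA\<^esub> \<pi> a" if "a \<in> carrier fam.SA" for a c
    unfolding f_def by (rule e.b.base_change_extend_pure[OF d.SA.module_axioms algebra_homs_linear[OF \<pi>']])
      (simp_all only: X module_extend_simps that complex_ring_simps UNIV_I)
  note LM = e.b.base_change_assoc_algebra
  have unit: "(\<lambda>a. e.b.tensor a 1) \<in> algebra_homs R fam.SA (restrict_scalars e.ev e.b.LM)"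
    using e.b.base_change_unit_hom by (simp only: X algebra_homs_extend complex_ring_simps)
  \<comment> \<open>Conversely, in the fibre a function \<open>f\<close> crosses the tensor sign as
    the number \<open>f p\<close>, so the classes of the letters obey the relations with parameter
    \<open>Q p\<close>.\<close>
  have lg: "sphere_letters e.b.LM (Q p) (Q' p) (\<lambda>x. e.b.tensor (fam.letr x) 1)"
  proof -
    have sm: "f p \<odot>\<^bsub>e.b.LM\<^esub> e.b.tensor a 1 = e.b.tensor (f \<odot>\<^bsub>fam.SA\<^esub> a) 1" if "f \<in> F" "a \<in> carrier fam.SA" for f a
      using algebra_homs_smult[OF unit, of f a] that by simp
    note L = fam.letters[unfolded sphere_letters_def]
    show ?thesis
      unfolding sphere_letters_def
      using L algebra_homs_closed[OF unit]
      by (simp add: algebra_homs_mult[OF unit, simplified, symmetric] algebra_homs_add[OF unit, simplified, symmetric]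
          algebra_homs_one[OF unit, simplified, symmetric] sm[OF Q_closed(1)] sm[OF Q_closed(2)] image_subset_iff)
  qed
  define g where "g = hom_from_letters complex_ring e.b.LM (\<lambda>x. e.b.tensor (fam.letr x) 1)"
  have g: "g \<in> algebra_homs complex_ring d.SA e.b.LM" "\<And>x. g (d.letr x) = e.b.tensor (fam.letr x) 1"
    unfolding g_def by (rule d.sphere_hom[OF LM lg] d.sphere_hom_letr[OF LM lg])+
  have fg: "f (g y) = y" if "y \<in> carrier d.SA" for y
    by (rule d.hom_eq_on_letters[OF d.SA algebra_homs_compose[OF g(1) f] algebra_homs_id _ that])
       (simp add: g(2) fp \<pi>(2) d.SA.smult_one[unfolded complex_ring_simps])
  \<comment> \<open>Both sides are homomorphisms over the function ring, so letters suffice. With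
    this, \<open>gf\<close> has to be checked only on the spanning elements a \<otimes> 1.\<close>
  have g\<pi>: "g (\<pi> a) = e.b.tensor a 1" if "a \<in> carrier fam.SA" for a
    by (rule fam.hom_eq_on_letters[OF e.b.restrict_scalars_assoc_algebra[OF LM]
          algebra_homs_compose[OF \<pi>(1) e.b.algebra_homs_restrict[OF g(1)]] unit _ that])
       (simp add: \<pi>(2) g(2))
  have gf: "g (f u) = u" if u: "u \<in> carrier e.b.LM" for u
  proof (rule linear_maps_eqI[OF e.b.LM.module_axioms e.b.LM.module_axioms e.b.base_change_spanning[OF spanning_carrier]
        algebra_homs_linear[OF algebra_homs_compose[OF f g(1)]] linear_maps_id _ u])
    fix w assume "w \<in> (\<lambda>m. e.b.tensor m \<one>\<^bsub>complex_ring\<^esub>) ` carrier fam.fib"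
    then obtain a where a: "a \<in> carrier fam.SA" "w = e.b.tensor a 1"
      by (simp only: X module_extend_simps complex_ring_simps) blast
    have "\<pi> a \<in> carrier d.SA" using algebra_homs_closed[OF \<pi>(1) a(1)] by simp
    thus "g (f w) = w" using a by (simp add: fp g\<pi> d.SA.smult_one[unfolded complex_ring_simps])
  qed
  have iso: "f \<in> algebra_isos complex_ring e.b.LM d.SA"
    by (rule algebra_isosI[OF LM d.SA f g(1) gf fg])
  have "comodule_algebra_isomorphic complex_ring O_U1 (eval_fibre F O_U1 p fam.fib) d.fib"
  proof (rule comodule_algebra_isomorphicI[OF e.graded d.fib.comodule_algebra])
    show "f \<in> algebra_isos complex_ring (eval_fibre F O_U1 p fam.fib) d.fib"
      using iso by (simp only: algebra_isos_def Z Y algebra_homs_extend module_extend_simps)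
    fix x n assume "x \<in> e.GE n"
    then obtain w c where w: "degree w = n" "x = e.b.tensor (fam.word w) c"
      by (auto simp: e.GE_def fam.words_of_degree_def)
    have fx: "f x = c \<odot>\<^bsub>d.SA\<^esub> d.word w" by (simp add: w fp \<pi>w)
    have "coact d.fib (c \<odot>\<^bsub>d.SA\<^esub> d.word w) = c \<odot>\<^bsub>tensor_algebra complex_ring d.SA O_U1\<^esub> coact d.fib (d.word w)"
      using linear_maps_smult[OF d.fib.coact_linear, of c "d.word w"] by (simp add: Y)
    also have "\<dots> = pure_tensor complex_ring d.SA O_U1 (f x) (u1_power n)"
      using linear_maps_smult[OF pure_tensor_linear_left[OF d.SA laurent_hopf.H[OF O_U1_laurent] laurent_hopf.T_closed[OF O_U1_laurent]], of c "d.word w" "n"]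
      by (simp add: d.coact_word w(1) fx)
    finally show "coact d.fib (f x) = pure_tensor complex_ring d.fib O_U1 (f x) (u1_power n)"
      by (simp add: fx Y)
  qed
  thus ?thesis by (simp add: O_S3_family_eq O_S3_deformed_eq)
qed

end

section \<open>The two-sphere\<close>

definition s2_relations where
  "s2_relations = (let F = free_algebra complex_ring; w = basis_elem complex_ring in
     commutation_relations complex_ring \<union>
     {(w [Adj gen_x], w [Gen gen_x]),
      (w [Adj gen_z, Gen gen_z] \<oplus>\<^bsub>F\<^esub> w [Gen gen_x, Gen gen_x], \<one>\<^bsub>F\<^esub>)})"

lemma O_S2_eq: "O_S2 = star_algebra complex_ring cnj s2_relations"
  by (simp add: O_S2_def s2_relations_def Let_def)

lemma s2_presentation: "star_presentation complex_ring cnj s2_relations"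
proof -
  have FA: "assoc_algebra complex_ring (free_algebra complex_ring)"
    unfolding free_algebra_def by (rule monoid_algebra_assoc_algebra[OF complex_ring word_monoid])
  interpret FA: assoc_algebra complex_ring "free_algebra complex_ring" by (rule FA)
  have "basis_elem complex_ring w \<in> carrier (free_algebra complex_ring)" for w
    unfolding free_algebra_def by (rule basis_elem_closed[OF complex_ring]) simp
  thus ?thesis
    by (intro star_presentation.intro star_presentation_axioms.intro complex_ring cnj_hom)
       (auto simp: s2_relations_def commutation_relations_def Let_def)
qed

interpretation S: star_presentation complex_ring cnj s2_relations
  by (rule s2_presentation)

abbreviation s2z where "s2z \<equiv> S.letr (Gen gen_z)"
abbreviation s2zs where "s2zs \<equiv> S.letr (Adj gen_z)"
abbreviation s2x where "s2x \<equiv> S.letr (Gen gen_x)"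

lemma s2_commute: "S.letr x \<otimes>\<^bsub>S.SA\<^esub> S.letr y = S.letr y \<otimes>\<^bsub>S.SA\<^esub> S.letr x"
proof -
  have "(basis_elem complex_ring [x, y], basis_elem complex_ring [y, x]) \<in> s2_relations"
    by (auto simp: s2_relations_def commutation_relations_def Let_def)
  from S.rels_hold(1)[OF this] show ?thesis by (simp add: S.letr_eq S.word_mult)
qed

lemma s2_selfadjoint: "S.letr (Adj gen_x) = s2x"
proof -
  have "(basis_elem complex_ring [Adj gen_x], basis_elem complex_ring [Gen gen_x]) \<in> s2_relations"
    by (auto simp: s2_relations_def Let_def)
  from S.rels_hold(1)[OF this] show ?thesis by (simp add: S.letr_eq)
qed

lemma s2_sphere: "s2zs \<otimes>\<^bsub>S.SA\<^esub> s2z \<oplus>\<^bsub>S.SA\<^esub> s2x \<otimes>\<^bsub>S.SA\<^esub> s2x = \<one>\<^bsub>S.SA\<^esub>"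
proof -
  have "(basis_elem complex_ring [Adj gen_z, Gen gen_z] \<oplus>\<^bsub>S.FA\<^esub> basis_elem complex_ring [Gen gen_x, Gen gen_x], \<one>\<^bsub>S.FA\<^esub>) \<in> s2_relations"
    by (auto simp: s2_relations_def Let_def)
  from S.rels_hold(1)[OF this] show ?thesis
    by (simp add: S.letr_eq S.word_mult S.FA_one S.word_Nil algebra_homs_add[OF S.cls_hom S.basis_closed S.basis_closed])
qed

lemma s2_universal:
  assumes P: "assoc_algebra complex_ring P" and v: "\<And>x. v x \<in> carrier P"
    and comm: "\<And>x y. v x \<otimes>\<^bsub>P\<^esub> v y = v y \<otimes>\<^bsub>P\<^esub> v x"
    and sa: "v (Adj gen_x) = v (Gen gen_x)"
    and sph: "v (Adj gen_z) \<otimes>\<^bsub>P\<^esub> v (Gen gen_z) \<oplus>\<^bsub>P\<^esub> v (Gen gen_x) \<otimes>\<^bsub>P\<^esub> v (Gen gen_x) = \<one>\<^bsub>P\<^esub>"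
  shows s2_hom: "hom_from_letters complex_ring P v \<in> algebra_homs complex_ring S.SA P"
    and s2_hom_letr: "hom_from_letters complex_ring P v (S.letr x) = v x"
proof -
  interpret P: assoc_algebra complex_ring P by (rule P)
  note h = S.ext_letters_hom[OF P v]
  note E = S.ext_letters_basis[OF P v] algebra_homs_one[OF h] algebra_homs_add[OF h] v S.free_star_add
  have 1: "S.ext_letters P v r = S.ext_letters P v s" if "(r, s) \<in> s2_relations" for r s
    using that comm sa sph by (auto simp: s2_relations_def commutation_relations_def Let_def E)
  have 2: "S.ext_letters P v (free_star cnj r) = S.ext_letters P v (free_star cnj s)" if "(r, s) \<in> s2_relations" for r s
    using that comm sa sph by (auto simp: s2_relations_def commutation_relations_def Let_def E)
  show "hom_from_letters complex_ring P v \<in> algebra_homs complex_ring S.SA P"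
    by (rule S.hom_from_letters_hom[OF P v 1 2])
  show "hom_from_letters complex_ring P v (S.letr x) = v x"
    by (rule S.hom_from_letters_letr[OF P v 1 2])
qed

text \<open>Letters commute by the relations; an induction on words passes this to a letter and any
  element, a second one to any two elements. Commutativity is what permits rearranging the monomials
  below.\<close>

lemma s2_cring: "cring S.SA"
proof -
  have 1: "S.letr x \<otimes>\<^bsub>S.SA\<^esub> b = b \<otimes>\<^bsub>S.SA\<^esub> S.letr x" if "b \<in> carrier S.SA" for x b
  proof (rule linear_maps_eqI[OF S.SA.module_axioms S.SA.module_axioms S.word_spanning
        S.SA.mult_left_linear[OF S.letr_closed] S.SA.mult_right_linear[OF S.letr_closed] _ that])
    have "S.letr x \<otimes>\<^bsub>S.SA\<^esub> S.word w = S.word w \<otimes>\<^bsub>S.SA\<^esub> S.letr x" for w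
    proof (induction w)
      case (Cons y w)
      have "S.letr x \<otimes>\<^bsub>S.SA\<^esub> S.word (y # w) = (S.letr y \<otimes>\<^bsub>S.SA\<^esub> S.letr x) \<otimes>\<^bsub>S.SA\<^esub> S.word w"
        by (simp add: S.word_Cons s2_commute[of y x] flip: S.SA.A.m_assoc)
      also have "\<dots> = S.word (y # w) \<otimes>\<^bsub>S.SA\<^esub> S.letr x"
        using Cons by (simp add: S.word_Cons S.SA.A.m_assoc)
      finally show ?case .
    qed (simp add: S.word_Nil)
    thus "S.letr x \<otimes>\<^bsub>S.SA\<^esub> b = b \<otimes>\<^bsub>S.SA\<^esub> S.letr x" if "b \<in> range (\<lambda>w. S.word w)" for b using that by auto
  qed
  have 2: "a \<otimes>\<^bsub>S.SA\<^esub> b = b \<otimes>\<^bsub>S.SA\<^esub> a" if "a \<in> carrier S.SA" "b \<in> carrier S.SA" for a b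
  proof (rule linear_maps_eqI[OF S.SA.module_axioms S.SA.module_axioms S.word_spanning
        S.SA.mult_right_linear[OF that(2)] S.SA.mult_left_linear[OF that(2)] _ that(1)])
    have "S.word w \<otimes>\<^bsub>S.SA\<^esub> b = b \<otimes>\<^bsub>S.SA\<^esub> S.word w" for w
    proof (induction w)
      case (Cons y w)
      have "S.word (y # w) \<otimes>\<^bsub>S.SA\<^esub> b = (S.letr y \<otimes>\<^bsub>S.SA\<^esub> b) \<otimes>\<^bsub>S.SA\<^esub> S.word w"
        using Cons that(2) by (simp add: S.word_Cons S.SA.A.m_assoc)
      also have "\<dots> = b \<otimes>\<^bsub>S.SA\<^esub> S.word (y # w)"
        using that(2) by (simp add: S.word_Cons 1 S.SA.A.m_assoc)
      finally show ?case .
    qed (simp add: S.word_Nil that(2))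
    thus "a \<otimes>\<^bsub>S.SA\<^esub> b = b \<otimes>\<^bsub>S.SA\<^esub> a" if "a \<in> range (\<lambda>w. S.word w)" for a using that by auto
  qed
  show ?thesis
    by (intro cring.intro S.SA.A.ring_axioms comm_monoid.intro comm_monoid_axioms.intro S.SA.A.monoid_axioms 2)
qed

text \<open>A normal form: since z and its adjoint multiply to 1 - x^2, they need never occur
  together, so one integer records both exponents, a negative one standing for a power of the
  adjoint.\<close>

definition s2_monomial :: "int \<times> nat \<Rightarrow> (s2_gen letter list \<Rightarrow> complex) set" where
  "s2_monomial = (\<lambda>(n, j). (if n \<ge> 0 then s2z [^]\<^bsub>S.SA\<^esub> nat n else s2zs [^]\<^bsub>S.SA\<^esub> nat (- n)) \<otimes>\<^bsub>S.SA\<^esub>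
     (s2x [^]\<^bsub>S.SA\<^esub> j))"

interpretation SC: cring S.SA by (rule s2_cring)

lemma s2_monomial_nonneg: "s2_monomial (int n, j) = s2z [^]\<^bsub>S.SA\<^esub> n \<otimes>\<^bsub>S.SA\<^esub> s2x [^]\<^bsub>S.SA\<^esub> j"
  and s2_monomial_nonpos: "s2_monomial (- int n, j) = s2zs [^]\<^bsub>S.SA\<^esub> n \<otimes>\<^bsub>S.SA\<^esub> s2x [^]\<^bsub>S.SA\<^esub> j"
  by (simp_all add: s2_monomial_def)

lemma int_sign_cases:
  obtains (nonneg) k where "n = int k" | (neg) k where "n = - int (Suc k)"
  by (cases n) auto

lemma s2_monomial_closed: "s2_monomial p \<in> carrier S.SA"
proof (cases p)
  case (Pair n j)
  show ?thesis unfolding Pair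
    by (cases n rule: int_sign_cases) (simp_all only: s2_monomial_nonneg s2_monomial_nonpos
        S.SA.A.m_closed S.SA.A.nat_pow_closed S.letr_closed)
qed

lemma s2_monomial_zero: "s2_monomial (0, j) = s2x [^]\<^bsub>S.SA\<^esub> j"
  using s2_monomial_nonneg[of 0 j] by simp

lemma s2_monomial_Suc:
  "s2_monomial (int (Suc n), j) = s2z \<otimes>\<^bsub>S.SA\<^esub> s2_monomial (int n, j)"
  "s2_monomial (- int (Suc n), j) = s2zs \<otimes>\<^bsub>S.SA\<^esub> s2_monomial (- int n, j)"
  unfolding s2_monomial_nonneg s2_monomial_nonpos by (simp_all add: SC.m_ac)

lemma s2_monomial_x: "s2x \<otimes>\<^bsub>S.SA\<^esub> s2_monomial (n, j) = s2_monomial (n, Suc j)"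
  by (cases n rule: int_sign_cases)
     (simp_all only: s2_monomial_nonneg s2_monomial_nonpos, simp_all add: SC.m_ac)

text \<open>The span \<open>N\<close> of the monomials contains the unit and is closed under left
  multiplication by letters, hence contains all words. The case that is not immediate, z meeting its
  adjoint, is reduced by \<open>zz\<close>.\<close>

lemma s2_spanning: "spanning complex_ring S.SA (range s2_monomial)"
proof (rule spanning_trans[OF S.SA.module_axioms S.word_spanning])
  show "range s2_monomial \<subseteq> carrier S.SA" using s2_monomial_closed by blast
  define N where "N = submodule_generated complex_ring S.SA (range s2_monomial)"
  have N: "submodule N complex_ring S.SA"
    unfolding N_def by (rule submodule_generated_submodule[OF S.SA.module_axioms]) (auto simp: s2_monomial_closed)
  have m: "s2_monomial p \<in> N" for p
    unfolding N_def by (rule subsetD[OF submodule_generated_subset rangeI])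
  note Nz = submodule_zero[OF S.SA.module_axioms N] and Na = submodule_add[OF S.SA.module_axioms N]
    and Ns = submodule_smult[OF S.SA.module_axioms N]
  \<comment> \<open>The sphere relation solved for the product of the adjoint of z with z, and
    applied to an arbitrary right factor.\<close>
  have zz: "s2zs \<otimes>\<^bsub>S.SA\<^esub> (s2z \<otimes>\<^bsub>S.SA\<^esub> a) = a \<oplus>\<^bsub>S.SA\<^esub> (- 1) \<odot>\<^bsub>S.SA\<^esub> (s2x \<otimes>\<^bsub>S.SA\<^esub> (s2x \<otimes>\<^bsub>S.SA\<^esub> a))"
    if "a \<in> carrier S.SA" for a
  proof -
    have "\<ominus>\<^bsub>complex_ring\<^esub> \<one>\<^bsub>complex_ring\<^esub> = - 1"
      using cring.axioms(1)[OF complex_ring, THEN ring.is_abelian_group, THEN abelian_group.minus_equality, of "-1" 1] by simp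
    hence min: "(- 1) \<odot>\<^bsub>S.SA\<^esub> c = \<ominus>\<^bsub>S.SA\<^esub> c" if "c \<in> carrier S.SA" for c
      using S.SA.minus_eq_smult[OF that] by simp
    have "a = (s2zs \<otimes>\<^bsub>S.SA\<^esub> s2z \<oplus>\<^bsub>S.SA\<^esub> s2x \<otimes>\<^bsub>S.SA\<^esub> s2x) \<otimes>\<^bsub>S.SA\<^esub> a" using that by (simp add: s2_sphere)
    hence "a = s2zs \<otimes>\<^bsub>S.SA\<^esub> (s2z \<otimes>\<^bsub>S.SA\<^esub> a) \<oplus>\<^bsub>S.SA\<^esub> s2x \<otimes>\<^bsub>S.SA\<^esub> (s2x \<otimes>\<^bsub>S.SA\<^esub> a)"
      using that by (simp add: S.SA.A.l_distr S.SA.A.m_assoc)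
    thus ?thesis using that by (simp add: min) (metis S.SA.add.inv_solve_right S.SA.A.m_closed S.letr_closed)
  qed
  have step: "S.letr y \<otimes>\<^bsub>S.SA\<^esub> s2_monomial (n, j) \<in> N" for y n j
  proof -
    have x: "s2x \<otimes>\<^bsub>S.SA\<^esub> s2_monomial (n, j) \<in> N" by (simp add: s2_monomial_x m)
    have z: "s2z \<otimes>\<^bsub>S.SA\<^esub> s2_monomial (n, j) \<in> N"
    proof (cases "n \<ge> 0")
      case True
      thus ?thesis using s2_monomial_Suc(1)[of "nat n" j, symmetric] m by simp
    next
      case False
      then obtain k where k: "n = - int (Suc k)" by (cases n rule: int_sign_cases) auto
      have "s2z \<otimes>\<^bsub>S.SA\<^esub> s2_monomial (n, j) = s2zs \<otimes>\<^bsub>S.SA\<^esub> (s2z \<otimes>\<^bsub>S.SA\<^esub> s2_monomial (- int k, j))"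
        unfolding k s2_monomial_Suc(2) using s2_monomial_closed by (simp add: SC.m_lcomm)
      also have "\<dots> \<in> N" using s2_monomial_closed by (simp add: zz s2_monomial_x) (intro Na Ns m; simp)
      finally show ?thesis .
    qed
    have zs: "s2zs \<otimes>\<^bsub>S.SA\<^esub> s2_monomial (n, j) \<in> N"
    proof (cases "n \<le> 0")
      case True
      thus ?thesis using s2_monomial_Suc(2)[of "nat (- n)" j, symmetric] m by simp
    next
      case False
      then obtain k where k: "n = int (Suc k)" by (metis zero_less_imp_eq_int not_le Suc_pred)
      have "s2zs \<otimes>\<^bsub>S.SA\<^esub> s2_monomial (n, j) = s2zs \<otimes>\<^bsub>S.SA\<^esub> (s2z \<otimes>\<^bsub>S.SA\<^esub> s2_monomial (int k, j))"
        unfolding k s2_monomial_Suc(1) ..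
      also have "\<dots> \<in> N" using s2_monomial_closed by (simp add: zz s2_monomial_x) (intro Na Ns m; simp)
      finally show ?thesis .
    qed
    show ?thesis using x z zs s2_selfadjoint by (cases y; rename_tac g; case_tac g) auto
  qed
  have closed: "S.letr y \<otimes>\<^bsub>S.SA\<^esub> a \<in> N" if "a \<in> N" for y a
  proof -
    have "submodule {a \<in> carrier S.SA. S.letr y \<otimes>\<^bsub>S.SA\<^esub> a \<in> N} complex_ring S.SA"
      by (rule submodule_sep[OF S.SA.module_axioms]) (auto simp: S.SA.A.r_distr S.SA.smult_mult_right Nz Na Ns)
    hence "N \<subseteq> {a \<in> carrier S.SA. S.letr y \<otimes>\<^bsub>S.SA\<^esub> a \<in> N}"
      unfolding N_def by (rule submodule_generated_minimal) (use s2_monomial_closed step in \<open>auto simp: N_def\<close>)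
    thus ?thesis using that by blast
  qed
  have word: "S.word w \<in> N" for w
  proof (induction w)
    case Nil
    have "S.word [] = s2_monomial (0, 0)" by (simp add: S.word_Nil s2_monomial_zero)
    thus ?case using m by simp
  qed (simp add: S.word_Cons closed)
  fix b N' assume "b \<in> range (\<lambda>w. S.word w)" "submodule N' complex_ring S.SA" "range s2_monomial \<subseteq> N'"
  thus "b \<in> N'" using word submodule_generated_minimal[of N'] unfolding N_def by blast
qed

section \<open>Coinvariants of the Hopf fibrations\<close>

primrec letter_base :: "'g letter \<Rightarrow> 'g" where
  "letter_base (Gen g) = g" | "letter_base (Adj g) = g"

section \<open>Commutation of letters in the deformed sphere\<close>

context deformed_sphere
begin

abbreviation Z1 where "Z1 \<equiv> letr (Gen gen_z1)"
abbreviation Z2 where "Z2 \<equiv> letr (Gen gen_z2)"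
abbreviation Z1s where "Z1s \<equiv> letr (Adj gen_z1)"
abbreviation Z2s where "Z2s \<equiv> letr (Adj gen_z2)"

text \<open>This is \<open>q\<close> to the power m1 m2' - m2 m1', where (m1, m2) and (m1', m2') are
  the degrees of the two letters in the grading by pairs of integers: (1, 0) and (0, 1) for the
  generators, the negatives for their adjoints.\<close>

definition qc :: "s3_gen letter \<Rightarrow> s3_gen letter \<Rightarrow> 'k" where
  "qc x y = (if letter_base x = letter_base y then \<one>\<^bsub>K\<^esub>
     else if (letter_base x = gen_z1) = (letter_degree x = letter_degree y) then q else q')"

lemma qc_closed [simp]: "qc x y \<in> carrier K" by (simp add: qc_def)

lemma q_inv': "q' \<otimes>\<^bsub>K\<^esub> q = \<one>\<^bsub>K\<^esub>" using q_inv K0.m_comm by simp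

lemma qc_adjoint: "qc x y \<otimes>\<^bsub>K\<^esub> qc x (adjoint y) = \<one>\<^bsub>K\<^esub>"
  by (cases x; cases y) (auto simp: qc_def q_inv q_inv')

lemma letr_commute: "letr x \<otimes>\<^bsub>SA\<^esub> letr y = qc x y \<odot>\<^bsub>SA\<^esub> (letr y \<otimes>\<^bsub>SA\<^esub> letr x)"
proof -
  \<comment> \<open>Each relation is also used with its sides exchanged and the inverse scalar. The
    four relations and their inverses, normality and the case of equal letters cover all sixteen
    pairs.\<close>
  have flip: "b = k' \<odot>\<^bsub>SA\<^esub> a" if "a = k \<odot>\<^bsub>SA\<^esub> b" "k' \<otimes>\<^bsub>K\<^esub> k = \<one>\<^bsub>K\<^esub>" "k \<in> carrier K" "k' \<in> carrier K" "b \<in> carrier SA" for a b k k'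
    using that by (simp add: SA.smult_assoc1[symmetric])
  note L = letters[unfolded sphere_letters_def]
  have r: "Z1 \<otimes>\<^bsub>SA\<^esub> Z2 = q \<odot>\<^bsub>SA\<^esub> (Z2 \<otimes>\<^bsub>SA\<^esub> Z1)" "Z1 \<otimes>\<^bsub>SA\<^esub> Z2s = q' \<odot>\<^bsub>SA\<^esub> (Z2s \<otimes>\<^bsub>SA\<^esub> Z1)"
    "Z2s \<otimes>\<^bsub>SA\<^esub> Z1s = q' \<odot>\<^bsub>SA\<^esub> (Z1s \<otimes>\<^bsub>SA\<^esub> Z2s)" "Z2 \<otimes>\<^bsub>SA\<^esub> Z1s = q \<odot>\<^bsub>SA\<^esub> (Z1s \<otimes>\<^bsub>SA\<^esub> Z2)"
    using L by blast+
  have rf: "Z2 \<otimes>\<^bsub>SA\<^esub> Z1 = q' \<odot>\<^bsub>SA\<^esub> (Z1 \<otimes>\<^bsub>SA\<^esub> Z2)" "Z2s \<otimes>\<^bsub>SA\<^esub> Z1 = q \<odot>\<^bsub>SA\<^esub> (Z1 \<otimes>\<^bsub>SA\<^esub> Z2s)"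
    "Z1s \<otimes>\<^bsub>SA\<^esub> Z2s = q \<odot>\<^bsub>SA\<^esub> (Z2s \<otimes>\<^bsub>SA\<^esub> Z1s)" "Z1s \<otimes>\<^bsub>SA\<^esub> Z2 = q' \<odot>\<^bsub>SA\<^esub> (Z2 \<otimes>\<^bsub>SA\<^esub> Z1s)"
    by (rule flip[OF r(1)] flip[OF r(2)] flip[OF r(3)] flip[OF r(4)]; simp add: q_inv q_inv')+
  have n: "Z1 \<otimes>\<^bsub>SA\<^esub> Z1s = Z1s \<otimes>\<^bsub>SA\<^esub> Z1" "Z2 \<otimes>\<^bsub>SA\<^esub> Z2s = Z2s \<otimes>\<^bsub>SA\<^esub> Z2" using L by blast+
  have s: "a \<otimes>\<^bsub>SA\<^esub> b = \<one>\<^bsub>K\<^esub> \<odot>\<^bsub>SA\<^esub> (b \<otimes>\<^bsub>SA\<^esub> a)" if "a \<otimes>\<^bsub>SA\<^esub> b = b \<otimes>\<^bsub>SA\<^esub> a" "a \<in> carrier SA" "b \<in> carrier SA" for a b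
    using that by simp
  obtain g where x: "x = Gen g \<or> x = Adj g" by (cases x) auto
  obtain h where y: "y = Gen h \<or> y = Adj h" by (cases y) auto
  show ?thesis
    using x y by (cases g; cases h; elim disjE)
      (simp_all only: qc_def letter_base.simps letter_degree.simps s3_gen.distinct simp_thms if_True if_False
        one_neq_neg_one neg_one_neq_one,
       (rule r rf s n letr_closed refl n[symmetric] | simp)+)
qed

text \<open>A letter moved past \<open>y\<close> and past its adjoint collects two factors that are
  inverse to each other, by \<open>qc_adjoint\<close>. Hence the product commutes with every letter,
  whatever \<open>q\<close> is.\<close>

lemma letr_pair_central:
  assumes "a \<in> carrier SA"
  shows "a \<otimes>\<^bsub>SA\<^esub> (letr y \<otimes>\<^bsub>SA\<^esub> letr (adjoint y)) = (letr y \<otimes>\<^bsub>SA\<^esub> letr (adjoint y)) \<otimes>\<^bsub>SA\<^esub> a"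
proof -
  let ?N = "letr y \<otimes>\<^bsub>SA\<^esub> letr (adjoint y)"
  have l: "letr x \<otimes>\<^bsub>SA\<^esub> ?N = ?N \<otimes>\<^bsub>SA\<^esub> letr x" for x
  proof -
    have "letr x \<otimes>\<^bsub>SA\<^esub> ?N = (letr x \<otimes>\<^bsub>SA\<^esub> letr y) \<otimes>\<^bsub>SA\<^esub> letr (adjoint y)" by (simp add: SA.A.m_assoc)
    also have "\<dots> = qc x y \<odot>\<^bsub>SA\<^esub> (letr y \<otimes>\<^bsub>SA\<^esub> (letr x \<otimes>\<^bsub>SA\<^esub> letr (adjoint y)))"
      by (subst letr_commute) (simp add: SA.smult_mult_left SA.A.m_assoc)
    also have "\<dots> = (qc x y \<otimes>\<^bsub>K\<^esub> qc x (adjoint y)) \<odot>\<^bsub>SA\<^esub> (?N \<otimes>\<^bsub>SA\<^esub> letr x)"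
      by (subst letr_commute[of x "adjoint y"]) (simp add: SA.smult_mult_right SA.smult_assoc1 SA.A.m_assoc)
    finally show ?thesis by (simp add: qc_adjoint)
  qed
  have w: "word w \<otimes>\<^bsub>SA\<^esub> ?N = ?N \<otimes>\<^bsub>SA\<^esub> word w" for w
  proof (induction w)
    case (Cons x w)
    have "word (x # w) \<otimes>\<^bsub>SA\<^esub> ?N = letr x \<otimes>\<^bsub>SA\<^esub> (?N \<otimes>\<^bsub>SA\<^esub> word w)"
      using Cons by (simp add: word_Cons SA.A.m_assoc[of "letr x" "word w"])
    also have "\<dots> = (?N \<otimes>\<^bsub>SA\<^esub> letr x) \<otimes>\<^bsub>SA\<^esub> word w"
      by (simp only: l[symmetric]) (simp add: SA.A.m_assoc)
    also have "\<dots> = ?N \<otimes>\<^bsub>SA\<^esub> word (x # w)" by (simp add: word_Cons SA.A.m_assoc)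
    finally show ?case .
  qed (simp add: word_Nil)
  have N: "?N \<in> carrier SA" by simp
  show ?thesis
    by (rule linear_maps_eqI[OF SA.module_axioms SA.module_axioms word_spanning
          SA.mult_right_linear[OF N] SA.mult_left_linear[OF N] _ assms]) (use w in auto)
qed

text \<open>The value of the scalar is immaterial: the subset into which words are to be brought is
  closed under scalars.\<close>

lemma word_letr_commute: "\<exists>k\<in>carrier K. word w \<otimes>\<^bsub>SA\<^esub> letr x = k \<odot>\<^bsub>SA\<^esub> (letr x \<otimes>\<^bsub>SA\<^esub> word w)"
proof (induction w)
  case Nil
  show ?case by (rule bexI[of _ "\<one>\<^bsub>K\<^esub>"]) (simp_all add: word_Nil)
next
  case (Cons y w)
  then obtain k where k: "k \<in> carrier K" "word w \<otimes>\<^bsub>SA\<^esub> letr x = k \<odot>\<^bsub>SA\<^esub> (letr x \<otimes>\<^bsub>SA\<^esub> word w)" by blast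
  have "word (y # w) \<otimes>\<^bsub>SA\<^esub> letr x = letr y \<otimes>\<^bsub>SA\<^esub> (k \<odot>\<^bsub>SA\<^esub> (letr x \<otimes>\<^bsub>SA\<^esub> word w))"
    using k by (simp add: word_Cons SA.A.m_assoc)
  also have "\<dots> = k \<odot>\<^bsub>SA\<^esub> ((letr y \<otimes>\<^bsub>SA\<^esub> letr x) \<otimes>\<^bsub>SA\<^esub> word w)"
    using k by (simp add: SA.smult_mult_right SA.A.m_assoc)
  also have "\<dots> = (k \<otimes>\<^bsub>K\<^esub> qc y x) \<odot>\<^bsub>SA\<^esub> (letr x \<otimes>\<^bsub>SA\<^esub> word (y # w))"
    by (subst letr_commute) (use k in \<open>simp add: SA.smult_mult_left SA.smult_assoc1 SA.A.m_assoc word_Cons\<close>)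
  finally show ?case by (rule bexI[of _ "k \<otimes>\<^bsub>K\<^esub> qc y x"]) (simp add: k(1))
qed

end

lemma letter_degree_cases: "letter_degree x = 1 \<or> letter_degree x = - 1"
  by (cases x) auto

text \<open>The second alternative forces the degree to be plus or minus the length
  (\<open>degree_constant\<close>), so a nonempty word of degree 0 falls under the first.\<close>

lemma adjacent_opposite:
  "(\<exists>u x y v. w = u @ [x, y] @ v \<and> letter_degree y = - letter_degree x) \<or>
   (\<exists>s. (s = 1 \<or> s = - 1) \<and> (\<forall>x\<in>set w. letter_degree x = s))"
proof (induction w)
  case (Cons a w)
  show ?case
  proof (cases "\<exists>u x y v. w = u @ [x, y] @ v \<and> letter_degree y = - letter_degree x")
    case True
    then obtain u x y v where "w = u @ [x, y] @ v" "letter_degree y = - letter_degree x" by blast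
    hence "a # w = (a # u) @ [x, y] @ v" by simp
    thus ?thesis using \<open>letter_degree y = _\<close> by blast
  next
    case False
    then obtain s where s: "s = 1 \<or> s = - 1" "\<forall>x\<in>set w. letter_degree x = s" using Cons by blast
    show ?thesis
    proof (cases w)
      case Nil thus ?thesis using letter_degree_cases[of a] by auto
    next
      case w: (Cons b v)
      show ?thesis
      proof (cases "letter_degree a = s")
        case True thus ?thesis using s by auto
      next
        case False
        hence "letter_degree b = - letter_degree a" using s letter_degree_cases[of a] w by auto
        moreover have "a # w = [] @ [a, b] @ v" using w by simp
        ultimately show ?thesis by blast
      qed
    qed
  qed
qed auto

lemma degree_constant: "(\<forall>x\<in>set w. letter_degree x = s) \<Longrightarrow> degree w = s * int (length w)"
  by (induction w) (auto simp: algebra_simps)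

section \<open>The map from the two-sphere to the deformed three-sphere\<close>

locale coinvariant_map = deformed_sphere K cj q q' + sc: scalar_extension complex_ring K \<phi>
  for K :: "'k ring" and cj q q' and \<phi>
begin

text \<open>For commuting n = \<open>N1\<close> and m = \<open>N2\<close> with sum 1, the sphere
  relation of the images reads 4nm + (n - m)^2 = (n + m)^2 = 1; this is where the factor 2 comes
  from. The default case gives x and its adjoint the same image.\<close>

definition s2v :: "s2_gen letter \<Rightarrow> (s3_gen letter list \<Rightarrow> 'k) set" where
  "s2v x = (case x of Gen gen_z \<Rightarrow> \<phi> 2 \<odot>\<^bsub>SA\<^esub> (Z1 \<otimes>\<^bsub>SA\<^esub> Z2s) | Adj gen_z \<Rightarrow> \<phi> 2 \<odot>\<^bsub>SA\<^esub> (Z2 \<otimes>\<^bsub>SA\<^esub> Z1s)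
     | _ \<Rightarrow> Z1 \<otimes>\<^bsub>SA\<^esub> Z1s \<ominus>\<^bsub>SA\<^esub> Z2 \<otimes>\<^bsub>SA\<^esub> Z2s)"

lemma s2v_simps [simp]:
  "s2v (Gen gen_z) = \<phi> 2 \<odot>\<^bsub>SA\<^esub> (Z1 \<otimes>\<^bsub>SA\<^esub> Z2s)" "s2v (Adj gen_z) = \<phi> 2 \<odot>\<^bsub>SA\<^esub> (Z2 \<otimes>\<^bsub>SA\<^esub> Z1s)"
  "s2v (Gen gen_x) = Z1 \<otimes>\<^bsub>SA\<^esub> Z1s \<ominus>\<^bsub>SA\<^esub> Z2 \<otimes>\<^bsub>SA\<^esub> Z2s" "s2v (Adj gen_x) = Z1 \<otimes>\<^bsub>SA\<^esub> Z1s \<ominus>\<^bsub>SA\<^esub> Z2 \<otimes>\<^bsub>SA\<^esub> Z2s"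
  by (simp_all add: s2v_def)

lemma phi_closed [simp]: "\<phi> c \<in> carrier K" using sc.\<phi>_simps(1) by simp

lemma s2v_closed [simp]: "s2v x \<in> carrier SA"
  by (cases x; rename_tac g; case_tac g) simp_all

abbreviation N1 where "N1 \<equiv> Z1 \<otimes>\<^bsub>SA\<^esub> Z1s"
abbreviation N2 where "N2 \<equiv> Z2 \<otimes>\<^bsub>SA\<^esub> Z2s"

lemma N_central: "a \<in> carrier SA \<Longrightarrow> a \<otimes>\<^bsub>SA\<^esub> N1 = N1 \<otimes>\<^bsub>SA\<^esub> a" "a \<in> carrier SA \<Longrightarrow> a \<otimes>\<^bsub>SA\<^esub> N2 = N2 \<otimes>\<^bsub>SA\<^esub> a"
  using letr_pair_central[of a "Gen gen_z1"] letr_pair_central[of a "Gen gen_z2"] by simp_all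

lemma normal: "Z1s \<otimes>\<^bsub>SA\<^esub> Z1 = N1" "Z2s \<otimes>\<^bsub>SA\<^esub> Z2 = N2"
  using letters by (auto simp: sphere_letters_def)

lemma N_sum: "N1 \<oplus>\<^bsub>SA\<^esub> N2 = \<one>\<^bsub>SA\<^esub>"
  using letters by (auto simp: sphere_letters_def)

text \<open>The inner factors form one of the central elements \<open>N1\<close> and
  \<open>N2\<close>, which can be pulled out. Both orders give the same, so the image of z commutes
  with that of its adjoint although \<open>Z1\<close> and \<open>Z2\<close> need not
  commute.\<close>

lemma z_prod: "(Z1 \<otimes>\<^bsub>SA\<^esub> Z2s) \<otimes>\<^bsub>SA\<^esub> (Z2 \<otimes>\<^bsub>SA\<^esub> Z1s) = N1 \<otimes>\<^bsub>SA\<^esub> N2"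
    "(Z2 \<otimes>\<^bsub>SA\<^esub> Z1s) \<otimes>\<^bsub>SA\<^esub> (Z1 \<otimes>\<^bsub>SA\<^esub> Z2s) = N1 \<otimes>\<^bsub>SA\<^esub> N2"
proof -
  have "(Z1 \<otimes>\<^bsub>SA\<^esub> Z2s) \<otimes>\<^bsub>SA\<^esub> (Z2 \<otimes>\<^bsub>SA\<^esub> Z1s) = (Z1 \<otimes>\<^bsub>SA\<^esub> (Z2s \<otimes>\<^bsub>SA\<^esub> Z2)) \<otimes>\<^bsub>SA\<^esub> Z1s"
    by (simp add: SA.A.m_assoc)
  also have "\<dots> = (N2 \<otimes>\<^bsub>SA\<^esub> Z1) \<otimes>\<^bsub>SA\<^esub> Z1s" by (simp only: normal N_central(2)[OF letr_closed])
  also have "\<dots> = N2 \<otimes>\<^bsub>SA\<^esub> N1" by (rule SA.A.m_assoc) simp_all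
  also have "\<dots> = N1 \<otimes>\<^bsub>SA\<^esub> N2" by (rule N_central) simp
  finally show "(Z1 \<otimes>\<^bsub>SA\<^esub> Z2s) \<otimes>\<^bsub>SA\<^esub> (Z2 \<otimes>\<^bsub>SA\<^esub> Z1s) = N1 \<otimes>\<^bsub>SA\<^esub> N2" .
  have "(Z2 \<otimes>\<^bsub>SA\<^esub> Z1s) \<otimes>\<^bsub>SA\<^esub> (Z1 \<otimes>\<^bsub>SA\<^esub> Z2s) = (Z2 \<otimes>\<^bsub>SA\<^esub> (Z1s \<otimes>\<^bsub>SA\<^esub> Z1)) \<otimes>\<^bsub>SA\<^esub> Z2s"
    by (simp add: SA.A.m_assoc)
  also have "\<dots> = (N1 \<otimes>\<^bsub>SA\<^esub> Z2) \<otimes>\<^bsub>SA\<^esub> Z2s" by (simp only: normal N_central(1)[OF letr_closed])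
  also have "\<dots> = N1 \<otimes>\<^bsub>SA\<^esub> N2" by (rule SA.A.m_assoc) simp_all
  finally show "(Z2 \<otimes>\<^bsub>SA\<^esub> Z1s) \<otimes>\<^bsub>SA\<^esub> (Z1 \<otimes>\<^bsub>SA\<^esub> Z2s) = N1 \<otimes>\<^bsub>SA\<^esub> N2" .
qed

abbreviation RSA where "RSA \<equiv> restrict_scalars \<phi> SA"

lemma RSA: "assoc_algebra complex_ring RSA" by (rule sc.restrict_scalars_assoc_algebra[OF SA])

definition \<Phi>0 where "\<Phi>0 = hom_from_letters complex_ring RSA s2v"

lemma x_central:
  assumes "a \<in> carrier SA"
  shows "a \<otimes>\<^bsub>SA\<^esub> (N1 \<ominus>\<^bsub>SA\<^esub> N2) = (N1 \<ominus>\<^bsub>SA\<^esub> N2) \<otimes>\<^bsub>SA\<^esub> a"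
  using assms N_central[OF assms] by (simp add: a_minus_def SA.A.r_distr SA.A.l_distr SA.A.r_minus SA.A.l_minus)

text \<open>Once the scalar 4 is written as a fourfold sum, the sphere relation becomes a mere
  rearrangement in the additive group of \<open>SA\<close>.\<close>

lemma four: "\<phi> 2 \<odot>\<^bsub>SA\<^esub> (\<phi> 2 \<odot>\<^bsub>SA\<^esub> a) = a \<oplus>\<^bsub>SA\<^esub> (a \<oplus>\<^bsub>SA\<^esub> (a \<oplus>\<^bsub>SA\<^esub> a))" if "a \<in> carrier SA"
proof -
  have "\<phi> 4 \<odot>\<^bsub>SA\<^esub> a = \<phi> (1 + (1 + (1 + 1))) \<odot>\<^bsub>SA\<^esub> a" by simp
  also have "\<dots> = a \<oplus>\<^bsub>SA\<^esub> (a \<oplus>\<^bsub>SA\<^esub> (a \<oplus>\<^bsub>SA\<^esub> a))"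
    using sc.\<phi>_simps(4)[of 1] sc.\<phi>_simps(2) that
    by (simp only: complex_ring_simps UNIV_I SA.smult_l_distr phi_closed K0.a_closed K0.one_closed SA.smult_one)
  finally show ?thesis
    using sc.\<phi>_simps(5)[of 2 2] that by (simp add: SA.smult_assoc1[symmetric])
qed

lemma \<Phi>0: "\<Phi>0 \<in> algebra_homs complex_ring S.SA RSA" "\<Phi>0 (S.letr x) = s2v x"
proof -
  have comm: "s2v x \<otimes>\<^bsub>SA\<^esub> s2v y = s2v y \<otimes>\<^bsub>SA\<^esub> s2v x" for x y
  proof -
    have 1: "s2v x \<otimes>\<^bsub>SA\<^esub> s2v (Gen gen_x) = s2v (Gen gen_x) \<otimes>\<^bsub>SA\<^esub> s2v x" for x
      using x_central[OF s2v_closed] by simp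
    have 2: "s2v (Gen gen_z) \<otimes>\<^bsub>SA\<^esub> s2v (Adj gen_z) = s2v (Adj gen_z) \<otimes>\<^bsub>SA\<^esub> s2v (Gen gen_z)"
      by (simp add: SA.smult_mult_left SA.smult_mult_right z_prod)
    have 3: "s2v (Adj gen_x) = s2v (Gen gen_x)" by simp
    show ?thesis
      by (cases x; cases y; rename_tac g h; case_tac g; case_tac h)
         (simp_all only: 3, (rule 1 2 1[symmetric] 2[symmetric] refl)+)
  qed
  have sph: "s2v (Adj gen_z) \<otimes>\<^bsub>SA\<^esub> s2v (Gen gen_z) \<oplus>\<^bsub>SA\<^esub> s2v (Gen gen_x) \<otimes>\<^bsub>SA\<^esub> s2v (Gen gen_x) = \<one>\<^bsub>SA\<^esub>"
  proof -
    define n m where "n = N1" and "m = N2"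
    have nm: "n \<in> carrier SA" "m \<in> carrier SA" "m \<otimes>\<^bsub>SA\<^esub> n = n \<otimes>\<^bsub>SA\<^esub> m" "n \<oplus>\<^bsub>SA\<^esub> m = \<one>\<^bsub>SA\<^esub>"
      using N_central(1)[of N2] N_sum by (auto simp: n_def m_def)
    have "s2v (Adj gen_z) \<otimes>\<^bsub>SA\<^esub> s2v (Gen gen_z) = \<phi> 2 \<odot>\<^bsub>SA\<^esub> (\<phi> 2 \<odot>\<^bsub>SA\<^esub> (n \<otimes>\<^bsub>SA\<^esub> m))"
      by (simp add: SA.smult_mult_left SA.smult_mult_right z_prod n_def m_def)
    moreover have "s2v (Gen gen_x) = n \<ominus>\<^bsub>SA\<^esub> m" by (simp add: n_def m_def)
    moreover have "(\<phi> 2 \<odot>\<^bsub>SA\<^esub> (\<phi> 2 \<odot>\<^bsub>SA\<^esub> (n \<otimes>\<^bsub>SA\<^esub> m))) \<oplus>\<^bsub>SA\<^esub> (n \<ominus>\<^bsub>SA\<^esub> m) \<otimes>\<^bsub>SA\<^esub> (n \<ominus>\<^bsub>SA\<^esub> m) =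
      (n \<oplus>\<^bsub>SA\<^esub> m) \<otimes>\<^bsub>SA\<^esub> (n \<oplus>\<^bsub>SA\<^esub> m)"
    proof -
      \<comment> \<open>Here \<open>a\<close>, \<open>b\<close>, \<open>c\<close> stand for nm, n^2
        and m^2.\<close>
      have r: "a \<oplus>\<^bsub>SA\<^esub> (a \<oplus>\<^bsub>SA\<^esub> (a \<oplus>\<^bsub>SA\<^esub> a)) \<oplus>\<^bsub>SA\<^esub> (b \<oplus>\<^bsub>SA\<^esub> \<ominus>\<^bsub>SA\<^esub> a \<oplus>\<^bsub>SA\<^esub> (\<ominus>\<^bsub>SA\<^esub> a \<oplus>\<^bsub>SA\<^esub> c)) =
          b \<oplus>\<^bsub>SA\<^esub> a \<oplus>\<^bsub>SA\<^esub> (a \<oplus>\<^bsub>SA\<^esub> c)"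
        if "a \<in> carrier SA" "b \<in> carrier SA" "c \<in> carrier SA" for a b c
        using that by (simp add: SA.a_ac SA.r_neg SA.r_neg1 SA.r_neg2)
      show ?thesis
        using r[of "n \<otimes>\<^bsub>SA\<^esub> m" "n \<otimes>\<^bsub>SA\<^esub> n" "m \<otimes>\<^bsub>SA\<^esub> m"] nm(1-3)
        by (simp add: four a_minus_def SA.A.r_distr SA.A.l_distr SA.A.r_minus SA.A.l_minus SA.minus_add)
    qed
    ultimately show ?thesis using nm by simp
  qed
  have c: "s2v x \<in> carrier RSA" for x by simp
  show "\<Phi>0 \<in> algebra_homs complex_ring S.SA RSA" unfolding \<Phi>0_def
    by (rule s2_hom[OF RSA c]) (use comm sph in \<open>simp_all only: restrict_scalars_simps, simp_all\<close>)
  show "\<Phi>0 (S.letr x) = s2v x" unfolding \<Phi>0_def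
    by (rule s2_hom_letr[OF RSA c]) (use comm sph in \<open>simp_all only: restrict_scalars_simps, simp_all\<close>)
qed

sublocale b: base_change_algebra complex_ring K \<phi> S.SA
  by (intro base_change_algebra.intro sc.scalar_extension_axioms S.SA)

definition \<Phi> where "\<Phi> = lin_lift complex_ring RSA (\<lambda>(b, k). k \<odot>\<^bsub>SA\<^esub> \<Phi>0 b)"

lemma \<Phi>: "\<Phi> \<in> algebra_homs K b.LM SA"
  unfolding \<Phi>_def by (rule b.base_change_extend_hom[OF SA \<Phi>0(1)])

lemma \<Phi>_pure: "b \<in> carrier S.SA \<Longrightarrow> k \<in> carrier K \<Longrightarrow> \<Phi> (b.tensor b k) = k \<odot>\<^bsub>SA\<^esub> \<Phi>0 b"
  unfolding \<Phi>_def by (rule b.base_change_extend_pure[OF SA.module_axioms algebra_homs_linear[OF \<Phi>0(1)]])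

lemma \<Phi>_letr: "\<Phi> (b.tensor (S.letr x) \<one>\<^bsub>K\<^esub>) = s2v x"
  by (simp add: \<Phi>_pure \<Phi>0(2))

section \<open>Words of degree 0 lie in the image of the two-sphere\<close>

definition Im where "Im = \<Phi> ` carrier b.LM"

lemma Im_closed: "a \<in> Im \<Longrightarrow> a \<in> carrier SA"
  using algebra_homs_closed[OF \<Phi>] by (auto simp: Im_def)

lemma Im_add: "a \<in> Im \<Longrightarrow> a' \<in> Im \<Longrightarrow> a \<oplus>\<^bsub>SA\<^esub> a' \<in> Im"
  unfolding Im_def by (auto simp: algebra_homs_add[OF \<Phi>, symmetric] simp del: base_change_simps intro!: imageI)

lemma Im_mult: "a \<in> Im \<Longrightarrow> a' \<in> Im \<Longrightarrow> a \<otimes>\<^bsub>SA\<^esub> a' \<in> Im"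
  unfolding Im_def by (auto simp: algebra_homs_mult[OF \<Phi>, symmetric] simp del: base_change_simps intro!: imageI)

lemma Im_smult: "k \<in> carrier K \<Longrightarrow> a \<in> Im \<Longrightarrow> k \<odot>\<^bsub>SA\<^esub> a \<in> Im"
  unfolding Im_def by (auto simp: algebra_homs_smult[OF \<Phi>, symmetric] simp del: base_change_simps intro!: imageI)

lemma Im_one: "\<one>\<^bsub>SA\<^esub> \<in> Im"
  unfolding Im_def using algebra_homs_one[OF \<Phi>] b.LM.A.one_closed by (metis imageI)

lemma Im_zero: "\<zero>\<^bsub>SA\<^esub> \<in> Im"
  unfolding Im_def using linear_maps_zero[OF b.LM.module_axioms SA.module_axioms algebra_homs_linear[OF \<Phi>]]
    b.LM.zero_closed by (metis imageI)

lemma Im_s2v: "s2v x \<in> Im"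
  unfolding Im_def using \<Phi>_letr[of x] by (intro image_eqI[of _ _ "b.tensor (S.letr x) \<one>\<^bsub>K\<^esub>"]) simp_all

lemma half: "a \<in> carrier SA \<Longrightarrow> \<phi> (1 / 2) \<odot>\<^bsub>SA\<^esub> (\<phi> 2 \<odot>\<^bsub>SA\<^esub> a) = a"
  using sc.\<phi>_simps(5)[of "1/2" 2] sc.\<phi>_simps(2) by (simp add: SA.smult_assoc1[symmetric])

lemma two: "a \<in> carrier SA \<Longrightarrow> \<phi> 2 \<odot>\<^bsub>SA\<^esub> a = a \<oplus>\<^bsub>SA\<^esub> a"
  using sc.\<phi>_simps(4)[of 1 1] sc.\<phi>_simps(2) by (simp add: SA.smult_l_distr)

lemma Im_opposite:
  assumes "letter_degree y = - letter_degree x"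
  shows "letr x \<otimes>\<^bsub>SA\<^esub> letr y \<in> Im"
proof -
  have h: "a \<in> Im" if "a \<in> carrier SA" "\<phi> 2 \<odot>\<^bsub>SA\<^esub> a \<in> Im" for a
    using Im_smult[OF phi_closed that(2), of "1/2"] half[OF that(1)] by simp
  have z: "Z1 \<otimes>\<^bsub>SA\<^esub> Z2s \<in> Im" using Im_s2v[of "Gen gen_z"] by - (rule h, simp_all)
  have zs: "Z2 \<otimes>\<^bsub>SA\<^esub> Z1s \<in> Im" using Im_s2v[of "Adj gen_z"] by - (rule h, simp_all)
  have x: "N1 \<ominus>\<^bsub>SA\<^esub> N2 \<in> Im" using Im_s2v[of "Gen gen_x"] by simp
  \<comment> \<open>As \<open>N1\<close> and \<open>N2\<close> have sum 1 and difference the image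
    of x, halving 1 + x gives \<open>N1\<close>; \<open>N2\<close> is then 1 minus
    \<open>N1\<close>.\<close>
  have n1: "N1 \<in> Im"
  proof (rule h)
    have "\<phi> 2 \<odot>\<^bsub>SA\<^esub> N1 = (N1 \<oplus>\<^bsub>SA\<^esub> N2) \<oplus>\<^bsub>SA\<^esub> (N1 \<ominus>\<^bsub>SA\<^esub> N2)"
      by (simp add: two a_minus_def SA.a_ac SA.r_neg SA.r_neg1 SA.r_neg2)
    thus "\<phi> 2 \<odot>\<^bsub>SA\<^esub> N1 \<in> Im" using x Im_one Im_add by (simp add: N_sum)
  qed simp
  have min: "\<ominus>\<^bsub>SA\<^esub> a \<in> Im" if "a \<in> Im" for a
    using Im_smult[OF _ that, of "\<ominus>\<^bsub>K\<^esub> \<one>\<^bsub>K\<^esub>"] Im_closed[OF that] by (simp add: SA.minus_eq_smult)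
  have n2: "N2 \<in> Im"
  proof -
    have "(a \<oplus>\<^bsub>SA\<^esub> b) \<oplus>\<^bsub>SA\<^esub> \<ominus>\<^bsub>SA\<^esub> a = b" if "a \<in> carrier SA" "b \<in> carrier SA" for a b
      using that by (simp add: SA.a_comm[of a b] SA.a_assoc SA.r_neg)
    from this[of N1 N2] have "N2 = (N1 \<oplus>\<^bsub>SA\<^esub> N2) \<oplus>\<^bsub>SA\<^esub> \<ominus>\<^bsub>SA\<^esub> N1" by simp
    thus ?thesis using Im_add[OF Im_one min[OF n1]] by (simp add: N_sum)
  qed
  have c: "letr x \<otimes>\<^bsub>SA\<^esub> letr y \<in> Im" if "letr y \<otimes>\<^bsub>SA\<^esub> letr x \<in> Im" for x y
    by (subst letr_commute) (rule Im_smult[OF qc_closed that])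
  show ?thesis
    using assms by (cases x; cases y; rename_tac g h; case_tac g; case_tac h)
      (auto intro: z zs n1 n2 c[OF z] c[OF zs] c[OF n1] c[OF n2])
qed

lemma word_degree_zero_Im: "degree w = 0 \<Longrightarrow> word w \<in> Im"
proof (induction "length w" arbitrary: w rule: less_induct)
  case less
  show ?case
  proof (cases "w = []")
    case True thus ?thesis using Im_one by (simp add: word_Nil)
  next
    case False
    have "\<not> (\<exists>s. (s = 1 \<or> s = - 1) \<and> (\<forall>x\<in>set w. letter_degree x = s))"
    proof (rule notI, elim exE conjE)
      fix s :: int assume "s = 1 \<or> s = - 1" "\<forall>x\<in>set w. letter_degree x = s"
      thus False using degree_constant[of w s] less.prems False by auto
    qed
    then obtain u x y v where w: "w = u @ [x, y] @ v" "letter_degree y = - letter_degree x"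
      using adjacent_opposite[of w] by blast
    obtain k where k: "k \<in> carrier K" "word u \<otimes>\<^bsub>SA\<^esub> letr x = k \<odot>\<^bsub>SA\<^esub> (letr x \<otimes>\<^bsub>SA\<^esub> word u)"
      using word_letr_commute by blast
    obtain l where l: "l \<in> carrier K" "word u \<otimes>\<^bsub>SA\<^esub> letr y = l \<odot>\<^bsub>SA\<^esub> (letr y \<otimes>\<^bsub>SA\<^esub> word u)"
      using word_letr_commute by blast
    have "word w = (word u \<otimes>\<^bsub>SA\<^esub> letr x) \<otimes>\<^bsub>SA\<^esub> (letr y \<otimes>\<^bsub>SA\<^esub> word v)"
      by (simp add: w letr_eq word_mult)
    also have "\<dots> = k \<odot>\<^bsub>SA\<^esub> (letr x \<otimes>\<^bsub>SA\<^esub> ((word u \<otimes>\<^bsub>SA\<^esub> letr y) \<otimes>\<^bsub>SA\<^esub> word v))"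
      using k(1) by (simp add: k(2) SA.smult_mult_left SA.A.m_assoc)
    also have "\<dots> = k \<odot>\<^bsub>SA\<^esub> (l \<odot>\<^bsub>SA\<^esub> ((letr x \<otimes>\<^bsub>SA\<^esub> letr y) \<otimes>\<^bsub>SA\<^esub> word (u @ v)))"
      using l(1) by (simp add: l(2) SA.smult_mult_left SA.smult_mult_right SA.A.m_assoc word_mult[symmetric])
    \<comment> \<open>The extracted pair has degree 0, so \<open>u @ v\<close> again has degree 0
      and is shorter by two letters.\<close>
    also have "\<dots> \<in> Im"
      using w less.prems by (intro Im_smult k l Im_mult Im_opposite less.hyps) auto
    finally show ?thesis .
  qed
qed

end

text \<open>The complex-linear endomorphisms of the space of all functions on the integers, made an
  algebra over \<open>K\<close> through \<open>e\<close>. So a sphere over any ground ring with a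
  ring homomorphism \<open>e\<close> to the complex numbers can be represented on one and the same
  space.\<close>

definition op_algebra :: "('k \<Rightarrow> complex) \<Rightarrow> ('k, (int \<Rightarrow> complex) \<Rightarrow> int \<Rightarrow> complex) module" where
  "op_algebra e = \<lparr>carrier = {T. (\<forall>f g. T (\<lambda>n. f n + g n) = (\<lambda>n. T f n + T g n)) \<and>
       (\<forall>c f. T (\<lambda>n. c * f n) = (\<lambda>n. c * T f n))},
     mult = (\<lambda>S T f. S (T f)), one = (\<lambda>f. f), zero = (\<lambda>f n. 0), add = (\<lambda>S T f n. S f n + T f n),
     smult = (\<lambda>k T f n. e k * T f n)\<rparr>"

lemma op_algebra_simps [simp]:
  "S \<otimes>\<^bsub>op_algebra e\<^esub> T = (\<lambda>f. S (T f))" "\<one>\<^bsub>op_algebra e\<^esub> = (\<lambda>f. f)" "\<zero>\<^bsub>op_algebra e\<^esub> = (\<lambda>f n. 0)"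
  "S \<oplus>\<^bsub>op_algebra e\<^esub> T = (\<lambda>f n. S f n + T f n)" "k \<odot>\<^bsub>op_algebra e\<^esub> T = (\<lambda>f n. e k * T f n)"
  by (simp_all add: op_algebra_def)

lemma op_algebra_carrier: "T \<in> carrier (op_algebra e) \<longleftrightarrow>
    (\<forall>f g. T (\<lambda>n. f n + g n) = (\<lambda>n. T f n + T g n)) \<and> (\<forall>c f. T (\<lambda>n. c * f n) = (\<lambda>n. c * T f n))"
  by (simp add: op_algebra_def)

lemma op_algebra_closed:
  assumes "S \<in> carrier (op_algebra e)" "T \<in> carrier (op_algebra e)"
  shows "(\<lambda>f. S (T f)) \<in> carrier (op_algebra e)" "(\<lambda>f n. S f n + T f n) \<in> carrier (op_algebra e)"
    "(\<lambda>f n. c * T f n) \<in> carrier (op_algebra e)"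
  using assms by (simp_all add: op_algebra_carrier algebra_simps)

lemma op_algebra:
  fixes K :: "'k ring"
  assumes "cring K" "e \<in> ring_hom K complex_ring"
  shows "assoc_algebra K (op_algebra e)"
proof (rule assoc_algebraI)
  interpret K: cring K by fact
  have e: "e (k \<oplus>\<^bsub>K\<^esub> l) = e k + e l" "e (k \<otimes>\<^bsub>K\<^esub> l) = e k * e l" "e \<one>\<^bsub>K\<^esub> = 1" if "k \<in> carrier K" "l \<in> carrier K" for k l
    using assms(2) that by (auto simp: ring_hom_def)
  show "module K (op_algebra e)"
  proof (rule moduleI[OF assms(1)])
    show "abelian_group (op_algebra e)"
    proof (rule abelian_groupI)
      fix T assume "T \<in> carrier (op_algebra e)"
      hence "(\<lambda>f n. - T f n) \<in> carrier (op_algebra e)" by (simp add: op_algebra_carrier fun_eq_iff)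
      moreover have "(\<lambda>f n. - T f n) \<oplus>\<^bsub>op_algebra e\<^esub> T = \<zero>\<^bsub>op_algebra e\<^esub>" by simp
      ultimately show "\<exists>S\<in>carrier (op_algebra e). S \<oplus>\<^bsub>op_algebra e\<^esub> T = \<zero>\<^bsub>op_algebra e\<^esub>" by blast
    qed (auto simp: op_algebra_closed algebra_simps, simp add: op_algebra_carrier)
    show "\<one>\<^bsub>K\<^esub> \<odot>\<^bsub>op_algebra e\<^esub> T = T" for T using e(3)[OF K.one_closed K.one_closed] by simp
  qed (auto simp: op_algebra_closed algebra_simps e)
  show "\<one>\<^bsub>op_algebra e\<^esub> \<in> carrier (op_algebra e)" by (simp add: op_algebra_carrier)
  fix S assume S: "S \<in> carrier (op_algebra e)"
  show "(\<lambda>T. S \<otimes>\<^bsub>op_algebra e\<^esub> T) \<in> linear_maps K (op_algebra e) (op_algebra e)"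
    by (rule linear_mapsI) (use S in \<open>simp_all add: op_algebra_closed\<close>, use S in \<open>simp_all add: op_algebra_carrier\<close>)
  show "(\<lambda>T. T \<otimes>\<^bsub>op_algebra e\<^esub> S) \<in> linear_maps K (op_algebra e) (op_algebra e)"
    by (rule linear_mapsI) (use S in \<open>simp_all add: op_algebra_closed\<close>)
qed (simp_all add: op_algebra_closed)

lemma op_algebra_minus:
  fixes K :: "'k ring"
  assumes "cring K" "e \<in> ring_hom K complex_ring" "S \<in> carrier (op_algebra e)" "T \<in> carrier (op_algebra e)"
  shows "S \<ominus>\<^bsub>op_algebra e\<^esub> T = (\<lambda>f n. S f n - T f n)"
proof -
  interpret P: assoc_algebra K "op_algebra e" by (rule op_algebra[OF assms(1,2)])
  have "(\<lambda>f n. - T f n) \<in> carrier (op_algebra e)" using assms(4) by (simp add: op_algebra_carrier fun_eq_iff)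
  hence "\<ominus>\<^bsub>op_algebra e\<^esub> T = (\<lambda>f n. - T f n)" using assms(4) by (intro P.minus_equality) auto
  thus ?thesis by (simp add: a_minus_def)
qed

text \<open>\<open>monoid_algebra K I\<close> serves here as the free module on the index type; the
  product and the unit of \<open>I\<close> are placeholders.\<close>

lemma spanning_lin_ext:
  fixes \<beta> :: "'i \<Rightarrow> 'a"
  assumes "module K M" "spanning K M (range \<beta>)" "u \<in> carrier M"
  defines "I \<equiv> \<lparr>carrier = UNIV, mult = (\<lambda>x y. x), one = undefined\<rparr> :: 'i monoid"
  shows "\<exists>f\<in>carrier (monoid_algebra K I). u = lin_ext K M \<beta> f"
proof -
  interpret M: module K M by fact
  interpret F: module K "monoid_algebra K I" by (rule monoid_algebra_module[OF M.is_cring])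
  have \<beta>: "\<beta> \<in> carrier I \<rightarrow> carrier M" using assms(2) by (auto simp: spanning_def)
  note L = lin_ext_linear[OF assms(1) \<beta>]
  show ?thesis using assms(1-3)
  proof (induction rule: spanning_induct)
    case zero
    show ?case using linear_maps_zero[OF F.module_axioms assms(1) L] by (metis F.zero_closed)
  next
    case (base x)
    then obtain i where "x = \<beta> i" by blast
    thus ?case using lin_ext_basis[OF assms(1) \<beta>, of i] basis_elem_closed[OF M.is_cring, of i I]
      by (auto simp: I_def intro!: bexI[of _ "basis_elem K i"])
  next
    case (add x y)
    thus ?case using linear_maps_add[OF L] by (metis F.a_closed)
  next
    case (smult k x)
    thus ?case using linear_maps_smult[OF L] by (metis F.smult_closed)
  qed
qed

text \<open>Passes from the sum of an abstract module to an ordinary complex sum, to which counting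
  the roots of a polynomial applies.\<close>

lemma finsum_complex:
  fixes K :: "'k ring"
  assumes "cring K" "e \<in> ring_hom K complex_ring"
  shows "finsum (ring_as_algebra complex_ring e) g A = sum g A"
proof -
  interpret K: cring K by fact
  interpret s: scalar_extension K complex_ring e
    by (intro scalar_extension.intro scalar_extension_axioms.intro assms complex_ring)
  interpret P: assoc_algebra K "ring_as_algebra complex_ring e" by (rule s.ring_as_algebra_assoc_algebra)
  show ?thesis
  proof (induction A rule: infinite_finite_induct)
    case (insert a A) thus ?case by (subst P.finsum_insert) auto
  qed auto
qed

text \<open>A polynomial with infinitely many roots is zero, and an open interval supplies them.
  Coefficients outside \<open>J\<close> are padded with 0 to reach a sum over consecutive
  exponents.\<close>

lemma poly_sum_vanishes:
  fixes d :: "nat \<Rightarrow> complex"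
  assumes "finite J" "\<And>x. - 1 < x \<Longrightarrow> x < (1 :: real) \<Longrightarrow> (\<Sum>j\<in>J. d j * complex_of_real x ^ j) = 0" "j \<in> J"
  shows "d j = 0"
proof -
  obtain n where n: "J \<subseteq> {..n}" using assms(1) unfolding finite_nat_set_iff_bounded_le by auto
  let ?d = "\<lambda>i. if i \<in> J then d i else 0"
  have "(\<Sum>i\<le>n. ?d i * z ^ i) = (\<Sum>j\<in>J. d j * z ^ j)" for z
    using n by (intro sum.mono_neutral_cong_right) auto
  hence "complex_of_real ` {- 1<..<1} \<subseteq> {z. (\<Sum>i\<le>n. ?d i * z ^ i) = 0}" using assms(2) by auto
  moreover have "infinite (complex_of_real ` {- 1<..<1})"
    by (subst finite_image_iff) (auto simp: inj_on_def)
  ultimately have "\<not> finite {z. (\<Sum>i\<le>n. ?d i * z ^ i) = 0}" using finite_subset by blast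
  hence "\<not> (\<exists>i\<le>n. ?d i \<noteq> 0)" unfolding polyfun_finite_roots .
  thus ?thesis using assms(3) n by auto
qed

context coinvariant_map
begin

context
  fixes e :: "'k \<Rightarrow> complex" and a b :: complex
  assumes e: "e \<in> ring_hom K complex_ring" and e\<phi>: "\<And>c. e (\<phi> c) = c" and ab: "a * a + b * b = 1"
begin

text \<open>\<open>Z1\<close> acts as \<open>a\<close> U with the shift (U f)(n) = f(n - 1), and
  \<open>Z2\<close> as \<open>b\<close> V with V multiplication by the n-th power of
  \<open>e q'\<close>. Then U V is \<open>e q\<close> times V U, because the shift lowers the
  exponent of \<open>e q'\<close> by one. The adjoint letters act as \<open>a\<close> and
  \<open>b\<close> times the inverses of U and V; no Hilbert space adjoint is involved.\<close>

definition opv :: "s3_gen letter \<Rightarrow> (int \<Rightarrow> complex) \<Rightarrow> int \<Rightarrow> complex" where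
  "opv x f n = (case x of Gen gen_z1 \<Rightarrow> a * f (n - 1) | Adj gen_z1 \<Rightarrow> a * f (n + 1)
     | Gen gen_z2 \<Rightarrow> b * e q' powi n * f n | Adj gen_z2 \<Rightarrow> b * e q powi n * f n)"

lemma opv_simps:
  "opv (Gen gen_z1) = (\<lambda>f n. a * f (n - 1))" "opv (Adj gen_z1) = (\<lambda>f n. a * f (n + 1))"
  "opv (Gen gen_z2) = (\<lambda>f n. b * e q' powi n * f n)" "opv (Adj gen_z2) = (\<lambda>f n. b * e q powi n * f n)"
  by (auto simp: opv_def fun_eq_iff)

lemma e_inv: "e q * e q' = 1"
proof -
  have "e (q \<otimes>\<^bsub>K\<^esub> q') = e q * e q'" using e by (simp add: ring_hom_def)
  thus ?thesis using e by (simp add: q_inv ring_hom_def)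
qed

lemma e_nz: "e q \<noteq> 0" "e q' \<noteq> 0" using e_inv by auto

lemma e_powi: "e q powi n * e q' powi n = 1" "e q' powi n * e q powi n = 1"
  using e_inv by (simp_all add: power_int_mult_distrib[symmetric] mult.commute)

lemma e_powi_shift: "e q' powi (n - 1) = e q * e q' powi n" "e q powi (n - 1) = e q' * e q powi n"
  "e q' powi (n + 1) = e q' * e q' powi n" "e q powi (n + 1) = e q * e q powi n"
proof -
  have "inverse (e q') = e q" "inverse (e q) = e q'"
    using e_inv by (metis inverse_unique mult.commute)+
  thus "e q' powi (n - 1) = e q * e q' powi n" "e q powi (n - 1) = e q' * e q powi n"
    using e_nz by (simp_all add: power_int_diff divide_inverse mult.commute)
  show "e q' powi (n + 1) = e q' * e q' powi n" "e q powi (n + 1) = e q * e q powi n"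
    using e_nz by (simp_all add: power_int_add mult.commute)
qed

lemma op: "assoc_algebra K (op_algebra e)" by (rule op_algebra[OF K0.is_cring e])

lemma opv_closed: "opv x \<in> carrier (op_algebra e)"
  by (cases x; rename_tac g; case_tac g) (simp_all add: opv_simps op_algebra_carrier fun_eq_iff algebra_simps)

lemma op_letters: "sphere_letters (op_algebra e) q q' opv"
proof -
  have sum: "a * (a * c) + b * (b * c) = c" for c
    using ab by (simp add: distrib_right[symmetric] flip: mult.assoc)
  show ?thesis
    unfolding sphere_letters_def using opv_closed
    by (auto simp: opv_simps e_powi_shift fun_eq_iff algebra_simps e_inv e_powi sum)
qed

definition \<rho> where "\<rho> = hom_from_letters K (op_algebra e) opv"

lemma \<rho>: "\<rho> \<in> algebra_homs K SA (op_algebra e)" "\<rho> (letr x) = opv x"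
  unfolding \<rho>_def by (rule sphere_hom[OF op op_letters] sphere_hom_letr[OF op op_letters])+

lemma \<rho>_pair: "\<rho> (letr x \<otimes>\<^bsub>SA\<^esub> letr y) = (\<lambda>f. opv x (opv y f))"
  using algebra_homs_mult[OF \<rho>(1), of "letr x" "letr y"] by (simp add: \<rho>(2))

text \<open>In \<open>N1\<close> and \<open>N2\<close> the shift and the diagonal operator cancel
  against their inverses, which leaves x acting as a scalar, while z and its adjoint become weighted
  shifts in opposite directions.\<close>

lemma \<rho>_s2v:
  "\<rho> (s2v (Gen gen_z)) f n = 2 * a * b * e q powi (n - 1) * f (n - 1)"
  "\<rho> (s2v (Adj gen_z)) f n = 2 * a * b * e q' powi n * f (n + 1)"
  "\<rho> (s2v (Gen gen_x)) f n = (a * a - b * b) * f n"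
proof -
  show "\<rho> (s2v (Gen gen_z)) f n = 2 * a * b * e q powi (n - 1) * f (n - 1)"
    "\<rho> (s2v (Adj gen_z)) f n = 2 * a * b * e q' powi n * f (n + 1)"
    by (simp_all add: algebra_homs_smult[OF \<rho>(1)] \<rho>_pair e\<phi> opv_simps)
  have "\<rho> (N1 \<ominus>\<^bsub>SA\<^esub> N2) = (\<lambda>f n. \<rho> N1 f n - \<rho> N2 f n)"
    using linear_maps_minus[OF SA.module_axioms assoc_algebra_module[OF op] algebra_homs_linear[OF \<rho>(1)], of N1 N2]
      op_algebra_minus[OF K0.is_cring e] algebra_homs_closed[OF \<rho>(1)] by simp
  show "\<rho> (s2v (Gen gen_x)) f n = (a * a - b * b) * f n"
  proof -
    have "b * e q' powi n * (b * e q powi n * f n) = b * b * f n * (e q' powi n * e q powi n)"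
      by (simp only: mult_ac)
    hence "b * e q' powi n * (b * e q powi n * f n) = b * b * f n" by (simp only: e_powi mult_1_right)
    thus ?thesis using \<open>\<rho> (N1 \<ominus>\<^bsub>SA\<^esub> N2) = _\<close> by (simp add: \<rho>_pair opv_simps algebra_simps)
  qed
qed

lemma \<rho>\<Phi>_mult: "x \<in> carrier S.SA \<Longrightarrow> y \<in> carrier S.SA \<Longrightarrow> \<rho> (\<Phi>0 (x \<otimes>\<^bsub>S.SA\<^esub> y)) f = \<rho> (\<Phi>0 x) (\<rho> (\<Phi>0 y) f)"
proof -
  assume x: "x \<in> carrier S.SA" and y: "y \<in> carrier S.SA"
  have c: "\<Phi>0 x \<in> carrier SA" "\<Phi>0 y \<in> carrier SA"
    using algebra_homs_closed[OF \<Phi>0(1) x] algebra_homs_closed[OF \<Phi>0(1) y] by simp_all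
  have "\<Phi>0 (x \<otimes>\<^bsub>S.SA\<^esub> y) = \<Phi>0 x \<otimes>\<^bsub>SA\<^esub> \<Phi>0 y" using algebra_homs_mult[OF \<Phi>0(1) x y] by simp
  thus ?thesis using algebra_homs_mult[OF \<rho>(1) c] by simp
qed

abbreviation \<delta>0 :: "int \<Rightarrow> complex" where "\<delta>0 \<equiv> \<lambda>n. if n = 0 then 1 else 0"

text \<open>Each factor z moves \<open>\<delta>0\<close> one place to the right, its adjoint one
  place to the left, and x multiplies by a scalar. The constant depends on \<open>n\<close> but not
  on \<open>j\<close>, so for fixed \<open>n\<close> a combination of monomials shows up as one
  polynomial in \<open>a * a - b * b\<close>.\<close>

lemma \<rho>_monomial:
  assumes "a \<noteq> 0" "b \<noteq> 0"
  shows "\<exists>c. c \<noteq> 0 \<and> (\<forall>j. \<rho> (\<Phi>0 (s2_monomial (n, j))) \<delta>0 = (\<lambda>m. if m = n then c * (a * a - b * b) ^ j else 0))"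
proof -
  have zero: "\<rho> (\<Phi>0 (s2_monomial (0, j))) \<delta>0 = (\<lambda>m. if m = 0 then (a * a - b * b) ^ j else 0)" for j
  proof (induction j)
    case 0
    have "\<Phi>0 \<one>\<^bsub>S.SA\<^esub> = \<one>\<^bsub>SA\<^esub>" using algebra_homs_one[OF \<Phi>0(1)] by simp
    thus ?case using algebra_homs_one[OF \<rho>(1)] by (simp add: s2_monomial_zero fun_eq_iff)
  next
    case (Suc j)
    show ?case
      unfolding s2_monomial_x[of 0 j, symmetric]
      using Suc s2_monomial_closed by (simp add: \<rho>\<Phi>_mult \<Phi>0(2) \<rho>_s2v(3) fun_eq_iff del: s2v_simps)
  qed
  have pos_ex: "\<exists>c. c \<noteq> 0 \<and> (\<forall>j. \<rho> (\<Phi>0 (s2_monomial (int k, j))) \<delta>0 = (\<lambda>m. if m = int k then c * (a * a - b * b) ^ j else 0))" for k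
  proof (induction k)
    case 0
    show ?case using zero by (intro exI[of _ 1]) (simp add: fun_eq_iff)
  next
    case (Suc k)
    then obtain c where c: "c \<noteq> 0"
      "\<And>j. \<rho> (\<Phi>0 (s2_monomial (int k, j))) \<delta>0 = (\<lambda>m. if m = int k then c * (a * a - b * b) ^ j else 0)" by blast
    show ?case unfolding s2_monomial_Suc(1)
      using c assms e_nz s2_monomial_closed
      \<comment> \<open>The new factor is the weight of the shift z at the place of arrival
        \<open>int (Suc k)\<close>, in which the exponent is one less than the place.\<close>
      by (intro exI[of _ "2 * a * b * e q powi (int k) * c"])
         (auto simp: \<rho>\<Phi>_mult \<Phi>0(2) \<rho>_s2v fun_eq_iff simp del: s2v_simps)
  qed
  have neg_ex: "\<exists>c. c \<noteq> 0 \<and> (\<forall>j. \<rho> (\<Phi>0 (s2_monomial (- int k, j))) \<delta>0 = (\<lambda>m. if m = - int k then c * (a * a - b * b) ^ j else 0))" for k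
  proof (induction k)
    case 0
    show ?case using zero by (intro exI[of _ 1]) (simp add: fun_eq_iff)
  next
    case (Suc k)
    then obtain c where c: "c \<noteq> 0"
      "\<And>j. \<rho> (\<Phi>0 (s2_monomial (- int k, j))) \<delta>0 = (\<lambda>m. if m = - int k then c * (a * a - b * b) ^ j else 0)" by blast
    have "- int (Suc k) + 1 = - int k" by simp
    show ?case unfolding s2_monomial_Suc(2)
      using c assms e_nz s2_monomial_closed
      \<comment> \<open>For the adjoint of z, the exponent in the weight is the place of arrival
        itself.\<close>
      by (intro exI[of _ "2 * a * b * e q' powi (- int (Suc k)) * c"])
         (auto simp: \<rho>\<Phi>_mult \<Phi>0(2) \<rho>_s2v fun_eq_iff simp del: s2v_simps)
  qed
  show ?thesis
  proof (cases n rule: int_sign_cases)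
    case (nonneg k)
    show ?thesis unfolding nonneg by (rule pos_ex)
  next
    case (neg k)
    show ?thesis unfolding neg by (rule neg_ex)
  qed
qed

end

text \<open>\<open>E\<close> consists of ring homomorphisms to the complex numbers that fix
  constants and jointly detect zero. Each of them turns the coefficients of a combination of
  monomials into complex numbers, and the operators show that these vanish.\<close>

lemma \<Phi>_injective:
  fixes E :: "('k \<Rightarrow> complex) set"
  assumes E: "\<And>e. e \<in> E \<Longrightarrow> e \<in> ring_hom K complex_ring" "\<And>e c. e \<in> E \<Longrightarrow> e (\<phi> c) = c"
    and sep: "\<And>k. k \<in> carrier K \<Longrightarrow> (\<And>e. e \<in> E \<Longrightarrow> e k = 0) \<Longrightarrow> k = \<zero>\<^bsub>K\<^esub>"
  shows "inj_on \<Phi> (carrier b.LM)"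
proof -
  let ?\<beta> = "\<lambda>p. b.tensor (s2_monomial p) \<one>\<^bsub>K\<^esub>"
  note LM = b.base_change_assoc_algebra
  note [simp del] = base_change_simps(6)
  let ?I = "\<lparr>carrier = UNIV, mult = (\<lambda>x y. x), one = undefined\<rparr> :: (int \<times> nat) monoid"
  have ker: "u = \<zero>\<^bsub>b.LM\<^esub>" if u: "u \<in> carrier b.LM" "\<Phi> u = \<zero>\<^bsub>SA\<^esub>" for u
  proof -
    have "spanning K b.LM (range ?\<beta>)"
      using b.base_change_spanning[OF s2_spanning] by (simp add: image_image)
    from spanning_lin_ext[OF b.LM.module_axioms this u(1)]
    obtain f where f: "f \<in> carrier (monoid_algebra K ?I)" "u = lin_ext K b.LM ?\<beta> f" by blast
    have fc: "f p \<in> carrier K" for p using monoid_algebra_value[OF K0.is_cring f(1)] .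
    have fin: "finite (supp K f)" using f(1) by (simp add: monoid_algebra_carrier)
    have "f (m, j) = \<zero>\<^bsub>K\<^esub>" for m j
    proof (rule sep[OF fc])
      fix e assume e: "e \<in> E"
      note E = E[OF e]
      \<comment> \<open>The exponents of x that occur beside the shift \<open>m\<close>; monomials
        with another shift contribute nothing at the place \<open>m\<close>.\<close>
      define J where "J = {j. (m, j) \<in> supp K f}"
      have finJ: "finite J"
        by (rule finite_subset[OF _ finite_imageI[OF fin, of snd]]) (force simp: J_def)
      have e0: "e \<zero>\<^bsub>K\<^esub> = 0" using ring_hom_zero[OF E(1) K0.ring_axioms] cring.axioms(1)[OF complex_ring] by simp
      have "(\<Sum>j\<in>J. e (f (m, j)) * complex_of_real x ^ j) = 0" if x: "- 1 < x" "x < 1" for x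
      proof -
        \<comment> \<open>The nonnegative solution of \<open>a * a + b * b = 1\<close> and
          \<open>a * a - b * b = x\<close>. Both numbers are nonzero because \<open>x\<close> lies
          strictly between -1 and 1.\<close>
        define a b where "a = complex_of_real (sqrt ((1 + x) / 2))" and "b = complex_of_real (sqrt ((1 - x) / 2))"
        have sq: "a * a = complex_of_real ((1 + x) / 2)" "b * b = complex_of_real ((1 - x) / 2)"
          using x by (simp_all add: a_def b_def flip: of_real_mult)
        have "(1 + x) / 2 + (1 - x) / 2 = 1" "(1 + x) / 2 - (1 - x) / 2 = x" by (simp_all add: field_simps)
        hence ab1: "a * a + b * b = 1" and X: "a * a - b * b = complex_of_real x"
          unfolding sq by (metis of_real_1 of_real_add, metis of_real_diff)
        have ab: "a * a + b * b = 1" "a \<noteq> 0" "b \<noteq> 0"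
          using x ab1 by (auto simp: a_def b_def)
        note R = \<rho>[OF E ab(1)]
        obtain c where c: "c \<noteq> 0" "\<And>j. \<rho> e a b (\<Phi>0 (s2_monomial (m, j))) (\<lambda>n. if n = 0 then 1 else 0) m = c * complex_of_real x ^ j"
          using \<rho>_monomial[OF E ab, of m] X by auto
        have c0: "\<rho> e a b (\<Phi>0 (s2_monomial (n, j))) (\<lambda>n. if n = 0 then 1 else 0) m = 0" if "n \<noteq> m" for n j
          using \<rho>_monomial[OF E ab, of n] that by auto
        \<comment> \<open>The value at \<open>m\<close> of the operator of \<open>\<Phi> u\<close>
          applied to the delta function at 0: linear over \<open>K\<close> through \<open>e\<close>,
          and explicit on monomials.\<close>
        define L where "L u = \<rho> e a b (\<Phi> u) (\<lambda>n. if n = 0 then 1 else 0) m" for u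
        note h = algebra_homs_compose[OF \<Phi> R(1)]
        have L: "L \<in> linear_maps K b.LM (ring_as_algebra complex_ring e)"
          by (rule linear_mapsI)
             (simp_all add: L_def algebra_homs_add[OF h, simplified] algebra_homs_smult[OF h, simplified])
        have ring: "module K (ring_as_algebra complex_ring e)"
          by (intro assoc_algebra_module scalar_extension.ring_as_algebra_assoc_algebra scalar_extension.intro
              scalar_extension_axioms.intro K0.is_cring complex_ring E(1))
        have \<beta>c: "?\<beta> p \<in> carrier b.LM" for p using s2_monomial_closed by simp
        have L\<beta>: "L (?\<beta> p) = (if fst p = m then c * complex_of_real x ^ snd p else 0)" for p
          using c c0 algebra_homs_closed[OF \<Phi>0(1) s2_monomial_closed[of p]]
          by (cases p) (simp add: L_def \<Phi>_pure s2_monomial_closed)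
        have "0 = L u" using u(2) linear_maps_zero[OF SA.module_axioms assoc_algebra_module[OF op[OF E ab(1)]] algebra_homs_linear[OF R(1)]]
          by (simp add: L_def)
        also have "L u = finsum (ring_as_algebra complex_ring e) (\<lambda>p. L (f p \<odot>\<^bsub>b.LM\<^esub> ?\<beta> p)) (supp K f)"
          unfolding f(2) lin_ext_def
          by (rule linear_maps_finsum[OF b.LM.module_axioms ring L]) (use fc \<beta>c in \<open>blast intro: b.LM.smult_closed\<close>)
        also have "\<dots> = (\<Sum>p\<in>supp K f. e (f p) * L (?\<beta> p))"
          unfolding finsum_complex[OF K0.is_cring E(1)]
          using linear_maps_smult[OF L fc \<beta>c] by (intro sum.cong) simp_all
        also have "\<dots> = (\<Sum>p\<in>Pair m ` J. e (f p) * L (?\<beta> p))"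
          by (rule sum.mono_neutral_right[OF fin]) (auto simp: J_def L\<beta>)
        also have "\<dots> = (\<Sum>j\<in>J. e (f (m, j)) * (c * complex_of_real x ^ j))"
          by (subst sum.reindex) (auto simp: inj_on_def L\<beta>)
        also have "\<dots> = c * (\<Sum>j\<in>J. e (f (m, j)) * complex_of_real x ^ j)"
          by (simp add: sum_distrib_left algebra_simps)
        finally show ?thesis using c(1) by simp
      qed
      from poly_sum_vanishes[OF finJ this] show "e (f (m, j)) = 0"
        using e0 by (cases "j \<in> J") (auto simp: J_def supp_def)
    qed
    hence "supp K f = {}" by (auto simp: supp_def)
    thus ?thesis unfolding f(2) lin_ext_def by simp
  qed
  show ?thesis
  proof (rule inj_onI)
    fix u v assume uv: "u \<in> carrier b.LM" "v \<in> carrier b.LM" "\<Phi> u = \<Phi> v"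
    have "\<Phi> (u \<ominus>\<^bsub>b.LM\<^esub> v) = \<Phi> u \<ominus>\<^bsub>SA\<^esub> \<Phi> v"
      by (rule linear_maps_minus[OF b.LM.module_axioms SA.module_axioms algebra_homs_linear[OF \<Phi>] uv(1,2)])
    also have "\<dots> = \<zero>\<^bsub>SA\<^esub>" unfolding uv(3) a_minus_def
      by (rule SA.r_neg) (rule algebra_homs_closed[OF \<Phi> uv(2)])
    finally have "u \<ominus>\<^bsub>b.LM\<^esub> v = \<zero>\<^bsub>b.LM\<^esub>" using ker[OF b.LM.minus_closed[OF uv(1,2)]] by blast
    hence "u \<oplus>\<^bsub>b.LM\<^esub> \<ominus>\<^bsub>b.LM\<^esub> v = \<zero>\<^bsub>b.LM\<^esub>" by (simp only: a_minus_def)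
    from b.LM.minus_equality[OF this b.LM.a_inv_closed[OF uv(2)] uv(1)]
    show "u = v" using b.LM.minus_minus[OF uv(2)] by simp
  qed
qed

end

section \<open>Inverse isomorphisms and base change along the identity\<close>

lemma algebra_isos_compose:
  assumes "f \<in> algebra_isos K A B" "g \<in> algebra_isos K B D"
  shows "(\<lambda>x. g (f x)) \<in> algebra_isos K A D"
  using assms algebra_homs_compose[of f K A B g D] bij_betw_trans[of f "carrier A" "carrier B" g "carrier D"]
  by (simp add: algebra_isos_def comp_def)

lemma algebra_isos_inv:
  assumes B: "assoc_algebra K B" and f: "f \<in> algebra_isos K B A"
  shows "inv_into (carrier B) f \<in> algebra_isos K A B"
proof -
  interpret B: assoc_algebra K B by (rule B)
  have hom: "f \<in> algebra_homs K B A" and bij: "bij_betw f (carrier B) (carrier A)"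
    using f by (auto simp: algebra_isos_def)
  let ?g = "inv_into (carrier B) f"
  have g: "?g y \<in> carrier B" "f (?g y) = y" if "y \<in> carrier A" for y
    using bij that by (auto simp: bij_betw_def inv_into_into f_inv_into_f)
  have eq: "x = ?g y" if "x \<in> carrier B" "f x = y" for x y
    using bij that by (auto simp: bij_betw_def)
  have "?g \<in> algebra_homs K A B"
  proof (intro algebra_homsI linear_mapsI)
    show "?g \<one>\<^bsub>A\<^esub> = \<one>\<^bsub>B\<^esub>" by (rule eq[symmetric]) (simp_all add: algebra_homs_one[OF hom])
    fix x assume x: "x \<in> carrier A"
    show "?g x \<in> carrier B" using x by (rule g)
    show "?g (k \<odot>\<^bsub>A\<^esub> x) = k \<odot>\<^bsub>B\<^esub> ?g x" if "k \<in> carrier K" for k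
      by (rule eq[symmetric]) (use x that in \<open>simp_all add: g algebra_homs_smult[OF hom]\<close>)
    fix y assume y: "y \<in> carrier A"
    show "?g (x \<oplus>\<^bsub>A\<^esub> y) = ?g x \<oplus>\<^bsub>B\<^esub> ?g y"
      by (rule eq[symmetric]) (use x y in \<open>simp_all add: g algebra_homs_add[OF hom]\<close>)
    show "?g (x \<otimes>\<^bsub>A\<^esub> y) = ?g x \<otimes>\<^bsub>B\<^esub> ?g y"
      by (rule eq[symmetric]) (use x y in \<open>simp_all add: g algebra_homs_mult[OF hom]\<close>)
  qed
  thus ?thesis using bij_betw_inv_into[OF bij] by (simp add: algebra_isos_def)
qed

lemma algebra_homs_restrict_id: "algebra_homs K A (restrict_scalars (\<lambda>k. k) P) = algebra_homs K A P"
  by (simp add: algebra_homs_def linear_maps_def ring_hom_def)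

text \<open>The general result has a base change of \<open>O_S2\<close> as its base. Over the
  complex numbers themselves this is the base change along the identity, which has to be removed to
  reach \<open>O_S2\<close>.\<close>

lemma base_change_id:
  assumes "assoc_algebra K B"
  shows "\<exists>f. f \<in> algebra_isos K (base_change K K (\<lambda>k. k) B) B"
proof -
  have b: "base_change_algebra K K (\<lambda>k. k) B"
    using assms assoc_algebra.axioms(1)[OF assms]
    by (intro base_change_algebra.intro scalar_extension_id) (auto simp: module_def)
  let ?L = "base_change K K (\<lambda>k. k) B"
  let ?t = "pure_tensor K B (ring_as_algebra K (\<lambda>k. k))"
  let ?f = "lin_lift K (restrict_scalars (\<lambda>k. k) B) (\<lambda>(m, x). x \<odot>\<^bsub>B\<^esub> m)"
  note L = base_change_algebra.base_change_assoc_algebra[OF b]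
  interpret B: assoc_algebra K B by fact
  have id: "(\<lambda>m. m) \<in> algebra_homs K B (restrict_scalars (\<lambda>k. k) B)"
    unfolding algebra_homs_restrict_id by (rule algebra_homs_id)
  have f: "?f \<in> algebra_homs K ?L B"
    by (rule base_change_algebra.base_change_extend_hom[OF b assms id])
  have fp: "?f (?t m x) = x \<odot>\<^bsub>B\<^esub> m" if "m \<in> carrier B" "x \<in> carrier K" for m x
    by (rule base_change_algebra.base_change_extend_pure[OF b B.module_axioms algebra_homs_linear[OF id] that])
  have g: "(\<lambda>m. ?t m \<one>\<^bsub>K\<^esub>) \<in> algebra_homs K B ?L"
    using base_change_algebra.base_change_unit_hom[OF b] unfolding algebra_homs_restrict_id .
  have "?f \<in> algebra_isos K ?L B"
  proof (rule algebra_isosI[OF L assms f g])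
    show "?f (?t m \<one>\<^bsub>K\<^esub>) = m" if "m \<in> carrier B" for m using fp[OF that] that by simp
    show "?t (?f u) \<one>\<^bsub>K\<^esub> = u" if "u \<in> carrier ?L" for u
    proof (rule linear_maps_eqI[OF assoc_algebra_module[OF L] assoc_algebra_module[OF L]
          base_change_algebra.base_change_spanning[OF b spanning_carrier]
          algebra_homs_linear[OF algebra_homs_compose[OF f g]] linear_maps_id _ that])
      fix w assume "w \<in> (\<lambda>m. ?t m \<one>\<^bsub>K\<^esub>) ` carrier B"
      then obtain m where "m \<in> carrier B" "w = ?t m \<one>\<^bsub>K\<^esub>" by blast
      thus "?t (?f w) \<one>\<^bsub>K\<^esub> = w" using fp[of m "\<one>\<^bsub>K\<^esub>"] by simp
    qed
  qed
  thus ?thesis by blast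
qed

lemma coinvariants_simps [simp]:
  "carrier (coinvariants K H A) = {a \<in> carrier A. coact A a = pure_tensor K A H a \<one>\<^bsub>H\<^esub>}"
  "mult (coinvariants K H A) = mult A" "one (coinvariants K H A) = one A"
  "add (coinvariants K H A) = add A" "smult (coinvariants K H A) = smult A"
  by (simp_all add: coinvariants_def module.defs)

section \<open>Coinvariants and principality of the fibration\<close>

locale coinvariant_fibration = deformed_hopf_fibration K cj q q' H T C + coinvariant_map K cj q q' \<phi>
  for K :: "'k ring" and cj q q' and H :: "('k, 'h) hopf" and T C \<phi>
begin

text \<open>The coinvariants are spanned by the words of degree 0, which lie in \<open>Im\<close>.
  In the other direction, they form a subalgebra, because the coaction is multiplicative, and they
  contain the images \<open>s2v\<close> of the letters.\<close>

lemma Im_eq: "Im = carrier (coinvariants K H fib)"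
proof
  obtain X where X: "fib = module.extend SA X" using fib_eq by blast
  have fc: "carrier fib = carrier SA" by (simp add: X)
  have coinv: "carrier (coinvariants K H fib) = submodule_generated K fib (words_of_degree 0)"
  proof -
    have "submodule_generated K fib (words_of_degree 0) \<subseteq> carrier fib"
      using submodule_generated_submodule[OF fib.A.module_axioms, of "words_of_degree 0"] fib.G_closed
        submodule_carrier[OF fib.A.module_axioms] by blast
    thus ?thesis using fib.coinvariant_iff by auto
  qed
  have sub: "submodule (submodule_generated K fib (words_of_degree 0)) K fib"
    by (rule submodule_generated_submodule[OF fib.A.module_axioms]) (auto intro: fib.G_closed)
  have ImS: "submodule Im K fib"
  proof -
    have "submodule {a \<in> carrier fib. a \<in> Im} K fib"
      by (rule submodule_sep[OF fib.A.module_axioms]) (use Im_zero Im_add Im_smult in \<open>simp_all add: X\<close>)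
    moreover have "{a \<in> carrier fib. a \<in> Im} = Im" using Im_closed by (auto simp: fc)
    ultimately show ?thesis by simp
  qed
  have "words_of_degree 0 \<subseteq> Im" using word_degree_zero_Im by (auto simp: words_of_degree_def)
  thus "carrier (coinvariants K H fib) \<subseteq> Im" unfolding coinv by (rule submodule_generated_minimal[OF ImS])
  have pair: "letr x \<otimes>\<^bsub>SA\<^esub> letr y \<in> carrier (coinvariants K H fib)" if "letter_degree y = - letter_degree x" for x y
  proof -
    have "word [x, y] \<in> words_of_degree 0" using that unfolding words_of_degree_def by (intro CollectI exI[of _ "[x, y]"]) simp
    thus ?thesis unfolding coinv using submodule_generated_subset[of "words_of_degree 0" K fib] by (auto simp: letr_eq word_mult)
  qed
  have sm: "k \<odot>\<^bsub>SA\<^esub> a \<in> carrier (coinvariants K H fib)" if "k \<in> carrier K" "a \<in> carrier (coinvariants K H fib)" for k a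
    using submodule_smult[OF fib.A.module_axioms sub that(1)] that(2) unfolding coinv by (simp add: X)
  have ad: "a \<oplus>\<^bsub>SA\<^esub> a' \<in> carrier (coinvariants K H fib)"
    if "a \<in> carrier (coinvariants K H fib)" "a' \<in> carrier (coinvariants K H fib)" for a a'
    using submodule_add[OF fib.A.module_axioms sub] that unfolding coinv by (simp add: X)
  have inSA: "a \<in> carrier SA" if "a \<in> carrier (coinvariants K H fib)" for a using that by (simp add: fc)
  have mi: "a \<ominus>\<^bsub>SA\<^esub> a' \<in> carrier (coinvariants K H fib)"
    if "a \<in> carrier (coinvariants K H fib)" "a' \<in> carrier (coinvariants K H fib)" for a a'
    using ad[OF that(1) sm[OF _ that(2), of "\<ominus>\<^bsub>K\<^esub> \<one>\<^bsub>K\<^esub>"]] inSA[OF that(2)] by (simp add: a_minus_def SA.minus_eq_smult del: coinvariants_simps)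
  have s2v: "s2v x \<in> carrier (coinvariants K H fib)" for x
    by (cases x; rename_tac g; case_tac g) (simp_all add: sm mi pair del: coinvariants_simps)
  interpret f: right_comodule_algebra K H fib by (rule fib.comodule_algebra)
  note T0 = pure_tensor_mult[OF fib.A H]
  have mu: "a \<otimes>\<^bsub>SA\<^esub> a' \<in> carrier (coinvariants K H fib)"
    if "a \<in> carrier (coinvariants K H fib)" "a' \<in> carrier (coinvariants K H fib)" for a a'
  proof -
    have "coact fib (a \<otimes>\<^bsub>fib\<^esub> a') = pure_tensor K fib H (a \<otimes>\<^bsub>fib\<^esub> a') \<one>\<^bsub>H\<^esub>"
      using that algebra_homs_mult[OF f.coact_hom, of a a'] by (simp add: T0)
    thus ?thesis using that by (simp add: X)
  qed
  have w: "\<Phi>0 (S.word w) \<in> carrier (coinvariants K H fib)" for w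
  proof (induction w)
    case Nil
    have "\<Phi>0 \<one>\<^bsub>S.SA\<^esub> = \<one>\<^bsub>SA\<^esub>" using algebra_homs_one[OF \<Phi>0(1)] by simp
    moreover have "word [] \<in> words_of_degree 0" unfolding words_of_degree_def by (intro CollectI exI[of _ "[]"]) simp
    ultimately show ?case using submodule_generated_subset[of "words_of_degree 0" K fib]
      unfolding coinv by (auto simp: S.word_Nil word_Nil)
  next
    case (Cons x w)
    have "\<Phi>0 (S.word (x # w)) = s2v x \<otimes>\<^bsub>SA\<^esub> \<Phi>0 (S.word w)"
      using algebra_homs_mult[OF \<Phi>0(1) S.letr_closed S.word_closed, of x w] by (simp add: S.word_Cons \<Phi>0(2))
    thus ?case using mu[OF s2v Cons] by simp
  qed
  show "Im \<subseteq> carrier (coinvariants K H fib)"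
  proof
    fix a assume "a \<in> Im"
    then obtain u where u: "u \<in> carrier b.LM" "a = \<Phi> u" by (auto simp: Im_def)
    have \<Phi>': "\<Phi> \<in> linear_maps K b.LM fib" using algebra_homs_linear[OF \<Phi>] by (simp only: X linear_maps_extend)
    have "coact fib (\<Phi> u) = pure_tensor K fib H (\<Phi> u) \<one>\<^bsub>H\<^esub>"
    proof (rule linear_maps_eqI[OF b.LM.module_axioms tensor_algebra_module[OF fib.A H] b.base_change_spanning[OF S.word_spanning]
          linear_maps_compose[OF \<Phi>' fib.coact_linear]
          linear_maps_compose[OF \<Phi>' pure_tensor_linear_left[OF fib.A H H.A.one_closed]] _ u(1)])
      fix v assume "v \<in> (\<lambda>m. b.tensor m \<one>\<^bsub>K\<^esub>) ` range (\<lambda>w. S.word w)"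
      then obtain w' where v: "v = b.tensor (S.word w') \<one>\<^bsub>K\<^esub>" by blast
      have "\<Phi> v = \<Phi>0 (S.word w')"
        using algebra_homs_closed[OF \<Phi>0(1) S.word_closed, of w'] by (simp add: v \<Phi>_pure)
      thus "coact fib (\<Phi> v) = pure_tensor K fib H (\<Phi> v) \<one>\<^bsub>H\<^esub>" using w[of w'] by simp
    qed
    thus "a \<in> carrier (coinvariants K H fib)" using linear_maps_closed[OF \<Phi>' u(1)] u(2) by simp
  qed
qed

lemma principal_over_base:
  fixes E :: "('k \<Rightarrow> complex) set"
  assumes "\<And>e. e \<in> E \<Longrightarrow> e \<in> ring_hom K complex_ring" "\<And>e c. e \<in> E \<Longrightarrow> e (\<phi> c) = c"
    "\<And>k. k \<in> carrier K \<Longrightarrow> (\<And>e. e \<in> E \<Longrightarrow> e k = 0) \<Longrightarrow> k = \<zero>\<^bsub>K\<^esub>"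
  shows "principal_over K H (base_change complex_ring K \<phi> O_S2) fib"
proof -
  obtain X where X: "fib = module.extend SA X" using fib_eq by blast
  have "\<Phi> \<in> algebra_homs K b.LM (coinvariants K H fib)"
  proof (intro algebra_homsI linear_mapsI)
    show "\<Phi> u \<in> carrier (coinvariants K H fib)" if "u \<in> carrier b.LM" for u
      using that Im_eq by (auto simp: Im_def)
  qed (simp_all add: X algebra_homs_add[OF \<Phi>, simplified] algebra_homs_mult[OF \<Phi>, simplified]
      algebra_homs_smult[OF \<Phi>, simplified] algebra_homs_one[OF \<Phi>, simplified])
  moreover have "inj_on \<Phi> (carrier b.LM)"
    by (rule \<Phi>_injective[of E]) (use assms in blast)+
  hence "bij_betw \<Phi> (carrier b.LM) (carrier (coinvariants K H fib))"
    using Im_eq by (simp add: bij_betw_def Im_def)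
  ultimately have "\<Phi> \<in> algebra_isos K b.LM (coinvariants K H fib)" by (simp add: algebra_isos_def)
  \<comment> \<open>\<open>principal_over\<close> asks for a map out of the coinvariants, whereas
    \<open>\<Phi>\<close> goes into them.\<close>
  from algebra_isos_inv[OF b.base_change_assoc_algebra this] show ?thesis
    using fib.principal b.base_change_assoc_algebra
    unfolding principal_over_def O_S2_eq by blast
qed

end

lemma O_S3_deformed_principal: "principal_over complex_ring O_U1 O_S2 (O_S3_deformed \<theta>)"
proof -
  let ?B = "base_change complex_ring complex_ring (\<lambda>k. k) O_S2"
  have c: "coinvariant_fibration complex_ring cnj (deform_param \<theta>) (inverse (deform_param \<theta>)) O_U1 u1_power u1_coord (\<lambda>k. k)"
    by (intro coinvariant_fibration.intro coinvariant_map.intro deformed_fibration_complex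
        deformed_sphere_complex scalar_extension_id complex_ring)
  have p: "principal_over complex_ring O_U1 ?B (O_S3_deformed \<theta>)"
    unfolding O_S3_deformed_eq
    \<comment> \<open>Over the complex numbers the identity alone detects zero.\<close>
    by (rule coinvariant_fibration.principal_over_base[OF c, of "{\<lambda>k. k}"]) (auto simp: ring_hom_def)
  have S2: "assoc_algebra complex_ring O_S2" unfolding O_S2_eq by (rule S.SA)
  obtain f where "f \<in> algebra_isos complex_ring ?B O_S2" using base_change_id[OF S2] by blast
  moreover obtain g where "g \<in> algebra_isos complex_ring (coinvariants complex_ring O_U1 (O_S3_deformed \<theta>)) ?B"
    using p by (auto simp: principal_over_def)
  ultimately have "(\<lambda>x. f (g x)) \<in> algebra_isos complex_ring (coinvariants complex_ring O_U1 (O_S3_deformed \<theta>)) O_S2"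
    by (rule algebra_isos_compose[rotated])
  thus ?thesis using p S2 by (auto simp: principal_over_def)
qed

lemma (in theta_family) family_principal:
  "principal_over R (hopf_family F O_U1) (algebra_family F O_S2) (O_S3_family F \<theta>)"
proof -
  have c: "coinvariant_fibration R cjF Q Q' (hopf_family F O_U1) (\<lambda>n. u.tensor (u1_power n) (\<lambda>y. 1)) u.CL const_fun"
    by (intro coinvariant_fibration.intro coinvariant_map.intro fam.deformed_hopf_fibration_axioms
        family_sphere constants)
  show ?thesis
    unfolding O_S3_family_eq
    \<comment> \<open>The evaluations at all real points: elements of \<open>F\<close> are
      functions, so one that vanishes at every point is zero.\<close>
    by (rule coinvariant_fibration.principal_over_base[OF c, of "range (\<lambda>y f. f y)"])
       (auto simp: ring_hom_def fun_eq_iff)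
qed

theorem proposition6p3:
  fixes \<theta> :: real and F :: "(real \<Rightarrow> complex) set"
  assumes "admissible_functions F"
  shows "comodule_algebra_isomorphic complex_ring O_U1
           (eval_fibre F O_U1 0 (O_S3_family F \<theta>)) O_S3 \<and>
         comodule_algebra_isomorphic complex_ring O_U1
           (eval_fibre F O_U1 1 (O_S3_family F \<theta>)) (O_S3_deformed \<theta>) \<and>
         homotopy_equivalent TYPE((s3_gen letter list \<Rightarrow> real \<Rightarrow> complex) set) F
           O_U1 O_S2 O_S3 (O_S3_deformed \<theta>)"
proof -
  interpret theta_family F \<theta> by unfold_locales fact
  \<comment> \<open>Every fibre, not only those at the two ends, is the sphere with parameter
    \<open>\<theta> * p\<close>.\<close>
  have fibre: "comodule_algebra_isomorphic complex_ring O_U1 (eval_fibre F O_U1 p (O_S3_family F \<theta>)) (O_S3_deformed (\<theta> * p))" for p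
    by (rule theta_fibre.fibre_isomorphic) unfold_locales
  have 0: "comodule_algebra_isomorphic complex_ring O_U1 (eval_fibre F O_U1 0 (O_S3_family F \<theta>)) O_S3"
    using fibre[of 0] by (simp add: O_S3_eq)
  have 1: "comodule_algebra_isomorphic complex_ring O_U1 (eval_fibre F O_U1 1 (O_S3_family F \<theta>)) (O_S3_deformed \<theta>)"
    using fibre[of 1] by simp
  have p: "principal_over complex_ring O_U1 O_S2 O_S3" "principal_over complex_ring O_U1 O_S2 (O_S3_deformed \<theta>)"
    unfolding O_S3_eq by (rule O_S3_deformed_principal)+
  \<comment> \<open>One elementary homotopy suffices, so the chain in the generated equivalence has
    a single link.\<close>
  have "elementary_homotopic TYPE((s3_gen letter list \<Rightarrow> real \<Rightarrow> complex) set) F O_U1 O_S2 O_S3 (O_S3_deformed \<theta>)"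
    unfolding elementary_homotopic_def using p family_principal 0 1 by blast
  hence "homotopy_equivalent TYPE((s3_gen letter list \<Rightarrow> real \<Rightarrow> complex) set) F O_U1 O_S2 O_S3 (O_S3_deformed \<theta>)"
    unfolding homotopy_equivalent_def using p by (simp add: r_into_equivclp)
  with 0 1 show ?thesis by blast
qed

end
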